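(* Let $\theta\in[0,\pi)\setminus\{\pi/2\}$ and put $\kappa_\theta:=\gamma-\log 2+\tan\theta$, where $\gamma$ is the Euler–Mascheroni constant. Let $e^{-t\Delta(\theta)}(x,\tilde x)$ denote the heat kernel of the self-adjoint operator $\Delta(\theta)$ in $L^2(0,\infty)$ and set $\mathrm{Tr}_1 e^{-t\Delta(\theta)}:=\int_0^1 e^{-t\Delta(\theta)}(x,x)\,dx$. Then there exist constants $a_j\in\mathbb{R}$, $j=0,1,2,\dots$, such that for every $N\in\mathbb{N}$, as $t\to0^+$, $$\mathrm{Tr}_1 e^{-t\Delta(\theta)}=\mathrm{Tr}_1 e^{-t\Delta(\pi/2)}+\sum_{j=0}^{N-1}a_jt^j+\frac1\pi\,\mathrm{Im}\left(\int_1^\infty\frac{e^{-ty}}{y}\big(\log y+i\pi+2\kappa_\theta\big)^{-1}dy\right)+O(t^N).$$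
   Context: Let $\Delta=-\frac{d^2}{dx^2}-\frac{1}{4x^2}$ acting on $C^\infty_c(0,\infty)\subset L^2(0,\infty)$. Let $\Delta_{\min}$ be its graph closure and $\Delta_{\max}:=(\Delta_{\min})^*$. Every $f\in\mathcal D(\Delta_{\max})$ can be written uniquely as $f(x)=c_+(f)\sqrt x+c_-(f)\sqrt x\log x+\tilde f(x)$ with constants $c_\pm(f)\in\mathbb C$ and $\tilde f\in\mathcal D(\Delta_{\min})$ continuously differentiable with $\tilde f(x)=O(x^{3/2}\log x)$, $\tilde f'(x)=O(x^{1/2}\log x)$ as $x\to0$. For $\theta\in[0,\pi)$, $\Delta(\theta)$ denotes the restriction of $\Delta_{\max}$ to $\{f\in\mathcal D(\Delta_{\max}) : \cos\theta\, c_+(f)+\sin\theta\, c_-(f)=0\}$; it is self-adjoint, and $\Delta(\pi/2)$ is the Friedrichs extension, whose heat kernel is $E_+(x,\tilde x,t)=\frac{\sqrt{x\tilde x}}{2t}I_0\!\left(\frac{x\tilde x}{2t}\right)\exp\!\left(-\frac{x^2+\tilde x^2}{4t}\right)$, $I_0$ the modified Bessel function. *)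

theory Defs
  imports "HOL-Analysis.Analysis" "HOL-Library.Landau_Symbols"
begin

definition sq_int :: "(real \<Rightarrow> real) \<Rightarrow> bool" where
  "sq_int f \<longleftrightarrow> (\<lambda>x. indicator {0<..} x * f x) \<in> borel_measurable lborel
     \<and> set_integrable lborel {0<..} (\<lambda>x. (f x)^2)"

definition L2_norm :: "(real \<Rightarrow> real) \<Rightarrow> real" where
  "L2_norm f = sqrt (LINT x:{0<..}|lborel. (f x)^2)"

definition test_fun :: "(real \<Rightarrow> real) \<Rightarrow> bool" where
  "test_fun \<phi> \<longleftrightarrow> (\<forall>n x. ((deriv ^^ n) \<phi>) differentiable (at x))
     \<and> (\<exists>a b. 0 < a \<and> a \<le> b \<and> (\<forall>x. x \<notin> {a..b} \<longrightarrow> \<phi> x = 0))"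

definition Delta_op :: "(real \<Rightarrow> real) \<Rightarrow> real \<Rightarrow> real" where
  "Delta_op \<phi> x = - (deriv ^^ 2) \<phi> x - \<phi> x / (4 * x^2)"

text \<open>Graph of Delta_max = adjoint of Delta on test functions (= adjoint of its closure).\<close>
definition Delta_max_rel :: "(real \<Rightarrow> real) \<Rightarrow> (real \<Rightarrow> real) \<Rightarrow> bool" where
  "Delta_max_rel f h \<longleftrightarrow> sq_int f \<and> sq_int h \<and>
     (\<forall>\<phi>. test_fun \<phi> \<longrightarrow>
        (LINT x:{0<..}|lborel. f x * Delta_op \<phi> x) = (LINT x:{0<..}|lborel. h x * \<phi> x))"

text \<open>Graph of Delta(theta): boundary condition cos theta c_+ + sin theta c_- = 0, where
  c_+, c_- are the coefficients of sqrt x and sqrt x log x in the expansion at 0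
  (of a representative of f), remainder O(x^(3/2) log x).\<close>
definition Delta_theta_rel :: "real \<Rightarrow> (real \<Rightarrow> real) \<Rightarrow> (real \<Rightarrow> real) \<Rightarrow> bool" where
  "Delta_theta_rel \<theta> f h \<longleftrightarrow> Delta_max_rel f h \<and>
     (\<exists>cp cm g. cos \<theta> * cp + sin \<theta> * cm = 0 \<and>
        (AE x in lborel. 0 < x \<longrightarrow> f x = g x) \<and>
        (\<lambda>x. g x - cp * sqrt x - cm * sqrt x * ln x) \<in> O[at_right 0](\<lambda>x. x powr (3/2) * ln x))"

text \<open>K x y t is the (continuous) heat kernel of Delta(theta): for every f in L^2 the
  function u(t) = integral K(.,y,t) f(y) dy is the strong solution of u' = - Delta(theta) u,
  u(0) = f, i.e. u(t) = exp(-t Delta(theta)) f.\<close>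
definition heat_kernel :: "real \<Rightarrow> (real \<Rightarrow> real \<Rightarrow> real \<Rightarrow> real) \<Rightarrow> bool" where
  "heat_kernel \<theta> K \<longleftrightarrow>
     (\<forall>t>0. continuous_on ({0<..} \<times> {0<..}) (\<lambda>(x,y). K x y t)) \<and>
     (\<forall>f. sq_int f \<longrightarrow>
        (\<forall>t>0. \<forall>x>0. set_integrable lborel {0<..} (\<lambda>y. K x y t * f y)) \<and>
        (let u = (\<lambda>t x. LINT y:{0<..}|lborel. K x y t * f y) in
          (\<forall>t>0. \<exists>w. Delta_theta_rel \<theta> (u t) w \<and>
              ((\<lambda>s. L2_norm (\<lambda>x. (u (t + s) x - u t x) / s + w x)) \<longlongrightarrow> 0) (at 0)) \<and>
          ((\<lambda>t. L2_norm (\<lambda>x. u t x - f x)) \<longlongrightarrow> 0) (at_right 0)))"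

definition bessel_I0 :: "real \<Rightarrow> real" where
  "bessel_I0 z = (\<Sum>k. (z / 2) ^ (2 * k) / (fact k)^2)"

text \<open>Heat kernel of the Friedrichs extension Delta(pi/2).\<close>
definition E_plus :: "real \<Rightarrow> real \<Rightarrow> real \<Rightarrow> real" where
  "E_plus x y t = sqrt (x * y) / (2 * t) * bessel_I0 (x * y / (2 * t)) * exp (- (x^2 + y^2) / (4 * t))"

definition Tr1 :: "(real \<Rightarrow> real \<Rightarrow> real \<Rightarrow> real) \<Rightarrow> real \<Rightarrow> real" where
  "Tr1 K t = (LINT x:{0<..<1}|lborel. K x x t)"

definition kappa :: "real \<Rightarrow> real" where
  "kappa \<theta> = euler_mascheroni - ln 2 + tan \<theta>"

end

theory Submission
  imports Defs "HOL-Real_Asymp.Real_Asymp"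
begin

text \<open>
  Let \<open>p\<^sub>r(x) = sqrt x / (2 r) exp (- x\<^sup>2 / (4 r))\<close>. This family solves the heat equation, and
  \<open>\<langle>p\<^sub>a, p\<^sub>b\<rangle> = 1 / (2 (a + b))\<close>. For \<open>f\<close> in the domain of \<open>Delta(\<theta>)\<close> with logarithmic coefficient \<open>c\<^sub>-\<close>, Green's formula
  gives \<open>d/dr \<langle>f, p\<^sub>r\<rangle> = c\<^sub>- / (2 r) - \<langle>Delta f, p\<^sub>r\<rangle>\<close>, and the boundary condition reads
  \<open>\<langle>f, p\<^sub>r\<rangle> - (c\<^sub>- / 2) (ln r + \<gamma> - 2 \<kappa>) \<longrightarrow> 0\<close> as \<open>r \<longrightarrow> 0\<close>. Let \<open>c = exp (- 2 \<kappa>)\<close> and let \<open>\<nu>(x) = \<integral> x\<^sup>s / \<Gamma>(1 + s) ds\<close>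
  over \<open>s > 0\<close> be Volterra's function; then the convolution of \<open>\<rho> = d/dt \<nu>(c t)\<close> and \<open>ln r + \<gamma> - 2 \<kappa>\<close> is constantly \<open>- 1\<close>.
  With \<open>q\<^sub>a\<close> half the convolution of \<open>\<rho>\<close> and \<open>1 / (a + r)\<close>, the functional
  \<open>B(v, s) = \<langle>v, p\<^bsub>a+s\<^esub>\<rangle> + 2 \<integral> \<langle>v, p\<^sub>r\<rangle> q\<^sub>a(s - r) dr\<close> satisfies \<open>d/ds B(f, s) = - B(Delta f, s)\<close>. So \<open>B(u(T - s), s)\<close> is
  constant along the heat flow \<open>u\<close>, which expresses \<open>\<langle>u(T), p\<^sub>a\<rangle>\<close> through the initial datum. Since the
  \<open>p\<^sub>a\<close> separate functions (a moment problem on \<open>[0, 1]\<close>), the heat kernel is \<open>E_plus + D\<close> with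
  \<open>D(x, y, T) = 2 \<integral>\<integral> p\<^sub>r(x) \<rho>(s) p\<^bsub>T-r-s\<^esub>(y) ds dr\<close>.

  The integral of \<open>D(x, x, T)\<close> over the half line is \<open>\<nu>(c T)\<close>, and the part over \<open>x > 1\<close> is \<open>O(exp (- 1 / (4 T)))\<close>. Inserting a
  Hankel representation of \<open>1 / \<Gamma>\<close> into \<open>\<nu>\<close> shows that \<open>\<nu>(x)\<close> is a power series minus
  \<open>\<integral> exp (- x v) / (v (ln\<^sup>2 v + \<pi>\<^sup>2)) dv\<close> over \<open>v > e\<close>. The substitution \<open>v = y / c\<close> produces the logarithmic integral of
  the theorem up to the choice of the lower limit, which changes it by an entire function of \<open>t\<close>.
\<close>

section \<open>Parameter integrals and the pairing on the half line\<close>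

text \<open>\<open>heat_kernel\<close> describes a kernel only by its action on L^2, so the task is
  to identify an arbitrary such \<open>K\<close>. Of u(t) only the membership in the domain and the
  differential equation are known; duality with the explicit family p_r, on which the Friedrichs
  flow acts by the shift r -> r + t, extracts enough. The obstacle is that p_r violates the boundary
  condition of \<open>Delta(\<theta>)\<close>: Green's formula leaves the flux c_- / (2 r) with an
  unknown c_-. The convolution term of B is there to cancel this flux, which forces an integral
  equation with the kernel ln r + const; Volterra's function solves it. Since \<rho>, the p_r and D
  are nonnegative, most multiple integrals are reordered in \<open>ennreal\<close> without
  integrability questions. The kernel is identified on the diagonal for almost every x, and the
  trace sees no more. The second obstacle is the logarithm. After the contour is folded, integration
  in s meets exp (- s ln v), which decays only for ln v > 0. Hence the cut at v = e, where ln v >=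
  1; what lies below it ends up in an entire function of t, one of the sources of the a_j.\<close>

lemma tendsto_integral_at_within:
  fixes F :: "real \<Rightarrow> 'a \<Rightarrow> real" and f w :: "'a \<Rightarrow> real"
  assumes ev: "\<forall>\<^sub>F h in at a within S. F h \<in> borel_measurable M \<and> (AE x in M. \<bar>F h x\<bar> \<le> w x)"
    and lim: "AE x in M. ((\<lambda>h. F h x) \<longlongrightarrow> f x) (at a within S)"
    and f: "f \<in> borel_measurable M" and w: "integrable M w"
  shows "((\<lambda>h. \<integral>x. F h x \<partial>M) \<longlongrightarrow> (\<integral>x. f x \<partial>M)) (at a within S)"
  unfolding tendsto_at_iff_sequentially
proof (intro allI impI)
  fix X :: "nat \<Rightarrow> real"
  assume X: "\<forall>i. X i \<in> S - {a}" "X \<longlonglongrightarrow> a"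
  have X': "filterlim X (at a within S) sequentially"
    using X by (auto simp: filterlim_at)
  have "\<forall>\<^sub>F n in sequentially. F (X n) \<in> borel_measurable M \<and> (AE x in M. \<bar>F (X n) x\<bar> \<le> w x)"
    using X' ev by (rule eventually_compose_filterlim[rotated])
  then obtain N where N: "\<And>n. n \<ge> N \<Longrightarrow> F (X n) \<in> borel_measurable M \<and> (AE x in M. \<bar>F (X n) x\<bar> \<le> w x)"
    unfolding eventually_sequentially by blast
  \<comment> \<open>Domination is available only from the index \<open>N\<close> on; the shift is
    undone at the end by \<open>LIMSEQ_offset\<close>.\<close>
  have "(\<lambda>n. \<integral>x. F (X (n + N)) x \<partial>M) \<longlonglongrightarrow> (\<integral>x. f x \<partial>M)"
  proof (rule integral_dominated_convergence[OF f _ w])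
    show "F (X (n + N)) \<in> borel_measurable M" for n using N by simp
    show "AE x in M. norm (F (X (n + N)) x) \<le> w x" for n using N[of "n + N"] by simp
    show "AE x in M. (\<lambda>n. F (X (n + N)) x) \<longlonglongrightarrow> f x"
      using lim by eventually_elim
        (rule LIMSEQ_ignore_initial_segment, rule filterlim_compose[OF _ X'])
  qed
  then show "((\<lambda>h. \<integral>x. F h x \<partial>M) \<circ> X) \<longlonglongrightarrow> (\<integral>x. f x \<partial>M)"
    unfolding comp_def by (rule LIMSEQ_offset)
qed

lemma continuous_on_Icc_abs_bounded:
  fixes q :: "real \<Rightarrow> real"
  assumes "continuous_on {a..b} q"
  obtains C where "\<And>x. x \<in> {a..b} \<Longrightarrow> \<bar>q x\<bar> \<le> C"
proof -
  have "bounded (q ` {a..b})"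
    using assms by (intro compact_imp_bounded compact_continuous_image) auto
  then show ?thesis
    using that unfolding bounded_iff real_norm_def by blast
qed

text \<open>\<open>k\<close> is merely integrable, so continuity must come from \<open>q\<close>. As
  \<open>k\<close> has bounded support, only values of \<open>q\<close> on a compact interval enter;
  there \<open>q\<close> is bounded and a multiple of \<open>|k|\<close> dominates.\<close>

lemma isCont_convolution:
  fixes k q :: "real \<Rightarrow> real"
  assumes k: "integrable lborel k" and supp: "\<And>x. x \<notin> {0..B} \<Longrightarrow> k x = 0"
    and q: "continuous_on UNIV q"
  shows "isCont (\<lambda>s. \<integral>r. k r * q (s - r) \<partial>lborel) s"
proof -
  have [measurable]: "k \<in> borel_measurable lborel" "q \<in> borel_measurable borel"
    using k q by (auto intro: borel_measurable_continuous_onI)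
  obtain C where C: "\<And>x. x \<in> {s - 1 - B..s + 1} \<Longrightarrow> \<bar>q x\<bar> \<le> C"
    by (rule continuous_on_Icc_abs_bounded[OF continuous_on_subset[OF q subset_UNIV]]) blast
  have "((\<lambda>h. \<integral>r. k r * q (h - r) \<partial>lborel) \<longlongrightarrow> (\<integral>r. k r * q (s - r) \<partial>lborel)) (at s within UNIV)"
  proof (rule tendsto_integral_at_within[where w = "\<lambda>r. \<bar>k r\<bar> * C"])
    show "\<forall>\<^sub>F h in at s. (\<lambda>r. k r * q (h - r)) \<in> borel_measurable lborel \<and>
        (AE x in lborel. \<bar>k x * q (h - x)\<bar> \<le> \<bar>k x\<bar> * C)"
      unfolding eventually_at
    proof (intro exI[of _ 1] conjI ballI impI, goal_cases)
      case (3 h)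
      have "\<bar>k x * q (h - x)\<bar> \<le> \<bar>k x\<bar> * C" for x
      proof (cases "x \<in> {0..B}")
        case True
        then have "\<bar>q (h - x)\<bar> \<le> C" using 3 by (intro C) (auto simp: dist_real_def)
        then show ?thesis by (simp add: abs_mult mult_left_mono)
      qed (simp add: supp)
      then show ?case by simp
    qed auto
    have "isCont q x" for x using q by (simp add: continuous_on_eq_continuous_at)
    then show "AE x in lborel. ((\<lambda>h. k x * q (h - x)) \<longlongrightarrow> k x * q (s - x)) (at s)"
      by (intro AE_I2 tendsto_intros isCont_tendsto_compose[of _ q]) auto
    show "integrable lborel (\<lambda>r. \<bar>k r\<bar> * C)" using k by simp
  qed simp
  then show ?thesis by (simp add: isCont_def)
qed

text \<open>The derivative falls on the differentiable factor. By the mean value inequality its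
  difference quotients are bounded by a bound for \<open>q\<close> on a compact interval, uniformly
  in the increment.\<close>

lemma DERIV_convolution:
  fixes k q V :: "real \<Rightarrow> real"
  assumes k: "integrable lborel k" and supp: "\<And>x. x \<notin> {0..B} \<Longrightarrow> k x = 0"
    and q: "continuous_on UNIV q" and V: "\<And>x. (V has_real_derivative q x) (at x)"
  shows "((\<lambda>s. \<integral>r. k r * V (s - r) \<partial>lborel) has_real_derivative
          (\<integral>r. k r * q (s - r) \<partial>lborel)) (at s)"
proof -
  have Vc: "continuous_on UNIV V"
    by (rule DERIV_continuous_on[OF V])
  have [measurable]: "k \<in> borel_measurable lborel" "q \<in> borel_measurable borel" "V \<in> borel_measurable borel"
    using k q Vc by (auto intro: borel_measurable_continuous_onI)
  obtain C where C: "\<And>x. x \<in> {s - 1 - B..s + 1} \<Longrightarrow> \<bar>q x\<bar> \<le> C"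
    by (rule continuous_on_Icc_abs_bounded[OF continuous_on_subset[OF q subset_UNIV]]) blast
  have quot: "\<bar>(V (s + h - x) - V (s - x)) / h\<bar> \<le> C" if h: "h \<noteq> 0" "\<bar>h\<bar> < 1" "x \<in> {0..B}" for h x
  proof -
    have "norm (V (s + h - x) - V (s - x)) \<le> C * norm ((s + h - x) - (s - x))"
    proof (rule field_differentiable_bound[of "{s - 1 - B..s + 1}" V q])
      show "(V has_field_derivative q z) (at z within {s - 1 - B..s + 1})" for z
        using V by (rule has_field_derivative_at_within)
    qed (use C h in auto)
    then have "\<bar>V (s + h - x) - V (s - x)\<bar> \<le> C * \<bar>h\<bar>" by simp
    then show ?thesis using h by (simp add: divide_le_eq)
  qed
  have int: "integrable lborel (\<lambda>r. k r * V (x - r))" for x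
  proof -
    obtain D where D: "\<And>y. y \<in> {x - B..x} \<Longrightarrow> \<bar>V y\<bar> \<le> D"
      by (rule continuous_on_Icc_abs_bounded[OF continuous_on_subset[OF Vc subset_UNIV]]) blast
    show ?thesis
    proof (rule Bochner_Integration.integrable_bound)
      show "integrable lborel (\<lambda>r. \<bar>k r\<bar> * D)" using k by simp
      show "AE r in lborel. norm (k r * V (x - r)) \<le> norm (\<bar>k r\<bar> * D)"
      proof (intro AE_I2)
        fix r show "norm (k r * V (x - r)) \<le> norm (\<bar>k r\<bar> * D)"
        proof (cases "r \<in> {0..B}")
          case True
          then have "\<bar>V (x - r)\<bar> \<le> \<bar>D\<bar>" using D[of "x - r"] by auto
          then show ?thesis by (simp add: abs_mult mult_left_mono)
        qed (simp add: supp)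
      qed
    qed simp
  qed
  have "((\<lambda>h. \<integral>r. k r * ((V (s + h - r) - V (s - r)) / h) \<partial>lborel) \<longlongrightarrow> (\<integral>r. k r * q (s - r) \<partial>lborel)) (at 0 within UNIV)"
  proof (rule tendsto_integral_at_within[where w = "\<lambda>r. \<bar>k r\<bar> * C"])
    show "\<forall>\<^sub>F h in at 0. (\<lambda>r. k r * ((V (s + h - r) - V (s - r)) / h)) \<in> borel_measurable lborel \<and>
        (AE x in lborel. \<bar>k x * ((V (s + h - x) - V (s - x)) / h)\<bar> \<le> \<bar>k x\<bar> * C)"
      unfolding eventually_at
    proof (intro exI[of _ 1] conjI ballI impI, goal_cases)
      case (3 h)
      have "\<bar>k x * ((V (s + h - x) - V (s - x)) / h)\<bar> \<le> \<bar>k x\<bar> * C" for x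
        using quot[of h x] 3 supp[of x] unfolding abs_mult by (cases "x \<in> {0..B}") (auto intro!: mult_left_mono simp del: abs_divide)
      then show ?case by simp
    qed auto
    show "AE x in lborel. ((\<lambda>h. k x * ((V (s + h - x) - V (s - x)) / h)) \<longlongrightarrow> k x * q (s - x)) (at 0)"
    proof (intro AE_I2 tendsto_mult tendsto_const)
      fix x
      have "((\<lambda>h. (V ((s - x) + h) - V (s - x)) / h) \<longlongrightarrow> q (s - x)) (at 0)"
        using V[of "s - x"] by (simp add: DERIV_def)
      then show "((\<lambda>h. (V (s + h - x) - V (s - x)) / h) \<longlongrightarrow> q (s - x)) (at 0)"
        by (simp add: algebra_simps)
    qed
    show "integrable lborel (\<lambda>r. \<bar>k r\<bar> * C)" using k by simp
  qed simp
  also have "(\<lambda>h. \<integral>r. k r * ((V (s + h - r) - V (s - r)) / h) \<partial>lborel) =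
      (\<lambda>h. ((\<integral>r. k r * V (s + h - r) \<partial>lborel) - (\<integral>r. k r * V (s - r) \<partial>lborel)) / h)"
    by (subst Bochner_Integration.integral_diff[symmetric, OF int int])
       (simp add: right_diff_distrib diff_divide_distrib[symmetric])
  finally show ?thesis by (simp add: DERIV_def)
qed

section \<open>The real L^2 pairing and its Cauchy-Schwarz inequality\<close>

definition ip :: "(real \<Rightarrow> real) \<Rightarrow> (real \<Rightarrow> real) \<Rightarrow> real" where
  "ip f g = (LINT x:{0<..}|lborel. f x * g x)"

lemma sq_int_measurable: "sq_int f \<Longrightarrow> (\<lambda>x. indicator {0<..} x * f x) \<in> borel_measurable lborel"
  by (simp add: sq_int_def)

lemma sq_int_integrable_mult:
  assumes f: "sq_int f" and g: "sq_int g"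
  shows "set_integrable lborel {0<..} (\<lambda>x. f x * g x)"
  unfolding set_integrable_def
proof (rule Bochner_Integration.integrable_bound)
  show "integrable lborel (\<lambda>x. indicator {0<..} x *\<^sub>R (f x)^2 + indicator {0<..} x *\<^sub>R (g x)^2)"
    using f g by (auto simp: sq_int_def set_integrable_def)
  have "(\<lambda>x. (indicator {0<..} x * f x) * (indicator {0<..} x * g x)) \<in> borel_measurable lborel"
    using f[THEN sq_int_measurable] g[THEN sq_int_measurable] by (rule borel_measurable_times)
  also have "(\<lambda>x. (indicator {0<..} x * f x) * (indicator {0<..} x * g x)) = (\<lambda>x. indicator {0<..} x *\<^sub>R (f x * g x))"
    by (auto simp: indicator_def)
  finally show "(\<lambda>x. indicator {0<..} x *\<^sub>R (f x * g x)) \<in> borel_measurable lborel" .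
  have "\<bar>a * b\<bar> \<le> a\<^sup>2 + b\<^sup>2" for a b :: real
  proof -
    have "2 * (\<bar>a\<bar> * \<bar>b\<bar>) \<le> a\<^sup>2 + b\<^sup>2" using sum_squares_bound[of "\<bar>a\<bar>" "\<bar>b\<bar>"] by simp
    moreover have "0 \<le> \<bar>a\<bar> * \<bar>b\<bar>" by simp
    ultimately show ?thesis unfolding abs_mult by linarith
  qed
  then show "AE x in lborel. norm (indicator {0<..} x *\<^sub>R (f x * g x)) \<le>
      norm (indicator {0<..} x *\<^sub>R (f x)^2 + indicator {0<..} x *\<^sub>R (g x)^2)"
    by (auto simp: indicator_def)
qed

lemma sq_int_add:
  assumes f: "sq_int f" and g: "sq_int g"
  shows "sq_int (\<lambda>x. f x + g x)"
proof -
  have "(\<lambda>x. indicator {0<..} x * f x + indicator {0<..} x * g x) \<in> borel_measurable lborel"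
    using f[THEN sq_int_measurable] g[THEN sq_int_measurable] by (rule borel_measurable_add)
  moreover have "set_integrable lborel {0<..} (\<lambda>x. (f x)^2 + 2 * (f x * g x) + (g x)^2)"
    using f g sq_int_integrable_mult[OF f g]
    by (intro set_integral_add set_integrable_mult_right) (auto simp: sq_int_def)
  moreover have "(\<lambda>x. (f x)^2 + 2 * (f x * g x) + (g x)^2) = (\<lambda>x. (f x + g x)^2)"
    by (auto simp: power2_sum algebra_simps)
  ultimately show ?thesis by (simp add: sq_int_def algebra_simps)
qed

lemma sq_int_cmult:
  assumes f: "sq_int f"
  shows "sq_int (\<lambda>x. c * f x)"
proof -
  have "(\<lambda>x. c * (indicator {0<..} x * f x)) \<in> borel_measurable lborel"
    by (rule borel_measurable_times[OF borel_measurable_const sq_int_measurable[OF f]])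
  moreover have "set_integrable lborel {0<..} (\<lambda>x. c^2 * (f x)^2)"
    using f by (intro set_integrable_mult_right) (auto simp: sq_int_def)
  ultimately show ?thesis by (simp add: sq_int_def algebra_simps power_mult_distrib)
qed

lemma sq_int_diff:
  assumes f: "sq_int f" and g: "sq_int g"
  shows "sq_int (\<lambda>x. f x - g x)"
  using sq_int_add[OF f sq_int_cmult[OF g, of "-1"]] by simp

lemma ip_diff_left: "sq_int f \<Longrightarrow> sq_int g \<Longrightarrow> sq_int h \<Longrightarrow> ip (\<lambda>x. f x - g x) h = ip f h - ip g h"
  unfolding ip_def left_diff_distrib by (intro set_integral_diff sq_int_integrable_mult)

lemma ip_diff_right: "sq_int f \<Longrightarrow> sq_int g \<Longrightarrow> sq_int h \<Longrightarrow> ip h (\<lambda>x. f x - g x) = ip h f - ip h g"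
  unfolding ip_def right_diff_distrib by (intro set_integral_diff sq_int_integrable_mult)

lemma ip_cmult_left: "ip (\<lambda>x. c * f x) h = c * ip f h"
  unfolding ip_def by (simp add: mult.assoc)

lemma ip_cmult_right: "ip h (\<lambda>x. c * f x) = c * ip h f"
  unfolding ip_def by (simp add: mult.left_commute)

lemma ip_commute: "ip f g = ip g f"
  by (simp add: ip_def mult.commute)

lemma L2_norm_nonneg: "0 \<le> L2_norm f"
  unfolding L2_norm_def set_lebesgue_integral_def by (intro real_sqrt_ge_zero integral_nonneg_AE) auto

lemma L2_norm_power2: "(L2_norm f)^2 = ip f f"
  unfolding L2_norm_def ip_def set_lebesgue_integral_def
  by (subst real_sqrt_pow2) (auto intro!: integral_nonneg_AE simp: power2_eq_square)

text \<open>The quadratic form of \<open>s f - t g\<close> is nonnegative. Inserting the norms,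
  \<open>(s, t) = (B, A)\<close> and \<open>(B, - A)\<close>, gives both signs after division by
  \<open>2 A B\<close>; a vanishing norm needs its own choice of \<open>s\<close> and
  \<open>t\<close>.\<close>

lemma Cauchy_Schwarz_ip:
  assumes f: "sq_int f" and g: "sq_int g"
  shows "\<bar>ip f g\<bar> \<le> L2_norm f * L2_norm g"
proof -
  have *: "0 \<le> s^2 * ip f f - 2 * s * t * ip f g + t^2 * ip g g" for s t
  proof -
    define k where "k = (\<lambda>x. s * f x - t * g x)"
    have k: "sq_int k" unfolding k_def by (intro sq_int_diff sq_int_cmult f g)
    have "0 \<le> ip k k" using L2_norm_power2[of k] by (metis zero_le_power2)
    also have "ip k k = ip (\<lambda>x. s * f x) k - ip (\<lambda>x. t * g x) k"
      unfolding k_def by (intro ip_diff_left sq_int_diff sq_int_cmult f g)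
    also have "\<dots> = s * ip f k - t * ip g k" by (simp add: ip_cmult_left)
    also have "ip f k = s * ip f f - t * ip f g"
      unfolding k_def by (subst ip_diff_right) (auto simp: ip_cmult_right intro!: sq_int_cmult f g)
    also have "ip g k = s * ip f g - t * ip g g"
      unfolding k_def by (subst ip_diff_right) (auto simp: ip_cmult_right ip_commute intro!: sq_int_cmult f g)
    finally show ?thesis by (simp add: algebra_simps power2_eq_square)
  qed
  define A where "A = L2_norm f"
  define B where "B = L2_norm g"
  have A: "ip f f = A^2" "0 \<le> A" and B: "ip g g = B^2" "0 \<le> B"
    by (simp_all add: A_def B_def L2_norm_power2 L2_norm_nonneg)
  have eq0: "ip f g = 0" if "A = 0 \<or> B = 0"
  proof (rule ccontr)
    assume nz: "ip f g \<noteq> 0"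
    have "0 \<le> s^2 * A^2 - 2 * s * t * ip f g + t^2 * B^2" for s t using *[of s t] A B by simp
    \<comment> \<open>If \<open>A = 0\<close> the form is linear in \<open>s\<close>, if
      \<open>B = 0\<close> linear in \<open>t\<close>; a large coefficient then makes it negative
      unless the pairing vanishes. The summand 1 keeps this strict when both norms are 0.\<close>
    from this[of "if A = 0 then (B^2 + 1) else ip f g" "if A = 0 then ip f g else A^2 + 1"] that nz
    have "0 \<le> (ip f g)\<^sup>2 * (B^2 - 2 * (B^2 + 1)) \<or> 0 \<le> (ip f g)\<^sup>2 * (A^2 - 2 * (A^2 + 1))"
      by (auto simp: power2_eq_square algebra_simps split: if_splits)
    moreover have "(ip f g)\<^sup>2 * (z\<^sup>2 - 2 * (z\<^sup>2 + 1)) < 0" for z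
    proof -
      have "p - 2 * (p + 1) < 0" if "0 \<le> p" for p :: real using that by simp
      from this[OF zero_le_power2] have "z\<^sup>2 - 2 * (z\<^sup>2 + 1) < 0" .
      then show ?thesis using nz by (intro mult_pos_neg) auto
    qed
    ultimately show False by (meson not_less)
  qed
  show ?thesis
  proof (cases "A = 0 \<or> B = 0")
    case False
    then have pos: "0 < A" "0 < B" using A B by auto
    have "2 * (A * B) * ip f g \<le> 2 * (A * B) * (A * B)"
    proof -
      have "0 \<le> B\<^sup>2 * A\<^sup>2 - 2 * B * A * ip f g + A\<^sup>2 * B\<^sup>2" using *[of B A] unfolding A(1) B(1) .
      moreover have "B\<^sup>2 * A\<^sup>2 - 2 * B * A * ip f g + A\<^sup>2 * B\<^sup>2 = 2 * (A * B) * (A * B) - 2 * (A * B) * ip f g"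
        by algebra
      ultimately show ?thesis by linarith
    qed
    then have "ip f g \<le> A * B" by (rule mult_left_le_imp_le) (use pos in simp)
    moreover have "2 * (A * B) * (- ip f g) \<le> 2 * (A * B) * (A * B)"
    proof -
      have "0 \<le> B\<^sup>2 * A\<^sup>2 - 2 * B * (-A) * ip f g + (-A)\<^sup>2 * B\<^sup>2" using *[of B "-A"] unfolding A(1) B(1) .
      moreover have "B\<^sup>2 * A\<^sup>2 - 2 * B * (-A) * ip f g + (-A)\<^sup>2 * B\<^sup>2 = 2 * (A * B) * (A * B) - 2 * (A * B) * (- ip f g)"
        by algebra
      ultimately show ?thesis by linarith
    qed
    then have "- ip f g \<le> A * B" by (rule mult_left_le_imp_le) (use pos in simp)
    ultimately show ?thesis unfolding A_def B_def by linarith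
  qed (use eq0 A B in \<open>auto simp: A_def B_def\<close>)
qed

section \<open>The boundary profile\<close>

text \<open>Up to the factor \<open>sqrt y\<close> this is \<open>E_plus x y r\<close> at \<open>y = 0\<close>; hence it solves the heat equation in \<open>r\<close>,
  whose two sides are \<open>dgauss\<close> and \<open>- Delta gauss\<close>.\<close>

definition gauss :: "real \<Rightarrow> real \<Rightarrow> real" where
  "gauss r x = (if 0 < r \<and> 0 < x then sqrt x / (2 * r) * exp (- (x^2) / (4 * r)) else 0)"

definition dgauss :: "real \<Rightarrow> real \<Rightarrow> real" where
  "dgauss r x = gauss r x * (x^2 / (4 * r^2) - 1 / r)"

lemma gauss_nonneg: "0 \<le> gauss r x"
  by (simp add: gauss_def)

lemma measurable_gauss [measurable]: "(\<lambda>(r, x). gauss r x) \<in> borel_measurable (borel \<Otimes>\<^sub>M borel)"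
  unfolding gauss_def by measurable

lemma has_bochner_integral_of_has_integral:
  fixes f :: "real \<Rightarrow> real"
  assumes f: "f \<in> borel_measurable borel" "\<And>x. 0 \<le> f x" and I: "(f has_integral I) UNIV"
  shows "has_bochner_integral lborel f I"
proof (rule has_bochner_integral_nn_integral)
  show "0 \<le> I" using I f(2) by (rule has_integral_nonneg)
  show "(\<integral>\<^sup>+x. ennreal (f x) \<partial>lborel) = ennreal I" by (rule nn_integral_has_integral_lborel[OF f I])
qed (use f in auto)

text \<open>The substitution \<open>y = b x^2\<close> reduces this to Euler's integral for
  \<open>Gamma a\<close>; the 2 in the denominator comes from \<open>dy = 2 b x dx\<close>.\<close>

lemma has_bochner_integral_powr_gaussian:
  assumes a: "0 < a" and b: "0 < (b::real)"
  shows "has_bochner_integral lborel (\<lambda>x. indicator {0<..} x * (x powr (2 * a - 1) * exp (- (b * x^2))))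
           (Gamma a / (2 * b powr a))"
proof -
  define f where "f = (\<lambda>y::real. y powr (a - 1) / exp y)"
  have "(f has_integral Gamma a) {0<..}"
    by (rule iffD2[OF has_integral_spike_set_eq, OF _ _ Gamma_integral_real[OF a, folded f_def]])
      (rule negligible_subset[of "{0}"]; force simp: f_def)+
  then have f: "f absolutely_integrable_on {0<..}" "integral {0<..} f = Gamma a"
    by (auto intro!: nonnegative_absolutely_integrable_1 simp: f_def integral_unique has_integral_integrable)
  define g where "g = (\<lambda>x::real. b * x^2)"
  have img: "g ` {0<..} = {0<..}"
  proof (intro set_eqI iffI)
    fix y :: real assume "y \<in> {0<..}"
    then have "y = g (sqrt (y / b))" "sqrt (y / b) \<in> {0<..}" using b by (auto simp: g_def)
    then show "y \<in> g ` {0<..}" by blast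
  qed (use b in \<open>auto simp: g_def\<close>)
  have "(\<lambda>x. \<bar>2 * b * x\<bar> * f (g x)) absolutely_integrable_on {0<..} \<and>
      integral {0<..} (\<lambda>x. \<bar>2 * b * x\<bar> * f (g x)) = Gamma a"
  proof (subst has_absolute_integral_change_of_variables_1'[where g = g])
    show "inj_on g {0<..}" using b by (auto simp: inj_on_def g_def power2_eq_iff)
    show "(g has_real_derivative 2 * b * x) (at x within {0<..})" for x
      unfolding g_def by (auto intro!: derivative_eq_intros)
    show "{0<..} \<in> sets (lebesgue::real measure)" by simp
    show "f absolutely_integrable_on g ` {0<..} \<and> integral (g ` {0<..}) f = Gamma a"
      using f img by simp
  qed
  then have "((\<lambda>x. \<bar>2 * b * x\<bar> * f (g x)) has_integral Gamma a) {0<..}"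
    using absolutely_integrable_on_def has_integral_iff by blast
  then have "((\<lambda>x. \<bar>2 * b * x\<bar> * f (g x) / (2 * b powr a)) has_integral Gamma a / (2 * b powr a)) {0<..}"
    by (rule has_integral_divide)
  moreover have "\<bar>2 * b * x\<bar> * f (g x) / (2 * b powr a) = x powr (2 * a - 1) * exp (- (b * x^2))"
    if "x \<in> {0<..}" for x
  proof -
    have x: "0 < x" using that by simp
    have "x\<^sup>2 = x powr 2" using x by (simp add: powr_numeral)
    then have "(b * x^2) powr (a - 1) = b powr (a - 1) * x powr (2 * (a - 1))"
      using x b unfolding \<open>x\<^sup>2 = x powr 2\<close>
      by (subst powr_mult) (auto simp: powr_powr simp del: powr_numeral)
    then have "\<bar>2 * b * x\<bar> * f (g x) = 2 * (b * b powr (a - 1)) * (x * x powr (2 * (a - 1))) * exp (- (b * x^2))"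
      using x b by (simp add: f_def g_def exp_minus field_simps)
    also have "b * b powr (a - 1) = b powr a" using b by (simp add: powr_diff)
    also have "x * x powr (2 * (a - 1)) = x powr (2 * a - 1)"
      using x powr_add[of x 1 "2 * (a - 1)"] by (simp add: algebra_simps)
    finally show ?thesis using b by simp
  qed
  ultimately have "((\<lambda>x. x powr (2 * a - 1) * exp (- (b * x^2))) has_integral Gamma a / (2 * b powr a)) {0<..}"
    by (rule has_integral_eq[rotated])
  then have "((\<lambda>x. indicator {0<..} x * (x powr (2 * a - 1) * exp (- (b * x^2)))) has_integral Gamma a / (2 * b powr a)) UNIV"
  proof -
    have "(\<lambda>x. indicator {0<..} x * g x) = (\<lambda>x. if x \<in> {0<..} then g x else 0)" for g :: "real \<Rightarrow> real"
      by (auto simp: indicator_def)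
    then show "((\<lambda>x. x powr (2 * a - 1) * exp (- (b * x^2))) has_integral Gamma a / (2 * b powr a)) {0<..} \<Longrightarrow> ?thesis"
      by (simp only: has_integral_restrict_UNIV)
  qed
  then show ?thesis
    by (intro has_bochner_integral_of_has_integral) auto
qed

text \<open>Source of the explicit moments: norms, pairings, the logarithmic moment and the termwise
  integration of the Bessel series. The bound on \<open>e\<close> is exactly integrability of
  \<open>sqrt x * x powr e\<close> at 0.\<close>

lemma has_bochner_integral_gauss_powr:
  assumes r: "0 < r" and e: "e > - 3 / 2"
  shows "has_bochner_integral lborel (\<lambda>x. gauss r x * x powr e)
           ((4 * r) powr (e / 2 + 3 / 4) * Gamma (e / 2 + 3 / 4) / (4 * r))"
proof -
  define a where "a = e / 2 + 3 / 4"
  have a: "0 < a" using e by (simp add: a_def)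
  have "has_bochner_integral lborel (\<lambda>x. 1 / (2 * r) * (indicator {0<..} x * (x powr (2 * a - 1) * exp (- (1 / (4 * r) * x^2)))))
      (1 / (2 * r) * (Gamma a / (2 * (1 / (4 * r)) powr a)))"
    using r by (intro has_bochner_integral_mult_right has_bochner_integral_powr_gaussian a) auto
  also have "(\<lambda>x. 1 / (2 * r) * (indicator {0<..} x * (x powr (2 * a - 1) * exp (- (1 / (4 * r) * x^2))))) =
      (\<lambda>x. gauss r x * x powr e)"
  proof
    fix x :: real
    show "1 / (2 * r) * (indicator {0<..} x * (x powr (2 * a - 1) * exp (- (1 / (4 * r) * x^2)))) = gauss r x * x powr e"
    proof (cases "0 < x")
      case True
      have "sqrt x * x powr e = x powr (1 / 2 + e)" using True by (simp add: powr_half_sqrt powr_add)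
      also have "1 / 2 + e = 2 * a - 1" by (simp add: a_def)
      finally show ?thesis using True r by (simp add: gauss_def)
    qed (simp add: gauss_def)
  qed
  also have "1 / (2 * r) * (Gamma a / (2 * (1 / (4 * r)) powr a)) = (4 * r) powr a * Gamma a / (4 * r)"
    using r by (simp add: powr_divide field_simps)
  finally show ?thesis unfolding a_def .
qed

lemma has_bochner_integral_gauss_sqrt:
  assumes "0 < r"
  shows "has_bochner_integral lborel (\<lambda>x. gauss r x * sqrt x) 1"
proof -
  have "(\<lambda>x. gauss r x * x powr (1/2)) = (\<lambda>x. gauss r x * sqrt x)"
    by (auto simp: gauss_def powr_half_sqrt)
  then show ?thesis
    using has_bochner_integral_gauss_powr[OF assms, of "1/2"] assms by (simp add: Gamma_1)
qed

text \<open>Inverse parameters add, \<open>1/h = 1/r + 1/s\<close>, so a product of two profiles is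
  one profile times \<open>sqrt x\<close>, whose integral is already known.\<close>

lemma gauss_mult_gauss:
  assumes r: "0 < r" and s: "0 < s"
  shows "gauss r x * gauss s x = 1 / (2 * (r + s)) * (gauss (r * s / (r + s)) x * sqrt x)"
proof (cases "0 < x")
  case True
  define h where "h = r * s / (r + s)"
  have h: "0 < h" using r s by (simp add: h_def)
  have "- (x^2) / (4 * r) + - (x^2) / (4 * s) = - (x^2) / (4 * h)"
    using r s unfolding h_def by (simp add: divide_simps) (simp add: algebra_simps)
  then have E: "exp (- (x^2) / (4 * r)) * exp (- (x^2) / (4 * s)) = exp (- (x^2) / (4 * h))"
    by (simp only: exp_add[symmetric])
  have c: "1 / (4 * r * s) = 1 / (2 * (r + s)) * (1 / (2 * h))"
    using r s by (simp add: h_def divide_simps)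
  have "gauss r x * gauss s x = (sqrt x * sqrt x) * (1 / (4 * r * s)) * (exp (- (x^2) / (4 * r)) * exp (- (x^2) / (4 * s)))"
    using r s True by (simp add: gauss_def mult_ac del: real_sqrt_mult_self)
  also have "\<dots> = 1 / (2 * (r + s)) * (gauss h x * sqrt x)"
    unfolding E c using h True by (simp add: gauss_def)
  finally show ?thesis by (simp add: h_def)
qed (simp add: gauss_def)

lemma has_bochner_integral_gauss_gauss:
  assumes r: "0 < r" and s: "0 < s"
  shows "has_bochner_integral lborel (\<lambda>x. gauss r x * gauss s x) (1 / (2 * (r + s)))"
proof -
  have "has_bochner_integral lborel (\<lambda>x. gauss (r * s / (r + s)) x * sqrt x) 1"
    using r s by (intro has_bochner_integral_gauss_sqrt) simp
  then have "has_bochner_integral lborel (\<lambda>x. 1 / (2 * (r + s)) * (gauss (r * s / (r + s)) x * sqrt x)) (1 / (2 * (r + s)) * 1)"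
    by (rule has_bochner_integral_mult_right)
  then show ?thesis unfolding gauss_mult_gauss[OF r s] mult_1_right .
qed

lemma set_gauss: "indicator {0<..} x *\<^sub>R (f x * gauss r x) = f x * gauss r x"
  by (auto simp: gauss_def indicator_def)

lemma ip_gauss_eq: "ip f (gauss r) = (\<integral>x. f x * gauss r x \<partial>lborel)"
  by (simp add: ip_def set_lebesgue_integral_def set_gauss del: real_scaleR_def)

lemma ip_gauss_gauss:
  assumes r: "0 < r" and s: "0 < s"
  shows "ip (gauss r) (gauss s) = 1 / (2 * (r + s))"
  unfolding ip_gauss_eq using has_bochner_integral_gauss_gauss[OF assms] by (rule has_bochner_integral_integral_eq)

lemma sq_int_gauss_powr:
  assumes r: "0 < r" and e: "0 \<le> e"
  shows "sq_int (\<lambda>x. gauss r x * x powr e)"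
proof -
  have "integrable lborel (\<lambda>x. 1 / (4 * r) * (gauss (r / 2) x * x powr (1 / 2 + 2 * e)))"
    using has_bochner_integral_gauss_powr[of "r / 2" "1 / 2 + 2 * e"] r e
    by (intro integrable_mult_right) (auto simp: has_bochner_integral_iff)
  moreover have "indicator {0<..} x *\<^sub>R (gauss r x * x powr e)\<^sup>2 = 1 / (4 * r) * (gauss (r / 2) x * x powr (1 / 2 + 2 * e))" for x
  proof (cases "0 < x")
    case True
    have "(gauss r x)\<^sup>2 = 1 / (4 * r) * (gauss (r / 2) x * sqrt x)"
      using gauss_mult_gauss[OF r r, of x] r by (simp add: power2_eq_square)
    moreover have "(x powr e)\<^sup>2 = x powr (2 * e)"
      using True by (simp add: power2_eq_square powr_add[symmetric])
    ultimately show ?thesis using True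
      by (simp add: power_mult_distrib powr_add powr_half_sqrt)
  qed (simp add: gauss_def)
  ultimately show ?thesis unfolding sq_int_def set_integrable_def by simp
qed

lemma sq_int_cong: "(\<And>x. 0 < x \<Longrightarrow> f x = g x) \<Longrightarrow> sq_int f \<longleftrightarrow> sq_int g"
  unfolding sq_int_def set_integrable_def
  by (intro arg_cong2[of _ _ _ _ "(\<and>)"] arg_cong[of _ _ "\<lambda>f. f \<in> _"] arg_cong[of _ _ "integrable lborel"] ext)
     (auto simp: indicator_def)

lemma sq_int_gauss: "sq_int (gauss r)"
proof (cases "0 < r")
  case True
  then show ?thesis
    using sq_int_gauss_powr[of r 0] sq_int_cong[of "\<lambda>x. gauss r x * x powr 0" "gauss r"] by simp
qed (simp add: gauss_def[abs_def] sq_int_def set_integrable_def)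

lemma L2_norm_gauss:
  assumes "0 < r"
  shows "L2_norm (gauss r) = 1 / (2 * sqrt r)"
proof -
  have "(L2_norm (gauss r))\<^sup>2 = (1 / (2 * sqrt r))\<^sup>2"
    using ip_gauss_gauss[of r r] assms by (simp add: L2_norm_power2 power_divide power_mult_distrib)
  then show ?thesis using L2_norm_nonneg[of "gauss r"] assms by (simp add: power2_eq_iff_nonneg)
qed

lemma ip_gauss_le:
  assumes "sq_int f" "0 < r"
  shows "\<bar>ip f (gauss r)\<bar> \<le> L2_norm f / (2 * sqrt r)"
  using Cauchy_Schwarz_ip[OF assms(1) sq_int_gauss, of r] L2_norm_gauss[OF assms(2)] by simp

text \<open>The majorant of \<open>dgauss_le\<close>, valid for all parameters in
  \<open>[r/2, 2 r]\<close> at once; its square integrability permits differentiation under the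
  pairing with any L^2 function.\<close>

lemma sq_int_dgauss_bound:
  assumes r: "0 < r"
  shows "sq_int (\<lambda>x. 4 * (gauss (2 * r) x * (x^2 / r^2 + 2 / r)))"
proof -
  have "sq_int (\<lambda>x. 4 / r^2 * (gauss (2 * r) x * x powr 2) + 8 / r * gauss (2 * r) x)"
    using r by (intro sq_int_add sq_int_cmult sq_int_gauss_powr sq_int_gauss) auto
  then show ?thesis
    by (subst (asm) sq_int_cong[where g = "\<lambda>x. 4 * (gauss (2 * r) x * (x^2 / r^2 + 2 / r))"])
       (auto simp: powr_numeral algebra_simps)
qed

lemma gauss_le:
  assumes r: "0 < r" and s: "r / 2 \<le> s" "s \<le> 2 * r"
  shows "gauss s x \<le> 4 * gauss (2 * r) x"
proof (cases "0 < x")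
  case True
  have "exp (- (x^2) / (4 * s)) \<le> exp (- (x^2) / (4 * (2 * r)))"
    using r s True by (auto simp: field_simps)
  moreover have "sqrt x / (2 * s) \<le> 4 * (sqrt x / (2 * (2 * r)))"
    using r s True by (simp add: field_simps mult_left_mono)
  ultimately have "sqrt x / (2 * s) * exp (- (x^2) / (4 * s)) \<le> 4 * (sqrt x / (2 * (2 * r))) * exp (- (x^2) / (4 * (2 * r)))"
    using r s True by (intro mult_mono) auto
  then show ?thesis using r s True by (simp add: gauss_def)
qed (simp add: gauss_def)

lemma dgauss_le:
  assumes r: "0 < r" and s: "r / 2 \<le> s" "s \<le> 2 * r"
  shows "\<bar>dgauss s x\<bar> \<le> 4 * (gauss (2 * r) x * (x^2 / r^2 + 2 / r))"
proof -
  have "x\<^sup>2 / (4 * s\<^sup>2) \<le> x\<^sup>2 / r\<^sup>2"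
  proof (rule divide_left_mono)
    have "r\<^sup>2 \<le> (2 * s)\<^sup>2" using r s by (intro power_mono) auto
    then show "r\<^sup>2 \<le> 4 * s\<^sup>2" by (simp add: power_mult_distrib)
  qed (use r s in auto)
  moreover have "1 / s \<le> 2 / r" using r s by (simp add: field_simps)
  moreover have "0 \<le> x\<^sup>2 / (4 * s\<^sup>2)" "0 \<le> 1 / s" using r s by auto
  ultimately have "\<bar>x\<^sup>2 / (4 * s\<^sup>2) - 1 / s\<bar> \<le> x^2 / r^2 + 2 / r" by linarith
  then have "gauss s x * \<bar>x\<^sup>2 / (4 * s\<^sup>2) - 1 / s\<bar> \<le> (4 * gauss (2 * r) x) * (x^2 / r^2 + 2 / r)"
    using gauss_le[OF assms, of x] gauss_nonneg r by (intro mult_mono) auto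
  then show ?thesis using gauss_nonneg[of s x] by (simp add: dgauss_def abs_mult)
qed

lemma DERIV_gauss:
  assumes "0 < r"
  shows "((\<lambda>r. gauss r x) has_real_derivative dgauss r x) (at r)"
proof (cases "0 < x")
  case True
  have "((\<lambda>r. sqrt x / (2 * r) * exp (- (x^2) / (4 * r))) has_real_derivative dgauss r x) (at r)"
    using assms True
    by (auto intro!: derivative_eq_intros simp: dgauss_def gauss_def field_simps power2_eq_square)
  then show ?thesis
    by (rule DERIV_cong_ev[THEN iffD1, rotated -1])
       (use assms True eventually_nhds_in_open[of "{0<..}" r] in \<open>auto simp: gauss_def elim: eventually_mono\<close>)
next
  case False
  then have "(\<lambda>r. gauss r x) = (\<lambda>r. 0)" "dgauss r x = 0" by (auto simp: gauss_def dgauss_def)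
  then show ?thesis by simp
qed

lemma sq_int_dgauss:
  assumes "0 < r"
  shows "sq_int (dgauss r)"
proof -
  have "sq_int (\<lambda>x. 1 / (4 * r^2) * (gauss r x * x powr 2) - 1 / r * gauss r x)"
    using assms by (intro sq_int_diff sq_int_cmult sq_int_gauss_powr sq_int_gauss) auto
  then show ?thesis
    by (subst (asm) sq_int_cong[where g = "dgauss r"]) (auto simp: powr_numeral algebra_simps dgauss_def)
qed

text \<open>For \<open>|h| < r / 2\<close> the mean value inequality in the parameter bounds the
  difference quotients of \<open>gauss\<close> by \<open>W\<close>, and \<open>f W\<close> is
  integrable as a product of two L^2 functions.\<close>

lemma DERIV_ip_gauss:
  assumes f: "sq_int f" and r: "0 < r"
  shows "((\<lambda>r. ip f (gauss r)) has_real_derivative ip f (dgauss r)) (at r)"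
proof -
  define F where "F = (\<lambda>x. indicator {0<..} x * f x)"
  have [measurable]: "F \<in> borel_measurable lborel" using sq_int_measurable[OF f] by (simp add: F_def)
  define W where "W = (\<lambda>x. 4 * (gauss (2 * r) x * (x^2 / r^2 + 2 / r)))"
  have W: "sq_int W" unfolding W_def by (rule sq_int_dgauss_bound[OF r])
  have W0: "0 \<le> W x" for x using r gauss_nonneg[of "2 * r" x] by (simp add: W_def)
  have quot: "\<bar>(gauss (r + h) x - gauss r x) / h\<bar> \<le> W x" if h: "h \<noteq> 0" "\<bar>h\<bar> < r / 2" for h x
  proof -
    have "norm (gauss (r + h) x - gauss r x) \<le> W x * norm ((r + h) - r)"
    proof (rule field_differentiable_bound[of "{r / 2..2 * r}" "\<lambda>s. gauss s x" "\<lambda>s. dgauss s x" "W x" "r + h" r])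
      show "((\<lambda>r. gauss r x) has_field_derivative dgauss z x) (at z within {r / 2..2 * r})"
        if "z \<in> {r / 2..2 * r}" for z
        using that r by (intro has_field_derivative_at_within[OF DERIV_gauss]) auto
      show "norm (dgauss z x) \<le> W x" if "z \<in> {r / 2..2 * r}" for z
        using that dgauss_le[OF r, of z x] by (simp add: W_def)
      have "- (r / 2) < h" "h < r / 2" using h by linarith+
      then show "r \<in> {r / 2..2 * r}" "r + h \<in> {r / 2..2 * r}" using r by auto
    qed simp
    then have "\<bar>gauss (r + h) x - gauss r x\<bar> \<le> W x * \<bar>h\<bar>" by (simp only: real_norm_def add_diff_cancel_left')
    then show ?thesis using h by (simp add: divide_le_eq)
  qed
  have "((\<lambda>h. \<integral>x. F x * ((gauss (r + h) x - gauss r x) / h) \<partial>lborel) \<longlongrightarrow> (\<integral>x. F x * dgauss r x \<partial>lborel)) (at 0 within UNIV)"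
  proof (rule tendsto_integral_at_within[where w = "\<lambda>x. \<bar>F x * W x\<bar>"])
    show "\<forall>\<^sub>F h in at 0. (\<lambda>x. F x * ((gauss (r + h) x - gauss r x) / h)) \<in> borel_measurable lborel \<and>
        (AE x in lborel. \<bar>F x * ((gauss (r + h) x - gauss r x) / h)\<bar> \<le> \<bar>F x * W x\<bar>)"
      unfolding eventually_at
    proof (intro exI[of _ "r / 2"] conjI ballI impI, goal_cases)
      case (3 h)
      have "\<bar>F x * ((gauss (r + h) x - gauss r x) / h)\<bar> \<le> \<bar>F x * W x\<bar>" for x
        using quot[of h x] 3 W0[of x] unfolding abs_mult
        by (intro mult_left_mono) (auto simp del: abs_divide)
      then show ?case by simp
    qed (use r in auto)
    show "AE x in lborel. ((\<lambda>h. F x * ((gauss (r + h) x - gauss r x) / h)) \<longlongrightarrow> F x * dgauss r x) (at 0)"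
    proof (intro AE_I2 tendsto_mult tendsto_const)
      show "((\<lambda>h. (gauss (r + h) x - gauss r x) / h) \<longlongrightarrow> dgauss r x) (at 0)" for x
        using DERIV_gauss[OF r, of x] by (simp add: DERIV_def)
    qed
    show "integrable lborel (\<lambda>x. \<bar>F x * W x\<bar>)"
      using sq_int_integrable_mult[OF f W] by (simp add: set_integrable_def F_def mult.assoc)
    show "(\<lambda>x. F x * dgauss r x) \<in> borel_measurable lborel"
      unfolding dgauss_def by measurable
  qed
  moreover have "(\<integral>x. F x * ((gauss (r + h) x - gauss r x) / h) \<partial>lborel) = (ip f (gauss (r + h)) - ip f (gauss r)) / h" for h
  proof -
    have "ip f (\<lambda>x. 1 / h * (gauss (r + h) x - gauss r x)) = 1 / h * (ip f (gauss (r + h)) - ip f (gauss r))"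
      by (subst ip_cmult_right, subst ip_diff_right) (auto intro: sq_int_gauss f)
    then show ?thesis by (simp add: ip_def set_lebesgue_integral_def F_def mult.assoc)
  qed
  moreover have "(\<integral>x. F x * dgauss r x \<partial>lborel) = ip f (dgauss r)"
    by (simp add: ip_def set_lebesgue_integral_def F_def mult.assoc)
  ultimately show ?thesis by (simp only: DERIV_def)
qed

section \<open>Logarithmic moments as derivatives of power moments\<close>

lemma abs_powr_minus_one_le:
  fixes x e :: real
  assumes x: "0 < x" and e: "0 < e" "e < 1"
  shows "\<bar>(x powr e - 1) / e\<bar> \<le> \<bar>ln x\<bar> * (1 + x)"
proof -
  define y where "y = e * ln x"
  have xy: "x powr e = exp y" using x by (simp add: powr_def y_def)
  have "\<bar>x powr e - 1\<bar> \<le> e * (\<bar>ln x\<bar> * (1 + x))"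
  proof (cases "1 \<le> x")
    case True
    have y: "0 \<le> y" using True e by (simp add: y_def)
    have "1 - y \<le> exp (- y)" using exp_ge_add_one_self[of "- y"] by simp
    then have "(1 - y) * exp y \<le> exp (- y) * exp y" by (intro mult_right_mono) auto
    then have "exp y - 1 \<le> y * exp y" by (simp add: exp_minus algebra_simps)
    also have "exp y \<le> 1 + x"
    proof -
      have "x powr e \<le> x powr 1" using True e by (intro powr_mono) auto
      then show ?thesis using x xy by simp
    qed
    then have "y * exp y \<le> y * (1 + x)" using y by (rule mult_left_mono)
    finally have "exp y - 1 \<le> e * (\<bar>ln x\<bar> * (1 + x))" using True by (simp add: y_def mult.assoc)
    moreover have "0 \<le> exp y - 1" using y by simp
    ultimately show ?thesis by (simp add: xy)
  next
    case False
    then have y: "y \<le> 0" using x e by (simp add: y_def mult_le_0_iff)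
    then have "exp y \<le> 1" by simp
    then have "\<bar>exp y - 1\<bar> \<le> - y" using exp_ge_add_one_self[of y] by linarith
    also have "- y = e * \<bar>ln x\<bar>" using False x by (simp add: y_def)
    also have "\<dots> \<le> e * (\<bar>ln x\<bar> * (1 + x))" using e x by (intro mult_left_mono) (auto simp: mult_left_le algebra_simps)
    finally show ?thesis by (simp add: xy)
  qed
  then show ?thesis using e by (simp add: divide_le_eq mult.commute)
qed

text \<open>As \<open>(x powr e - 1) / e\<close> tends to \<open>ln x\<close>, a logarithmic moment
  is a right derivative of power moments at exponent 0. The majorant \<open>|ln x| (1 + x)\<close>,
  uniform in \<open>e\<close>, dictates the two integrability assumptions. The lemma serves twice:
  for \<open>gauss\<close> and for \<open>rho\<close>.\<close>

lemma tendsto_integral_powr_quotient: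
  fixes k :: "real \<Rightarrow> real"
  assumes [measurable]: "k \<in> borel_measurable borel" and k0: "\<And>x. x \<le> 0 \<Longrightarrow> k x = 0"
    and k1: "integrable lborel (\<lambda>x. k x * ln x)" and k2: "integrable lborel (\<lambda>x. k x * (x * ln x))"
  shows "((\<lambda>e. \<integral>x. k x * ((x powr e - 1) / e) \<partial>lborel) \<longlongrightarrow> (\<integral>x. k x * ln x \<partial>lborel)) (at_right 0)"
proof (rule tendsto_integral_at_within[where w = "\<lambda>x. \<bar>k x * ln x\<bar> + \<bar>k x * (x * ln x)\<bar>"])
  have bd: "\<bar>k x * ((x powr e - 1) / e)\<bar> \<le> \<bar>k x * ln x\<bar> + \<bar>k x * (x * ln x)\<bar>" if "0 < e" "e < 1" for e x
  proof (cases "0 < x")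
    case True
    have "\<bar>k x\<bar> * \<bar>(x powr e - 1) / e\<bar> \<le> \<bar>k x\<bar> * (\<bar>ln x\<bar> * (1 + x))"
      by (intro mult_left_mono abs_powr_minus_one_le True that) auto
    then have "\<bar>k x * ((x powr e - 1) / e)\<bar> \<le> \<bar>k x\<bar> * (\<bar>ln x\<bar> * (1 + x))" by (simp only: abs_mult)
    also have "\<dots> = \<bar>k x * ln x\<bar> + \<bar>k x * (x * ln x)\<bar>" using True by (simp add: abs_mult algebra_simps)
    finally show ?thesis .
  qed (simp add: k0)
  show "\<forall>\<^sub>F e in at_right 0. (\<lambda>x. k x * ((x powr e - 1) / e)) \<in> borel_measurable lborel \<and>
      (AE x in lborel. \<bar>k x * ((x powr e - 1) / e)\<bar> \<le> \<bar>k x * ln x\<bar> + \<bar>k x * (x * ln x)\<bar>)"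
    unfolding eventually_at_right_field using bd by (intro exI[of _ 1]) auto
  show "AE x in lborel. ((\<lambda>e. k x * ((x powr e - 1) / e)) \<longlongrightarrow> k x * ln x) (at_right 0)"
  proof (intro AE_I2)
    fix x
    show "((\<lambda>e. k x * ((x powr e - 1) / e)) \<longlongrightarrow> k x * ln x) (at_right 0)"
    proof (cases "0 < x")
      case True
      then have "((\<lambda>e. x powr e) has_real_derivative ln x) (at 0)"
        by (auto intro!: derivative_eq_intros)
      then have "((\<lambda>e. (x powr e - 1) / e) \<longlongrightarrow> ln x) (at 0)" using True by (simp add: DERIV_def)
      then have "((\<lambda>e. (x powr e - 1) / e) \<longlongrightarrow> ln x) (at_right 0)"
        by (rule tendsto_mono[rotated]) (simp add: at_le)
      then show ?thesis by (rule tendsto_mult_left)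
    qed (simp add: k0)
  qed
qed (use k1 k2 in auto)

text \<open>From \<open>ln y <= y\<close> applied to \<open>x\<close> and to
  \<open>x powr (- 1/2)\<close>. It trades the logarithm for two powers with known moments, which
  settles integrability.\<close>

lemma abs_ln_le:
  fixes x :: real
  assumes "0 < x"
  shows "\<bar>ln x\<bar> \<le> 2 * x powr (- (1 / 2)) + x"
proof -
  have "ln x \<le> x" using assms ln_le_minus_one[of x] by simp
  moreover have "- ln x = 2 * ln (x powr (- (1 / 2)))" using assms by (simp add: ln_powr)
  moreover have "ln (x powr (- (1 / 2))) \<le> x powr (- (1 / 2))"
    using assms ln_le_minus_one[of "x powr (- (1 / 2))"] by simp
  moreover have "0 \<le> x powr (- (1 / 2))" by simp
  ultimately show ?thesis using assms by linarith
qed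

lemma integrable_gauss_powr:
  assumes "0 < r" "- 3 / 2 < e"
  shows "integrable lborel (\<lambda>x. gauss r x * x powr e)"
  using has_bochner_integral_gauss_powr[OF assms] by (rule integrable.intros)

lemma integrable_gauss_powr_ln:
  assumes r: "0 < r" and e: "- 1 < e"
  shows "integrable lborel (\<lambda>x. gauss r x * x powr e * ln x)"
proof (rule Bochner_Integration.integrable_bound)
  show "integrable lborel (\<lambda>x. 2 * (gauss r x * x powr (e - 1 / 2)) + gauss r x * x powr (e + 1))"
    using r e by (intro Bochner_Integration.integrable_add integrable_mult_right integrable_gauss_powr) auto
  show "AE x in lborel. norm (gauss r x * x powr e * ln x) \<le>
      norm (2 * (gauss r x * x powr (e - 1 / 2)) + gauss r x * x powr (e + 1))"
  proof (intro AE_I2)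
    fix x
    show "norm (gauss r x * x powr e * ln x) \<le> norm (2 * (gauss r x * x powr (e - 1 / 2)) + gauss r x * x powr (e + 1))"
    proof (cases "0 < x")
      case True
      have "gauss r x * x powr e * \<bar>ln x\<bar> \<le> gauss r x * x powr e * (2 * x powr (- (1 / 2)) + x)"
        using True gauss_nonneg[of r x] by (intro mult_left_mono abs_ln_le) auto
      also have "\<dots> = 2 * (gauss r x * x powr (e - 1 / 2)) + gauss r x * x powr (e + 1)"
      proof -
        have "x powr (e - 1 / 2) = x powr e * x powr (- (1 / 2))" by (simp add: powr_add[symmetric])
        moreover have "x powr (e + 1) = x powr e * x" using True by (simp add: powr_add)
        ultimately show ?thesis by (simp add: algebra_simps)
      qed
      finally show ?thesis using gauss_nonneg[of r x] by (simp add: abs_mult)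
    qed (simp add: gauss_def)
  qed
qed measurable

lemma gauss_sqrt_powr: "gauss r x * x powr (1 / 2) = gauss r x * sqrt x"
  by (simp add: gauss_def powr_half_sqrt)

lemma integrable_gauss_sqrt_ln: "0 < r \<Longrightarrow> integrable lborel (\<lambda>x. gauss r x * sqrt x * ln x)"
  using integrable_gauss_powr_ln[of r "1 / 2"] by (simp add: gauss_sqrt_powr)

text \<open>The moment with exponent \<open>1/2 + e\<close> equals
  \<open>(4 r) powr (e / 2) * Gamma (1 + e / 2)\<close>. Its derivative at \<open>e = 0\<close>
  brings in the Euler constant through Gamma'(1), and the halves because the Gaussian depends on
  \<open>x^2\<close>.\<close>

lemma integral_gauss_sqrt_ln:
  assumes r: "0 < r"
  shows "(\<integral>x. gauss r x * sqrt x * ln x \<partial>lborel) = (ln (4 * r) - euler_mascheroni) / 2"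
proof -
  define k where "k = (\<lambda>x. gauss r x * sqrt x)"
  have "((\<lambda>e. \<integral>x. k x * ((x powr e - 1) / e) \<partial>lborel) \<longlongrightarrow> (\<integral>x. k x * ln x \<partial>lborel)) (at_right 0)"
  proof (rule tendsto_integral_powr_quotient)
    show "k \<in> borel_measurable borel" unfolding k_def by measurable
    show "integrable lborel (\<lambda>x. k x * ln x)" using integrable_gauss_sqrt_ln[OF r] by (simp add: k_def)
    have "integrable lborel (\<lambda>x. gauss r x * x powr (3 / 2) * ln x)"
      using r by (intro integrable_gauss_powr_ln) auto
    moreover have "gauss r x * x powr (3 / 2) * ln x = k x * (x * ln x)" for x
    proof (cases "0 < x")
      case True
      have "x powr (3 / 2) = x powr (1 / 2) * x" using True powr_add[of x "1/2" 1] by simp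
      then show ?thesis using True by (simp add: k_def powr_half_sqrt)
    qed (simp add: k_def gauss_def)
    ultimately show "integrable lborel (\<lambda>x. k x * (x * ln x))" by simp
  qed (simp add: k_def gauss_def)
  moreover have "((\<lambda>e. \<integral>x. k x * ((x powr e - 1) / e) \<partial>lborel) \<longlongrightarrow> (ln (4 * r) - euler_mascheroni) / 2) (at_right 0)"
  proof -
    have "((\<lambda>e. (4 * r) powr (e / 2) * Gamma (1 + e / 2)) has_real_derivative (ln (4 * r) - euler_mascheroni) / 2) (at 0)"
      using r by (auto intro!: derivative_eq_intros simp: Gamma_1 field_simps)
    then have "((\<lambda>e. ((4 * r) powr (e / 2) * Gamma (1 + e / 2) - 1) / e) \<longlongrightarrow> (ln (4 * r) - euler_mascheroni) / 2) (at 0)"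
      using r by (simp add: DERIV_def Gamma_1)
    then have *: "((\<lambda>e. ((4 * r) powr (e / 2) * Gamma (1 + e / 2) - 1) / e) \<longlongrightarrow> (ln (4 * r) - euler_mascheroni) / 2) (at_right 0)"
      by (rule tendsto_mono[rotated]) (simp add: at_le)
    have "(\<integral>x. k x * ((x powr e - 1) / e) \<partial>lborel) = ((4 * r) powr (e / 2) * Gamma (1 + e / 2) - 1) / e" if "0 < e" for e
    proof -
      have "has_bochner_integral lborel (\<lambda>x. gauss r x * x powr (1 / 2 + e)) ((4 * r) powr (e / 2) * Gamma (1 + e / 2))"
        using has_bochner_integral_gauss_powr[OF r, of "1 / 2 + e"] that r
        by (simp add: add_divide_distrib powr_add add.commute)
      then have "has_bochner_integral lborel (\<lambda>x. gauss r x * x powr (1 / 2 + e) - gauss r x * sqrt x) ((4 * r) powr (e / 2) * Gamma (1 + e / 2) - 1)"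
        by (intro has_bochner_integral_diff has_bochner_integral_gauss_sqrt r)
      then have "has_bochner_integral lborel (\<lambda>x. (gauss r x * x powr (1 / 2 + e) - gauss r x * sqrt x) / e) (((4 * r) powr (e / 2) * Gamma (1 + e / 2) - 1) / e)"
        by (intro has_bochner_integral_divide)
      moreover have "(gauss r x * x powr (1 / 2 + e) - gauss r x * sqrt x) / e = k x * ((x powr e - 1) / e)" for x
        by (cases "0 < x") (simp_all add: k_def powr_add powr_half_sqrt gauss_def algebra_simps diff_divide_distrib)
      ultimately show ?thesis by (simp add: has_bochner_integral_iff)
    qed
    then have "\<forall>\<^sub>F e in at_right 0. ((4 * r) powr (e / 2) * Gamma (1 + e / 2) - 1) / e = (\<integral>x. k x * ((x powr e - 1) / e) \<partial>lborel)"
      by (auto simp: eventually_at_right_field intro!: exI[of _ 1])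
    with * show ?thesis by (rule Lim_transform_eventually)
  qed
  ultimately have "(\<integral>x. k x * ln x \<partial>lborel) = (ln (4 * r) - euler_mascheroni) / 2"
    by (rule tendsto_unique[rotated]) simp
  then show ?thesis by (simp add: k_def)
qed

text \<open>\<open>gauss r x * sqrt x\<close> is a probability density that concentrates at 0 as
  \<open>r\<close> decreases. Pairing with \<open>gauss r\<close> therefore reads off the expansion
  at 0: \<open>sqrt x\<close> contributes 1, and \<open>sqrt x * ln x\<close> contributes the moment
  of \<open>integral_gauss_sqrt_ln\<close>.\<close>

lemma tendsto_ip_gauss_expansion:
  assumes f: "sq_int f" and d: "0 < d"
    and exp: "AE x in lborel. 0 < x \<and> x < d \<longrightarrow> \<bar>f x - cp * sqrt x - cm * (sqrt x * ln x)\<bar> \<le> C * x"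
  shows "((\<lambda>r. ip f (gauss r) - cp - cm * ((ln (4 * r) - euler_mascheroni) / 2)) \<longlongrightarrow> 0) (at_right 0)"
proof -
  define R where "R = (\<lambda>x. f x - cp * sqrt x - cm * (sqrt x * ln x))"
  have int_f: "integrable lborel (\<lambda>x. f x * gauss r x)" for r
    using sq_int_integrable_mult[OF f sq_int_gauss, of r]
    by (simp add: set_integrable_def set_gauss del: real_scaleR_def)
  have R_eq: "R x * gauss r x = f x * gauss r x - cp * (gauss r x * sqrt x) - cm * (gauss r x * sqrt x * ln x)" for r x
    by (simp add: R_def algebra_simps)
  have int_R: "integrable lborel (\<lambda>x. R x * gauss r x)" if "0 < r" for r
    unfolding R_eq using that has_bochner_integral_gauss_sqrt[OF that]
    by (intro Bochner_Integration.integrable_diff integrable_mult_right int_f integrable_gauss_sqrt_ln)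
       (auto simp: has_bochner_integral_iff)
  have R_ip: "(\<integral>x. R x * gauss r x \<partial>lborel) = ip f (gauss r) - cp - cm * ((ln (4 * r) - euler_mascheroni) / 2)"
    if "0 < r" for r
    unfolding R_eq using that has_bochner_integral_gauss_sqrt[OF that] int_f integrable_gauss_sqrt_ln[OF that] integral_gauss_sqrt_ln[OF that]
    by (simp add: has_bochner_integral_iff ip_gauss_eq)
  define A where "A = (\<integral>x. \<bar>R x * gauss 1 x\<bar> \<partial>lborel)"
  define G where "G = \<bar>C\<bar> * Gamma (5 / 4)"
  \<comment> \<open>Below \<open>d\<close> the remainder is at most \<open>|C| x\<close>, and the
    pairing of \<open>x\<close> is of order \<open>r powr (1/4)\<close>. Beyond \<open>d\<close>,
    comparison with the fixed profile \<open>gauss 1\<close> gains the factor \<open>E\<close>,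
    which is exponentially small in \<open>1/r\<close>.\<close>
  have bound: "\<bar>\<integral>x. R x * gauss r x \<partial>lborel\<bar> \<le> G * (4 * r) powr (1 / 4) + A * (1 / r * exp (- (d^2 / 4) * (1 / r - 1)))"
    if r: "0 < r" "r < 1" for r
  proof -
    define E where "E = 1 / r * exp (- (d^2 / 4) * (1 / r - 1))"
    have E: "0 \<le> E" using r by (simp add: E_def)
    have "\<bar>\<integral>x. R x * gauss r x \<partial>lborel\<bar> \<le> (\<integral>x. \<bar>R x * gauss r x\<bar> \<partial>lborel)"
      by (rule integral_abs_bound)
    also have "\<dots> \<le> (\<integral>x. \<bar>C\<bar> * (gauss r x * x powr 1) + E * \<bar>R x * gauss 1 x\<bar> \<partial>lborel)"
    proof (rule integral_mono_AE)
      show "integrable lborel (\<lambda>x. \<bar>R x * gauss r x\<bar>)" using int_R[OF r(1)] by simp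
      show "integrable lborel (\<lambda>x. \<bar>C\<bar> * (gauss r x * x powr 1) + E * \<bar>R x * gauss 1 x\<bar>)"
        using int_R[of 1] integrable_gauss_powr[OF r(1), of 1]
        by (intro Bochner_Integration.integrable_add integrable_mult_right) auto
      show "AE x in lborel. \<bar>R x * gauss r x\<bar> \<le> \<bar>C\<bar> * (gauss r x * x powr 1) + E * \<bar>R x * gauss 1 x\<bar>"
        using exp
      proof eventually_elim
        fix x assume x: "0 < x \<and> x < d \<longrightarrow> \<bar>f x - cp * sqrt x - cm * (sqrt x * ln x)\<bar> \<le> C * x"
        consider "x \<le> 0" | "0 < x" "x < d" | "0 < x" "d \<le> x" by linarith
        then show "\<bar>R x * gauss r x\<bar> \<le> \<bar>C\<bar> * (gauss r x * x powr 1) + E * \<bar>R x * gauss 1 x\<bar>"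
        proof cases
          case 1
          then show ?thesis by (simp add: gauss_def)
        next
          case 2
          then have "\<bar>R x\<bar> \<le> C * x" using x by (simp add: R_def)
          also have "\<dots> \<le> \<bar>C\<bar> * x" using 2 by (intro mult_right_mono) auto
          finally have "\<bar>R x\<bar> * gauss r x \<le> \<bar>C\<bar> * x * gauss r x"
            by (rule mult_right_mono) (rule gauss_nonneg)
          moreover have "0 \<le> E * \<bar>R x * gauss 1 x\<bar>" using E by simp
          ultimately show ?thesis using gauss_nonneg[of r x] 2 by (simp add: abs_mult algebra_simps)
        next
          case 3
          have "gauss r x \<le> E * gauss 1 x"
          proof -
            have "- (x\<^sup>2) / (4 * r) \<le> - (d^2 / 4) * (1 / r - 1) - x\<^sup>2 / 4"
            proof -
              have "d^2 / 4 * (1 / r - 1) \<le> x^2 / 4 * (1 / r - 1)"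
                using 3 d r by (intro mult_right_mono divide_right_mono power_mono) (auto simp: field_simps)
              then show ?thesis by (simp add: algebra_simps diff_divide_distrib)
            qed
            then have "exp (- (x\<^sup>2) / (4 * r)) \<le> exp (- (d^2 / 4) * (1 / r - 1)) * exp (- (x\<^sup>2) / 4)"
              by (simp add: exp_add[symmetric])
            then have "sqrt x / (2 * r) * exp (- (x\<^sup>2) / (4 * r)) \<le> sqrt x / (2 * r) * (exp (- (d^2 / 4) * (1 / r - 1)) * exp (- (x\<^sup>2) / 4))"
              using 3 r by (intro mult_left_mono) auto
            then show ?thesis using 3 r by (simp add: gauss_def E_def mult_ac)
          qed
          then have "\<bar>R x\<bar> * gauss r x \<le> \<bar>R x\<bar> * (E * gauss 1 x)" by (intro mult_left_mono) auto
          then have "\<bar>R x * gauss r x\<bar> \<le> E * \<bar>R x * gauss 1 x\<bar>"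
            using gauss_nonneg[of r x] gauss_nonneg[of 1 x] by (simp add: abs_mult mult_ac)
          moreover have "0 \<le> \<bar>C\<bar> * (gauss r x * x powr 1)" using 3 gauss_nonneg[of r x] by simp
          ultimately show ?thesis by linarith
        qed
      qed
    qed
    also have "\<dots> = \<bar>C\<bar> * ((4 * r) powr (5 / 4) * Gamma (5 / 4) / (4 * r)) + E * A"
      using int_R[of 1] has_bochner_integral_gauss_powr[OF r(1), of 1]
      by (subst Bochner_Integration.integral_add) (auto simp: has_bochner_integral_iff A_def)
    also have "(4 * r) powr (5 / 4) * Gamma (5 / 4) / (4 * r) = (4 * r) powr (1 / 4) * Gamma (5 / 4)"
    proof -
      have "(4 * r) powr (5 / 4) = (4 * r) powr (1 / 4) * (4 * r)" using r powr_add[of "4 * r" "1/4" 1] by simp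
      then show ?thesis using r by simp
    qed
    finally show ?thesis by (simp add: E_def G_def algebra_simps)
  qed
  define e where "e = d^2 / 4"
  have e: "0 < e" using d by (simp add: e_def)
  have "((\<lambda>r. G * (4 * r) powr (1 / 4) + A * (1 / r * exp (- e * (1 / r - 1)))) \<longlongrightarrow> G * 0 + A * 0) (at_right 0)"
    by (intro tendsto_add tendsto_mult_left) (use e in real_asymp)+
  then have lim: "((\<lambda>r. G * (4 * r) powr (1 / 4) + A * (1 / r * exp (- (d^2 / 4) * (1 / r - 1)))) \<longlongrightarrow> 0) (at_right 0)"
    by (simp add: e_def)
  show ?thesis
  proof (rule Lim_null_comparison[OF _ lim])
    show "\<forall>\<^sub>F r in at_right 0. norm (ip f (gauss r) - cp - cm * ((ln (4 * r) - euler_mascheroni) / 2)) \<le>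
        G * (4 * r) powr (1 / 4) + A * (1 / r * exp (- (d^2 / 4) * (1 / r - 1)))"
      unfolding eventually_at_right_field using bound R_ip by (intro exI[of _ 1]) auto
  qed
qed

section \<open>Smooth cutoffs\<close>

text \<open>Demands \<open>n\<close> successive derivatives in the sense of \<open>deriv\<close>,
  with no continuity of the last one. Quantified over all \<open>n\<close> and on the whole line
  this is the smoothness that \<open>test_fun\<close> requires, and the recursion makes closure
  properties plain inductions.\<close>

primrec Ck :: "nat \<Rightarrow> real set \<Rightarrow> (real \<Rightarrow> real) \<Rightarrow> bool" where
  "Ck 0 S f = True"
| "Ck (Suc n) S f = ((\<forall>x\<in>S. f differentiable (at x)) \<and> Ck n S (deriv f))"

lemma Ck_cong:
  assumes "open S" "\<And>x. x \<in> S \<Longrightarrow> f x = g x" "Ck n S f"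
  shows "Ck n S g"
  using assms(2,3)
proof (induction n arbitrary: f g)
  case (Suc n)
  have D: "(g has_real_derivative deriv f x) (at x)" if "x \<in> S" for x
  proof (rule has_field_derivative_transform_within_open[OF _ \<open>open S\<close> that])
    show "(f has_real_derivative deriv f x) (at x)"
      using Suc.prems(2) that by (simp add: DERIV_deriv_iff_real_differentiable)
  qed (rule Suc.prems(1))
  have "Ck n S (deriv g)"
  proof (rule Suc.IH)
    show "Ck n S (deriv f)" using Suc.prems(2) by simp
    show "deriv f x = deriv g x" if "x \<in> S" for x using DERIV_imp_deriv[OF D[OF that]] by simp
  qed
  with D show ?case by (auto simp: real_differentiable_def)
qed simp

lemma Ck_SucI:
  assumes "open S" "\<And>x. x \<in> S \<Longrightarrow> (f has_real_derivative f' x) (at x)" "Ck n S f'"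
  shows "Ck (Suc n) S f"
proof -
  have "Ck n S (deriv f)"
    by (rule Ck_cong[OF assms(1) _ assms(3)]) (simp add: DERIV_imp_deriv[OF assms(2)])
  then show ?thesis using assms(2) by (auto simp: real_differentiable_def)
qed

lemma Ck_SucD: "Ck (Suc n) S f \<Longrightarrow> x \<in> S \<Longrightarrow> (f has_real_derivative deriv f x) (at x)"
  by (simp add: DERIV_deriv_iff_real_differentiable)

lemma Ck_lower: "Ck (Suc n) S f \<Longrightarrow> Ck n S f"
  by (induction n arbitrary: f) simp_all

lemma Ck_const: "Ck n S (\<lambda>x. c)"
  by (induction n arbitrary: c) simp_all

lemma Ck_add: "open S \<Longrightarrow> Ck n S f \<Longrightarrow> Ck n S g \<Longrightarrow> Ck n S (\<lambda>x. f x + g x)"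
proof (induction n arbitrary: f g)
  case (Suc n)
  show ?case
  proof (rule Ck_SucI[OF Suc.prems(1)])
    show "Ck n S (\<lambda>x. deriv f x + deriv g x)" using Suc by simp
  qed (intro derivative_intros Ck_SucD[OF Suc.prems(2)] Ck_SucD[OF Suc.prems(3)])
qed simp

lemma Ck_mult: "open S \<Longrightarrow> Ck n S f \<Longrightarrow> Ck n S g \<Longrightarrow> Ck n S (\<lambda>x. f x * g x)"
proof (induction n arbitrary: f g)
  case (Suc n)
  show ?case
  proof (rule Ck_SucI[OF Suc.prems(1)])
    show "((\<lambda>x. f x * g x) has_real_derivative deriv f x * g x + deriv g x * f x) (at x)" if "x \<in> S" for x
      by (intro DERIV_mult Ck_SucD[OF Suc.prems(2) that] Ck_SucD[OF Suc.prems(3) that])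
    show "Ck n S (\<lambda>x. deriv f x * g x + deriv g x * f x)"
    proof -
      have "Ck n S (deriv f)" "Ck n S (deriv g)" using Suc.prems by simp_all
      then show ?thesis
        by (intro Ck_add Suc.IH Suc.prems(1) Ck_lower[OF Suc.prems(2)] Ck_lower[OF Suc.prems(3)])
    qed
  qed
qed simp

lemma Ck_affine: "Ck n S (\<lambda>x. a * x + b)"
proof (cases n)
  case (Suc m)
  have "deriv (\<lambda>x. a * x + b) = (\<lambda>x. a)" by (auto intro!: DERIV_imp_deriv derivative_eq_intros)
  then show ?thesis using Suc by (auto intro!: Ck_const derivative_intros)
qed simp

lemma Ck_compose:
  "open S \<Longrightarrow> open T \<Longrightarrow> (\<And>x. x \<in> S \<Longrightarrow> g x \<in> T) \<Longrightarrow> Ck n T f \<Longrightarrow> Ck n S g \<Longrightarrow> Ck n S (\<lambda>x. f (g x))"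
proof (induction n arbitrary: f)
  case (Suc n)
  show ?case
  proof (rule Ck_SucI[OF Suc.prems(1)])
    show "((\<lambda>x. f (g x)) has_real_derivative deriv f (g x) * deriv g x) (at x)" if "x \<in> S" for x
      by (rule DERIV_chain2[OF Ck_SucD[OF Suc.prems(4) Suc.prems(3)[OF that]] Ck_SucD[OF Suc.prems(5) that]])
    have "Ck n S (\<lambda>x. deriv f (g x))"
    proof (rule Suc.IH)
      show "Ck n T (deriv f)" using Suc.prems(4) by simp
      show "Ck n S g" by (rule Ck_lower[OF Suc.prems(5)])
    qed (use Suc.prems(1-3) in blast)+
    moreover have "Ck n S (deriv g)" using Suc.prems(5) by simp
    ultimately show "Ck n S (\<lambda>x. deriv f (g x) * deriv g x)" by (intro Ck_mult Suc.prems(1))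
  qed
qed simp

lemma Ck_inverse: "Ck n (- {0}) inverse"
proof (induction n)
  case (Suc n)
  show ?case
  proof (rule Ck_SucI)
    show "(inverse has_real_derivative (-1) * (inverse x * inverse x)) (at x)" if "x \<in> - {0}" for x :: real
      using that by (auto intro!: derivative_eq_intros simp: power2_eq_square)
    show "Ck n (- {0}) (\<lambda>x. (-1) * (inverse x * inverse x))"
      by (intro Ck_mult Ck_const Suc) auto
  qed auto
qed simp

lemma Ck_exp: "Ck n UNIV exp"
proof (induction n)
  case (Suc n) then show ?case by (intro Ck_SucI[of _ exp exp]) (auto intro: DERIV_exp)
qed simp

lemma Ck_sqrt: "Ck n {0<..} sqrt"
proof (induction n)
  case (Suc n)
  show ?case
  proof (rule Ck_SucI)
    show "(sqrt has_real_derivative (1 / 2) * inverse (sqrt x)) (at x)" if "x \<in> {0<..}" for x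
      using that by (auto intro!: derivative_eq_intros simp: field_simps)
    show "Ck n {0<..} (\<lambda>x. (1 / 2) * inverse (sqrt x))"
      by (intro Ck_mult Ck_const Ck_compose[OF _ _ _ Ck_inverse Suc]) auto
  qed auto
qed simp

lemma Ck_Un: "Ck n S f \<Longrightarrow> Ck n T f \<Longrightarrow> Ck n (S \<union> T) f"
  by (induction n arbitrary: f) auto

lemma Ck_deriv_funpow: "Ck (Suc n) S f \<Longrightarrow> x \<in> S \<Longrightarrow> (deriv ^^ n) f differentiable (at x)"
  by (induction n arbitrary: f) (simp_all add: funpow_swap1)

text \<open>Cauchy's flat function exp(-1/x) with an extra factor x^(-k). The derivative of a member
  is a linear combination of members, see \<open>DERIV_flat\<close>, so smoothness of the whole
  family is a single induction.\<close>

definition flat :: "nat \<Rightarrow> real \<Rightarrow> real" where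
  "flat k x = (if 0 < x then inverse x ^ k * exp (- inverse x) else 0)"

lemma tendsto_flat_quotient: "((\<lambda>x. inverse x ^ k * exp (- inverse x)) \<longlongrightarrow> (0::real)) (at_right 0)"
proof -
  have "((\<lambda>x. inverse x ^ k / exp (inverse x)) \<longlongrightarrow> (0::real)) (at_right 0)"
    by (rule filterlim_compose[OF tendsto_power_div_exp_0 filterlim_inverse_at_top_right])
  then show ?thesis by (simp add: exp_minus divide_inverse)
qed

lemma DERIV_flat: "(flat k has_real_derivative flat (k + 2) x - real k * flat (k + 1) x) (at x)"
proof -
  consider "x < 0" | "x = 0" | "0 < x" by linarith
  then show ?thesis
  proof cases
    case 1
    then have "((\<lambda>x. 0) has_real_derivative flat (k + 2) x - real k * flat (k + 1) x) (at x)"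
      by (simp add: flat_def)
    then show ?thesis
      by (rule has_field_derivative_transform_within_open[of _ _ _ "{..<0}"]) (use 1 in \<open>auto simp: flat_def\<close>)
  next
    case 2
    have "((\<lambda>h. (flat k (0 + h) - flat k 0) / h) \<longlongrightarrow> 0) (at_left 0)"
      by (rule Lim_transform_eventually[OF tendsto_const])
         (auto simp: eventually_at_left_field flat_def intro!: exI[of _ "-1"])
    \<comment> \<open>From the right the quotient is
      \<open>inverse h ^ Suc k * exp (- inverse h)\<close>, where the exponential beats every
      power.\<close>
    moreover have "((\<lambda>h. (flat k (0 + h) - flat k 0) / h) \<longlongrightarrow> 0) (at_right 0)"
      by (rule Lim_transform_eventually[OF tendsto_flat_quotient[of "Suc k"]])
         (auto simp: eventually_at_right_field flat_def divide_inverse mult_ac intro!: exI[of _ 1])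
    ultimately have "((\<lambda>h. (flat k (0 + h) - flat k 0) / h) \<longlongrightarrow> 0) (at 0)"
      by (rule filterlim_split_at)
    then show ?thesis using 2 by (simp add: DERIV_def flat_def)
  next
    case 3
    have "((\<lambda>x. inverse x ^ k * exp (- inverse x)) has_real_derivative flat (k + 2) x - real k * flat (k + 1) x) (at x)"
    proof -
      have i: "(inverse has_real_derivative - (inverse x ^ 2)) (at x)"
        using 3 by (auto intro!: derivative_eq_intros simp: power2_eq_square)
      have e: "((\<lambda>x. exp (- inverse x)) has_real_derivative exp (- inverse x) * inverse x ^ 2) (at x)"
        using 3 by (auto intro!: derivative_eq_intros simp: power2_eq_square)
      have "real k * (- (inverse x ^ 2) * inverse x ^ (k - Suc 0)) * exp (- inverse x) + exp (- inverse x) * inverse x ^ 2 * inverse x ^ k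
          = flat (k + 2) x - real k * flat (k + 1) x"
        using 3 by (cases k) (simp_all add: flat_def algebra_simps power2_eq_square)
      with DERIV_mult[OF DERIV_power[OF i, of k] e] show ?thesis by simp
    qed
    then show ?thesis
      by (rule has_field_derivative_transform_within_open[of _ _ _ "{0<..}"]) (use 3 in \<open>auto simp: flat_def\<close>)
  qed
qed

lemma Ck_flat: "Ck n UNIV (flat k)"
proof (induction n arbitrary: k)
  case (Suc n)
  show ?case
  proof (rule Ck_SucI[OF _ DERIV_flat])
    have "Ck n UNIV (\<lambda>x. flat (k + 2) x + (- real k) * flat (k + 1) x)"
      by (intro Ck_add Ck_mult Ck_const Suc) auto
    then show "Ck n UNIV (\<lambda>x. flat (k + 2) x - real k * flat (k + 1) x)" by simp
  qed auto
qed simp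

text \<open>A smooth step, 0 up to 1 and 1 from 2 on. The quotient is legitimate because
  \<open>x > 1\<close> or \<open>x < 2\<close> always holds, so the two summands of the denominator
  never vanish together.\<close>

definition chi :: "real \<Rightarrow> real" where
  "chi x = flat 0 (x - 1) * inverse (flat 0 (x - 1) + flat 0 (2 - x))"

lemma flat0: "flat 0 x = (if 0 < x then exp (- inverse x) else 0)"
  by (simp add: flat_def)

lemma chi_denom_pos: "0 < flat 0 (x - 1) + flat 0 (2 - x)"
  by (auto simp: flat0 intro: add_pos_pos)

lemma chi_0: "x \<le> 1 \<Longrightarrow> chi x = 0"
  by (simp add: chi_def flat0)

lemma chi_1: "2 \<le> x \<Longrightarrow> chi x = 1"
  by (simp add: chi_def flat0)

lemma chi_nonneg: "0 \<le> chi x" and chi_le_1: "chi x \<le> 1"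
proof -
  have "0 \<le> flat 0 (x - 1)" "0 \<le> flat 0 (2 - x)" by (simp_all add: flat0)
  then show "0 \<le> chi x" "chi x \<le> 1"
    using chi_denom_pos[of x] by (simp_all add: chi_def divide_inverse[symmetric])
qed

lemma Ck_chi: "Ck n UNIV chi"
  unfolding chi_def[abs_def]
proof (intro Ck_mult Ck_compose[of UNIV "- {0}" _ n inverse])
  have 1: "Ck n UNIV (\<lambda>x. flat 0 (x - 1))"
    using Ck_compose[OF _ _ _ Ck_flat Ck_affine[of n UNIV 1 "-1"]] by simp
  have 2: "Ck n UNIV (\<lambda>x. flat 0 (2 - x))"
    using Ck_compose[OF _ _ _ Ck_flat Ck_affine[of n UNIV "-1" 2]] by simp
  show "Ck n UNIV (\<lambda>x. flat 0 (x - 1))" by fact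
  show "Ck n UNIV (\<lambda>x. flat 0 (x - 1) + flat 0 (2 - x))" by (intro Ck_add 1 2) simp
  show "flat 0 (x - 1) + flat 0 (2 - x) \<in> - {0}" for x using chi_denom_pos[of x] by simp
qed (auto intro: Ck_inverse)

definition chi1 :: "real \<Rightarrow> real" where "chi1 = deriv chi"
definition chi2 :: "real \<Rightarrow> real" where "chi2 = deriv chi1"

lemma DERIV_chi: "(chi has_real_derivative chi1 x) (at x)"
  using Ck_SucD[OF Ck_chi[of "Suc 0"]] by (simp add: chi1_def)

lemma DERIV_chi1: "(chi1 has_real_derivative chi2 x) (at x)"
proof -
  have "Ck 1 UNIV (deriv chi)" using Ck_chi[of 2] by (simp add: numeral_2_eq_2)
  then show ?thesis using Ck_SucD[of 0 UNIV "deriv chi" x] by (simp add: chi1_def chi2_def)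
qed

lemma isCont_chi2: "isCont chi2 x"
proof -
  have "Ck (Suc 0) UNIV (deriv (deriv chi))" using Ck_chi[of 3] by (simp add: numeral_3_eq_3)
  from Ck_SucD[OF this] have "(chi2 has_real_derivative deriv chi2 x) (at x)" by (simp add: chi1_def chi2_def)
  then show ?thesis by (rule DERIV_isCont)
qed

lemma isCont_chi1: "isCont chi1 x"
  using DERIV_chi1 by (rule DERIV_isCont)

text \<open>Derivatives of \<open>chi\<close> are seen to vanish on open sets only; continuity
  carries this to the endpoints 1 and 2, where the cutoff calculations evaluate them.\<close>

lemma zero_outside_of_open:
  fixes g :: "real \<Rightarrow> real"
  assumes "isCont g 1" "isCont g 2" "\<And>x. x < 1 \<or> 2 < x \<Longrightarrow> g x = 0" "x \<le> 1 \<or> 2 \<le> x"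
  shows "g x = 0"
proof -
  have "g 1 = 0"
  proof (rule tendsto_unique[of "at_left 1"])
    show "(g \<longlongrightarrow> g 1) (at_left 1)" using assms(1) by (simp add: isCont_def filterlim_at_split)
    show "(g \<longlongrightarrow> 0) (at_left 1)"
      by (rule Lim_transform_eventually[OF tendsto_const])
         (auto simp: eventually_at_left_field assms(3) intro!: exI[of _ 0])
  qed simp
  moreover have "g 2 = 0"
  proof (rule tendsto_unique[of "at_right 2"])
    show "(g \<longlongrightarrow> g 2) (at_right 2)" using assms(2) by (simp add: isCont_def filterlim_at_split)
    show "(g \<longlongrightarrow> 0) (at_right 2)"
      by (rule Lim_transform_eventually[OF tendsto_const])
         (auto simp: eventually_at_right_field assms(3) intro!: exI[of _ 3])
  qed simp
  ultimately show ?thesis using assms(3,4) by (cases "x = 1 \<or> x = 2") auto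
qed

lemma chi1_0: "x \<le> 1 \<or> 2 \<le> x \<Longrightarrow> chi1 x = 0"
proof (rule zero_outside_of_open[of chi1, OF isCont_chi1 isCont_chi1])
  fix x :: real assume x: "x < 1 \<or> 2 < x"
  have "(chi has_real_derivative 0) (at x)"
  proof (cases "x < 1")
    case True
    then show ?thesis
      by (intro has_field_derivative_transform_within_open[of "\<lambda>_. 0" 0 x "{..<1}" chi]) (auto simp: chi_0)
  next
    case False
    with x show ?thesis
      by (intro has_field_derivative_transform_within_open[of "\<lambda>_. 1" 0 x "{2<..}" chi]) (auto simp: chi_1)
  qed
  with DERIV_chi[of x] show "chi1 x = 0" by (rule DERIV_unique)
qed

lemma chi2_0: "x \<le> 1 \<or> 2 \<le> x \<Longrightarrow> chi2 x = 0"
proof (rule zero_outside_of_open[of chi2, OF isCont_chi2 isCont_chi2])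
  fix x :: real assume x: "x < 1 \<or> 2 < x"
  have "(chi1 has_real_derivative 0) (at x)"
  proof (cases "x < 1")
    case True
    then show ?thesis
      by (intro has_field_derivative_transform_within_open[of "\<lambda>_. 0" 0 x "{..<1}" chi1]) (auto simp: chi1_0)
  next
    case False
    with x show ?thesis
      by (intro has_field_derivative_transform_within_open[of "\<lambda>_. 0" 0 x "{2<..}" chi1]) (auto simp: chi1_0)
  qed
  with DERIV_chi1[of x] show "chi2 x = 0" by (rule DERIV_unique)
qed

lemma chi_bound:
  obtains M where "0 < M" "\<And>x. \<bar>chi1 x\<bar> \<le> M" "\<And>x. \<bar>chi2 x\<bar> \<le> M"
proof -
  obtain A where A: "\<And>x. x \<in> {1..2} \<Longrightarrow> \<bar>chi1 x\<bar> \<le> A"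
    by (rule continuous_on_Icc_abs_bounded[of 1 2 chi1])
       (auto intro!: continuous_at_imp_continuous_on isCont_chi1)
  obtain B where B: "\<And>x. x \<in> {1..2} \<Longrightarrow> \<bar>chi2 x\<bar> \<le> B"
    by (rule continuous_on_Icc_abs_bounded[of 1 2 chi2])
       (auto intro!: continuous_at_imp_continuous_on isCont_chi2)
  show ?thesis
  proof (rule that[of "\<bar>A\<bar> + \<bar>B\<bar> + 1"])
    show "\<bar>chi1 x\<bar> \<le> \<bar>A\<bar> + \<bar>B\<bar> + 1" for x
      using A[of x] chi1_0[of x] by (cases "x \<in> {1..2}") auto
    show "\<bar>chi2 x\<bar> \<le> \<bar>A\<bar> + \<bar>B\<bar> + 1" for x
      using B[of x] chi2_0[of x] by (cases "x \<in> {1..2}") auto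
  qed simp
qed

lemma measurable_chi [measurable]: "chi \<in> borel_measurable borel" "chi1 \<in> borel_measurable borel" "chi2 \<in> borel_measurable borel"
  by (intro borel_measurable_continuous_onI continuous_at_imp_continuous_on ballI
      DERIV_isCont[OF DERIV_chi] isCont_chi1 isCont_chi2)+

section \<open>Space derivatives of the profile and its compactly supported approximations\<close>

definition gauss' :: "real \<Rightarrow> real \<Rightarrow> real" where
  "gauss' r x = gauss r x * (1 / (2 * x) - x / (2 * r))"

lemma DERIV_gauss_x:
  assumes r: "0 < r" and x: "0 < x"
  shows "(gauss r has_real_derivative gauss' r x) (at x)"
proof -
  have "((\<lambda>x. sqrt x / (2 * r) * exp (- (x^2) / (4 * r))) has_real_derivative gauss' r x) (at x)"
    using assms by (auto intro!: derivative_eq_intros simp: gauss'_def gauss_def divide_simps) (simp add: algebra_simps power2_eq_square)?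
  then show ?thesis
    by (rule has_field_derivative_transform_within_open[of _ _ _ "{0<..}"]) (use r x in \<open>auto simp: gauss_def\<close>)
qed

text \<open>Together with \<open>DERIV_gauss\<close> this is the heat equation for the profile: the
  second space derivative plus \<open>gauss r x / (4 x^2)\<close> equals the derivative in
  \<open>r\<close>.\<close>

lemma DERIV_gauss'_x:
  assumes r: "0 < r" and x: "0 < x"
  shows "(gauss' r has_real_derivative - gauss r x / (4 * x^2) + dgauss r x) (at x)"
proof -
  have "((\<lambda>x. gauss r x * (1 / (2 * x) - x / (2 * r))) has_real_derivative
      gauss' r x * (1 / (2 * x) - x / (2 * r)) + (- 1 / (2 * x^2) - 1 / (2 * r)) * gauss r x) (at x)"
    using x r by (intro DERIV_mult DERIV_gauss_x) (auto intro!: derivative_eq_intros simp: power2_eq_square)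
  also have "gauss' r x * (1 / (2 * x) - x / (2 * r)) + (- 1 / (2 * x^2) - 1 / (2 * r)) * gauss r x = - gauss r x / (4 * x^2) + dgauss r x"
    using x r by (simp add: gauss'_def dgauss_def divide_simps power2_eq_square) (simp add: algebra_simps)
  finally show ?thesis by (simp add: gauss'_def[abs_def])
qed

lemma Ck_gauss:
  assumes r: "0 < r"
  shows "Ck n {0<..} (gauss r)"
proof (rule Ck_cong[of "{0<..}" "\<lambda>x. sqrt x * (1 / (2 * r)) * exp ((- 1 / (4 * r)) * (x * x))"])
  have id: "Ck n {0<..} (\<lambda>x. x)" using Ck_affine[of n "{0<..}" 1 0] by simp
  show "Ck n {0<..} (\<lambda>x. sqrt x * (1 / (2 * r)) * exp ((- 1 / (4 * r)) * (x * x)))"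
    by (intro Ck_mult Ck_const Ck_sqrt id Ck_compose[OF _ _ _ Ck_exp]) auto
qed (use r in \<open>auto simp: gauss_def power2_eq_square\<close>)

text \<open>The two transitions have different scales: length \<open>1/n\<close> at the endpoint,
  where derivatives grow like \<open>n\<close> and \<open>n^2\<close> and produce the boundary term,
  but unit length at infinity, where the Gaussian decay suppresses everything.\<close>

definition cutoff :: "nat \<Rightarrow> real \<Rightarrow> real" where
  "cutoff n x = chi (real n * x) * chi (real n - x)"

lemma test_fun_cutoff_gauss:
  assumes r: "0 < r" and n: "4 \<le> n"
  shows "test_fun (\<lambda>x. cutoff n x * gauss r x)"
proof -
  have zero: "cutoff n x * gauss r x = 0" if "x \<notin> {1 / real n..real n}" for x
  proof (cases "x < 1 / real n")
    case True
    then have "real n * x \<le> 1" using n by (simp add: field_simps)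
    then show ?thesis by (simp add: cutoff_def chi_0)
  next
    case False
    then have "real n - x \<le> 1" using that by auto
    then show ?thesis by (simp add: cutoff_def chi_0)
  qed
  have "Ck k UNIV (\<lambda>x. cutoff n x * gauss r x)" for k
  proof -
    have 1: "Ck k {0<..} (\<lambda>x. chi (real n * x))"
      using Ck_compose[OF _ _ _ Ck_chi Ck_affine[of k "{0<..}" "real n" 0]] by simp
    have 2: "Ck k {0<..} (\<lambda>x. chi (real n - x))"
      using Ck_compose[OF _ _ _ Ck_chi Ck_affine[of k "{0<..}" "-1" "real n"]] by simp
    have "Ck k {0<..} (\<lambda>x. cutoff n x * gauss r x)"
      unfolding cutoff_def by (intro Ck_mult 1 2 Ck_gauss r) auto
    \<comment> \<open>\<open>gauss r\<close> is not smooth at 0, but the product vanishes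
      identically near 0. Two overlapping open sets cover the line.\<close>
    moreover have "Ck k {..<1 / real n} (\<lambda>x. cutoff n x * gauss r x)"
      by (rule Ck_cong[OF _ _ Ck_const[of k _ 0]]) (use zero in auto)
    ultimately have "Ck k ({0<..} \<union> {..<1 / real n}) (\<lambda>x. cutoff n x * gauss r x)" by (rule Ck_Un)
    moreover have "{0<..} \<union> {..<1 / real n} = UNIV"
    proof -
      have "0 < 1 / real n" using n by simp
      then have "x \<in> {0<..} \<union> {..<1 / real n}" for x
        by (simp only: Un_iff greaterThan_iff lessThan_iff) linarith
      then show ?thesis by blast
    qed
    ultimately show ?thesis by simp
  qed
  then have "\<forall>k x. (deriv ^^ k) (\<lambda>x. cutoff n x * gauss r x) differentiable (at x)"
    using Ck_deriv_funpow by blast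
  moreover have "0 < 1 / real n" using n by simp
  moreover have "1 / real n \<le> real n"
    by (rule order.trans[of _ 1]) (use n in auto)
  ultimately show ?thesis unfolding test_fun_def using zero by blast
qed

section \<open>Green's formula at the singular endpoint\<close>

text \<open>Leibniz' rule for the product. For \<open>n >= 4\<close> the inner transition zone
  \<open>[1/n, 2/n]\<close> and the outer one \<open>[n - 2, n - 1]\<close> are disjoint, so the
  commutator splits into a part at the endpoint and a part at infinity without mixed terms.\<close>

lemma Delta_op_cutoff_gauss:
  assumes r: "0 < r" and n: "4 \<le> n" and x: "0 < x"
  shows "Delta_op (\<lambda>x. cutoff n x * gauss r x) x = - cutoff n x * dgauss r x
    - (2 * real n * chi1 (real n * x) * gauss' r x + (real n)^2 * chi2 (real n * x) * gauss r x)
    - (chi2 (real n - x) * gauss r x - 2 * chi1 (real n - x) * gauss' r x)"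
proof -
  define N where "N = real n"
  have N: "4 \<le> N" using n by (simp add: N_def)
  define c1 where "c1 = (\<lambda>x. N * chi1 (N * x) * chi (N - x) - chi (N * x) * chi1 (N - x))"
  define c2 where "c2 = (\<lambda>x. N^2 * chi2 (N * x) * chi (N - x) - 2 * N * chi1 (N * x) * chi1 (N - x) + chi (N * x) * chi2 (N - x))"
  have lin: "((\<lambda>x. N * x) has_real_derivative N) (at x)" "((\<lambda>x. N - x) has_real_derivative - 1) (at x)" for x
    by (auto intro!: derivative_eq_intros)
  have chiN: "((\<lambda>x. chi (N * x)) has_real_derivative N * chi1 (N * x)) (at x)" for x
    using DERIV_chain2[OF DERIV_chi lin(1)[of x]] by (simp add: mult.commute[of _ N])
  have chi1N: "((\<lambda>x. chi1 (N * x)) has_real_derivative N * chi2 (N * x)) (at x)" for x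
    using DERIV_chain2[OF DERIV_chi1 lin(1)[of x]] by (simp add: mult.commute[of _ N])
  have chiR: "((\<lambda>x. chi (N - x)) has_real_derivative - chi1 (N - x)) (at x)" for x
    using DERIV_chain2[OF DERIV_chi lin(2)] by simp
  have chi1R: "((\<lambda>x. chi1 (N - x)) has_real_derivative - chi2 (N - x)) (at x)" for x
    using DERIV_chain2[OF DERIV_chi1 lin(2)] by simp
  have c: "(cutoff n has_real_derivative c1 x) (at x)" for x
    using DERIV_mult[OF chiN[of x] chiR[of x]]
    by (simp add: cutoff_def[abs_def] c1_def N_def mult_ac)
  have "((\<lambda>x. N * chi1 (N * x) * chi (N - x) - chi (N * x) * chi1 (N - x)) has_real_derivative c2 x) (at x)" for x
    by (rule DERIV_cong[OF DERIV_diff[OF DERIV_mult[OF DERIV_cmult[OF chi1N[of x], of N] chiR[of x]] DERIV_mult[OF chiN[of x] chi1R[of x]]]])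
       (simp add: c2_def power2_eq_square algebra_simps)
  then have cc: "(c1 has_real_derivative c2 x) (at x)" for x
    by (simp add: c1_def)
  define \<phi> where "\<phi> = (\<lambda>x. cutoff n x * gauss r x)"
  define \<phi>1 where "\<phi>1 = (\<lambda>x. c1 x * gauss r x + gauss' r x * cutoff n x)"
  have d1: "(\<phi> has_real_derivative \<phi>1 y) (at y)" if "0 < y" for y
    unfolding \<phi>_def \<phi>1_def by (rule DERIV_mult[OF c DERIV_gauss_x[OF r that]])
  have d2: "(\<phi>1 has_real_derivative (c2 x * gauss r x + gauss' r x * c1 x)
      + ((- gauss r x / (4 * x^2) + dgauss r x) * cutoff n x + c1 x * gauss' r x)) (at x)"
    unfolding \<phi>1_def
    by (rule DERIV_add[OF DERIV_mult[OF cc DERIV_gauss_x[OF r x]] DERIV_mult[OF DERIV_gauss'_x[OF r x] c]])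
  have "(deriv \<phi> has_real_derivative (c2 x * gauss r x + gauss' r x * c1 x)
      + ((- gauss r x / (4 * x^2) + dgauss r x) * cutoff n x + c1 x * gauss' r x)) (at x)"
    by (rule has_field_derivative_transform_within_open[OF d2, of "{0<..}"])
       (use x in \<open>auto simp: DERIV_imp_deriv[OF d1]\<close>)
  then have "(deriv ^^ 2) \<phi> x = (c2 x * gauss r x + gauss' r x * c1 x)
      + ((- gauss r x / (4 * x^2) + dgauss r x) * cutoff n x + c1 x * gauss' r x)"
    by (simp add: numeral_2_eq_2 DERIV_imp_deriv)
  then have eq: "Delta_op \<phi> x = - cutoff n x * dgauss r x - (2 * c1 x * gauss' r x + c2 x * gauss r x)"
    using x by (simp add: Delta_op_def \<phi>_def field_simps)
  \<comment> \<open>At every point either the inner transition is inactive or the outer factor is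
    constantly 1; \<open>far\<close> is the mirror statement.\<close>
  have cutoff_error: "chi1 (N * x) = 0 \<and> chi2 (N * x) = 0 \<or> chi (N - x) = 1 \<and> chi1 (N - x) = 0 \<and> chi2 (N - x) = 0"
  proof (cases "2 \<le> N * x")
    case False
    have "x \<le> 1"
    proof (rule ccontr)
      assume "\<not> x \<le> 1"
      then have "N * 1 \<le> N * x" using N by (intro mult_left_mono) auto
      then show False using False N by linarith
    qed
    then show ?thesis using N by (auto simp: chi_1 chi1_0 chi2_0)
  qed (simp add: chi1_0 chi2_0)
  have far: "chi1 (N - x) = 0 \<and> chi2 (N - x) = 0 \<or> chi (N * x) = 1"
  proof (cases "2 \<le> N - x")
    case False
    then have "2 \<le> x" using N by simp
    then have "4 * 1 \<le> N * x" using N by (intro mult_mono) auto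
    then show ?thesis by (auto simp: chi_1)
  qed (auto simp: chi1_0 chi2_0)
  have c1_eq: "c1 x = N * chi1 (N * x) - chi1 (N - x)"
    unfolding c1_def using cutoff_error far by auto
  have c2_eq: "c2 x = N^2 * chi2 (N * x) + chi2 (N - x)"
    unfolding c2_def using cutoff_error far by auto
  show ?thesis
    using eq unfolding \<phi>_def c1_eq c2_eq N_def by (simp add: algebra_simps)
qed

lemma sq_int_gauss_affine: "0 < r \<Longrightarrow> sq_int (\<lambda>x. gauss r x * (1 + x))"
proof -
  assume r: "0 < r"
  have "sq_int (\<lambda>x. gauss r x + gauss r x * x powr 1)"
    using r by (intro sq_int_add sq_int_gauss sq_int_gauss_powr) auto
  then show ?thesis
    by (subst (asm) sq_int_cong[where g = "\<lambda>x. gauss r x * (1 + x)"]) (auto simp: algebra_simps)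
qed

lemma sq_int_integrable_bounded:
  assumes f: "sq_int f" and w: "sq_int w" and b: "b \<in> borel_measurable borel"
    and bd: "\<And>x. 0 < x \<Longrightarrow> \<bar>b x\<bar> \<le> C * \<bar>w x\<bar>"
  shows "set_integrable lborel {0<..} (\<lambda>x. f x * b x)"
  unfolding set_integrable_def
proof (rule Bochner_Integration.integrable_bound)
  show "integrable lborel (\<lambda>x. C * \<bar>indicator {0<..} x *\<^sub>R (f x * w x)\<bar>)"
    using sq_int_integrable_mult[OF f w] by (intro integrable_mult_right integrable_abs) (simp add: set_integrable_def)
  have [measurable]: "(\<lambda>x. indicator {0<..} x * f x) \<in> borel_measurable lborel" by (rule sq_int_measurable[OF f])
  have "(\<lambda>x. (indicator {0<..} x * f x) * b x) \<in> borel_measurable lborel" using b by measurable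
  then show "(\<lambda>x. indicator {0<..} x *\<^sub>R (f x * b x)) \<in> borel_measurable lborel"
    by (simp add: mult.assoc)
  have "\<bar>f x * b x\<bar> \<le> \<bar>C * \<bar>f x * w x\<bar>\<bar>" if "0 < x" for x
  proof -
    have "\<bar>f x\<bar> * \<bar>b x\<bar> \<le> \<bar>f x\<bar> * (C * \<bar>w x\<bar>)" by (intro mult_left_mono bd that) auto
    also have "\<dots> = C * \<bar>f x * w x\<bar>" by (simp add: abs_mult mult_ac)
    also have "\<dots> \<le> \<bar>C * \<bar>f x * w x\<bar>\<bar>" by (rule abs_ge_self)
    finally show ?thesis by (simp only: abs_mult)
  qed
  then show "AE x in lborel. norm (indicator {0<..} x *\<^sub>R (f x * b x)) \<le> norm (C * \<bar>indicator {0<..} x *\<^sub>R (f x * w x)\<bar>)"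
    by (auto simp: indicator_def)
qed

lemma gauss'_abs_le:
  assumes "0 < r" "0 < x"
  shows "\<bar>gauss' r x\<bar> \<le> gauss r x * (1 / (2 * x) + x / (2 * r))"
proof -
  have "\<bar>1 / (2 * x) - x / (2 * r)\<bar> \<le> 1 / (2 * x) + x / (2 * r)"
    using assms by (simp add: abs_le_iff)
  then show ?thesis using gauss_nonneg[of r x] by (simp add: gauss'_def abs_mult mult_left_mono)
qed

lemma measurable_gauss' [measurable]: "gauss' r \<in> borel_measurable borel"
  unfolding gauss'_def by measurable

lemma measurable_dgauss [measurable]: "dgauss r \<in> borel_measurable borel"
  unfolding dgauss_def by measurable

lemma measurable_cutoff [measurable]: "cutoff n \<in> borel_measurable borel"
  unfolding cutoff_def by measurable

lemma cutoff_le: "0 \<le> cutoff n x" "cutoff n x \<le> 1"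
  unfolding cutoff_def using chi_nonneg chi_le_1 by (auto intro: mult_le_one)

lemma tendsto_cutoff:
  assumes "0 < x"
  shows "(\<lambda>n. cutoff n x) \<longlonglongrightarrow> 1"
proof (rule Lim_transform_eventually[OF tendsto_const])
  have "\<forall>\<^sub>F n in sequentially. real n \<ge> max (2 / x) (x + 2)"
    using filterlim_real_sequentially unfolding filterlim_at_top by blast
  then show "\<forall>\<^sub>F n in sequentially. 1 = cutoff n x"
    by eventually_elim (use assms in \<open>auto simp: cutoff_def chi_1 field_simps\<close>)
qed

text \<open>Infinity contributes no boundary term: the commutator there lives beyond
  \<open>n - 2\<close>, and \<open>gauss r x * (1 + x)\<close> is a square integrable majorant
  independent of \<open>n\<close>.\<close>

lemma far_term_tendsto_0:
  assumes f: "sq_int f" and r: "0 < r"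
  shows "(\<lambda>n. LINT x:{0<..}|lborel. f x * (chi2 (real n - x) * gauss r x - 2 * chi1 (real n - x) * gauss' r x)) \<longlonglongrightarrow> 0"
    and "4 \<le> n \<Longrightarrow> set_integrable lborel {0<..} (\<lambda>x. f x * (chi2 (real n - x) * gauss r x - 2 * chi1 (real n - x) * gauss' r x))"
proof -
  obtain M where M: "0 < M" "\<And>x. \<bar>chi1 x\<bar> \<le> M" "\<And>x. \<bar>chi2 x\<bar> \<le> M" by (rule chi_bound) blast
  define b where "b = (\<lambda>n x. chi2 (real n - x) * gauss r x - 2 * chi1 (real n - x) * gauss' r x)"
  define w where "w = (\<lambda>x. gauss r x * (1 + x))"
  have w: "sq_int w" unfolding w_def by (rule sq_int_gauss_affine[OF r])
  define C where "C = M * (2 + 1 / r)"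
  have bd: "\<bar>b n x\<bar> \<le> C * \<bar>w x\<bar>" if n: "4 \<le> n" and x: "0 < x" for n x
  proof (cases "2 \<le> real n - x")
    case True
    then show ?thesis using M(1) r by (simp add: b_def chi1_0 chi2_0 C_def)
  next
    case False
    \<comment> \<open>The outer zone starts beyond 2, so the singular factor \<open>1 / x\<close> in
      \<open>gauss'\<close> is harmless.\<close>
    then have x2: "1 \<le> x" using n by simp
    have "\<bar>b n x\<bar> \<le> \<bar>chi2 (real n - x) * gauss r x\<bar> + \<bar>2 * chi1 (real n - x) * gauss' r x\<bar>"
      unfolding b_def by (rule abs_triangle_ineq4)
    also have "\<dots> \<le> M * gauss r x + (2 * M) * (gauss r x * (1 / (2 * x) + x / (2 * r)))"
      unfolding abs_mult using gauss_nonneg[of r x] M gauss'_abs_le[OF r x]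
      by (intro add_mono mult_mono) auto
    also have "\<dots> = M * gauss r x * (1 + 1 / x + x / r)" using x r by (simp add: algebra_simps)
    also have "\<dots> \<le> M * gauss r x * ((2 + 1 / r) * (1 + x))"
    proof (intro mult_left_mono)
      have "1 / x \<le> 1" using x2 by simp
      moreover have "(2 + 1 / r) * (1 + x) = 2 + 2 * x + 1 / r + x / r" by (simp add: algebra_simps add_divide_distrib)
      ultimately show "1 + 1 / x + x / r \<le> (2 + 1 / r) * (1 + x)"
        using x2 zero_le_divide_1_iff[of r] r by linarith
    qed (use M gauss_nonneg in auto)
    finally show ?thesis using gauss_nonneg[of r x] x by (simp add: C_def w_def mult_ac)
  qed
  have [measurable]: "b n \<in> borel_measurable borel" for n unfolding b_def by measurable
  have int: "set_integrable lborel {0<..} (\<lambda>x. f x * b n x)" if "4 \<le> n" for n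
    by (rule sq_int_integrable_bounded[OF f w _ bd[OF that]]) auto
  then show "4 \<le> n \<Longrightarrow> set_integrable lborel {0<..} (\<lambda>x. f x * (chi2 (real n - x) * gauss r x - 2 * chi1 (real n - x) * gauss' r x))"
    by (simp add: b_def)
  have "(\<lambda>n. LINT x:{0<..}|lborel. f x * b (n + 4) x) \<longlonglongrightarrow> (\<integral>(x::real). (0::real) \<partial>lborel)"
    unfolding set_lebesgue_integral_def
  proof (rule integral_dominated_convergence[where f = "\<lambda>x. 0::real" and w = "\<lambda>x. C * \<bar>indicator {0<..} x *\<^sub>R (f x * w x)\<bar>"])
    show "integrable lborel (\<lambda>x. C * \<bar>indicator {0<..} x *\<^sub>R (f x * w x)\<bar>)"
      using sq_int_integrable_mult[OF f w] by (intro integrable_mult_right integrable_abs) (simp add: set_integrable_def)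
    show "(\<lambda>x. indicator {0<..} x *\<^sub>R (f x * b (n + 4) x)) \<in> borel_measurable lborel" for n
      using int[of "n + 4"] by (simp add: set_integrable_def integrable_iff_bounded)
    have "\<bar>f x * b (n + 4) x\<bar> \<le> C * \<bar>f x * w x\<bar>" if "0 < x" for x n
    proof -
      have "\<bar>f x\<bar> * \<bar>b (n + 4) x\<bar> \<le> \<bar>f x\<bar> * (C * \<bar>w x\<bar>)" by (intro mult_left_mono bd that) auto
      then show ?thesis by (simp add: abs_mult mult_ac)
    qed
    then show "AE x in lborel. norm (indicator {0<..} x *\<^sub>R (f x * b (n + 4) x)) \<le> C * \<bar>indicator {0<..} x *\<^sub>R (f x * w x)\<bar>" for n
      by (auto simp: indicator_def)
    show "AE x in lborel. (\<lambda>n. indicator {0<..} x *\<^sub>R (f x * b (n + 4) x)) \<longlonglongrightarrow> 0"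
    proof (intro AE_I2)
      fix x :: real
      have "\<forall>\<^sub>F n in sequentially. real n \<ge> x + 2"
        using filterlim_real_sequentially by (simp add: filterlim_at_top)
      then have "\<forall>\<^sub>F n in sequentially. 0 = indicator {0<..} x *\<^sub>R (f x * b (n + 4) x)"
        by eventually_elim (auto simp: b_def chi1_0 chi2_0)
      then show "(\<lambda>n. indicator {0<..} x *\<^sub>R (f x * b (n + 4) x)) \<longlonglongrightarrow> 0"
        by (rule Lim_transform_eventually[OF tendsto_const])
    qed
  qed simp
  then have "(\<lambda>n. LINT x:{0<..}|lborel. f x * b (n + 4) x) \<longlonglongrightarrow> 0" by simp
  then show "(\<lambda>n. LINT x:{0<..}|lborel. f x * (chi2 (real n - x) * gauss r x - 2 * chi1 (real n - x) * gauss' r x)) \<longlonglongrightarrow> 0"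
    unfolding b_def by (rule LIMSEQ_offset)
qed

text \<open>The part of the commutator of \<open>Delta\<close> with the cutoff that lives near the endpoint \<open>0\<close>.\<close>

definition cutoff_error :: "real \<Rightarrow> nat \<Rightarrow> real \<Rightarrow> real" where
  "cutoff_error r n x = 2 * real n * chi1 (real n * x) * gauss' r x + (real n)^2 * chi2 (real n * x) * gauss r x"

lemma measurable_cutoff_error [measurable]: "cutoff_error r n \<in> borel_measurable borel"
  unfolding cutoff_error_def by measurable

lemma cutoff_error_outside: "x \<notin> {1 / real n..2 / real n} \<Longrightarrow> 0 < n \<Longrightarrow> cutoff_error r n x = 0"
proof -
  assume "x \<notin> {1 / real n..2 / real n}" "0 < n"
  then have "real n * x \<le> 1 \<or> 2 \<le> real n * x" by (auto simp: field_simps)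
  then show ?thesis by (simp add: cutoff_error_def chi1_0 chi2_0)
qed

lemma cutoff_error_bound:
  assumes r: "0 < r" and n: "4 \<le> n" and x: "x \<in> {1 / real n..2 / real n}"
    and M: "0 < M" "\<And>x. \<bar>chi1 x\<bar> \<le> M" "\<And>x. \<bar>chi2 x\<bar> \<le> M"
  shows "\<bar>cutoff_error r n x\<bar> \<le> gauss r x * (M * (2 * (real n)^2 + 2 / r))"
proof -
  have n0: "0 < real n" using n by simp
  have x0: "0 < x" using x n0 by (auto intro: less_le_trans[of 0 "1 / real n"])
  have "1 / (2 * x) \<le> real n / 2" using x n0 x0 by (simp add: field_simps)
  moreover have "x / (2 * r) \<le> 1 / (real n * r)" using x n0 r by (simp add: field_simps)
  ultimately have "gauss r x * (1 / (2 * x) + x / (2 * r)) \<le> gauss r x * (real n / 2 + 1 / (real n * r))"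
    by (intro mult_left_mono add_mono) (auto simp: gauss_nonneg)
  then have g': "\<bar>gauss' r x\<bar> \<le> gauss r x * (real n / 2 + 1 / (real n * r))"
    using gauss'_abs_le[OF r x0] by linarith
  have "\<bar>cutoff_error r n x\<bar> \<le> \<bar>2 * real n * chi1 (real n * x) * gauss' r x\<bar> + \<bar>(real n)^2 * chi2 (real n * x) * gauss r x\<bar>"
    unfolding cutoff_error_def by (rule abs_triangle_ineq)
  also have "\<dots> \<le> 2 * real n * M * (gauss r x * (real n / 2 + 1 / (real n * r))) + (real n)^2 * M * gauss r x"
    unfolding abs_mult using g' M gauss_nonneg[of r x] by (intro add_mono mult_mono) auto
  also have "\<dots> = gauss r x * (M * (2 * (real n)^2 + 2 / r))"
    using n0 r by (simp add: field_simps power2_eq_square)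
  finally show ?thesis .
qed

lemma set_integrable_cutoff_error:
  assumes f: "sq_int f" and r: "0 < r" and n: "4 \<le> n"
  shows "set_integrable lborel {0<..} (\<lambda>x. f x * cutoff_error r n x)"
proof -
  obtain M where M: "0 < M" "\<And>x. \<bar>chi1 x\<bar> \<le> M" "\<And>x. \<bar>chi2 x\<bar> \<le> M" by (rule chi_bound) blast
  show ?thesis
  proof (rule sq_int_integrable_bounded[OF f sq_int_gauss])
    fix x :: real assume x: "0 < x"
    show "\<bar>cutoff_error r n x\<bar> \<le> (M * (2 * (real n)^2 + 2 / r)) * \<bar>gauss r x\<bar>"
    proof (cases "x \<in> {1 / real n..2 / real n}")
      case True
      then show ?thesis using cutoff_error_bound[OF r n True M] gauss_nonneg[of r x] by (simp add: mult.commute)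
    next
      case False
      then show ?thesis using cutoff_error_outside[OF False] n M r gauss_nonneg[of r x] by simp
    qed
  qed measurable
qed

text \<open>On the singular part \<open>F\<close> of \<open>f\<close> the commutator is a total
  derivative plus \<open>n chi1(n x)\<close> times the Wronskian \<open>Z\<close> of
  \<open>gauss r\<close> and \<open>F\<close>. Since \<open>n chi1(n x)\<close> has integral 1 and
  shrinks to the endpoint, the limit is the Wronskian at 0, and only the logarithmic coefficient
  survives there. The remainder \<open>f - F\<close> costs \<open>O(1 / sqrt n)\<close>.\<close>

lemma cutoff_error_term_tendsto:
  assumes f: "sq_int f" and r: "0 < r" and d: "0 < d"
    and exp: "AE x in lborel. 0 < x \<and> x < d \<longrightarrow> \<bar>f x - cp * sqrt x - cm * (sqrt x * ln x)\<bar> \<le> C * x"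
  shows "(\<lambda>n. LINT x:{0<..}|lborel. f x * cutoff_error r n x) \<longlonglongrightarrow> - cm / (2 * r)"
proof -
  obtain M where M: "0 < M" "\<And>x. \<bar>chi1 x\<bar> \<le> M" "\<And>x. \<bar>chi2 x\<bar> \<le> M" by (rule chi_bound) blast
  define F where "F = (\<lambda>x. cp * sqrt x + cm * (sqrt x * ln x))"
  define Z where "Z = (\<lambda>x. - exp (- (x^2) / (4 * r)) * (cm / (2 * r) + (cp * x^2 + cm * (x^2 * ln x)) / (4 * r^2)))"
  define Z0 where "Z0 = - cm / (2 * r)"
  have limZ: "(Z \<longlongrightarrow> Z0) (at_right 0)"
  proof -
    have "((\<lambda>x::real. x^2 * ln x) \<longlongrightarrow> 0) (at_right 0)" by real_asymp
    moreover have "((\<lambda>x::real. x^2) \<longlongrightarrow> 0) (at_right 0)" by real_asymp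
    ultimately have "(Z \<longlongrightarrow> - exp (- 0 / (4 * r)) * (cm / (2 * r) + (cp * 0 + cm * 0) / (4 * r^2))) (at_right 0)"
      unfolding Z_def using r by (intro tendsto_intros) auto
    then show ?thesis by (simp add: Z0_def)
  qed
  have DF: "(F has_real_derivative F x / (2 * x) + cm / sqrt x) (at x)" if "0 < x" for x
  proof -
    define s where "s = sqrt x"
    have s: "0 < s" "x = s * s" using that by (simp_all add: s_def)
    have "cp * (inverse (sqrt x) / 2) + cm * (inverse (sqrt x) / 2 * ln x + inverse x * sqrt x) = F x / (2 * x) + cm / sqrt x"
      unfolding F_def s_def[symmetric] using s by (simp add: s(2) field_simps)
    moreover have "(F has_real_derivative cp * (inverse (sqrt x) / 2) + cm * (inverse (sqrt x) / 2 * ln x + inverse x * sqrt x)) (at x)"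
      unfolding F_def
      by (rule DERIV_add[OF DERIV_cmult[OF DERIV_real_sqrt[OF that]]
            DERIV_cmult[OF DERIV_mult[OF DERIV_real_sqrt[OF that] DERIV_ln[OF that]]]])
    ultimately show ?thesis by simp
  qed
  \<comment> \<open>The Wronskian \<open>gauss' F - gauss F'\<close>. The terms of order
    \<open>1/x\<close> cancel because both functions carry the factor \<open>sqrt x\<close>, so
    \<open>Z\<close> has a finite limit at 0.\<close>
  have Zeq: "gauss' r x * F x - gauss r x * (F x / (2 * x) + cm / sqrt x) = Z x" if "0 < x" for x
  proof -
    have "x = sqrt x * sqrt x" using that by simp
    have "gauss' r x * F x - gauss r x * (F x / (2 * x) + cm / sqrt x) = - gauss r x * (x * F x / (2 * r) + cm / sqrt x)"
      by (simp add: gauss'_def algebra_simps)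
    also have "\<dots> = - exp (- (x^2) / (4 * r)) * ((sqrt x * (x * F x)) / (4 * r^2) + cm / (2 * r))"
      using that r by (simp add: gauss_def field_simps power2_eq_square)
    also have "sqrt x * (x * F x) = cp * x^2 + cm * (x^2 * ln x)"
    proof -
      have "sqrt x * (x * F x) = x * (sqrt x * sqrt x) * (cp + cm * ln x)"
        by (simp add: F_def algebra_simps)
      then show ?thesis using that by (simp add: power2_eq_square algebra_simps)
    qed
    finally show ?thesis by (simp add: Z_def algebra_simps)
  qed
  have contF: "continuous_on {0<..} F"
    by (rule DERIV_continuous_on[of _ _ "\<lambda>x. F x / (2 * x) + cm / sqrt x"])
       (auto intro: has_field_derivative_at_within[OF DF])
  have contg: "continuous_on {0<..} (gauss r)"
    by (rule DERIV_continuous_on[of _ _ "gauss' r"])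
       (auto intro: has_field_derivative_at_within[OF DERIV_gauss_x[OF r]])
  have contg': "continuous_on {0<..} (gauss' r)"
    by (rule DERIV_continuous_on[of _ _ "\<lambda>x. - gauss r x / (4 * x^2) + dgauss r x"])
       (rule has_field_derivative_at_within, rule DERIV_gauss'_x[OF r], simp)
  have contZ: "continuous_on {0<..} Z"
    unfolding Z_def using r by (intro continuous_intros) auto
  have contchi: "continuous_on A (\<lambda>x. chi1 (c * x))" "continuous_on A (\<lambda>x. chi2 (c * x))" for A c
    by (auto intro!: continuous_at_imp_continuous_on continuous_intros isCont_o2[of _ _ chi1] isCont_o2[of _ _ chi2] isCont_chi1 isCont_chi2)
  define K where "K = \<bar>C\<bar> * 2 * (sqrt 2 / (2 * r) * (M * (2 + 2 / r)))"
  have main: "\<bar>(LINT x:{0<..}|lborel. f x * cutoff_error r n x) - Z0\<bar> \<le> M * e + K / sqrt (real n)"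
    if n: "4 \<le> n" and nd: "2 / real n < d" and e: "\<And>x. x \<in> {1 / real n..2 / real n} \<Longrightarrow> \<bar>Z x - Z0\<bar> \<le> e" for n e
  proof -
    define I where "I = {1 / real n..2 / real n}"
    have n0: "0 < real n" using n by simp
    have In: "1 / real n \<le> 2 / real n" using n0 by (simp add: divide_right_mono)
    have I0: "I \<subseteq> {0<..}" unfolding I_def using n0 by (auto intro: less_le_trans[of 0 "1 / real n"])
    \<comment> \<open>The primitive \<open>W = n chi1(n x) gauss F\<close> absorbs the
      \<open>n^2 chi2\<close> term and half of the \<open>2 n chi1 gauss'\<close> term. It vanishes
      at both ends of the zone.\<close>
    have hb1: "has_bochner_integral lborel (\<lambda>x. indicator I x *\<^sub>R (F x * cutoff_error r n x - real n * chi1 (real n * x) * Z x)) 0"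
    proof -
      define W where "W = (\<lambda>x. (real n * chi1 (real n * x)) * (gauss r x * F x))"
      have "has_bochner_integral lborel (\<lambda>x. indicator {1 / real n..2 / real n} x *\<^sub>R (F x * cutoff_error r n x - real n * chi1 (real n * x) * Z x)) (W (2 / real n) - W (1 / real n))"
      proof (rule has_bochner_integral_FTC_Icc[OF In])
        fix x assume x: "1 / real n \<le> x" "x \<le> 2 / real n"
        then have x0: "0 < x" using I0 by (auto simp: I_def)
        have lin: "((\<lambda>x. real n * x) has_real_derivative real n) (at x)" by (auto intro!: derivative_eq_intros)
        have c: "((\<lambda>x. real n * chi1 (real n * x)) has_real_derivative real n * (chi2 (real n * x) * real n)) (at x)"
          by (rule DERIV_cmult[OF DERIV_chain2[OF DERIV_chi1 lin]])
        have "(W has_real_derivative F x * cutoff_error r n x - real n * chi1 (real n * x) * Z x) (at x)"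
          unfolding W_def
          by (rule DERIV_cong[OF DERIV_mult[OF c DERIV_mult[OF DERIV_gauss_x[OF r x0] DF[OF x0]]]])
             (simp add: Zeq[OF x0, symmetric] cutoff_error_def algebra_simps power2_eq_square)
        then show "(W has_vector_derivative F x * cutoff_error r n x - real n * chi1 (real n * x) * Z x) (at x within {1 / real n..2 / real n})"
          by (rule has_vector_derivative_at_within[OF has_real_derivative_iff_has_vector_derivative[THEN iffD1]])
      next
        show "continuous_on {1 / real n..2 / real n} (\<lambda>x. F x * cutoff_error r n x - real n * chi1 (real n * x) * Z x)"
          unfolding cutoff_error_def using I0 unfolding I_def
          by (intro continuous_intros contchi continuous_on_subset[OF contF] continuous_on_subset[OF contg]
              continuous_on_subset[OF contg'] continuous_on_subset[OF contZ]) auto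
      qed
      moreover have "W (2 / real n) = 0" "W (1 / real n) = 0" using n0 by (simp_all add: W_def chi1_0)
      ultimately show ?thesis by (simp add: I_def)
    qed
    have hb2: "has_bochner_integral lborel (\<lambda>x. indicator I x *\<^sub>R (real n * chi1 (real n * x))) 1"
    proof -
      have "has_bochner_integral lborel (\<lambda>x. indicator {1 / real n..2 / real n} x *\<^sub>R (real n * chi1 (real n * x)))
          (chi (real n * (2 / real n)) - chi (real n * (1 / real n)))"
      proof (rule has_bochner_integral_FTC_Icc[OF In])
        fix x assume "1 / real n \<le> x" "x \<le> 2 / real n"
        have lin: "((\<lambda>x. real n * x) has_real_derivative real n) (at x)" by (auto intro!: derivative_eq_intros)
        have "((\<lambda>x. chi (real n * x)) has_real_derivative real n * chi1 (real n * x)) (at x)"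
          using DERIV_chain2[OF DERIV_chi lin] by (simp add: mult.commute)
        then show "((\<lambda>x. chi (real n * x)) has_vector_derivative real n * chi1 (real n * x)) (at x within {1 / real n..2 / real n})"
          by (rule has_vector_derivative_at_within[OF has_real_derivative_iff_has_vector_derivative[THEN iffD1]])
      qed (intro continuous_intros contchi)
      then show ?thesis using n0 by (simp add: I_def chi_0 chi_1)
    qed
    define E where "E = (\<lambda>x. indicator {0<..} x *\<^sub>R (f x * cutoff_error r n x)
      - indicator I x *\<^sub>R (F x * cutoff_error r n x - real n * chi1 (real n * x) * Z x)
      - Z0 * (indicator I x *\<^sub>R (real n * chi1 (real n * x))))"
    have intf: "integrable lborel (\<lambda>x. indicator {0<..} x *\<^sub>R (f x * cutoff_error r n x))"
      using set_integrable_cutoff_error[OF f r n] by (simp add: set_integrable_def)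
    have intE: "integrable lborel E"
      unfolding E_def using hb1 hb2
      by (intro Bochner_Integration.integrable_diff integrable_mult_right intf) (auto simp: has_bochner_integral_iff)
    have valE: "(\<integral>x. E x \<partial>lborel) = (LINT x:{0<..}|lborel. f x * cutoff_error r n x) - Z0"
      unfolding E_def using hb1 hb2 intf
      by (simp add: has_bochner_integral_iff set_lebesgue_integral_def)
    \<comment> \<open>The second summand bounds \<open>|f - F| <= |C| x\<close> times the
      commutator, of size \<open>n^2 sqrt(1/n)\<close>. After multiplication by the length
      \<open>1/n\<close> of the zone it is of order \<open>n^(-1/2)\<close>: a remainder
      \<open>O(x)\<close> is small enough.\<close>
    define B where "B = real n * M * e + \<bar>C\<bar> * (2 / real n) * (sqrt (2 / real n) / (2 * r) * (M * (2 * (real n)^2 + 2 / r)))"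
    have Ebound: "AE x in lborel. \<bar>E x\<bar> \<le> indicator I x * B"
      using exp
    proof eventually_elim
      fix x assume R: "0 < x \<and> x < d \<longrightarrow> \<bar>f x - cp * sqrt x - cm * (sqrt x * ln x)\<bar> \<le> C * x"
      show "\<bar>E x\<bar> \<le> indicator I x * B"
      proof (cases "x \<in> I")
        case False
        then have "cutoff_error r n x = 0" using n by (intro cutoff_error_outside) (auto simp: I_def)
        then show ?thesis using False by (simp add: E_def)
      next
        case True
        then have x: "0 < x" "x \<le> 2 / real n" "x < d" using I0 nd by (auto simp: I_def)
        have "E x = real n * chi1 (real n * x) * (Z x - Z0) + (f x - F x) * cutoff_error r n x"
          using True x(1) by (simp add: E_def algebra_simps)
        moreover have "\<bar>real n * chi1 (real n * x) * (Z x - Z0)\<bar> \<le> real n * M * e"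
          unfolding abs_mult using M e[of x] True by (intro mult_mono) (auto simp: I_def)
        moreover have "\<bar>(f x - F x) * cutoff_error r n x\<bar> \<le> \<bar>C\<bar> * (2 / real n) * (sqrt (2 / real n) / (2 * r) * (M * (2 * (real n)^2 + 2 / r)))"
          unfolding abs_mult
        proof (intro mult_mono)
          have "\<bar>f x - F x\<bar> \<le> C * x" using R x by (simp add: F_def algebra_simps)
          also have "\<dots> \<le> \<bar>C\<bar> * (2 / real n)" using x by (intro mult_mono) auto
          finally show "\<bar>f x - F x\<bar> \<le> \<bar>C\<bar> * (2 / real n)" .
          have "gauss r x \<le> sqrt (2 / real n) / (2 * r)"
          proof -
            have "sqrt x / (2 * r) * exp (- (x^2) / (4 * r)) \<le> sqrt x / (2 * r) * 1"
              using x r by (intro mult_left_mono) auto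
            then have "gauss r x \<le> sqrt x / (2 * r)" using x r by (simp add: gauss_def)
            also have "\<dots> \<le> sqrt (2 / real n) / (2 * r)" using x r by (intro divide_right_mono) auto
            finally show ?thesis .
          qed
          then have "gauss r x * (M * (2 * (real n)^2 + 2 / r)) \<le> sqrt (2 / real n) / (2 * r) * (M * (2 * (real n)^2 + 2 / r))"
            using M r by (intro mult_right_mono) auto
          then show "\<bar>cutoff_error r n x\<bar> \<le> sqrt (2 / real n) / (2 * r) * (M * (2 * (real n)^2 + 2 / r))"
            using cutoff_error_bound[OF r n _ M, of x] True by (simp add: I_def)
        qed auto
        ultimately have "\<bar>E x\<bar> \<le> B" unfolding B_def by linarith
        then show ?thesis using True by simp
      qed
    qed
    have "\<bar>\<integral>x. E x \<partial>lborel\<bar> \<le> (\<integral>x. \<bar>E x\<bar> \<partial>lborel)" by (rule integral_abs_bound)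
    also have "\<dots> \<le> (\<integral>x. indicator I x * B \<partial>lborel)"
    proof (rule integral_mono_AE[OF _ _ Ebound])
      show "integrable lborel (\<lambda>x. \<bar>E x\<bar>)" using intE by simp
      show "integrable lborel (\<lambda>x. indicator I x * B)"
        by (intro integrable_mult_left integrable_real_indicator) (simp_all add: I_def emeasure_lborel_Icc_eq)
    qed
    also have "(\<integral>x. indicator I x * B \<partial>lborel) = 1 / real n * B"
      using In by (simp add: I_def diff_divide_distrib[symmetric])
    also have "1 / real n * B \<le> M * e + K / sqrt (real n)"
    proof -
      define s where "s = sqrt (real n)"
      have s: "0 < s" "s * s = real n" using n0 by (simp_all add: s_def)
      have "2 * (real n)^2 + 2 / r \<le> (2 + 2 / r) * (real n)^2"
      proof -
        have "1 \<le> (real n)^2" using n by (simp add: one_le_power)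
        then have "2 / r * 1 \<le> 2 / r * (real n)^2" using r by (intro mult_left_mono) auto
        then show ?thesis by (simp add: algebra_simps)
      qed
      then have "1 / real n * B \<le> 1 / real n * (real n * M * e + \<bar>C\<bar> * (2 / real n) * (sqrt (2 / real n) / (2 * r) * (M * ((2 + 2 / r) * (real n)^2))))"
        unfolding B_def using n0 r M by (intro mult_left_mono add_left_mono) auto
      also have "\<dots> = M * e + K / s"
      proof -
        define q where "q = 2 + 2 / r"
        have "K = \<bar>C\<bar> * 2 * (sqrt 2 / (2 * r) * (M * q))" by (simp add: K_def q_def)
        moreover have "sqrt (2 / real n) = sqrt 2 / s" by (simp add: real_sqrt_divide s_def)
        ultimately show ?thesis unfolding q_def[symmetric] using n0 r s(1)
          by (simp add: power2_eq_square field_simps)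
      qed
      finally show ?thesis by (simp add: s_def)
    qed
    finally show ?thesis by (simp add: valE)
  qed
  show ?thesis
  proof (rule LIMSEQ_I)
    fix \<epsilon> :: real assume \<epsilon>: "0 < \<epsilon>"
    define e where "e = \<epsilon> / (3 * M)"
    have e: "0 < e" using \<epsilon> M by (simp add: e_def)
    have "\<forall>\<^sub>F x in at_right 0. dist (Z x) Z0 < e" using limZ e by (rule tendstoD)
    then obtain b where b: "0 < b" "\<And>x. 0 < x \<Longrightarrow> x < b \<Longrightarrow> \<bar>Z x - Z0\<bar> < e"
      unfolding eventually_at_right_field dist_real_def by blast
    have "(\<lambda>n. 2 / real n) \<longlonglongrightarrow> 0" by real_asymp
    then have "\<forall>\<^sub>F n in sequentially. 2 / real n < min b d"
      by (rule order_tendstoD(2)) (use b d in simp)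
    moreover have "(\<lambda>n. K / sqrt (real n)) \<longlonglongrightarrow> 0" by real_asymp
    then have "\<forall>\<^sub>F n in sequentially. K / sqrt (real n) < \<epsilon> / 3"
      by (rule order_tendstoD(2)) (use \<epsilon> in simp)
    ultimately have "\<forall>\<^sub>F n in sequentially. norm ((LINT x:{0<..}|lborel. f x * cutoff_error r n x) - (- cm / (2 * r))) < \<epsilon>"
      using eventually_ge_at_top[of 4]
    proof eventually_elim
      fix n :: nat assume n: "2 / real n < min b d" "K / sqrt (real n) < \<epsilon> / 3" "4 \<le> n"
      have "\<bar>(LINT x:{0<..}|lborel. f x * cutoff_error r n x) - Z0\<bar> \<le> M * e + K / sqrt (real n)"
      proof (rule main[OF n(3)])
        fix x assume x: "x \<in> {1 / real n..2 / real n}"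
        have "0 < 1 / real n" using n(3) by simp
        then have "0 < x" "x < b" using x n(1) by (auto simp del: zero_less_divide_1_iff)
        then show "\<bar>Z x - Z0\<bar> \<le> e" using b(2)[of x] by simp
      qed (use n in simp)
      also have "M * e = \<epsilon> / 3" using M by (simp add: e_def)
      finally show "norm ((LINT x:{0<..}|lborel. f x * cutoff_error r n x) - (- cm / (2 * r))) < \<epsilon>"
        using n(2) \<epsilon> by (simp add: Z0_def)
    qed
    then show "\<exists>no. \<forall>n\<ge>no. norm ((LINT x:{0<..}|lborel. f x * cutoff_error r n x) - (- cm / (2 * r))) < \<epsilon>"
      by (simp add: eventually_sequentially)
  qed
qed

lemma tendsto_cutoff_integral:
  assumes f: "set_integrable lborel {0<..} f"
  shows "(\<lambda>n. LINT x:{0<..}|lborel. f x * cutoff n x) \<longlonglongrightarrow> (LINT x:{0<..}|lborel. f x)"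
  unfolding set_lebesgue_integral_def
proof (rule integral_dominated_convergence[where w = "\<lambda>x. \<bar>indicator {0<..} x *\<^sub>R f x\<bar>"])
  have [measurable]: "(\<lambda>x. indicator {0<..} x *\<^sub>R f x) \<in> borel_measurable lborel"
    using f by (simp add: set_integrable_def)
  then show "(\<lambda>x. indicator {0<..} x *\<^sub>R f x) \<in> borel_measurable lborel" .
  have "(\<lambda>x. (indicator {0<..} x *\<^sub>R f x) * cutoff n x) \<in> borel_measurable lborel" for n by measurable
  then show "(\<lambda>x. indicator {0<..} x *\<^sub>R (f x * cutoff n x)) \<in> borel_measurable lborel" for n by (simp add: mult.assoc)
  show "integrable lborel (\<lambda>x. \<bar>indicator {0<..} x *\<^sub>R f x\<bar>)"
    using f by (simp add: set_integrable_def)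
  show "AE x in lborel. norm (indicator {0<..} x *\<^sub>R (f x * cutoff n x)) \<le> \<bar>indicator {0<..} x *\<^sub>R f x\<bar>" for n
    using cutoff_le[of n] by (auto simp: abs_mult indicator_def intro!: mult_left_le)
  show "AE x in lborel. (\<lambda>n. indicator {0<..} x *\<^sub>R (f x * cutoff n x)) \<longlonglongrightarrow> indicator {0<..} x *\<^sub>R f x"
  proof (intro AE_I2)
    fix x :: real
    show "(\<lambda>n. indicator {0<..} x *\<^sub>R (f x * cutoff n x)) \<longlonglongrightarrow> indicator {0<..} x *\<^sub>R f x"
    proof (cases "0 < x")
      case True
      have "(\<lambda>n. f x * cutoff n x) \<longlonglongrightarrow> f x * 1" by (intro tendsto_mult_left tendsto_cutoff True)
      then show ?thesis using True by simp
    qed simp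
  qed
qed

text \<open>The definition of \<open>Delta_max_rel\<close> may be tested only with compactly
  supported functions, hence with \<open>cutoff n * gauss r\<close>. As \<open>n\<close> grows, the
  commutator at infinity disappears and the one at the endpoint leaves the flux
  \<open>cm / (2 r)\<close>.\<close>

lemma Green_gauss:
  assumes rel: "Delta_max_rel f h" and r: "0 < r" and d: "0 < d"
    and exp: "AE x in lborel. 0 < x \<and> x < d \<longrightarrow> \<bar>f x - cp * sqrt x - cm * (sqrt x * ln x)\<bar> \<le> C * x"
  shows "ip f (dgauss r) = cm / (2 * r) - ip h (gauss r)"
proof -
  have f: "sq_int f" and h: "sq_int h" using rel by (auto simp: Delta_max_rel_def)
  define far where "far = (\<lambda>n x. chi2 (real n - x) * gauss r x - 2 * chi1 (real n - x) * gauss' r x)"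
  have eq: "(LINT x:{0<..}|lborel. (h x * gauss r x) * cutoff n x) =
      - (LINT x:{0<..}|lborel. (f x * dgauss r x) * cutoff n x) - (LINT x:{0<..}|lborel. f x * cutoff_error r n x)
      - (LINT x:{0<..}|lborel. f x * far n x)" if n: "4 \<le> n" for n
  proof -
    have int1: "set_integrable lborel {0<..} (\<lambda>x. f x * (cutoff n x * dgauss r x))"
    proof (rule sq_int_integrable_bounded[OF f sq_int_dgauss[OF r]])
      show "\<bar>cutoff n x * dgauss r x\<bar> \<le> 1 * \<bar>dgauss r x\<bar>" for x
        unfolding abs_mult using cutoff_le[of n x] by (intro mult_right_mono) auto
    qed measurable
    have int2: "set_integrable lborel {0<..} (\<lambda>x. f x * cutoff_error r n x)" by (rule set_integrable_cutoff_error[OF f r n])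
    have int3: "set_integrable lborel {0<..} (\<lambda>x. f x * far n x)"
      using far_term_tendsto_0(2)[OF f r n] by (simp add: far_def)
    have "(LINT x:{0<..}|lborel. (h x * gauss r x) * cutoff n x) = (LINT x:{0<..}|lborel. h x * (cutoff n x * gauss r x))"
      by (simp add: mult_ac)
    also have "\<dots> = (LINT x:{0<..}|lborel. f x * Delta_op (\<lambda>x. cutoff n x * gauss r x) x)"
      using rel test_fun_cutoff_gauss[OF r n] by (simp add: Delta_max_rel_def)
    also have "\<dots> = (LINT x:{0<..}|lborel. - (f x * (cutoff n x * dgauss r x)) - f x * cutoff_error r n x - f x * far n x)"
    proof (rule set_lebesgue_integral_cong)
      have "f x * Delta_op (\<lambda>x. cutoff n x * gauss r x) x = - (f x * (cutoff n x * dgauss r x)) - f x * cutoff_error r n x - f x * far n x"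
        if "0 < x" for x
        unfolding Delta_op_cutoff_gauss[OF r n that] cutoff_error_def far_def by (simp add: algebra_simps)
      then show "\<forall>x. x \<in> {0<..} \<longrightarrow> f x * Delta_op (\<lambda>x. cutoff n x * gauss r x) x = - (f x * (cutoff n x * dgauss r x)) - f x * cutoff_error r n x - f x * far n x"
        by simp
    qed simp
    also have "\<dots> = - (LINT x:{0<..}|lborel. f x * (cutoff n x * dgauss r x)) - (LINT x:{0<..}|lborel. f x * cutoff_error r n x) - (LINT x:{0<..}|lborel. f x * far n x)"
      using int1 int2 int3 by (simp add: set_integrable_def set_lebesgue_integral_def right_diff_distrib)
    finally show ?thesis by (simp add: mult_ac)
  qed
  have L: "(\<lambda>n. LINT x:{0<..}|lborel. (h x * gauss r x) * cutoff n x) \<longlonglongrightarrow> ip h (gauss r)"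
    unfolding ip_def by (intro tendsto_cutoff_integral sq_int_integrable_mult h sq_int_gauss)
  have "(\<lambda>n. - (LINT x:{0<..}|lborel. (f x * dgauss r x) * cutoff n x) - (LINT x:{0<..}|lborel. f x * cutoff_error r n x)
      - (LINT x:{0<..}|lborel. f x * far n x)) \<longlonglongrightarrow> - ip f (dgauss r) - (- cm / (2 * r)) - 0"
    unfolding ip_def far_def
    by (intro tendsto_diff tendsto_minus tendsto_cutoff_integral sq_int_integrable_mult f sq_int_dgauss r
        cutoff_error_term_tendsto[OF f r d exp] far_term_tendsto_0(1)[OF f r])
  then have "(\<lambda>n. LINT x:{0<..}|lborel. (h x * gauss r x) * cutoff n x) \<longlonglongrightarrow> - ip f (dgauss r) - (- cm / (2 * r)) - 0"
    by (rule Lim_transform_eventually) (rule eventually_mono[OF eventually_ge_at_top[of 4]], rule eq[symmetric])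
  with L have "ip h (gauss r) = - ip f (dgauss r) - (- cm / (2 * r)) - 0" by (rule LIMSEQ_unique)
  then show ?thesis by simp
qed

section \<open>The Volterra function\<close>

lemma rGamma_pos: "0 < x \<Longrightarrow> 0 < rGamma (x::real)"
  by (simp add: rGamma_inverse_Gamma Gamma_real_pos)

lemma rGamma_nonneg: "0 \<le> x \<Longrightarrow> 0 \<le> rGamma (x::real)"
  using rGamma_pos[of x] by (cases "x = 0") auto

lemma measurable_rGamma [measurable]: "(rGamma :: real \<Rightarrow> real) \<in> borel_measurable borel"
  by (intro borel_measurable_continuous_onI continuous_on_rGamma)

text \<open>Keep only \<open>t >= L\<close> in Euler's integral and bound \<open>t powr s\<close>
  below by \<open>L powr s\<close>. As \<open>L\<close> is free, the reciprocal Gamma function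
  decays faster than any exponential.\<close>

lemma rGamma_le:
  assumes s: "0 \<le> s" and L: "0 < (L::real)"
  shows "rGamma (1 + s) \<le> exp L * L powr (- s)"
proof -
  have G: "((\<lambda>t. t powr s / exp t) has_integral Gamma (1 + s)) {0..}"
    using Gamma_integral_real[of "1 + s"] s by simp
  have "((\<lambda>t::real. exp (- 1 * t)) has_integral exp (- 1 * L) / 1) {L..}"
    by (rule has_integral_exp_minus_to_infinity) simp
  then have "((\<lambda>t. L powr s * exp (- t)) has_integral L powr s * exp (- L)) {L..}"
    using has_integral_mult_right[of "\<lambda>t. exp (- t)" "exp (- L)" "{L..}" "L powr s"] by simp
  then have "((\<lambda>t. if t \<in> {L..} then L powr s * exp (- t) else 0) has_integral L powr s * exp (- L)) {0..}"
    by (subst has_integral_restrict) (use L in auto)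
  then have "L powr s * exp (- L) \<le> Gamma (1 + s)"
  proof (rule has_integral_le[OF _ G])
    fix t :: real assume "t \<in> {0..}"
    have "L powr s * exp (- t) \<le> t powr s / exp t" if "L \<le> t"
      using powr_mono2[OF s _ that] L by (simp add: exp_minus divide_inverse mult_right_mono)
    then show "(if t \<in> {L..} then L powr s * exp (- t) else 0) \<le> t powr s / exp t" by simp
  qed
  then have "inverse (Gamma (1 + s)) \<le> inverse (L powr s * exp (- L))"
    using L by (intro le_imp_inverse_le) auto
  then show ?thesis using L by (simp add: rGamma_inverse_Gamma exp_minus powr_minus mult.commute)
qed

text \<open>\<open>H 1\<close> is Volterra's function of the overview, and \<open>H 0 x\<close> is
  \<open>x\<close> times its derivative, whence the division by \<open>t\<close> in
  \<open>rho\<close>. The real parameter \<open>a\<close> in between allows convolutions with powers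
  to be differentiated in the exponent.\<close>

definition H :: "real \<Rightarrow> real \<Rightarrow> real" where
  "H a x = (\<integral>s. indicator {0<..} s * (x powr s * rGamma (s + a)) \<partial>lborel)"

lemma integrable_exp_minus_half:
  "integrable lborel (\<lambda>s::real. indicator {0<..} s * exp (- s / 2))"
proof -
  have "((\<lambda>t::real. exp (- (1/2) * t)) has_integral exp (- (1/2) * 0) / (1/2)) {0..}"
    by (rule has_integral_exp_minus_to_infinity) simp
  then have "((\<lambda>t::real. if t \<in> {0..} then exp (- t / 2) else 0) has_integral 2) UNIV"
    by (subst has_integral_restrict_UNIV) simp
  then have "has_bochner_integral lborel (\<lambda>t::real. if t \<in> {0..} then exp (- t / 2) else 0) 2"
    by (intro has_bochner_integral_of_has_integral) auto
  then have "integrable lborel (\<lambda>t::real. if t \<in> {0..} then exp (- t / 2) else 0)" by (rule integrable.intros)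
  then show ?thesis
    by (rule Bochner_Integration.integrable_bound) (auto simp: indicator_def)
qed

lemma integrable_H:
  fixes x a :: real
  assumes x: "0 < x" and a: "0 \<le> a"
  shows "integrable lborel (\<lambda>s. indicator {0<..} s * (x powr s * rGamma (s + a)))"
proof (rule Bochner_Integration.integrable_bound)
  \<comment> \<open>With this choice the bound \<open>L powr (- s)\<close> of
    \<open>rGamma_le\<close> cancels \<open>x powr s\<close> and leaves the decay
    \<open>exp (- s)\<close>.\<close>
  define L where "L = exp 1 * x"
  have L: "0 < L" unfolding L_def using x by (intro mult_pos_pos) auto
  define C where "C = exp L * L powr (- a) * (2 + a)"
  show "integrable lborel (\<lambda>s::real. C * (indicator {0<..} s * exp (- s / 2)))"
    by (intro integrable_mult_right integrable_exp_minus_half)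
  have "x powr s * rGamma (s + a) \<le> C * exp (- s / 2)" if s: "0 < s" for s
  proof -
    have "rGamma (s + a) = (s + a) * rGamma (1 + (s + a))"
      using rGamma_plus1[of "s + a"] by (simp add: add.commute)
    also have "\<dots> \<le> (s + a) * (exp L * L powr (- (s + a)))"
      using s a L by (intro mult_left_mono rGamma_le) auto
    finally have "x powr s * rGamma (s + a) \<le> x powr s * ((s + a) * (exp L * L powr (- (s + a))))"
      by (intro mult_left_mono) auto
    also have "L powr (- (s + a)) = L powr (- a) * L powr (- s)"
      using L by (simp add: powr_add[symmetric] algebra_simps)
    also have "L powr (- s) = exp (- s) * x powr (- s)"
      using x by (simp add: L_def powr_def ln_mult exp_add[symmetric] algebra_simps)
    also have "x powr s * ((s + a) * (exp L * (L powr (- a) * (exp (- s) * x powr (- s))))) =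
        exp L * L powr (- a) * ((s + a) * exp (- s))"
    proof -
      have "x powr s * x powr (- s) = 1" using x by (simp add: powr_add[symmetric])
      moreover have "x powr s * ((s + a) * (exp L * (L powr (- a) * (exp (- s) * x powr (- s))))) =
          (x powr s * x powr (- s)) * (exp L * L powr (- a) * ((s + a) * exp (- s)))" by (simp only: mult_ac)
      ultimately show ?thesis by simp
    qed
    also have "\<dots> \<le> exp L * L powr (- a) * ((2 + a) * exp (- s / 2))"
    proof (intro mult_left_mono)
      have "s / 2 \<le> exp (s / 2)" using exp_ge_add_one_self[of "s / 2"] by linarith
      moreover have "1 \<le> exp (s / 2)" using s by simp
      then have "a * 1 \<le> a * exp (s / 2)" using a by (rule mult_left_mono)
      ultimately have "s + a \<le> (2 + a) * exp (s / 2)" by (simp add: algebra_simps)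
      then have "(s + a) * exp (- s) \<le> (2 + a) * exp (s / 2) * exp (- s)" by (intro mult_right_mono) auto
      then show "(s + a) * exp (- s) \<le> (2 + a) * exp (- s / 2)" by (simp add: mult.assoc exp_add[symmetric])
    qed (use L in auto)
    finally show ?thesis by (simp add: C_def)
  qed
  moreover have "0 \<le> x powr s * rGamma (s + a)" if "0 < s" for s
    using that a by (intro mult_nonneg_nonneg rGamma_nonneg) auto
  ultimately show "AE s in lborel. norm (indicator {0<..} s * (x powr s * rGamma (s + a))) \<le> norm (C * (indicator {0<..} s * exp (- s / 2)))"
    by (intro AE_I2) (auto simp: indicator_def intro: order.trans[OF _ abs_ge_self])
qed measurable

lemma H_nonneg: "0 \<le> a \<Longrightarrow> 0 \<le> H a x"
  unfolding H_def by (intro integral_nonneg_AE AE_I2) (auto simp: indicator_def intro!: mult_nonneg_nonneg rGamma_nonneg)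

lemma nn_integral_H:
  assumes "0 < x" "0 \<le> a"
  shows "(\<integral>\<^sup>+s. ennreal (indicator {0<..} s * (x powr s * rGamma (s + a))) \<partial>lborel) = ennreal (H a x)"
  unfolding H_def using integrable_H[OF assms] assms
  by (intro nn_integral_eq_integral AE_I2) (auto simp: indicator_def intro!: mult_nonneg_nonneg rGamma_nonneg)

lemma measurable_H [measurable]: "H a \<in> borel_measurable borel"
  unfolding H_def by measurable

text \<open>\<open>rho c\<close> is the derivative of \<open>nu c\<close>; its convolution with \<open>ln r + euler_mascheroni + ln c\<close> is constant
  (see \<open>has_bochner_integral_log_shift_rho\<close>).\<close>

definition rho :: "real \<Rightarrow> real \<Rightarrow> real" where
  "rho c t = (if 0 < t then H 0 (c * t) / t else 0)"

definition nu :: "real \<Rightarrow> real \<Rightarrow> real" where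
  "nu c t = H 1 (c * t)"

lemma measurable_rho [measurable]: "rho c \<in> borel_measurable borel"
  unfolding rho_def by measurable

lemma rho_nonneg: "0 \<le> rho c t"
  by (simp add: rho_def H_nonneg)

lemma nn_integral_Beta:
  assumes a: "0 < a" and s: "0 < s" and t: "0 < (t::real)"
  shows "(\<integral>\<^sup>+r. ennreal (indicator {0<..<t} r * (r powr (a - 1) * (t - r) powr (s - 1))) \<partial>lborel)
    = ennreal (t powr (a + s - 1) * Beta a s)"
proof -
  define f where "f = (\<lambda>u::real. if u \<in> {0..1} then u powr (a - 1) * (1 - u) powr (s - 1) else 0)"
  have "(f has_integral Beta a s) UNIV"
    unfolding f_def has_integral_restrict_UNIV by (rule has_integral_Beta_real[OF a s])
  moreover have [measurable]: "f \<in> borel_measurable borel" unfolding f_def by measurable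
  ultimately have f: "(\<integral>\<^sup>+u. ennreal (f u) \<partial>lborel) = ennreal (Beta a s)"
    by (intro nn_integral_has_integral_lborel) (auto simp: f_def)
  have "(\<integral>\<^sup>+r. ennreal (indicator {0<..<t} r * (r powr (a - 1) * (t - r) powr (s - 1))) \<partial>lborel) =
      ennreal \<bar>t\<bar> * (\<integral>\<^sup>+u. ennreal (indicator {0<..<t} (0 + t * u) * ((0 + t * u) powr (a - 1) * (t - (0 + t * u)) powr (s - 1))) \<partial>lborel)"
    using t by (intro nn_integral_real_affine) auto
  also have "\<dots> = ennreal t * (\<integral>\<^sup>+u. ennreal (t powr (a + s - 2)) * ennreal (f u) \<partial>lborel)"
  proof -
    have "indicator {0<..<t} (0 + t * u) * ((0 + t * u) powr (a - 1) * (t - (0 + t * u)) powr (s - 1)) = t powr (a + s - 2) * f u" for u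
    proof (cases "0 < u \<and> u < 1")
      case True
      have "(t * u) powr (a - 1) * (t * (1 - u)) powr (s - 1) = (t powr (a - 1) * t powr (s - 1)) * (u powr (a - 1) * (1 - u) powr (s - 1))"
        using True t by (simp add: powr_mult)
      also have "t powr (a - 1) * t powr (s - 1) = t powr (a + s - 2)"
        by (simp add: powr_add[symmetric])
      finally show ?thesis using True t by (simp add: f_def algebra_simps)
    next
      case False
      then have "f u = 0" by (auto simp: f_def)
      moreover have "0 + t * u \<notin> {0<..<t}" using False t by (auto simp: zero_less_mult_iff)
      ultimately show ?thesis by simp
    qed
    then show ?thesis using t by (simp add: ennreal_mult' f_def)
  qed
  also have "\<dots> = ennreal t * (ennreal (t powr (a + s - 2)) * ennreal (Beta a s))"
    by (subst nn_integral_cmult) (simp_all add: f)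
  also have "\<dots> = ennreal (t * t powr (a + s - 2) * Beta a s)"
    using t by (simp add: ennreal_mult' mult.assoc)
  also have "t * t powr (a + s - 2) = t powr (a + s - 1)"
    using t powr_add[of t 1 "a + s - 2"] by simp
  finally show ?thesis .
qed

text \<open>Write \<open>rho\<close> as a superposition of powers
  \<open>c^s t^(s-1) / Gamma(s)\<close>. Convolving two powers gives a Beta integral, and
  \<open>Beta a s / Gamma s = Gamma a / Gamma (s + a)\<close> reassembles \<open>H a\<close>. All
  integrands are nonnegative, so Tonelli applies at once.\<close>

lemma nn_integral_powr_rho:
  assumes c: "0 < c" and a: "0 < a" and t: "0 < t"
  shows "(\<integral>\<^sup>+r. ennreal (indicator {0<..<t} r * (r powr (a - 1) * rho c (t - r))) \<partial>lborel)
    = ennreal (Gamma a * t powr (a - 1) * H a (c * t))"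
proof -
  have "(\<integral>\<^sup>+r. ennreal (indicator {0<..<t} r * (r powr (a - 1) * rho c (t - r))) \<partial>lborel) =
     (\<integral>\<^sup>+r. (\<integral>\<^sup>+s. ennreal (indicator {0<..<t} r * (r powr (a - 1) * (t - r) powr (s - 1))) *
        ennreal (indicator {0<..} s * (c powr s * rGamma s)) \<partial>lborel) \<partial>lborel)"
  proof (rule nn_integral_cong)
    fix r
    show "ennreal (indicator {0<..<t} r * (r powr (a - 1) * rho c (t - r))) =
      (\<integral>\<^sup>+s. ennreal (indicator {0<..<t} r * (r powr (a - 1) * (t - r) powr (s - 1))) *
        ennreal (indicator {0<..} s * (c powr s * rGamma s)) \<partial>lborel)"
    proof (cases "r \<in> {0<..<t}")
      case True
      then have tr: "0 < t - r" by simp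
      have "ennreal (indicator {0<..<t} r * (r powr (a - 1) * rho c (t - r))) =
          ennreal (r powr (a - 1) / (t - r)) * ennreal (H 0 (c * (t - r)))"
        using True by (simp add: rho_def ennreal_mult'[symmetric] H_nonneg)
      also have "ennreal (H 0 (c * (t - r))) = (\<integral>\<^sup>+s. ennreal (indicator {0<..} s * ((c * (t - r)) powr s * rGamma (s + 0))) \<partial>lborel)"
        using tr c by (intro nn_integral_H[symmetric]) auto
      also have "ennreal (r powr (a - 1) / (t - r)) * \<dots> =
          (\<integral>\<^sup>+s. ennreal (r powr (a - 1) / (t - r)) * ennreal (indicator {0<..} s * ((c * (t - r)) powr s * rGamma (s + 0))) \<partial>lborel)"
        by (rule nn_integral_cmult[symmetric]) measurable
      also have "\<dots> = (\<integral>\<^sup>+s. ennreal (indicator {0<..<t} r * (r powr (a - 1) * (t - r) powr (s - 1))) *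
        ennreal (indicator {0<..} s * (c powr s * rGamma s)) \<partial>lborel)"
      proof (rule nn_integral_cong)
        fix s
        have "r powr (a - 1) / (t - r) * (indicator {0<..} s * ((c * (t - r)) powr s * rGamma (s + 0))) =
          (indicator {0<..<t} r * (r powr (a - 1) * (t - r) powr (s - 1))) * (indicator {0<..} s * (c powr s * rGamma s))"
          using True tr c by (simp add: powr_mult powr_diff)
        then show "ennreal (r powr (a - 1) / (t - r)) * ennreal (indicator {0<..} s * ((c * (t - r)) powr s * rGamma (s + 0))) =
          ennreal (indicator {0<..<t} r * (r powr (a - 1) * (t - r) powr (s - 1))) * ennreal (indicator {0<..} s * (c powr s * rGamma s))"
          using tr by (simp only: ennreal_mult'[symmetric] divide_nonneg_pos powr_ge_zero mult_nonneg_nonneg indicator_pos_le)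
      qed
      finally show ?thesis .
    qed simp
  qed
  also have "\<dots> = (\<integral>\<^sup>+s. (\<integral>\<^sup>+r. ennreal (indicator {0<..<t} r * (r powr (a - 1) * (t - r) powr (s - 1))) *
        ennreal (indicator {0<..} s * (c powr s * rGamma s)) \<partial>lborel) \<partial>lborel)"
    by (rule lborel_pair.Fubini') measurable
  also have "\<dots> = (\<integral>\<^sup>+s. ennreal (Gamma a * t powr (a - 1)) * ennreal (indicator {0<..} s * ((c * t) powr s * rGamma (s + a))) \<partial>lborel)"
  proof (rule nn_integral_cong)
    fix s
    show "(\<integral>\<^sup>+r. ennreal (indicator {0<..<t} r * (r powr (a - 1) * (t - r) powr (s - 1))) *
        ennreal (indicator {0<..} s * (c powr s * rGamma s)) \<partial>lborel) =
      ennreal (Gamma a * t powr (a - 1)) * ennreal (indicator {0<..} s * ((c * t) powr s * rGamma (s + a)))"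
    proof (cases "0 < s")
      case True
      have "(\<integral>\<^sup>+r. ennreal (indicator {0<..<t} r * (r powr (a - 1) * (t - r) powr (s - 1))) *
        ennreal (indicator {0<..} s * (c powr s * rGamma s)) \<partial>lborel) = ennreal (t powr (a + s - 1) * Beta a s) * ennreal (c powr s * rGamma s)"
        using True by (subst nn_integral_multc) (simp_all add: nn_integral_Beta[OF a True t])
      also have "\<dots> = ennreal ((t powr (a + s - 1) * Beta a s) * (c powr s * rGamma s))"
        using True by (intro ennreal_mult''[symmetric] mult_nonneg_nonneg rGamma_nonneg) auto
      also have "(t powr (a + s - 1) * Beta a s) * (c powr s * rGamma s) = (Gamma a * t powr (a - 1)) * ((c * t) powr s * rGamma (s + a))"
      proof -
        have "Beta a s * rGamma s = Gamma a * rGamma (s + a)"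
          using Gamma_real_pos[OF True, THEN less_imp_neq] by (simp add: Beta_def rGamma_inverse_Gamma add.commute field_simps)
        moreover have "t powr (a + s - 1) = t powr (a - 1) * t powr s" by (simp add: powr_add[symmetric] algebra_simps)
        moreover have "(c * t) powr s = c powr s * t powr s" using c t by (simp add: powr_mult)
        ultimately show ?thesis by (metis (no_types, lifting) mult.assoc mult.commute mult.left_commute)
      qed
      finally show ?thesis using True a by (simp add: ennreal_mult' Gamma_real_pos less_imp_le)
    qed simp
  qed
  also have "\<dots> = ennreal (Gamma a * t powr (a - 1)) * ennreal (H a (c * t))"
    using nn_integral_H[of "c * t" a] c t a by (subst nn_integral_cmult) simp_all
  also have "\<dots> = ennreal (Gamma a * t powr (a - 1) * H a (c * t))"
    using a H_nonneg[of a] by (simp add: ennreal_mult'' )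
  finally show ?thesis .
qed

lemma has_bochner_integral_powr_rho:
  assumes c: "0 < c" and a: "0 < a" and t: "0 < t"
  shows "has_bochner_integral lborel (\<lambda>r. indicator {0<..<t} r * (r powr (a - 1) * rho c (t - r)))
    (Gamma a * t powr (a - 1) * H a (c * t))"
  using assms H_nonneg[of a "c * t"] Gamma_real_pos[OF a]
  by (intro has_bochner_integral_nn_integral nn_integral_powr_rho)
     (auto simp: rho_nonneg intro!: AE_I2)

lemma has_bochner_integral_rho:
  assumes c: "0 < c" and t: "0 < t"
  shows "has_bochner_integral lborel (\<lambda>r. indicator {0<..<t} r * rho c (t - r)) (nu c t)"
proof -
  have "has_bochner_integral lborel (\<lambda>r. indicator {0<..<t} r * (r powr (1 - 1) * rho c (t - r))) (nu c t)"
    using has_bochner_integral_powr_rho[OF c zero_less_one t] t by (simp add: nu_def Gamma_1)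
  also have "(\<lambda>r. indicator {0<..<t} r * (r powr (1 - 1) * rho c (t - r))) = (\<lambda>r. indicator {0<..<t} r * rho c (t - r))"
    by (auto simp: indicator_def)
  finally show ?thesis .
qed

section \<open>Convolution of Volterra's density with the shifted logarithm\<close>

definition log_shift :: "real \<Rightarrow> real \<Rightarrow> real" where
  "log_shift c r = ln r + euler_mascheroni + ln c"

lemma integrable_powr_rho:
  assumes "0 < c" "0 < a" "0 < t"
  shows "integrable lborel (\<lambda>r. indicator {0<..<t} r * rho c (t - r) * r powr (a - 1))"
proof -
  have "(\<lambda>r. indicator {0<..<t} r * (r powr (a - 1) * rho c (t - r))) = (\<lambda>r. indicator {0<..<t} r * rho c (t - r) * r powr (a - 1))"
    by (auto simp: mult_ac)
  then show ?thesis using has_bochner_integral_powr_rho[OF assms] by (simp add: has_bochner_integral_iff)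
qed

lemma integrable_powr_ln_rho:
  assumes c: "0 < c" and a: "0 \<le> a" and t: "0 < t"
  shows "integrable lborel (\<lambda>r. indicator {0<..<t} r * rho c (t - r) * (r powr a * ln r))"
proof (rule Bochner_Integration.integrable_bound)
  define k where "k = (\<lambda>r. indicator {0<..<t} r * rho c (t - r))"
  have k: "0 \<le> k r" for r by (simp add: k_def rho_nonneg)
  show "integrable lborel (\<lambda>r. 2 * (indicator {0<..<t} r * rho c (t - r) * r powr ((a + 1 / 2) - 1)) + indicator {0<..<t} r * rho c (t - r) * r powr ((a + 2) - 1))"
    using c a t by (intro Bochner_Integration.integrable_add integrable_mult_right integrable_powr_rho) auto
  have "\<bar>k r * (r powr a * ln r)\<bar> \<le> 2 * (k r * r powr ((a + 1 / 2) - 1)) + k r * r powr ((a + 2) - 1)" for r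
  proof (cases "0 < r")
    case True
    have "k r * r powr a * \<bar>ln r\<bar> \<le> k r * r powr a * (2 * r powr (- (1 / 2)) + r)"
      using True k by (intro mult_left_mono abs_ln_le) auto
    also have "\<dots> = 2 * (k r * (r powr a * r powr (- (1 / 2)))) + k r * (r powr a * r)" by (simp add: algebra_simps)
    also have "r powr a * r powr (- (1 / 2)) = r powr ((a + 1 / 2) - 1)" by (simp add: powr_add[symmetric] algebra_simps)
    also have "r powr a * r = r powr ((a + 2) - 1)" using True powr_add[of r a 1] by (simp add: algebra_simps)
    finally show ?thesis using k[of r] by (simp add: abs_mult mult.assoc)
  qed (simp add: k_def)
  then show "AE r in lborel. norm (indicator {0<..<t} r * rho c (t - r) * (r powr a * ln r))
     \<le> norm (2 * (indicator {0<..<t} r * rho c (t - r) * r powr ((a + 1 / 2) - 1)) + indicator {0<..<t} r * rho c (t - r) * r powr ((a + 2) - 1))"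
    unfolding k_def real_norm_def by (intro AE_I2 order.trans[OF _ abs_ge_self])
qed measurable

lemma continuous_on_rGamma_add: "continuous_on A (\<lambda>s::real. rGamma (s + a))"
  by (rule continuous_on_compose2[OF continuous_on_rGamma[of UNIV]]) (auto intro!: continuous_intros)

text \<open>Substituting \<open>s + e\<close> for \<open>s\<close> moves the dependence on
  \<open>e\<close> out of \<open>rGamma\<close> into the lower limit of a fixed integrand, where the
  fundamental theorem of calculus differentiates it.\<close>

lemma H_shift:
  assumes x: "0 < x" and e: "0 < e"
  shows "x powr e * H (1 + e) x = H 1 x - integral {0..e} (\<lambda>s. x powr s * rGamma (s + 1))"
proof -
  define g where "g = (\<lambda>s. x powr s * rGamma (s + 1))"
  have gc: "continuous_on A g" for A unfolding g_def using x by (intro continuous_intros continuous_on_rGamma_add) auto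
  have gi: "integrable lborel (\<lambda>s. indicator {0<..} s * g s)"
    unfolding g_def using integrable_H[OF x, of 1] by simp
  have [measurable]: "g \<in> borel_measurable borel" unfolding g_def by measurable
  have i1: "integrable lborel (\<lambda>s. indicator {0<..e} s * g s)"
    by (rule Bochner_Integration.integrable_bound[OF gi]) (auto simp: indicator_def)
  have i2: "integrable lborel (\<lambda>s. indicator {e<..} s * g s)"
    using e by (intro Bochner_Integration.integrable_bound[OF gi]) (auto simp: indicator_def)
  have "H 1 x = (\<integral>s. indicator {0<..e} s * g s + indicator {e<..} s * g s \<partial>lborel)"
    unfolding H_def g_def using e by (intro Bochner_Integration.integral_cong) (auto simp: indicator_def)
  also have "\<dots> = (\<integral>s. indicator {0<..e} s * g s \<partial>lborel) + (\<integral>s. indicator {e<..} s * g s \<partial>lborel)"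
    by (rule Bochner_Integration.integral_add[OF i1 i2])
  also have "(\<integral>s. indicator {e<..} s * g s \<partial>lborel) = (\<integral>u. indicator {e<..} (e + 1 * u) * g (e + 1 * u) \<partial>lborel)"
    using lborel_integral_real_affine[of 1 "\<lambda>s. indicator {e<..} s * g s" e] by simp
  also have "\<dots> = (\<integral>u. x powr e * (indicator {0<..} u * (x powr u * rGamma (u + (1 + e)))) \<partial>lborel)"
    by (intro Bochner_Integration.integral_cong) (auto simp: indicator_def g_def powr_add algebra_simps)
  also have "\<dots> = x powr e * H (1 + e) x" unfolding H_def by simp
  also have "(\<integral>s. indicator {0<..e} s * g s \<partial>lborel) = (LINT s:{0<..e}|lborel. g s)"
    by (simp add: set_lebesgue_integral_def)
  also have "\<dots> = integral {0<..e} g"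
    using i1 by (intro set_borel_integral_eq_integral) (simp add: set_integrable_def)
  also have "\<dots> = integral {0..e} g"
    by (rule integral_spike_set) (auto intro: negligible_subset[of "{0}"])
  finally show ?thesis by (simp add: g_def)
qed

text \<open>The right derivative at \<open>e = 0\<close> of the convolution with
  \<open>r powr e\<close>, which is \<open>Gamma (1 + e) c^(-e) (nu c t - J e)\<close>. The Gamma
  factor yields \<open>- euler_mascheroni\<close>, the power yields \<open>- ln c\<close>, and the
  \<open>- 1\<close> is minus the integrand of \<open>J\<close> at \<open>s = 0\<close>, namely
  \<open>rGamma 1\<close>.\<close>

lemma integral_ln_rho:
  assumes c: "0 < c" and t: "0 < t"
  shows "(\<integral>r. indicator {0<..<t} r * rho c (t - r) * ln r \<partial>lborel) = - 1 - (euler_mascheroni + ln c) * nu c t"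
proof -
  define k where "k = (\<lambda>r. indicator {0<..<t} r * rho c (t - r))"
  define J where "J = (\<lambda>e. integral {0..e} (\<lambda>s. (c * t) powr s * rGamma (s + 1)))"
  have ct: "0 < c * t" using c t by simp
  have "((\<lambda>e. \<integral>x. k x * ((x powr e - 1) / e) \<partial>lborel) \<longlongrightarrow> (\<integral>x. k x * ln x \<partial>lborel)) (at_right 0)"
  proof (rule tendsto_integral_powr_quotient)
    show "k \<in> borel_measurable borel" unfolding k_def by measurable
    have "(\<lambda>r. k r * (r powr 0 * ln r)) = (\<lambda>x. k x * ln x)" by (auto simp: k_def)
    then show "integrable lborel (\<lambda>x. k x * ln x)"
      using integrable_powr_ln_rho[OF c _ t, of 0] by (simp add: k_def)
    have "(\<lambda>r. k r * (r powr 1 * ln r)) = (\<lambda>x. k x * (x * ln x))" by (auto simp: k_def indicator_def)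
    then show "integrable lborel (\<lambda>x. k x * (x * ln x))"
      using integrable_powr_ln_rho[OF c _ t, of 1] by (simp add: k_def)
  qed (simp add: k_def)
  moreover have "((\<lambda>e. \<integral>x. k x * ((x powr e - 1) / e) \<partial>lborel) \<longlongrightarrow> - 1 - (euler_mascheroni + ln c) * nu c t) (at_right 0)"
  proof -
    define F where "F = (\<lambda>e. Gamma (1 + e) * c powr (- e) * (nu c t - J e))"
    \<comment> \<open>Only a one-sided derivative: the integral over \<open>{0..e}\<close> is 0 for
      negative \<open>e\<close>.\<close>
    have J: "(J has_real_derivative (c * t) powr 0 * rGamma (0 + 1)) (at 0 within {0..1})"
      unfolding J_def using ct
      by (intro integral_has_real_derivative continuous_intros continuous_on_rGamma_add) auto
    have J0: "J 0 = 0" by (simp add: J_def)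
    have "(F has_real_derivative - 1 - (euler_mascheroni + ln c) * nu c t) (at 0 within {0..1})"
    proof -
      have "((\<lambda>x. exp (- x * ln c)) has_real_derivative - ln c) (at 0 within {0..1})"
        by (auto intro!: derivative_eq_intros)
      then have p: "((\<lambda>x. c powr (- x)) has_real_derivative - ln c) (at 0 within {0..1})"
        using c by (simp add: powr_def)
      have g: "((\<lambda>x. Gamma (1 + x)) has_real_derivative - euler_mascheroni) (at 0 within {0..1})"
        by (auto intro!: derivative_eq_intros simp: Gamma_1)
      show ?thesis unfolding F_def
        by (rule DERIV_cong[OF DERIV_mult[OF DERIV_mult[OF g p] DERIV_diff[OF DERIV_const J]]])
           (use c ct t in \<open>simp add: J0 Gamma_1 rGamma_inverse_Gamma algebra_simps\<close>)
    qed
    then have "((\<lambda>e. (F e - F 0) / (e - 0)) \<longlongrightarrow> - 1 - (euler_mascheroni + ln c) * nu c t) (at_right 0)"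
      by (simp only: has_field_derivative_iff at_within_Icc_at_right[OF zero_less_one])
    moreover have "\<forall>\<^sub>F e in at_right 0. (F e - F 0) / (e - 0) = (\<integral>x. k x * ((x powr e - 1) / e) \<partial>lborel)"
      unfolding eventually_at_right_field
    proof (intro exI[of _ 1] conjI allI impI)
      fix e :: real assume e: "0 < e" "e < 1"
      have "has_bochner_integral lborel (\<lambda>r. k r * r powr e) (F e)"
      proof -
        have "Gamma (1 + e) * t powr (1 + e - 1) * H (1 + e) (c * t) = F e"
        proof -
          have "c powr e * t powr e * H (1 + e) (c * t) = nu c t - J e"
            using H_shift[OF ct e(1)] c t by (simp add: powr_mult nu_def J_def)
          then have "c powr (- e) * (c powr e * t powr e * H (1 + e) (c * t)) = c powr (- e) * (nu c t - J e)" by simp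
          moreover have "c powr (- e) * c powr e = 1" using c by (simp add: powr_add[symmetric])
          ultimately have "t powr e * H (1 + e) (c * t) = c powr (- e) * (nu c t - J e)"
            by (metis mult.assoc mult_1)
          then show ?thesis by (simp add: F_def mult.assoc)
        qed
        then have "has_bochner_integral lborel (\<lambda>r. indicator {0<..<t} r * (r powr (1 + e - 1) * rho c (t - r))) (F e)"
          using has_bochner_integral_powr_rho[OF c _ t, of "1 + e"] e by simp
        then show ?thesis by (simp add: k_def mult_ac)
      qed
      moreover have "has_bochner_integral lborel k (F 0)"
        using has_bochner_integral_rho[OF c t] c by (simp add: k_def F_def J0 Gamma_1)
      ultimately have "has_bochner_integral lborel (\<lambda>r. (k r * r powr e - k r) / e) ((F e - F 0) / e)"
        by (intro has_bochner_integral_divide has_bochner_integral_diff)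
      then show "(F e - F 0) / (e - 0) = (\<integral>x. k x * ((x powr e - 1) / e) \<partial>lborel)"
        by (simp add: has_bochner_integral_iff algebra_simps diff_divide_distrib)
    qed simp
    ultimately show ?thesis by (rule Lim_transform_eventually)
  qed
  ultimately have "(\<integral>x. k x * ln x \<partial>lborel) = - 1 - (euler_mascheroni + ln c) * nu c t"
    by (rule tendsto_unique[rotated]) simp
  then show ?thesis by (simp add: k_def)
qed

text \<open>The additive constant in \<open>log_shift\<close> is exactly the one that cancels the
  \<open>nu\<close> term of \<open>integral_ln_rho\<close>.\<close>

lemma has_bochner_integral_log_shift_rho:
  assumes c: "0 < c" and t: "0 < t"
  shows "has_bochner_integral lborel (\<lambda>r. indicator {0<..<t} r * rho c (t - r) * log_shift c r) (- 1)"
proof -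
  have "(\<lambda>r. indicator {0<..<t} r * rho c (t - r) * (r powr 0 * ln r)) = (\<lambda>r. indicator {0<..<t} r * rho c (t - r) * ln r)"
    by (auto simp: indicator_def)
  then have "has_bochner_integral lborel (\<lambda>r. indicator {0<..<t} r * rho c (t - r) * ln r) (- 1 - (euler_mascheroni + ln c) * nu c t)"
    using integrable_powr_ln_rho[OF c _ t, of 0] integral_ln_rho[OF c t] by (simp add: has_bochner_integral_iff)
  then have "has_bochner_integral lborel (\<lambda>r. indicator {0<..<t} r * rho c (t - r) * ln r + (euler_mascheroni + ln c) * (indicator {0<..<t} r * rho c (t - r)))
      (- 1 - (euler_mascheroni + ln c) * nu c t + (euler_mascheroni + ln c) * nu c t)"
    by (intro has_bochner_integral_add has_bochner_integral_mult_right has_bochner_integral_rho c t)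
  then show ?thesis by (simp add: log_shift_def algebra_simps)
qed

lemma integrable_rho:
  assumes c: "0 < c"
  shows "integrable lborel (\<lambda>r. indicator {..<T} r * rho c r)"
proof (cases "0 < T")
  case True
  have "integrable lborel (\<lambda>r. indicator {0<..<T} r * rho c (T - r))"
    using has_bochner_integral_rho[OF c True] by (rule integrable.intros)
  then have "integrable lborel (\<lambda>r. indicator {0<..<T} (T + (-1) * r) * rho c (T - (T + (-1) * r)))"
    by (rule lborel_integrable_real_affine) simp
  moreover have "(\<lambda>r. indicator {0<..<T} (T + (-1) * r) * rho c (T - (T + (-1) * r))) = (\<lambda>r. indicator {..<T} r * rho c r)"
    by (auto simp: indicator_def rho_def fun_eq_iff)
  ultimately show ?thesis by simp
next
  case False
  then have "(\<lambda>r. indicator {..<T} r * rho c r) = (\<lambda>r. 0)" by (auto simp: indicator_def rho_def fun_eq_iff)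
  then show ?thesis by simp
qed

text \<open>Twice the pairing of \<open>gauss a\<close> with \<open>gauss u\<close>, see
  \<open>ip_gauss_shifted_inverse\<close>. Cutting off at \<open>u = 0\<close> lets convolutions be
  written as integrals over the whole line.\<close>

definition shifted_inverse :: "real \<Rightarrow> real \<Rightarrow> real" where
  "shifted_inverse a u = (if 0 < u then 1 / (a + u) else 0)"

text \<open>The solution \<open>q\<close> of \<open>log_shift c * q = - ln ((a + t) / a) / 2\<close> (convolution), see
  \<open>has_bochner_integral_log_shift_flux_kernel\<close>.\<close>

definition flux_kernel :: "real \<Rightarrow> real \<Rightarrow> real \<Rightarrow> real" where
  "flux_kernel c a t = (1 / 2) * (\<integral>r. rho c r * shifted_inverse a (t - r) \<partial>lborel)"

lemma measurable_shifted_inverse [measurable]: "shifted_inverse a \<in> borel_measurable borel"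
  unfolding shifted_inverse_def by measurable

lemma shifted_inverse_nonneg: "0 < a \<Longrightarrow> 0 \<le> shifted_inverse a u"
  by (simp add: shifted_inverse_def)

lemma shifted_inverse_le: "0 < a \<Longrightarrow> shifted_inverse a u \<le> 1 / a"
  by (auto simp: shifted_inverse_def frac_le)

lemma rho_shifted_inverse_le:
  assumes a: "0 < a"
  shows "\<bar>rho c r * shifted_inverse a (t - r)\<bar> \<le> 1 / a * (indicator {..<t} r * rho c r)"
proof (cases "r < t")
  case True
  then show ?thesis
    using mult_left_mono[OF shifted_inverse_le[OF a, of "t - r"] rho_nonneg[of c r]] shifted_inverse_nonneg[OF a, of "t - r"] rho_nonneg[of c r]
    by (simp add: abs_mult)
qed (simp add: shifted_inverse_def)

lemma integrable_rho_shifted_inverse: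
  assumes c: "0 < c" and a: "0 < a"
  shows "integrable lborel (\<lambda>r. rho c r * shifted_inverse a (t - r))"
proof (rule Bochner_Integration.integrable_bound)
  show "integrable lborel (\<lambda>r. 1 / a * (indicator {..<t} r * rho c r))"
    by (intro integrable_mult_right integrable_rho c)
  show "AE r in lborel. norm (rho c r * shifted_inverse a (t - r)) \<le> norm (1 / a * (indicator {..<t} r * rho c r))"
    unfolding real_norm_def by (intro AE_I2 order.trans[OF rho_shifted_inverse_le[OF a] abs_ge_self])
qed measurable

lemma flux_kernel_nonneg: "0 < a \<Longrightarrow> 0 \<le> flux_kernel c a t"
  unfolding flux_kernel_def by (intro mult_nonneg_nonneg integral_nonneg_AE AE_I2) (auto intro: rho_nonneg shifted_inverse_nonneg)

lemma flux_kernel_nonpos: "t \<le> 0 \<Longrightarrow> flux_kernel c a t = 0"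
proof -
  assume "t \<le> 0"
  then have "(\<lambda>r. rho c r * shifted_inverse a (t - r)) = (\<lambda>r. 0)" by (auto simp: rho_def shifted_inverse_def)
  then show ?thesis by (simp add: flux_kernel_def)
qed

lemma measurable_flux_kernel [measurable]: "flux_kernel c a \<in> borel_measurable borel"
  unfolding flux_kernel_def by measurable

lemma isCont_flux_kernel:
  assumes c: "0 < c" and a: "0 < a"
  shows "isCont (flux_kernel c a) t"
proof -
  have "((\<lambda>h. \<integral>r. rho c r * shifted_inverse a (h - r) \<partial>lborel) \<longlongrightarrow> (\<integral>r. rho c r * shifted_inverse a (t - r) \<partial>lborel)) (at t within UNIV)"
  proof (rule tendsto_integral_at_within[where w = "\<lambda>r. 1 / a * (indicator {..<t + 1} r * rho c r)"])
    show "\<forall>\<^sub>F h in at t. (\<lambda>r. rho c r * shifted_inverse a (h - r)) \<in> borel_measurable lborel \<and>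
        (AE x in lborel. \<bar>rho c x * shifted_inverse a (h - x)\<bar> \<le> 1 / a * (indicator {..<t + 1} x * rho c x))"
      unfolding eventually_at
    proof (intro exI[of _ 1] conjI ballI impI, goal_cases)
      case (3 h)
      have "1 / a * (indicator {..<h} x * rho c x) \<le> 1 / a * (indicator {..<t + 1} x * rho c x)" for x
        using 3 a rho_nonneg[of c x] by (intro mult_left_mono mult_right_mono) (auto simp: indicator_def dist_real_def)
      then show ?case by (intro AE_I2 order.trans[OF rho_shifted_inverse_le[OF a]])
    qed auto
    \<comment> \<open>\<open>shifted_inverse\<close> jumps at 0; in the convolution the jump sits at
      the single point \<open>x = t\<close>, a null set.\<close>
    have "AE x in lborel. x \<noteq> t" by (rule AE_lborel_singleton)
    then show "AE x in lborel. ((\<lambda>h. rho c x * shifted_inverse a (h - x)) \<longlongrightarrow> rho c x * shifted_inverse a (t - x)) (at t)"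
    proof eventually_elim
      fix x assume x: "x \<noteq> t"
      have "isCont (shifted_inverse a) (t - x)"
      proof (cases "x < t")
        case True
        have "isCont (\<lambda>u. 1 / (a + u)) (t - x)" using a True by (intro continuous_intros) auto
        moreover have "\<forall>\<^sub>F u in nhds (t - x). shifted_inverse a u = 1 / (a + u)"
          using eventually_nhds_in_open[of "{0<..}" "t - x"] True by (auto simp: shifted_inverse_def elim: eventually_mono)
        ultimately show ?thesis by (simp cong: isCont_cong)
      next
        case False
        have "\<forall>\<^sub>F u in nhds (t - x). shifted_inverse a u = 0"
          using eventually_nhds_in_open[of "{..<0}" "t - x"] False x by (auto simp: shifted_inverse_def elim: eventually_mono)
        then show ?thesis by (simp cong: isCont_cong)
      qed
      then show "((\<lambda>h. rho c x * shifted_inverse a (h - x)) \<longlongrightarrow> rho c x * shifted_inverse a (t - x)) (at t)"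
        by (intro tendsto_mult_left isCont_tendsto_compose[of _ "shifted_inverse a"] tendsto_intros)
    qed
    show "integrable lborel (\<lambda>r. 1 / a * (indicator {..<t + 1} r * rho c r))"
      by (intro integrable_mult_right integrable_rho c)
  qed simp
  then have "((\<lambda>h. flux_kernel c a h) \<longlongrightarrow> flux_kernel c a t) (at t)"
    unfolding flux_kernel_def by (intro tendsto_mult_left) simp
  then show ?thesis by (simp add: isCont_def)
qed

lemma nn_flux_kernel:
  assumes c: "0 < c" and a: "0 < a"
  shows "ennreal (flux_kernel c a t) = ennreal (1 / 2) * (\<integral>\<^sup>+r. ennreal (rho c r) * ennreal (shifted_inverse a (t - r)) \<partial>lborel)"
proof -
  have "(\<integral>\<^sup>+r. ennreal (rho c r) * ennreal (shifted_inverse a (t - r)) \<partial>lborel) = (\<integral>\<^sup>+r. ennreal (rho c r * shifted_inverse a (t - r)) \<partial>lborel)"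
    by (intro nn_integral_cong) (simp add: ennreal_mult shifted_inverse_nonneg[OF a] rho_nonneg)
  also have "\<dots> = ennreal (\<integral>r. rho c r * shifted_inverse a (t - r) \<partial>lborel)"
    using shifted_inverse_nonneg[OF a] rho_nonneg by (intro nn_integral_eq_integral integrable_rho_shifted_inverse c a AE_I2) auto
  finally have *: "(\<integral>\<^sup>+r. ennreal (rho c r) * ennreal (shifted_inverse a (t - r)) \<partial>lborel) = ennreal (\<integral>r. rho c r * shifted_inverse a (t - r) \<partial>lborel)" .
  show ?thesis unfolding * flux_kernel_def by (rule ennreal_mult') simp
qed

lemma nn_integral_reflect:
  fixes f :: "real \<Rightarrow> ennreal"
  assumes [measurable]: "f \<in> borel_measurable borel"
  shows "(\<integral>\<^sup>+r. f (t - r) \<partial>lborel) = (\<integral>\<^sup>+r. f r \<partial>lborel)"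
  using nn_integral_real_affine[of f "-1" t] by simp

text \<open>Both sides are half the triple convolution of \<open>rho\<close> with the two shifted
  inverses, and convolution is commutative. This is the self-adjointness of the evolution as seen by
  the profiles.\<close>

lemma nn_flux_kernel_symmetric:
  assumes c: "0 < c" and a: "0 < a" and b: "0 < b"
  shows "(\<integral>\<^sup>+r. ennreal (shifted_inverse b r) * ennreal (flux_kernel c a (t - r)) \<partial>lborel) = (\<integral>\<^sup>+r. ennreal (shifted_inverse a r) * ennreal (flux_kernel c b (t - r)) \<partial>lborel)"
proof -
  have *: "(\<integral>\<^sup>+r. ennreal (shifted_inverse b r) * ennreal (flux_kernel c a (t - r)) \<partial>lborel) =
      ennreal (1 / 2) * (\<integral>\<^sup>+s. ennreal (rho c s) * (\<integral>\<^sup>+r. ennreal (shifted_inverse b r) * ennreal (shifted_inverse a (t - s - r)) \<partial>lborel) \<partial>lborel)"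
    if a: "0 < a" and b: "0 < b" for a b
  proof -
    have "(\<integral>\<^sup>+r. ennreal (shifted_inverse b r) * ennreal (flux_kernel c a (t - r)) \<partial>lborel) =
        (\<integral>\<^sup>+r. ennreal (1 / 2) * (\<integral>\<^sup>+s. ennreal (shifted_inverse b r) * (ennreal (rho c s) * ennreal (shifted_inverse a (t - r - s))) \<partial>lborel) \<partial>lborel)"
    proof (intro nn_integral_cong)
      fix r
      have "(\<integral>\<^sup>+s. ennreal (shifted_inverse b r) * (ennreal (rho c s) * ennreal (shifted_inverse a (t - r - s))) \<partial>lborel) =
          ennreal (shifted_inverse b r) * (\<integral>\<^sup>+s. (ennreal (rho c s) * ennreal (shifted_inverse a (t - r - s))) \<partial>lborel)"
        by (rule nn_integral_cmult) measurable
      then show "ennreal (shifted_inverse b r) * ennreal (flux_kernel c a (t - r)) =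
          ennreal (1 / 2) * (\<integral>\<^sup>+s. ennreal (shifted_inverse b r) * (ennreal (rho c s) * ennreal (shifted_inverse a (t - r - s))) \<partial>lborel)"
        unfolding nn_flux_kernel[OF c a] by (simp add: mult.left_commute)
    qed
    also have "\<dots> = ennreal (1 / 2) * (\<integral>\<^sup>+r. (\<integral>\<^sup>+s. ennreal (shifted_inverse b r) * (ennreal (rho c s) * ennreal (shifted_inverse a (t - r - s))) \<partial>lborel) \<partial>lborel)"
      by (rule nn_integral_cmult) measurable
    also have "(\<integral>\<^sup>+r. (\<integral>\<^sup>+s. ennreal (shifted_inverse b r) * (ennreal (rho c s) * ennreal (shifted_inverse a (t - r - s))) \<partial>lborel) \<partial>lborel) =
        (\<integral>\<^sup>+s. (\<integral>\<^sup>+r. ennreal (shifted_inverse b r) * (ennreal (rho c s) * ennreal (shifted_inverse a (t - r - s))) \<partial>lborel) \<partial>lborel)"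
      by (rule lborel_pair.Fubini') measurable
    also have "\<dots> = (\<integral>\<^sup>+s. ennreal (rho c s) * (\<integral>\<^sup>+r. ennreal (shifted_inverse b r) * ennreal (shifted_inverse a (t - s - r)) \<partial>lborel) \<partial>lborel)"
      by (intro nn_integral_cong, subst nn_integral_cmult[symmetric]) (auto simp: mult_ac diff_diff_eq add.commute)
    finally show ?thesis .
  qed
  have "(\<integral>\<^sup>+r. ennreal (shifted_inverse b r) * ennreal (shifted_inverse a (t - s - r)) \<partial>lborel) = (\<integral>\<^sup>+r. ennreal (shifted_inverse a r) * ennreal (shifted_inverse b (t - s - r)) \<partial>lborel)" for s
    using nn_integral_reflect[of "\<lambda>r. ennreal (shifted_inverse b r) * ennreal (shifted_inverse a (t - s - r))" "t - s"] by (simp add: mult.commute)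
  then show ?thesis unfolding *[OF a b] *[OF b a] by simp
qed

section \<open>The boundary flux kernel\<close>

lemma H_mono:
  assumes x: "0 < x" "x \<le> y" and a: "0 \<le> a"
  shows "H a x \<le> H a y"
  unfolding H_def
proof (rule integral_mono)
  show "integrable lborel (\<lambda>s. indicator {0<..} s * (x powr s * rGamma (s + a)))"
       "integrable lborel (\<lambda>s. indicator {0<..} s * (y powr s * rGamma (s + a)))"
    using x a by (auto intro!: integrable_H)
  show "indicator {0<..} s * (x powr s * rGamma (s + a)) \<le> indicator {0<..} s * (y powr s * rGamma (s + a))" for s
    using x a by (auto simp: indicator_def intro!: mult_right_mono powr_mono2 rGamma_nonneg)
qed

lemma has_bochner_integral_shifted_inverse:
  assumes a: "0 < a" and T: "0 < T"
  shows "has_bochner_integral lborel (\<lambda>s. indicator {0<..<T} s * shifted_inverse a s) (ln ((a + T) / a))"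
proof -
  have "has_bochner_integral lborel (\<lambda>s. indicator {0..T} s *\<^sub>R (1 / (a + s))) (ln (a + T) - ln (a + 0))"
  proof (rule has_bochner_integral_FTC_Icc)
    fix s assume s: "0 \<le> s" "s \<le> T"
    have "((\<lambda>s. ln (a + s)) has_real_derivative 1 / (a + s)) (at s)"
      using a s by (auto intro!: derivative_eq_intros)
    then show "((\<lambda>s. ln (a + s)) has_vector_derivative 1 / (a + s)) (at s within {0..T})"
      by (rule has_vector_derivative_at_within[OF has_real_derivative_iff_has_vector_derivative[THEN iffD1]])
  qed (use a T in \<open>auto intro!: continuous_intros\<close>)
  moreover have "AE s in lborel. indicator {0..T} s *\<^sub>R (1 / (a + s)) = indicator {0<..<T} s * shifted_inverse a s"
    using AE_lborel_singleton[of 0] AE_lborel_singleton[of T]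
    by eventually_elim (auto simp: indicator_def shifted_inverse_def)
  ultimately show ?thesis
    using a T by (subst (asm) has_bochner_integral_cong_AE) (auto simp: ln_div)
qed

lemma flux_kernel_alt:
  assumes c: "0 < c" and a: "0 < a"
  shows "has_bochner_integral lborel (\<lambda>s. rho c (t - s) * shifted_inverse a s) (2 * flux_kernel c a t)"
proof -
  have "has_bochner_integral lborel (\<lambda>r. rho c r * shifted_inverse a (t - r)) (2 * flux_kernel c a t)"
    using integrable_rho_shifted_inverse[OF c a] by (simp add: has_bochner_integral_iff flux_kernel_def)
  then show ?thesis
    using lborel_has_bochner_integral_real_affine_iff[of "-1" "\<lambda>r. rho c r * shifted_inverse a (t - r)" "2 * flux_kernel c a t" t] by simp
qed

text \<open>Associativity of convolution: \<open>log_shift c\<close> meets \<open>rho\<close> first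
  and gives the constant \<open>- 1\<close>, whose convolution with \<open>shifted_inverse a\<close>
  is \<open>- ln ((a + T) / a)\<close>. The half is the one in \<open>flux_kernel\<close>. As the
  logarithm changes sign, Fubini needs an absolute bound.\<close>

lemma has_bochner_integral_log_shift_flux_kernel:
  assumes c: "0 < c" and a: "0 < a" and T: "0 < T"
  shows "has_bochner_integral lborel (\<lambda>r. indicator {0<..} r * log_shift c r * flux_kernel c a (T - r)) (- (ln ((a + T) / a)) / 2)"
proof -
  define F where "F = (\<lambda>(s, r). shifted_inverse a s * (indicator {0<..} r * rho c (T - s - r) * log_shift c r))"
  have Fm [measurable]: "F \<in> borel_measurable (lborel \<Otimes>\<^sub>M lborel)"
    unfolding F_def log_shift_def by measurable
  define L where "L = max 0 (log_shift c T)"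
  have ind: "indicator {0<..} r * rho c (T - s - r) * z = indicator {0<..<T - s} r * rho c (T - s - r) * z" for r s z
    by (auto simp: indicator_def rho_def)
  have F0: "F (s, r) = 0" if "\<not> (0 < s \<and> s < T)" for s r
    using that by (auto simp: F_def shifted_inverse_def rho_def indicator_def)
  have F1: "has_bochner_integral lborel (\<lambda>r. F (s, r)) (shifted_inverse a s * (- 1))" if "0 < s" "s < T" for s
    unfolding F_def prod.case ind using has_bochner_integral_log_shift_rho[OF c, of "T - s"] that
    by (intro has_bochner_integral_mult_right) simp
  have Fabs: "(\<integral>r. norm (F (s, r)) \<partial>lborel) \<le> 1 / a * (1 + 2 * L * nu c T)" if s: "0 < s" "s < T" for s
  proof -
    have hb: "has_bochner_integral lborel (\<lambda>r. shifted_inverse a s * (2 * L * (indicator {0<..<T - s} r * rho c (T - s - r)) - indicator {0<..<T - s} r * rho c (T - s - r) * log_shift c r))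
        (shifted_inverse a s * (2 * L * nu c (T - s) - (- 1)))"
      using s by (intro has_bochner_integral_mult_right has_bochner_integral_diff has_bochner_integral_rho has_bochner_integral_log_shift_rho c) auto
    have "(\<integral>r. norm (F (s, r)) \<partial>lborel) \<le> (\<integral>r. shifted_inverse a s * (2 * L * (indicator {0<..<T - s} r * rho c (T - s - r)) - indicator {0<..<T - s} r * rho c (T - s - r) * log_shift c r) \<partial>lborel)"
    proof (rule integral_mono)
      show "integrable lborel (\<lambda>r. norm (F (s, r)))" using F1[OF s] by (auto simp: has_bochner_integral_iff)
      show "integrable lborel (\<lambda>r. shifted_inverse a s * (2 * L * (indicator {0<..<T - s} r * rho c (T - s - r)) - indicator {0<..<T - s} r * rho c (T - s - r) * log_shift c r))"
        using hb by (rule integrable.intros)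
      fix r
      \<comment> \<open>\<open>L\<close> bounds \<open>log_shift c\<close> from above on
        \<open>(0, T)\<close>, so the absolute value is at most an affine function of
        \<open>log_shift\<close> itself, whose convolution with \<open>rho\<close> is known.\<close>
      have "\<bar>log_shift c r\<bar> \<le> 2 * L - log_shift c r" if r: "0 < r" "r < T - s"
      proof -
        have "log_shift c r \<le> log_shift c T" using r s by (simp add: log_shift_def)
        then show ?thesis by (auto simp: L_def)
      qed
      then have "(indicator {0<..<T - s} r * rho c (T - s - r)) * \<bar>log_shift c r\<bar> \<le> (indicator {0<..<T - s} r * rho c (T - s - r)) * (2 * L - log_shift c r)"
        using rho_nonneg[of c "T - s - r"] by (auto simp: indicator_def intro: mult_left_mono)
      then have "shifted_inverse a s * ((indicator {0<..<T - s} r * rho c (T - s - r)) * \<bar>log_shift c r\<bar>) \<le> shifted_inverse a s * ((indicator {0<..<T - s} r * rho c (T - s - r)) * (2 * L - log_shift c r))"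
        by (rule mult_left_mono) (rule shifted_inverse_nonneg[OF a])
      then show "norm (F (s, r)) \<le> shifted_inverse a s * (2 * L * (indicator {0<..<T - s} r * rho c (T - s - r)) - indicator {0<..<T - s} r * rho c (T - s - r) * log_shift c r)"
        unfolding F_def prod.case ind using shifted_inverse_nonneg[OF a, of s] rho_nonneg[of c "T - s - r"]
        by (simp add: abs_mult algebra_simps)
    qed
    also have "\<dots> = shifted_inverse a s * (2 * L * nu c (T - s) - (- 1))" by (rule has_bochner_integral_integral_eq[OF hb])
    also have "\<dots> = shifted_inverse a s * (1 + 2 * L * nu c (T - s))" by simp
    also have "\<dots> \<le> 1 / a * (1 + 2 * L * nu c T)"
    proof (intro mult_mono shifted_inverse_le a add_mono mult_left_mono order.refl)
      show "nu c (T - s) \<le> nu c T" unfolding nu_def using c s by (intro H_mono) auto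
      show "0 \<le> 1 + 2 * L * nu c (T - s)" by (simp add: L_def nu_def H_nonneg)
    qed (use a in \<open>auto simp: L_def nu_def H_nonneg\<close>)
    finally show ?thesis .
  qed
  have intF: "integrable (lborel \<Otimes>\<^sub>M lborel) F"
  proof (rule lborel_pair.Fubini_integrable[OF Fm])
    show "integrable lborel (\<lambda>s. \<integral>r. norm (F (s, r)) \<partial>lborel)"
    proof (rule Bochner_Integration.integrable_bound)
      show "integrable lborel (\<lambda>s. indicator {0<..<T} s * (1 / a * (1 + 2 * L * nu c T)))"
        by (intro integrable_mult_left integrable_real_indicator) (use T in auto)
      show "AE s in lborel. norm (\<integral>r. norm (F (s, r)) \<partial>lborel) \<le> norm (indicator {0<..<T} s * (1 / a * (1 + 2 * L * nu c T)))"
      proof (intro AE_I2)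
        fix s
        show "norm (\<integral>r. norm (F (s, r)) \<partial>lborel) \<le> norm (indicator {0<..<T} s * (1 / a * (1 + 2 * L * nu c T)))"
        proof (cases "0 < s \<and> s < T")
          case True
          then have ind1: "indicator {0<..<T} s = (1::real)" by simp
          have "norm (\<integral>r. norm (F (s, r)) \<partial>lborel) = (\<integral>r. norm (F (s, r)) \<partial>lborel)" by simp
          also have "\<dots> \<le> 1 / a * (1 + 2 * L * nu c T)" using True by (intro Fabs) auto
          also have "\<dots> \<le> norm (indicator {0<..<T} s * (1 / a * (1 + 2 * L * nu c T)))"
            unfolding ind1 mult_1 real_norm_def by (rule abs_ge_self)
          finally show ?thesis .
        qed (simp add: F0)
      qed
    qed measurable
    show "AE s in lborel. integrable lborel (\<lambda>r. F (s, r))"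
    proof (intro AE_I2)
      fix s show "integrable lborel (\<lambda>r. F (s, r))"
        using F1[of s] F0[of s] by (cases "0 < s \<and> s < T") (auto simp: has_bochner_integral_iff)
    qed
  qed
  have inner: "(\<integral>s. F (s, r) \<partial>lborel) = 2 * (indicator {0<..} r * log_shift c r * flux_kernel c a (T - r))" for r
  proof -
    have "(\<integral>s. F (s, r) \<partial>lborel) = (\<integral>s. (indicator {0<..} r * log_shift c r) * (rho c (T - r - s) * shifted_inverse a s) \<partial>lborel)"
      by (intro Bochner_Integration.integral_cong) (auto simp: F_def algebra_simps)
    also have "\<dots> = (indicator {0<..} r * log_shift c r) * (2 * flux_kernel c a (T - r))"
      using flux_kernel_alt[OF c a, of "T - r"] by (simp add: has_bochner_integral_iff)
    finally show ?thesis by simp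
  qed
  have intF': "integrable (lborel \<Otimes>\<^sub>M lborel) (case_prod (\<lambda>s r. F (s, r)))" using intF by (simp add: case_prod_eta)
  have "integrable lborel (\<lambda>r. \<integral>s. F (s, r) \<partial>lborel)"
    by (rule lborel_pair.integrable_snd[OF intF'])
  then have "integrable lborel (\<lambda>r. 1 / 2 * (\<integral>s. F (s, r) \<partial>lborel))"
    by (intro integrable_mult_right)
  then have int: "integrable lborel (\<lambda>r. indicator {0<..} r * log_shift c r * flux_kernel c a (T - r))"
    unfolding inner by simp
  have "(\<integral>r. 2 * (indicator {0<..} r * log_shift c r * flux_kernel c a (T - r)) \<partial>lborel) = (\<integral>s. (\<integral>r. F (s, r) \<partial>lborel) \<partial>lborel)"
    unfolding inner[symmetric] by (rule lborel_pair.Fubini_integral[OF intF'])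
  also have "\<dots> = (\<integral>s. - (indicator {0<..<T} s * shifted_inverse a s) \<partial>lborel)"
  proof (intro Bochner_Integration.integral_cong refl)
    fix s show "(\<integral>r. F (s, r) \<partial>lborel) = - (indicator {0<..<T} s * shifted_inverse a s)"
      using F1[of s] F0[of s] by (cases "0 < s \<and> s < T") (auto simp: has_bochner_integral_iff)
  qed
  also have "\<dots> = - ln ((a + T) / a)"
    using has_bochner_integral_shifted_inverse[OF a T] by (simp add: has_bochner_integral_iff)
  finally show ?thesis using int by (simp add: has_bochner_integral_iff)
qed

text \<open>\<open>gauss (a + s)\<close> is the image of \<open>gauss a\<close> under the semigroup of the Friedrichs extension; the convolution term
  corrects it to the image under the semigroup of \<open>Delta(\<theta>)\<close>.\<close>

definition dual_pairing :: "real \<Rightarrow> real \<Rightarrow> (real \<Rightarrow> real) \<Rightarrow> real \<Rightarrow> real" where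
  "dual_pairing c a v s = ip v (gauss (a + s)) + 2 * (\<integral>r. ip v (gauss r) * flux_kernel c a (s - r) \<partial>lborel)"

lemma gauss_nonpos: "r \<le> 0 \<Longrightarrow> gauss r = (\<lambda>x. 0)"
  by (auto simp: gauss_def)

lemma ip_gauss_nonpos: "r \<le> 0 \<Longrightarrow> ip v (gauss r) = 0"
  by (simp add: gauss_nonpos ip_def)

lemma measurable_ip_gauss:
  assumes v: "sq_int v"
  shows "(\<lambda>r. ip v (gauss r)) \<in> borel_measurable borel"
proof -
  define F where "F = (\<lambda>x. indicator {0<..} x * v x)"
  have [measurable]: "F \<in> borel_measurable borel" using sq_int_measurable[OF v] by (simp add: F_def)
  have "(\<lambda>r. \<integral>x. F x * gauss r x \<partial>lborel) \<in> borel_measurable borel" by measurable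
  moreover have "(\<integral>x. F x * gauss r x \<partial>lborel) = ip v (gauss r)" for r
    by (simp add: ip_def set_lebesgue_integral_def F_def mult.assoc)
  ultimately show ?thesis by simp
qed

lemma integrable_inv_sqrt:
  assumes T: "0 < T"
  shows "integrable lborel (\<lambda>r. indicator {0<..<T} r / sqrt r)"
proof -
  have nn: "(\<integral>\<^sup>+r. ennreal (indicator {0<..<T} r * (r powr (1 / 2 - 1) * (T - r) powr (1 - 1))) \<partial>lborel) = ennreal (T powr (1 / 2 + 1 - 1) * Beta (1 / 2) 1)"
    by (rule nn_integral_Beta) (use T in auto)
  have "0 < Beta (1 / 2) (1::real)"
    unfolding Beta_def by (intro divide_pos_pos mult_pos_pos Gamma_real_pos) auto
  then have pos: "0 \<le> T powr (1 / 2 + 1 - 1) * Beta (1 / 2) 1" by simp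
  have "has_bochner_integral lborel (\<lambda>r. indicator {0<..<T} r * (r powr (1 / 2 - 1) * (T - r) powr (1 - 1))) (T powr (1 / 2 + 1 - 1) * Beta (1 / 2) 1)"
  proof (rule has_bochner_integral_nn_integral[OF _ _ pos nn])
    show "AE r in lborel. 0 \<le> indicator {0<..<T} r * (r powr (1 / 2 - 1) * (T - r) powr (1 - 1))"
      by (intro AE_I2 mult_nonneg_nonneg indicator_pos_le powr_ge_zero)
    show "(\<lambda>r. indicator {0<..<T} r * (r powr (1 / 2 - 1) * (T - r) powr (1 - 1))) \<in> borel_measurable lborel"
      by measurable
  qed
  moreover have "indicator {0<..<T} r * (r powr (1 / 2 - 1) * (T - r) powr (1 - 1)) = indicator {0<..<T} r / sqrt r" for r
    by (cases "0 < r \<and> r < T") (simp_all add: powr_minus_divide powr_half_sqrt)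
  ultimately show ?thesis by (simp add: has_bochner_integral_iff)
qed

text \<open>Cauchy-Schwarz bounds the pairing by a multiple of \<open>1 / sqrt r\<close>, which is
  integrable at 0. Hence \<open>dual_pairing\<close> makes sense for every L^2 function, in
  particular for images under the operator.\<close>

lemma integrable_ip_gauss:
  assumes v: "sq_int v" and T: "0 < T"
  shows "integrable lborel (\<lambda>r. indicator {0<..<T} r * ip v (gauss r))"
proof (rule Bochner_Integration.integrable_bound)
  show "integrable lborel (\<lambda>r. L2_norm v / 2 * (indicator {0<..<T} r / sqrt r))"
    by (intro integrable_mult_right integrable_inv_sqrt T)
  show "(\<lambda>r. indicator {0<..<T} r * ip v (gauss r)) \<in> borel_measurable lborel"
    using measurable_ip_gauss[OF v] by measurable
  show "AE r in lborel. norm (indicator {0<..<T} r * ip v (gauss r)) \<le> norm (L2_norm v / 2 * (indicator {0<..<T} r / sqrt r))"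
    using ip_gauss_le[OF v] L2_norm_nonneg[of v] by (intro AE_I2) (auto simp: indicator_def)
qed

lemma ip_gauss_flux_kernel_eq:
  assumes "s \<le> T"
  shows "ip v (gauss r) * flux_kernel c a (s - r) = indicator {0<..<T} r * ip v (gauss r) * flux_kernel c a (s - r)"
proof (cases "0 < r \<and> r < s")
  case False
  then have "ip v (gauss r) = 0 \<or> flux_kernel c a (s - r) = 0"
    using ip_gauss_nonpos[of r v] flux_kernel_nonpos[of "s - r" c a] by fastforce
  then show ?thesis by auto
qed (use assms in auto)

context
  fixes c a :: real
  assumes c: "0 < c" and a: "0 < a"
begin

lemma continuous_flux_kernel: "continuous_on A (flux_kernel c a)"
  by (intro continuous_at_imp_continuous_on ballI isCont_flux_kernel c a)

lemma integrable_ip_gauss_flux_kernel: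
  assumes v: "sq_int v" and s: "0 \<le> s"
  shows "integrable lborel (\<lambda>r. ip v (gauss r) * flux_kernel c a (s - r))"
proof -
  obtain C where C: "\<And>x. x \<in> {0..s} \<Longrightarrow> \<bar>flux_kernel c a x\<bar> \<le> C"
    by (rule continuous_on_Icc_abs_bounded[OF continuous_flux_kernel]) blast
  show ?thesis
  proof (rule Bochner_Integration.integrable_bound)
    show "integrable lborel (\<lambda>r. C * \<bar>indicator {0<..<s + 1} r * ip v (gauss r)\<bar>)"
      using s by (intro integrable_mult_right integrable_abs integrable_ip_gauss v) auto
    show "(\<lambda>r. ip v (gauss r) * flux_kernel c a (s - r)) \<in> borel_measurable lborel"
      using measurable_ip_gauss[OF v] by measurable
    have "\<bar>ip v (gauss r) * flux_kernel c a (s - r)\<bar> \<le> C * \<bar>indicator {0<..<s + 1} r * ip v (gauss r)\<bar>" for r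
    proof (cases "0 < r \<and> r < s")
      case True
      then have "\<bar>ip v (gauss r)\<bar> * \<bar>flux_kernel c a (s - r)\<bar> \<le> \<bar>ip v (gauss r)\<bar> * C"
        by (intro mult_left_mono C) auto
      then show ?thesis using True by (simp add: abs_mult mult.commute)
    next
      case False
      then have z: "ip v (gauss r) * flux_kernel c a (s - r) = 0" using ip_gauss_nonpos[of r v] flux_kernel_nonpos[of "s - r" c a] by fastforce
      have "0 \<le> C" using C[of 0] s by auto
      then show ?thesis unfolding z by simp
    qed
    then show "AE r in lborel. norm (ip v (gauss r) * flux_kernel c a (s - r)) \<le> norm (C * \<bar>indicator {0<..<s + 1} r * ip v (gauss r)\<bar>)"
      unfolding real_norm_def by (intro AE_I2 order.trans[OF _ abs_ge_self])
  qed
qed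

lemma dual_pairing_diff:
  assumes v: "sq_int v" and w: "sq_int w" and s: "0 \<le> s"
  shows "dual_pairing c a (\<lambda>x. v x - w x) s = dual_pairing c a v s - dual_pairing c a w s"
  unfolding dual_pairing_def using integrable_ip_gauss_flux_kernel[OF v s] integrable_ip_gauss_flux_kernel[OF w s]
  by (simp add: ip_diff_left[OF v w sq_int_gauss] left_diff_distrib)

lemma dual_pairing_cmult: "dual_pairing c a (\<lambda>x. k * v x) s = k * dual_pairing c a v s"
  unfolding dual_pairing_def by (simp add: ip_cmult_left algebra_simps)

text \<open>The constant is uniform in \<open>s\<close>. This lets norm convergence pass through the
  functional while \<open>s\<close> varies at the same time.\<close>

lemma dual_pairing_le:
  assumes T: "0 < T"
  obtains C where "\<And>v s. sq_int v \<Longrightarrow> 0 \<le> s \<Longrightarrow> s \<le> T \<Longrightarrow> \<bar>dual_pairing c a v s\<bar> \<le> C * L2_norm v"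
proof -
  obtain Q where Q: "\<And>x. x \<in> {0..T} \<Longrightarrow> \<bar>flux_kernel c a x\<bar> \<le> Q"
    by (rule continuous_on_Icc_abs_bounded[OF continuous_flux_kernel]) blast
  have Q0: "0 \<le> Q" using Q[of 0] T by auto
  define I where "I = (\<integral>r. indicator {0<..<T} r / sqrt r \<partial>lborel)"
  have "\<bar>dual_pairing c a v s\<bar> \<le> (1 / (2 * sqrt a) + Q * I) * L2_norm v" if v: "sq_int v" and s: "0 \<le> s" "s \<le> T" for v s
  proof -
    define A where "A = L2_norm v"
    have A: "0 \<le> A" by (simp add: A_def L2_norm_nonneg)
    have "\<bar>ip v (gauss (a + s))\<bar> \<le> A / (2 * sqrt (a + s))"
      unfolding A_def using a s by (intro ip_gauss_le v) auto
    also have "\<dots> \<le> A / (2 * sqrt a)" using a s A by (intro divide_left_mono) auto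
    finally have 1: "\<bar>ip v (gauss (a + s))\<bar> \<le> A / (2 * sqrt a)" .
    have "\<bar>\<integral>r. ip v (gauss r) * flux_kernel c a (s - r) \<partial>lborel\<bar> \<le> (\<integral>r. \<bar>ip v (gauss r) * flux_kernel c a (s - r)\<bar> \<partial>lborel)"
      by (rule integral_abs_bound)
    also have "\<dots> \<le> (\<integral>r. A / 2 * Q * (indicator {0<..<T} r / sqrt r) \<partial>lborel)"
    proof (rule integral_mono)
      show "integrable lborel (\<lambda>r. \<bar>ip v (gauss r) * flux_kernel c a (s - r)\<bar>)"
        using integrable_ip_gauss_flux_kernel[OF v s(1)] by simp
      show "integrable lborel (\<lambda>r. A / 2 * Q * (indicator {0<..<T} r / sqrt r))"
        by (intro integrable_mult_right integrable_inv_sqrt T)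
      show "\<bar>ip v (gauss r) * flux_kernel c a (s - r)\<bar> \<le> A / 2 * Q * (indicator {0<..<T} r / sqrt r)" for r
      proof (cases "0 < r \<and> r < s")
        case True
        have "\<bar>ip v (gauss r)\<bar> * \<bar>flux_kernel c a (s - r)\<bar> \<le> (A / (2 * sqrt r)) * Q"
          using True s A unfolding A_def by (intro mult_mono ip_gauss_le v Q) auto
        then show ?thesis using True s by (simp add: abs_mult field_simps)
      next
        case False
        then have z: "ip v (gauss r) * flux_kernel c a (s - r) = 0" using ip_gauss_nonpos[of r v] flux_kernel_nonpos[of "s - r" c a] by fastforce
        show ?thesis unfolding z using A Q0 by (simp add: indicator_def)
      qed
    qed
    also have "\<dots> = A / 2 * Q * I" unfolding I_def by (rule Bochner_Integration.integral_mult_right_zero)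
    finally have 2: "\<bar>\<integral>r. ip v (gauss r) * flux_kernel c a (s - r) \<partial>lborel\<bar> \<le> A / 2 * Q * I" .
    have "\<bar>dual_pairing c a v s\<bar> \<le> \<bar>ip v (gauss (a + s))\<bar> + 2 * \<bar>\<integral>r. ip v (gauss r) * flux_kernel c a (s - r) \<partial>lborel\<bar>"
      unfolding dual_pairing_def by linarith
    also have "\<dots> \<le> A / (2 * sqrt a) + 2 * (A / 2 * Q * I)" using 1 2 by linarith
    also have "\<dots> = (1 / (2 * sqrt a) + Q * I) * A" by (simp add: algebra_simps)
    finally show ?thesis by (simp add: A_def)
  qed
  then show ?thesis by (rule that)
qed

lemma isCont_dual_pairing:
  assumes v: "sq_int v" and s: "0 \<le> s"
  shows "isCont (dual_pairing c a v) s"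
proof -
  define k where "k = (\<lambda>r. indicator {0<..<s + 1} r * ip v (gauss r))"
  have k: "integrable lborel k" unfolding k_def using s by (intro integrable_ip_gauss v) auto
  have "isCont (\<lambda>s. \<integral>r. k r * flux_kernel c a (s - r) \<partial>lborel) s"
    by (rule isCont_convolution[OF k _ continuous_flux_kernel, of "s + 1"]) (auto simp: k_def indicator_def)
  moreover have "\<forall>\<^sub>F t in nhds s. (\<integral>r. ip v (gauss r) * flux_kernel c a (t - r) \<partial>lborel) = (\<integral>r. k r * flux_kernel c a (t - r) \<partial>lborel)"
  proof -
    have "\<forall>\<^sub>F t in nhds s. t \<in> {..<s + 1}" by (rule eventually_nhds_in_open) auto
    then show ?thesis
    proof eventually_elim
      fix t assume "t \<in> {..<s + 1}"
      then have "(\<lambda>r. ip v (gauss r) * flux_kernel c a (t - r)) = (\<lambda>r. k r * flux_kernel c a (t - r))"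
        by (intro ext) (simp add: k_def ip_gauss_flux_kernel_eq[of t "s + 1"])
      then show "(\<integral>r. ip v (gauss r) * flux_kernel c a (t - r) \<partial>lborel) = (\<integral>r. k r * flux_kernel c a (t - r) \<partial>lborel)" by simp
    qed
  qed
  ultimately have "isCont (\<lambda>t. \<integral>r. ip v (gauss r) * flux_kernel c a (t - r) \<partial>lborel) s"
    by (simp cong: isCont_cong)
  moreover have "isCont (\<lambda>t. ip v (gauss (a + t))) s"
  proof (rule isCont_o2[of _ "\<lambda>t. a + t" "\<lambda>r. ip v (gauss r)"])
    show "isCont (\<lambda>r. ip v (gauss r)) (a + s)" using a s by (intro DERIV_isCont[OF DERIV_ip_gauss[OF v]]) auto
  qed auto
  ultimately show ?thesis unfolding dual_pairing_def by (intro continuous_intros)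
qed

end

section \<open>Pairing with the boundary profile along the evolution\<close>

text \<open>Weakens the remainder \<open>O(x powr (3/2) * ln x)\<close> to \<open>C x\<close> near
  0, since \<open>sqrt x * ln x\<close> is bounded there; Green's formula and the limit of the
  pairing use only this form.\<close>

lemma Delta_theta_relE:
  assumes "Delta_theta_rel \<theta> f h"
  obtains cp cm d C where "cos \<theta> * cp + sin \<theta> * cm = 0" "0 < d"
    "AE x in lborel. 0 < x \<and> x < d \<longrightarrow> \<bar>f x - cp * sqrt x - cm * (sqrt x * ln x)\<bar> \<le> C * x"
proof -
  obtain cp cm g where bc: "cos \<theta> * cp + sin \<theta> * cm = 0" and ae: "AE x in lborel. 0 < x \<longrightarrow> f x = g x"
    and O: "(\<lambda>x. g x - cp * sqrt x - cm * sqrt x * ln x) \<in> O[at_right 0](\<lambda>x. x powr (3/2) * ln x)"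
    using assms unfolding Delta_theta_rel_def by blast
  from O obtain c where c: "0 < c"
    "\<forall>\<^sub>F x in at_right 0. norm (g x - cp * sqrt x - cm * sqrt x * ln x) \<le> c * norm (x powr (3/2) * ln x)"
    by (rule landau_o.bigE)
  then obtain b where b: "0 < b" "\<And>x. 0 < x \<Longrightarrow> x < b \<Longrightarrow> \<bar>g x - cp * sqrt x - cm * sqrt x * ln x\<bar> \<le> c * \<bar>x powr (3/2) * ln x\<bar>"
    unfolding eventually_at_right_field real_norm_def by blast
  have le: "\<bar>x powr (3/2) * ln x\<bar> \<le> 3 * x" if x: "0 < x" "x < 1" for x :: real
  proof -
    have "x powr (3/2) = x * x powr (1/2)" using x powr_add[of x 1 "1/2"] by simp
    then have "\<bar>x powr (3/2) * ln x\<bar> = x * (x powr (1/2) * \<bar>ln x\<bar>)" using x by (simp add: abs_mult)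
    also have "\<dots> \<le> x * (x powr (1/2) * (2 * x powr (- (1 / 2)) + x))"
      using x by (intro mult_left_mono abs_ln_le) auto
    also have "x powr (1/2) * (2 * x powr (- (1 / 2)) + x) = 2 + x powr (1/2) * x"
      using x by (simp add: distrib_left powr_add[symmetric])
    also have "x * (2 + x powr (1/2) * x) \<le> x * 3"
    proof (intro mult_left_mono)
      have "x powr (1/2) * x \<le> 1 * 1" using x by (intro mult_mono) (auto simp: powr_le1)
      then show "2 + x powr (1/2) * x \<le> 3" by simp
    qed (use x in simp)
    finally show ?thesis by (simp add: mult.commute)
  qed
  show ?thesis
  proof (rule that[OF bc, of "min b 1" "c * 3"])
    show "AE x in lborel. 0 < x \<and> x < min b 1 \<longrightarrow> \<bar>f x - cp * sqrt x - cm * (sqrt x * ln x)\<bar> \<le> c * 3 * x"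
      using ae
    proof eventually_elim
      case (elim x)
      show ?case
      proof
        assume x: "0 < x \<and> x < min b 1"
        then have "\<bar>f x - cp * sqrt x - cm * (sqrt x * ln x)\<bar> \<le> c * \<bar>x powr (3/2) * ln x\<bar>"
          using b(2)[of x] elim by (simp add: mult.assoc)
        also have "\<dots> \<le> c * (3 * x)" using x c le[of x] by (intro mult_left_mono) auto
        finally show "\<bar>f x - cp * sqrt x - cm * (sqrt x * ln x)\<bar> \<le> c * 3 * x" by simp
      qed
    qed
  qed (use b in auto)
qed

text \<open>For negative \<open>t\<close> the integral over \<open>{0..t}\<close> is 0, in agreement
  with a \<open>q\<close> that vanishes there. Anchoring the primitive at a negative
  \<open>L\<close> gives the two-sided derivative also at \<open>t = 0\<close>.\<close>

lemma DERIV_integral_of_causal: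
  fixes q :: "real \<Rightarrow> real"
  assumes q: "continuous_on UNIV q" and q0: "\<And>t. t \<le> 0 \<Longrightarrow> q t = 0"
  shows "((\<lambda>t. integral {0..t} q) has_real_derivative q t) (at t)"
proof -
  define L where "L = min (t - 1) (- 1)"
  have "((\<lambda>x. integral {L..x} q) has_real_derivative q t) (at t within {L..t + 1})"
    by (rule integral_has_real_derivative) (auto simp: L_def intro: continuous_on_subset[OF q])
  then have "((\<lambda>x. integral {L..x} q) has_real_derivative q t) (at t)"
    by (subst (asm) at_within_Icc_at) (auto simp: L_def)
  then show ?thesis
  proof (rule has_field_derivative_transform_within_open[of _ _ _ "{L<..}"])
    have q_int: "q integrable_on {u..v}" for u v
      by (rule integrable_continuous_interval[OF continuous_on_subset[OF q]]) simp
    have neg: "integral {L..x} q = 0" if "x \<le> 0" for x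
      using that q0 by (subst Henstock_Kurzweil_Integration.integral_cong[of _ _ "\<lambda>_. 0"]) auto
    fix x assume x: "x \<in> {L<..}"
    show "integral {L..x} q = integral {0..x} q"
    proof (cases "x \<le> 0")
      case True
      then show ?thesis using neg[of x] q0 by (cases "x = 0") auto
    next
      case False
      then have "integral {L..0} q + integral {0..x} q = integral {L..x} q"
        by (intro Henstock_Kurzweil_Integration.integral_combine q_int) (auto simp: L_def)
      then show ?thesis using neg[of 0] by simp
    qed
  qed (auto simp: L_def)
qed

text \<open>Subtracting \<open>cm / 2 * log_shift c r\<close> from the pairing of \<open>u\<close>
  leaves a function \<open>n\<close> with \<open>n' = -\<close> the pairing of \<open>w\<close> and
  limit 0 at 0. Integration by parts against the primitive of \<open>flux_kernel\<close> then has no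
  boundary terms, and the subtracted logarithm is integrated exactly by
  \<open>has_bochner_integral_log_shift_flux_kernel\<close>. The result can be differentiated in
  \<sigma> although \<open>w\<close> is merely in L^2.\<close>

lemma ip_gauss_flux_kernel_by_parts:
  assumes c: "0 < c" "ln c = - 2 * kappa \<theta>" and a: "0 < a" and \<theta>: "cos \<theta> \<noteq> 0" and \<sigma>: "0 < \<sigma>"
    and rel: "Delta_max_rel u w" and bc: "cos \<theta> * cp + sin \<theta> * cm = 0" and d: "0 < d"
    and exp: "AE x in lborel. 0 < x \<and> x < d \<longrightarrow> \<bar>u x - cp * sqrt x - cm * (sqrt x * ln x)\<bar> \<le> C * x"
  shows "(\<integral>r. ip u (gauss r) * flux_kernel c a (\<sigma> - r) \<partial>lborel) =
      - (cm / 4) * ln ((a + \<sigma>) / a) - (\<integral>r. ip w (gauss r) * integral {0..\<sigma> - r} (flux_kernel c a) \<partial>lborel)"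
proof -
  have u: "sq_int u" and w: "sq_int w" using rel by (auto simp: Delta_max_rel_def)
  define m where "m = (\<lambda>r. ip u (gauss r))"
  define k where "k = (\<lambda>r. ip w (gauss r))"
  define n where "n = (\<lambda>r. m r - cm / 2 * log_shift c r)"
  define V where "V = (\<lambda>t. integral {0..t} (flux_kernel c a))"
  note qc = continuous_flux_kernel[OF c(1) a]
  have V: "(V has_real_derivative flux_kernel c a t) (at t)" for t
    unfolding V_def by (rule DERIV_integral_of_causal[OF qc flux_kernel_nonpos])
  have V0: "V t = 0" if "t \<le> 0" for t
    using that by (cases "t = 0") (auto simp: V_def)
  have Vc: "continuous_on A V" for A
    by (rule continuous_on_subset[OF DERIV_continuous_on[of UNIV V "flux_kernel c a"]]) (use V in auto)
  have dm: "(m has_real_derivative cm / (2 * r) - k r) (at r)" if "0 < r" for r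
    unfolding m_def k_def using DERIV_ip_gauss[OF u that] Green_gauss[OF rel that d exp] by simp
  have dn: "(n has_real_derivative - k r) (at r)" if "0 < r" for r
  proof -
    have "(log_shift c has_real_derivative 1 / r) (at r)"
      unfolding log_shift_def[abs_def] using that by (auto intro!: derivative_eq_intros)
    then have "(n has_real_derivative (cm / (2 * r) - k r) - cm / 2 * (1 / r)) (at r)"
      unfolding n_def by (intro DERIV_diff DERIV_cmult dm that)
    then show ?thesis by simp
  qed
  \<comment> \<open>The only place where the boundary condition enters. With
    \<open>cp = - tan \<theta> * cm\<close> and \<open>ln c = - 2 * kappa \<theta>\<close> the
    constants \<open>ln 4\<close>, Euler's constant and \<open>tan \<theta>\<close> fit together to
    the shift in \<open>log_shift c\<close>.\<close>
  have n_lim: "(n \<longlongrightarrow> 0) (at_right 0)"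
  proof (rule Lim_transform_eventually[OF tendsto_ip_gauss_expansion[OF u d exp]])
    have cp: "cp = - tan \<theta> * cm"
      using bc \<theta> by (simp add: tan_def field_simps)
    have "ip u (gauss r) - cp - cm * ((ln (4 * r) - euler_mascheroni) / 2) = n r" if "0 < r" for r
    proof -
      have "ln (4 * r) = 2 * ln 2 + ln r"
        using that ln_mult[of 4 r] ln_realpow[of 2 2] by simp
      then show ?thesis
        unfolding n_def m_def log_shift_def c(2) cp kappa_def by (simp add: field_simps)
    qed
    then show "\<forall>\<^sub>F r in at_right 0. ip u (gauss r) - cp - cm * ((ln (4 * r) - euler_mascheroni) / 2) = n r"
      unfolding eventually_at_right_field by (intro exI[of _ 1]) auto
  qed
  \<comment> \<open>The value at \<open>r = 0\<close> is set to the limit 0, which makes \<phi>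
    continuous on the closed interval; at \<open>r = \<sigma>\<close> it vanishes through
    \<open>V 0 = 0\<close>.\<close>
  define \<phi> where "\<phi> = (\<lambda>r. (if 0 < r then n r else 0) * V (\<sigma> - r))"
  have lin: "((\<lambda>r. \<sigma> - r) has_real_derivative - 1) (at r)" for r by (auto intro!: derivative_eq_intros)
  have VD: "((\<lambda>r. V (\<sigma> - r)) has_real_derivative - flux_kernel c a (\<sigma> - r)) (at r)" for r
    using DERIV_chain2[OF V lin] by simp
  have \<phi>D: "(\<phi> has_real_derivative - (k r * V (\<sigma> - r) + n r * flux_kernel c a (\<sigma> - r))) (at r)" if "0 < r" for r
  proof -
    have "((\<lambda>r. n r * V (\<sigma> - r)) has_real_derivative - k r * V (\<sigma> - r) + (- flux_kernel c a (\<sigma> - r)) * n r) (at r)"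
      by (rule DERIV_mult[OF dn[OF that] VD])
    then have "((\<lambda>r. n r * V (\<sigma> - r)) has_real_derivative - (k r * V (\<sigma> - r) + n r * flux_kernel c a (\<sigma> - r))) (at r)"
      by (simp add: algebra_simps)
    then show ?thesis
      by (rule has_field_derivative_transform_within_open[of _ _ _ "{0<..}"]) (use that in \<open>auto simp: \<phi>_def\<close>)
  qed
  have "((\<lambda>r. - (k r * V (\<sigma> - r) + n r * flux_kernel c a (\<sigma> - r))) has_integral (\<phi> \<sigma> - \<phi> 0)) {0..\<sigma>}"
  proof (rule fundamental_theorem_of_calculus_interior)
    show "continuous_on {0..\<sigma>} \<phi>"
      unfolding continuous_on_def
    proof
      fix r assume r: "r \<in> {0..\<sigma>}"
      show "(\<phi> \<longlongrightarrow> \<phi> r) (at r within {0..\<sigma>})"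
      proof (cases "r = 0")
        case True
        have "(\<phi> \<longlongrightarrow> 0 * V (\<sigma> - 0)) (at_right 0)"
          unfolding \<phi>_def
        proof (rule tendsto_mult)
          show "((\<lambda>r. if 0 < r then n r else 0) \<longlongrightarrow> 0) (at_right 0)"
            by (rule Lim_transform_eventually[OF n_lim]) (auto simp: eventually_at_right_field intro!: exI[of _ 1])
          show "((\<lambda>r. V (\<sigma> - r)) \<longlongrightarrow> V (\<sigma> - 0)) (at_right 0)"
            using DERIV_isCont[OF VD[of 0]] by (simp add: isCont_def filterlim_at_split)
        qed
        then show ?thesis using True \<sigma> by (simp add: at_within_Icc_at_right \<phi>_def)
      next
        case False
        then have "isCont \<phi> r" using r by (intro DERIV_isCont[OF \<phi>D]) auto
        then show ?thesis by (meson isCont_def tendsto_within_subset subset_UNIV)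
      qed
    qed
    show "(\<phi> has_vector_derivative - (k r * V (\<sigma> - r) + n r * flux_kernel c a (\<sigma> - r))) (at r)" if "r \<in> {0<..<\<sigma>}" for r
      using \<phi>D[of r] that by (simp add: has_real_derivative_iff_has_vector_derivative)
  qed (use \<sigma> in simp)
  then have "((\<lambda>r. - (- (k r * V (\<sigma> - r) + n r * flux_kernel c a (\<sigma> - r)))) has_integral - (\<phi> \<sigma> - \<phi> 0)) {0..\<sigma>}"
    by (rule has_integral_neg)
  then have I0: "integral {0..\<sigma>} (\<lambda>r. k r * V (\<sigma> - r) + n r * flux_kernel c a (\<sigma> - r)) = 0"
    unfolding minus_minus using V0[of 0] by (subst integral_unique) (auto simp: \<phi>_def)
  have kV: "integrable lborel (\<lambda>r. k r * V (\<sigma> - r))"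
  proof -
    obtain D where D: "\<And>x. x \<in> {0..\<sigma>} \<Longrightarrow> \<bar>V x\<bar> \<le> D"
      by (rule continuous_on_Icc_abs_bounded[OF Vc]) blast
    have [measurable]: "V \<in> borel_measurable borel" by (rule borel_measurable_continuous_onI[OF Vc])
    have [measurable]: "k \<in> borel_measurable borel" unfolding k_def by (rule measurable_ip_gauss[OF w])
    show ?thesis
    proof (rule Bochner_Integration.integrable_bound)
      show "integrable lborel (\<lambda>r. D * \<bar>indicator {0<..<\<sigma> + 1} r * k r\<bar>)"
        unfolding k_def using \<sigma> by (intro integrable_mult_right integrable_abs integrable_ip_gauss w) auto
      have "\<bar>k r * V (\<sigma> - r)\<bar> \<le> D * \<bar>indicator {0<..<\<sigma> + 1} r * k r\<bar>" for r
      proof (cases "0 < r \<and> r < \<sigma>")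
        case True
        then have "\<bar>k r\<bar> * \<bar>V (\<sigma> - r)\<bar> \<le> \<bar>k r\<bar> * D" by (intro mult_left_mono D) auto
        then show ?thesis using True by (simp add: abs_mult mult.commute)
      next
        case False
        then have z: "k r * V (\<sigma> - r) = 0" using ip_gauss_nonpos[of r w] V0[of "\<sigma> - r"] by (fastforce simp: k_def)
        have "0 \<le> D" using D[of 0] \<sigma> by auto
        then show ?thesis unfolding z by simp
      qed
      then show "AE r in lborel. norm (k r * V (\<sigma> - r)) \<le> norm (D * \<bar>indicator {0<..<\<sigma> + 1} r * k r\<bar>)"
        unfolding real_norm_def by (intro AE_I2 order.trans[OF _ abs_ge_self])
    qed measurable
  qed
  have mq: "integrable lborel (\<lambda>r. m r * flux_kernel c a (\<sigma> - r))"
    unfolding m_def using \<sigma> by (intro integrable_ip_gauss_flux_kernel c(1) a u) auto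
  note lq = has_bochner_integral_log_shift_flux_kernel[OF c(1) a \<sigma>]
  define g where "g = (\<lambda>r. k r * V (\<sigma> - r) + (m r * flux_kernel c a (\<sigma> - r) - cm / 2 * (indicator {0<..} r * log_shift c r * flux_kernel c a (\<sigma> - r))))"
  have g_int: "integrable lborel g"
    unfolding g_def using lq
    by (intro Bochner_Integration.integrable_add Bochner_Integration.integrable_diff integrable_mult_right kV mq)
       (auto simp: has_bochner_integral_iff)
  have g_eq: "g r = indicator {0<..<\<sigma>} r * (k r * V (\<sigma> - r) + n r * flux_kernel c a (\<sigma> - r))" for r
  proof (cases "0 < r \<and> r < \<sigma>")
    case True
    then show ?thesis by (simp add: g_def n_def algebra_simps)
  next
    case False
    then have "k r * V (\<sigma> - r) = 0" "m r * flux_kernel c a (\<sigma> - r) = 0" "indicator {0<..} r * flux_kernel c a (\<sigma> - r) = 0"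
      using ip_gauss_nonpos[of r w] ip_gauss_nonpos[of r u] V0[of "\<sigma> - r"] flux_kernel_nonpos[of "\<sigma> - r" c a]
      by (fastforce simp: k_def m_def indicator_def)+
    then show ?thesis using False by (auto simp: g_def)
  qed
  have "(\<integral>r. g r \<partial>lborel) = (LINT r:{0<..<\<sigma>}|lborel. k r * V (\<sigma> - r) + n r * flux_kernel c a (\<sigma> - r))"
    by (simp add: g_eq set_lebesgue_integral_def)
  also have "\<dots> = integral {0<..<\<sigma>} (\<lambda>r. k r * V (\<sigma> - r) + n r * flux_kernel c a (\<sigma> - r))"
    using g_int by (intro set_borel_integral_eq_integral) (simp add: set_integrable_def flip: g_eq)
  also have "\<dots> = integral {0..\<sigma>} (\<lambda>r. k r * V (\<sigma> - r) + n r * flux_kernel c a (\<sigma> - r))"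
    by (rule integral_spike_set) (auto intro: negligible_subset[of "{0, \<sigma>}"])
  finally have "(\<integral>r. g r \<partial>lborel) = 0" using I0 by simp
  moreover have "(\<integral>r. g r \<partial>lborel) = (\<integral>r. k r * V (\<sigma> - r) \<partial>lborel) + ((\<integral>r. m r * flux_kernel c a (\<sigma> - r) \<partial>lborel) - cm / 2 * (- (ln ((a + \<sigma>) / a)) / 2))"
    unfolding g_def using lq kV mq by (simp add: has_bochner_integral_iff)
  ultimately show ?thesis by (simp add: k_def m_def V_def)
qed

text \<open>Green's formula contributes the flux \<open>cm / (2 (a + s))\<close>, and
  differentiating the logarithm from \<open>ip_gauss_flux_kernel_by_parts\<close> contributes its
  negative. The unknown coefficient \<open>cm\<close> drops out: \<open>flux_kernel\<close> was
  built for this cancellation.\<close>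

lemma DERIV_dual_pairing:
  assumes c: "0 < c" "ln c = - 2 * kappa \<theta>" and a: "0 < a" and \<theta>: "cos \<theta> \<noteq> 0" and s: "0 < s"
    and rel: "Delta_theta_rel \<theta> u w"
  shows "(dual_pairing c a u has_real_derivative - dual_pairing c a w s) (at s)"
proof -
  obtain cp cm d C where bc: "cos \<theta> * cp + sin \<theta> * cm = 0" and d: "0 < d"
    and exp: "AE x in lborel. 0 < x \<and> x < d \<longrightarrow> \<bar>u x - cp * sqrt x - cm * (sqrt x * ln x)\<bar> \<le> C * x"
    using rel by (rule Delta_theta_relE)
  have max: "Delta_max_rel u w" using rel by (simp add: Delta_theta_rel_def)
  then have u: "sq_int u" and w: "sq_int w" by (auto simp: Delta_max_rel_def)
  define V where "V = (\<lambda>t. integral {0..t} (flux_kernel c a))"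
  note qc = continuous_flux_kernel[OF c(1) a]
  have V: "(V has_real_derivative flux_kernel c a t) (at t)" for t
    unfolding V_def by (rule DERIV_integral_of_causal[OF qc flux_kernel_nonpos])
  have V0: "V t = 0" if "t \<le> 0" for t
    using that by (cases "t = 0") (auto simp: V_def)
  define k where "k = (\<lambda>r. indicator {0<..<s + 1} r * ip w (gauss r))"
  have k: "integrable lborel k" unfolding k_def using s by (intro integrable_ip_gauss w) auto
  have DV: "((\<lambda>t. \<integral>r. k r * V (t - r) \<partial>lborel) has_real_derivative (\<integral>r. k r * flux_kernel c a (s - r) \<partial>lborel)) (at s)"
    by (rule DERIV_convolution[OF k _ qc V, of "s + 1"]) (auto simp: k_def indicator_def)
  have DL: "((\<lambda>t. ln ((a + t) / a)) has_real_derivative 1 / (a + s)) (at s)"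
    using a s by (auto intro!: derivative_eq_intros simp: field_simps)
  have Dg: "((\<lambda>t. ip u (gauss (a + t))) has_real_derivative cm / (2 * (a + s)) - ip w (gauss (a + s))) (at s)"
  proof -
    have as: "0 < a + s" using a s by simp
    have lin: "((\<lambda>t. a + t) has_real_derivative 1) (at s)" by (auto intro!: derivative_eq_intros)
    show ?thesis
      using DERIV_chain2[where f = "\<lambda>r. ip u (gauss r)" and g = "\<lambda>t. a + t" and x = s, OF DERIV_ip_gauss[OF u as] lin] Green_gauss[OF max as d exp] by simp
  qed
  have "((\<lambda>t. ip u (gauss (a + t)) + 2 * (- (cm / 4) * ln ((a + t) / a) - (\<integral>r. k r * V (t - r) \<partial>lborel)))
      has_real_derivative (cm / (2 * (a + s)) - ip w (gauss (a + s))) + 2 * (- (cm / 4) * (1 / (a + s)) - (\<integral>r. k r * flux_kernel c a (s - r) \<partial>lborel))) (at s)"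
    by (intro DERIV_add DERIV_cmult DERIV_diff Dg DL DV)
  moreover have "(cm / (2 * (a + s)) - ip w (gauss (a + s))) + 2 * (- (cm / 4) * (1 / (a + s)) - (\<integral>r. k r * flux_kernel c a (s - r) \<partial>lborel)) = - dual_pairing c a w s"
  proof -
    have "(\<lambda>r. ip w (gauss r) * flux_kernel c a (s - r)) = (\<lambda>r. k r * flux_kernel c a (s - r))"
      by (intro ext) (simp add: k_def ip_gauss_flux_kernel_eq[of s "s + 1"])
    then have B: "dual_pairing c a w s = ip w (gauss (a + s)) + 2 * (\<integral>r. k r * flux_kernel c a (s - r) \<partial>lborel)" by (simp add: dual_pairing_def)
    have "A - p + 2 * (B - J) = - (p + 2 * J)" if "A = - 2 * B" for A B p J :: real using that by simp
    moreover have "cm / (2 * y) = - 2 * (- (cm / 4) * (1 / y))" for y by simp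
    ultimately show ?thesis unfolding B by blast
  qed
  ultimately have *: "((\<lambda>t. ip u (gauss (a + t)) + 2 * (- (cm / 4) * ln ((a + t) / a) - (\<integral>r. k r * V (t - r) \<partial>lborel)))
      has_real_derivative - dual_pairing c a w s) (at s)" by simp
  show ?thesis
  proof (rule has_field_derivative_transform_within_open[OF *, of "{0<..<s + 1}"])
    fix t assume t: "t \<in> {0<..<s + 1}"
    have "(\<lambda>r. ip w (gauss r) * V (t - r)) = (\<lambda>r. k r * V (t - r))"
    proof
      fix r show "ip w (gauss r) * V (t - r) = k r * V (t - r)"
        using t ip_gauss_nonpos[of r w] V0[of "t - r"] by (cases "0 < r \<and> r < s + 1") (auto simp: k_def)
    qed
    then show "ip u (gauss (a + t)) + 2 * (- (cm / 4) * ln ((a + t) / a) - (\<integral>r. k r * V (t - r) \<partial>lborel)) = dual_pairing c a u t"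
      using ip_gauss_flux_kernel_by_parts[OF c a \<theta> _ max bc d exp, of t] t by (simp add: dual_pairing_def V_def)
  qed (use s in auto)
qed

lemma L2_norm_cmult: "L2_norm (\<lambda>x. c * f x) = \<bar>c\<bar> * L2_norm f"
proof -
  have "(\<lambda>x. (c * f x)^2) = (\<lambda>x. c^2 * (f x)^2)" by (simp add: power_mult_distrib)
  then show ?thesis by (simp add: L2_norm_def real_sqrt_mult)
qed

lemma L2_norm_diff_le:
  assumes f: "sq_int f" and g: "sq_int g"
  shows "L2_norm (\<lambda>x. f x - g x) \<le> L2_norm f + L2_norm g"
proof (rule power2_le_imp_le)
  have "(L2_norm (\<lambda>x. f x - g x))^2 = ip f f - 2 * ip f g + ip g g"
    unfolding L2_norm_power2
    by (simp add: ip_diff_left[OF f g sq_int_diff[OF f g]] ip_diff_right[OF f g f] ip_diff_right[OF f g g] ip_commute[of g f])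
  also have "\<dots> \<le> (L2_norm f)^2 + 2 * (L2_norm f * L2_norm g) + (L2_norm g)^2"
    using Cauchy_Schwarz_ip[OF f g] by (simp add: L2_norm_power2[symmetric] abs_le_iff)
  finally show "(L2_norm (\<lambda>x. f x - g x))^2 \<le> (L2_norm f + L2_norm g)^2"
    by (simp add: power2_sum)
qed (simp add: L2_norm_nonneg)

text \<open>A duality argument of uniqueness type: any strong solution, however it was obtained, has
  prescribed pairings with all profiles. At \<open>s = 0\<close> the functional reduces to the
  pairing with \<open>gauss a\<close>, because the convolution is empty; at \<open>s = T\<close> it
  acts on the initial datum.\<close>

lemma ip_evolution_gauss:
  fixes u :: "real \<Rightarrow> real \<Rightarrow> real"
  assumes c: "0 < c" "ln c = - 2 * kappa \<theta>" and a: "0 < a" and \<theta>: "cos \<theta> \<noteq> 0" and T: "0 < T"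
    and f: "sq_int f"
    and evol: "\<And>t. 0 < t \<Longrightarrow> \<exists>w. Delta_theta_rel \<theta> (u t) w \<and>
              ((\<lambda>s. L2_norm (\<lambda>x. (u (t + s) x - u t x) / s + w x)) \<longlongrightarrow> 0) (at 0)"
    and init: "((\<lambda>t. L2_norm (\<lambda>x. u t x - f x)) \<longlongrightarrow> 0) (at_right 0)"
  shows "ip (u T) (gauss a) = dual_pairing c a f T"
proof -
  have u: "sq_int (u t)" if "0 < t" for t
    using evol[OF that] by (auto simp: Delta_theta_rel_def Delta_max_rel_def)
  obtain C where C: "\<And>v s. sq_int v \<Longrightarrow> 0 \<le> s \<Longrightarrow> s \<le> T \<Longrightarrow> \<bar>dual_pairing c a v s\<bar> \<le> C * L2_norm v"
    by (rule dual_pairing_le[OF c(1) a T]) blast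
  \<comment> \<open>Differentiability in norm implies continuity in norm: the increment is
    \<open>s\<close> times (error minus \<open>w\<close>).\<close>
  have cont: "((\<lambda>s. L2_norm (\<lambda>x. u (t + s) x - u t x)) \<longlongrightarrow> 0) (at 0)" if t: "0 < t" for t
  proof -
    obtain w where w: "Delta_theta_rel \<theta> (u t) w" and lim: "((\<lambda>s. L2_norm (\<lambda>x. (u (t + s) x - u t x) / s + w x)) \<longlongrightarrow> 0) (at 0)"
      using evol[OF t] by blast
    have sw: "sq_int w" using w by (auto simp: Delta_theta_rel_def Delta_max_rel_def)
    have "((\<lambda>s. \<bar>s\<bar> * (L2_norm (\<lambda>x. (u (t + s) x - u t x) / s + w x) + L2_norm w)) \<longlongrightarrow> \<bar>0\<bar> * (0 + L2_norm w)) (at 0)"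
      by (intro tendsto_intros lim)
    then have lim': "((\<lambda>s. \<bar>s\<bar> * (L2_norm (\<lambda>x. (u (t + s) x - u t x) / s + w x) + L2_norm w)) \<longlongrightarrow> 0) (at 0)" by simp
    show ?thesis
    proof (rule Lim_null_comparison[OF _ lim'])
      show "\<forall>\<^sub>F s in at 0. norm (L2_norm (\<lambda>x. u (t + s) x - u t x)) \<le> \<bar>s\<bar> * (L2_norm (\<lambda>x. (u (t + s) x - u t x) / s + w x) + L2_norm w)"
        unfolding eventually_at
      proof (intro exI[of _ t] conjI ballI impI t)
        fix s :: real assume s: "s \<noteq> 0 \<and> dist s 0 < t"
        define e where "e = (\<lambda>x. 1 / s * (u (t + s) x - u t x) + w x)"
        have e: "sq_int e"
          unfolding e_def using s by (intro sq_int_add sq_int_cmult sq_int_diff u t sw) (auto simp: dist_real_def)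
        have "(\<lambda>x. u (t + s) x - u t x) = (\<lambda>x. s * (e x - w x))" using s by (auto simp: e_def)
        then have "L2_norm (\<lambda>x. u (t + s) x - u t x) = \<bar>s\<bar> * L2_norm (\<lambda>x. e x - w x)" by (simp only: L2_norm_cmult)
        also have "\<dots> \<le> \<bar>s\<bar> * (L2_norm e + L2_norm w)" by (intro mult_left_mono L2_norm_diff_le e sw) auto
        finally show "norm (L2_norm (\<lambda>x. u (t + s) x - u t x)) \<le> \<bar>s\<bar> * (L2_norm (\<lambda>x. (u (t + s) x - u t x) / s + w x) + L2_norm w)"
          using L2_norm_nonneg by (simp add: e_def)
      qed
    qed
  qed
  define \<Phi> where "\<Phi> = (\<lambda>s. dual_pairing c a (u (T - s)) s)"
  have D: "(\<Phi> has_real_derivative 0) (at s)" if s: "s \<in> {0<..<T}" for s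
  proof -
    define t where "t = T - s"
    have t: "0 < t" using s by (simp add: t_def)
    obtain w where w: "Delta_theta_rel \<theta> (u t) w" and lim: "((\<lambda>s. L2_norm (\<lambda>x. (u (t + s) x - u t x) / s + w x)) \<longlongrightarrow> 0) (at 0)"
      using evol[OF t] by blast
    have sw: "sq_int w" using w by (auto simp: Delta_theta_rel_def Delta_max_rel_def)
    define E where "E = (\<lambda>h. (\<lambda>x. (u (t + h) x - u t x) / h + w x))"
    define \<delta> where "\<delta> = min (s / 2) (min ((T - s) / 2) t)"
    have \<delta>: "0 < \<delta>" using s t by (simp add: \<delta>_def)
    have E: "sq_int (E h)" if "\<bar>h\<bar> < t" for h
    proof -
      have "sq_int (\<lambda>x. 1 / h * (u (t + h) x - u t x) + w x)"
        using that by (intro sq_int_add sq_int_cmult sq_int_diff u t sw) auto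
      then show ?thesis by (simp add: E_def)
    qed
    \<comment> \<open>Both arguments of the functional move with \<open>s\<close>. As
      \<open>w - E (- h)\<close> is the difference quotient of the flow run backwards, this
      expression is the difference quotient of \<Phi>; the first two limits cancel by
      \<open>DERIV_dual_pairing\<close>, and the last vanishes by the uniform bound.\<close>
    have "((\<lambda>h. dual_pairing c a w (s + h) + (dual_pairing c a (u t) (s + h) - dual_pairing c a (u t) s) / h - dual_pairing c a (E (- h)) (s + h)) \<longlongrightarrow> dual_pairing c a w s + (- dual_pairing c a w s) - 0) (at 0)"
    proof (intro tendsto_diff tendsto_add)
      have "isCont (dual_pairing c a w) s" using s by (intro isCont_dual_pairing c a sw) auto
      then show "((\<lambda>h. dual_pairing c a w (s + h)) \<longlongrightarrow> dual_pairing c a w s) (at 0)" by (simp add: isCont_iff)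
      show "((\<lambda>h. (dual_pairing c a (u t) (s + h) - dual_pairing c a (u t) s) / h) \<longlongrightarrow> - dual_pairing c a w s) (at 0)"
        using DERIV_dual_pairing[OF c a \<theta> _ w, of s] s by (simp add: DERIV_def)
      have limE: "((\<lambda>h. L2_norm (E h)) \<longlongrightarrow> 0) (at 0)" using lim by (simp add: E_def)
      have "((\<lambda>h. L2_norm (E (- h))) \<longlongrightarrow> 0) (at 0)"
      proof (rule filterlim_compose[OF limE])
        show "filterlim (\<lambda>h::real. - h) (at 0) (at 0)"
          by (auto simp: filterlim_at eventually_at intro!: exI[of _ 1] tendsto_eq_intros)
      qed
      then have lim': "((\<lambda>h. C * L2_norm (E (- h))) \<longlongrightarrow> 0) (at 0)" by (rule tendsto_mult_right_zero)
      show "((\<lambda>h. dual_pairing c a (E (- h)) (s + h)) \<longlongrightarrow> 0) (at 0)"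
      proof (rule Lim_null_comparison[OF _ lim'])
        show "\<forall>\<^sub>F h in at 0. norm (dual_pairing c a (E (- h)) (s + h)) \<le> C * L2_norm (E (- h))"
          unfolding eventually_at
        proof (intro exI[of _ \<delta>] conjI ballI impI \<delta>)
          fix h :: real assume "h \<noteq> 0 \<and> dist h 0 < \<delta>"
          then have h: "\<bar>h\<bar> < s / 2" "\<bar>h\<bar> < (T - s) / 2" "\<bar>h\<bar> < t" by (auto simp: \<delta>_def)
          then show "norm (dual_pairing c a (E (- h)) (s + h)) \<le> C * L2_norm (E (- h))"
            unfolding real_norm_def using s by (intro C E) auto
        qed
      qed
    qed
    then have "((\<lambda>h. dual_pairing c a w (s + h) + (dual_pairing c a (u t) (s + h) - dual_pairing c a (u t) s) / h - dual_pairing c a (E (- h)) (s + h)) \<longlongrightarrow> 0) (at 0)" by simp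
    then have "((\<lambda>h. (\<Phi> (s + h) - \<Phi> s) / h) \<longlongrightarrow> 0) (at 0)"
    proof (rule Lim_transform_eventually)
      show "\<forall>\<^sub>F h in at 0. dual_pairing c a w (s + h) + (dual_pairing c a (u t) (s + h) - dual_pairing c a (u t) s) / h - dual_pairing c a (E (- h)) (s + h) = (\<Phi> (s + h) - \<Phi> s) / h"
        unfolding eventually_at
      proof (intro exI[of _ \<delta>] conjI ballI impI \<delta>)
        fix h :: real assume "h \<noteq> 0 \<and> dist h 0 < \<delta>"
        then have h: "h \<noteq> 0" "\<bar>h\<bar> < s / 2" "\<bar>h\<bar> < (T - s) / 2" "\<bar>h\<bar> < t" by (auto simp: \<delta>_def)
        have sh: "0 \<le> s + h" using h s by (auto simp: abs_less_iff)
        have th: "sq_int (u (t - h))" using h by (intro u) auto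
        have wE: "(\<lambda>x. w x - E (- h) x) = (\<lambda>x. 1 / h * (u (t - h) x - u t x))"
          using h by (auto simp: E_def field_simps)
        have "dual_pairing c a w (s + h) - dual_pairing c a (E (- h)) (s + h) = dual_pairing c a (\<lambda>x. w x - E (- h) x) (s + h)"
          using h by (intro dual_pairing_diff[symmetric] c a sw E sh) auto
        also have "\<dots> = 1 / h * (dual_pairing c a (u (t - h)) (s + h) - dual_pairing c a (u t) (s + h))"
          unfolding wE dual_pairing_cmult[OF c(1) a] by (subst dual_pairing_diff[OF c(1) a th u[OF t] sh]) simp
        finally have "dual_pairing c a w (s + h) + (dual_pairing c a (u t) (s + h) - dual_pairing c a (u t) s) / h - dual_pairing c a (E (- h)) (s + h) =
            1 / h * (dual_pairing c a (u (t - h)) (s + h) - dual_pairing c a (u t) (s + h)) + (dual_pairing c a (u t) (s + h) - dual_pairing c a (u t) s) / h" by linarith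
        also have "\<dots> = (dual_pairing c a (u (t - h)) (s + h) - dual_pairing c a (u t) s) / h"
          using h by (simp add: field_simps)
        also have "\<dots> = (\<Phi> (s + h) - \<Phi> s) / h" by (simp add: \<Phi>_def t_def algebra_simps)
        finally show "dual_pairing c a w (s + h) + (dual_pairing c a (u t) (s + h) - dual_pairing c a (u t) s) / h - dual_pairing c a (E (- h)) (s + h) = (\<Phi> (s + h) - \<Phi> s) / h" .
      qed
    qed
    then show ?thesis by (simp add: DERIV_def)
  qed
  obtain K where K: "\<And>s. s \<in> {0<..<T} \<Longrightarrow> \<Phi> s = K"
    using has_field_derivative_zero_constant[of "{0<..<T}" \<Phi>] D
    by (metis convex_real_interval(8) has_field_derivative_at_within)
  \<comment> \<open>Used at both ends of the interval: with \<open>v = u T\<close> as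
    \<open>s\<close> tends to 0 and with \<open>v = f\<close> as \<open>s\<close> tends to
    \<open>T\<close>.\<close>
  have cutoff_error: "\<bar>K - dual_pairing c a v s\<bar> \<le> C * L2_norm (\<lambda>x. u (T - s) x - v x)" if v: "sq_int v" and s: "s \<in> {0<..<T}" for v s
  proof -
    have "K - dual_pairing c a v s = dual_pairing c a (\<lambda>x. u (T - s) x - v x) s"
      using K[OF s] s by (subst dual_pairing_diff[OF c(1) a u v]) (auto simp: \<Phi>_def)
    moreover have "\<bar>dual_pairing c a (\<lambda>x. u (T - s) x - v x) s\<bar> \<le> C * L2_norm (\<lambda>x. u (T - s) x - v x)"
      using s by (intro C sq_int_diff u v) auto
    ultimately show ?thesis by simp
  qed
  have "((\<lambda>s. K - dual_pairing c a (u T) s) \<longlongrightarrow> 0) (at_right 0)"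
  proof (rule Lim_null_comparison)
    show "\<forall>\<^sub>F s in at_right 0. norm (K - dual_pairing c a (u T) s) \<le> C * L2_norm (\<lambda>x. u (T - s) x - u T x)"
      unfolding eventually_at_right_field using T cutoff_error[OF u[OF T]] by (intro exI[of _ T]) auto
    have "((\<lambda>s. L2_norm (\<lambda>x. u (T + s) x - u T x)) \<longlongrightarrow> 0) (at_left 0)"
      using cont[OF T] by (simp add: filterlim_at_split)
    then have "((\<lambda>s. L2_norm (\<lambda>x. u (T - s) x - u T x)) \<longlongrightarrow> 0) (at_right 0)"
      by (simp add: filterlim_at_left_to_right)
    then show "((\<lambda>s. C * L2_norm (\<lambda>x. u (T - s) x - u T x)) \<longlongrightarrow> 0) (at_right 0)" by (rule tendsto_mult_right_zero)
  qed
  moreover have "((\<lambda>s. K - dual_pairing c a (u T) s) \<longlongrightarrow> K - dual_pairing c a (u T) 0) (at_right 0)"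
    using isCont_dual_pairing[OF c(1) a u[OF T], of 0] by (intro tendsto_intros) (simp add: isCont_def filterlim_at_split)
  ultimately have 1: "K = dual_pairing c a (u T) 0"
    using tendsto_unique[of "at_right (0::real)"] by fastforce
  have "((\<lambda>s. K - dual_pairing c a f (T - s)) \<longlongrightarrow> 0) (at_right 0)"
  proof (rule Lim_null_comparison)
    show "\<forall>\<^sub>F s in at_right 0. norm (K - dual_pairing c a f (T - s)) \<le> C * L2_norm (\<lambda>x. u s x - f x)"
      unfolding eventually_at_right_field
    proof (intro exI[of _ T] conjI allI impI T)
      fix s assume "0 < s" "s < T"
      then show "norm (K - dual_pairing c a f (T - s)) \<le> C * L2_norm (\<lambda>x. u s x - f x)" using cutoff_error[OF f, of "T - s"] by simp
    qed
    show "((\<lambda>s. C * L2_norm (\<lambda>x. u s x - f x)) \<longlongrightarrow> 0) (at_right 0)" by (rule tendsto_mult_right_zero[OF init])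
  qed
  moreover have "((\<lambda>s. K - dual_pairing c a f (T - s)) \<longlongrightarrow> K - dual_pairing c a f (T - 0)) (at_right 0)"
  proof (intro tendsto_intros)
    have "isCont (\<lambda>s. dual_pairing c a f (T - s)) 0"
      using isCont_dual_pairing[OF c(1) a f, of T] T by (intro isCont_o2[of _ "\<lambda>s. T - s" "dual_pairing c a f"]) auto
    then show "((\<lambda>s. dual_pairing c a f (T - s)) \<longlongrightarrow> dual_pairing c a f (T - 0)) (at_right 0)"
      by (simp add: isCont_def filterlim_at_split)
  qed
  ultimately have 2: "K = dual_pairing c a f T"
    using tendsto_unique[of "at_right (0::real)"] by fastforce
  have "(\<lambda>r. ip (u T) (gauss r) * flux_kernel c a (0 - r)) = (\<lambda>r. 0)"
  proof
    fix r show "ip (u T) (gauss r) * flux_kernel c a (0 - r) = 0"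
      using ip_gauss_nonpos[of r "u T"] flux_kernel_nonpos[of "0 - r" c a] by (cases "0 \<le> r") auto
  qed
  then have "dual_pairing c a (u T) 0 = ip (u T) (gauss a)" by (simp add: dual_pairing_def)
  with 1 2 show ?thesis by simp
qed

section \<open>Identification of the heat kernel\<close>

text \<open>A Hausdorff moment problem in the variable \<open>exp (- x^2)\<close>, which maps the
  half line to the unit interval. Vanishing moments pass to Bernstein polynomials, then to
  continuous functions, then to indicators of half lines, which determine measures.\<close>

lemma AE_zero_of_exp_moments:
  fixes k :: "real \<Rightarrow> real"
  assumes k: "integrable lborel k" and k0: "\<And>x. x \<le> 0 \<Longrightarrow> k x = 0"
    and mom: "\<And>n::nat. (\<integral>x. k x * exp (- (x^2)) ^ n \<partial>lborel) = 0"
  shows "AE x in lborel. k x = 0"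
proof -
  have [measurable]: "k \<in> borel_measurable borel" using k by auto
  define v where "v = (\<lambda>x::real. exp (- (x^2)))"
  have v: "0 < v x" "v x \<le> 1" for x by (simp_all add: v_def)
  have [measurable]: "v \<in> borel_measurable borel" unfolding v_def by measurable
  have int: "integrable lborel (\<lambda>x. k x * b x)" if "b \<in> borel_measurable borel" "\<And>x. \<bar>b x\<bar> \<le> 1" for b
  proof (rule Bochner_Integration.integrable_bound[OF k])
    show "AE x in lborel. norm (k x * b x) \<le> norm (k x)"
      using that(2) by (intro AE_I2) (simp add: abs_mult mult_left_le)
  qed (use that(1) in measurable)
  have pb: "\<bar>v x ^ j * (1 - v x) ^ m\<bar> \<le> 1" for x j m
    using v[of x] by (auto simp: abs_mult power_abs intro!: mult_le_one power_le_one)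
  \<comment> \<open>Expanding \<open>(1 - v) ^ Suc m = (1 - v) ^ m - v (1 - v) ^ m\<close> lowers
    \<open>m\<close> at the price of raising \<open>j\<close>.\<close>
  have bern: "(\<integral>x. k x * (v x ^ j * (1 - v x) ^ m) \<partial>lborel) = 0" for j m
  proof (induction m arbitrary: j)
    case 0
    then show ?case using mom[of j] by (simp add: v_def)
  next
    case (Suc m)
    have "(\<integral>x. k x * (v x ^ j * (1 - v x) ^ Suc m) \<partial>lborel) =
        (\<integral>x. k x * (v x ^ j * (1 - v x) ^ m) - k x * (v x ^ Suc j * (1 - v x) ^ m) \<partial>lborel)"
      by (intro Bochner_Integration.integral_cong) (auto simp: algebra_simps)
    also have "\<dots> = 0"
      by (subst Bochner_Integration.integral_diff) (auto simp: Suc simp del: power_Suc intro!: int pb)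
    finally show ?case .
  qed
  have contz: "(\<integral>x. k x * f (v x) \<partial>lborel) = 0"
    if f: "continuous_on UNIV f" and f1: "\<And>y. \<bar>f y\<bar> \<le> 1" for f :: "real \<Rightarrow> real"
  proof (rule ccontr)
    have [measurable]: "f \<in> borel_measurable borel" by (rule borel_measurable_continuous_onI[OF f])
    define A where "A = (\<integral>x. \<bar>k x\<bar> \<partial>lborel)"
    have A: "0 \<le> A" by (simp add: A_def)
    assume nz: "(\<integral>x. k x * f (v x) \<partial>lborel) \<noteq> 0"
    define e where "e = \<bar>\<integral>x. k x * f (v x) \<partial>lborel\<bar> / (A + 1)"
    have e: "0 < e" using nz A by (simp add: e_def)
    obtain n where n: "\<And>x. x \<in> {0..1} \<Longrightarrow> \<bar>f x - (\<Sum>j\<le>n. f (j / n) * Bernstein n j x)\<bar> < e"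
      using Bernstein_Weierstrass[OF continuous_on_subset[OF f subset_UNIV] e] by blast
    define B where "B = (\<lambda>y. \<Sum>j\<le>n. f (real j / real n) * Bernstein n j y)"
    have iB: "integrable lborel (\<lambda>x. k x * (f (j / n) * Bernstein n j (v x)))" for j
    proof -
      have "integrable lborel (\<lambda>x. (f (j / n) * real (n choose j)) * (k x * (v x ^ j * (1 - v x) ^ (n - j))))"
        by (intro integrable_mult_right int pb) measurable
      then show ?thesis by (simp add: Bernstein_def mult_ac)
    qed
    have zB: "(\<integral>x. k x * (f (j / n) * Bernstein n j (v x)) \<partial>lborel) = 0" for j
    proof -
      have "(\<integral>x. k x * (f (j / n) * Bernstein n j (v x)) \<partial>lborel) = (\<integral>x. (f (j / n) * real (n choose j)) * (k x * (v x ^ j * (1 - v x) ^ (n - j))) \<partial>lborel)"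
        by (simp add: Bernstein_def mult_ac)
      then show ?thesis by (simp add: bern)
    qed
    have iB': "integrable lborel (\<lambda>x. k x * B (v x))"
      unfolding B_def sum_distrib_left by (intro Bochner_Integration.integrable_sum iB)
    have zB': "(\<integral>x. k x * B (v x) \<partial>lborel) = 0"
      unfolding B_def sum_distrib_left by (subst Bochner_Integration.integral_sum) (auto simp: zB intro: iB)
    have i_f: "integrable lborel (\<lambda>x. k x * f (v x))" by (intro int f1) measurable
    have "\<bar>\<integral>x. k x * f (v x) \<partial>lborel\<bar> = \<bar>\<integral>x. k x * f (v x) - k x * B (v x) \<partial>lborel\<bar>"
      using i_f iB' zB' by simp
    also have "\<dots> \<le> (\<integral>x. \<bar>k x * f (v x) - k x * B (v x)\<bar> \<partial>lborel)" by (rule integral_abs_bound)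
    also have "\<dots> \<le> (\<integral>x. e * \<bar>k x\<bar> \<partial>lborel)"
    proof (rule integral_mono)
      show "integrable lborel (\<lambda>x. \<bar>k x * f (v x) - k x * B (v x)\<bar>)" using i_f iB' by simp
      show "integrable lborel (\<lambda>x. e * \<bar>k x\<bar>)" using k by simp
      show "\<bar>k x * f (v x) - k x * B (v x)\<bar> \<le> e * \<bar>k x\<bar>" for x
      proof -
        have "\<bar>k x\<bar> * \<bar>f (v x) - B (v x)\<bar> \<le> \<bar>k x\<bar> * e"
          using n[of "v x"] v[of x] by (intro mult_left_mono) (auto simp: B_def)
        then show ?thesis by (simp add: abs_mult[symmetric] algebra_simps)
      qed
    qed
    also have "\<dots> = e * A" by (simp add: A_def)
    also have "\<dots> < e * (A + 1)" using e by simp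
    also have "\<dots> = \<bar>\<integral>x. k x * f (v x) \<partial>lborel\<bar>" using A by (simp add: e_def)
    finally show False by simp
  qed
  have half: "(\<integral>x. k x * indicator {t<..} x \<partial>lborel) = 0" for t
  proof (cases "0 < t")
    case False
    have "(\<integral>x. k x * indicator {t<..} x \<partial>lborel) = (\<integral>x. k x * exp (- (x^2)) ^ 0 \<partial>lborel)"
      using False k0 by (intro Bochner_Integration.integral_cong) (auto simp: indicator_def)
    then show ?thesis using mom[of 0] by simp
  next
    case True
    \<comment> \<open>Continuous ramps in \<open>y = v x\<close>, increasing to the indicator of
      \<open>y < v t\<close>; since \<open>v\<close> decreases on the half line, this is the
      indicator of \<open>x > t\<close>.\<close>
    define f where "f = (\<lambda>m y. max 0 (min 1 (real m * (v t - y))))"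
    have fc: "continuous_on UNIV (f m)" for m unfolding f_def by (intro continuous_intros)
    have f1: "\<bar>f m y\<bar> \<le> 1" for m y by (auto simp: f_def)
    have "(\<lambda>m. \<integral>x. k x * f m (v x) \<partial>lborel) \<longlonglongrightarrow> (\<integral>x. k x * indicator {t<..} x \<partial>lborel)"
    proof (rule integral_dominated_convergence[where w = "\<lambda>x. \<bar>k x\<bar>"])
      show "AE x in lborel. (\<lambda>m. k x * f m (v x)) \<longlonglongrightarrow> k x * indicator {t<..} x"
      proof (intro AE_I2)
        fix x
        show "(\<lambda>m. k x * f m (v x)) \<longlonglongrightarrow> k x * indicator {t<..} x"
        proof (cases "0 < x")
          case x: True
          show ?thesis
          proof (cases "t < x")
            case True
            then have "v x < v t" using x \<open>0 < t\<close> by (simp add: v_def power_strict_mono)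
            then have p: "0 < v t - v x" by simp
            have "\<forall>\<^sub>F m in sequentially. real m \<ge> 1 / (v t - v x)"
              using filterlim_real_sequentially unfolding filterlim_at_top by blast
            then have "\<forall>\<^sub>F m in sequentially. 1 = f m (v x)"
              by eventually_elim (use p in \<open>auto simp: f_def field_simps\<close>)
            then have "(\<lambda>m. f m (v x)) \<longlonglongrightarrow> 1" by (rule Lim_transform_eventually[OF tendsto_const])
            then have "(\<lambda>m. k x * f m (v x)) \<longlonglongrightarrow> k x * 1" by (rule tendsto_mult_left)
            then show ?thesis using True by simp
          next
            case False
            then have "v t \<le> v x" using x by (simp add: v_def power_mono)
            then have "real m * (v t - v x) \<le> 0" for m by (intro mult_nonneg_nonpos) auto
            moreover have "max 0 (min 1 z) = 0" if "z \<le> 0" for z :: real using that by simp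
            ultimately have "f m (v x) = 0" for m unfolding f_def by blast
            then show ?thesis using False by simp
          qed
        qed (simp add: k0)
      qed
      show "AE x in lborel. norm (k x * f m (v x)) \<le> \<bar>k x\<bar>" for m
        using f1 by (intro AE_I2) (simp add: abs_mult mult_left_le)
      have [measurable]: "f m \<in> borel_measurable borel" for m by (rule borel_measurable_continuous_onI[OF fc])
      show "(\<lambda>x. k x * f m (v x)) \<in> borel_measurable lborel" for m by measurable
    qed (use k in auto)
    moreover have "(\<integral>x. k x * f m (v x) \<partial>lborel) = 0" for m by (rule contz[OF fc f1])
    ultimately show ?thesis by (simp add: LIMSEQ_const_iff)
  qed
  define p where "p = (\<lambda>x. ennreal (max 0 (k x)))"
  define q where "q = (\<lambda>x. ennreal (max 0 (- k x)))"
  have [measurable]: "p \<in> borel_measurable lborel" "q \<in> borel_measurable lborel" unfolding p_def q_def by measurable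
  have ip: "integrable lborel (\<lambda>x. max 0 (k x) * indicator {t<..} x)" for t
    by (rule Bochner_Integration.integrable_bound[OF k]) (auto simp: indicator_def)
  have iq: "integrable lborel (\<lambda>x. max 0 (- k x) * indicator {t<..} x)" for t
    by (rule Bochner_Integration.integrable_bound[OF k]) (auto simp: indicator_def)
  have ep: "emeasure (density lborel p) {t<..} = ennreal (\<integral>x. max 0 (k x) * indicator {t<..} x \<partial>lborel)" for t
  proof -
    have "emeasure (density lborel p) {t<..} = (\<integral>\<^sup>+x. p x * indicator {t<..} x \<partial>lborel)"
      by (rule emeasure_density) auto
    also have "\<dots> = (\<integral>\<^sup>+x. ennreal (max 0 (k x) * indicator {t<..} x) \<partial>lborel)"
      by (intro nn_integral_cong) (auto simp: p_def indicator_def)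
    also have "\<dots> = ennreal (\<integral>x. max 0 (k x) * indicator {t<..} x \<partial>lborel)"
      by (rule nn_integral_eq_integral[OF ip]) auto
    finally show ?thesis .
  qed
  have eq: "emeasure (density lborel q) {t<..} = ennreal (\<integral>x. max 0 (- k x) * indicator {t<..} x \<partial>lborel)" for t
  proof -
    have "emeasure (density lborel q) {t<..} = (\<integral>\<^sup>+x. q x * indicator {t<..} x \<partial>lborel)"
      by (rule emeasure_density) auto
    also have "\<dots> = (\<integral>\<^sup>+x. ennreal (max 0 (- k x) * indicator {t<..} x) \<partial>lborel)"
      by (intro nn_integral_cong) (auto simp: q_def indicator_def)
    also have "\<dots> = ennreal (\<integral>x. max 0 (- k x) * indicator {t<..} x \<partial>lborel)"
      by (rule nn_integral_eq_integral[OF iq]) auto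
    finally show ?thesis .
  qed
  \<comment> \<open>Measures must be nonnegative, so the positive and negative parts of
    \<open>k\<close> are compared: they have the same mass on every half line.\<close>
  have "density lborel p = density lborel q"
  proof (rule measure_eqI_lessThan)
    show "emeasure (density lborel p) {t<..} = emeasure (density lborel q) {t<..}" for t
    proof -
      have "(\<integral>x. max 0 (k x) * indicator {t<..} x \<partial>lborel) - (\<integral>x. max 0 (- k x) * indicator {t<..} x \<partial>lborel)
        = (\<integral>x. max 0 (k x) * indicator {t<..} x - max 0 (- k x) * indicator {t<..} x \<partial>lborel)"
        using ip iq by simp
      also have "\<dots> = (\<integral>x. k x * indicator {t<..} x \<partial>lborel)"
        by (intro Bochner_Integration.integral_cong) (auto simp: indicator_def max_def)
      finally show ?thesis unfolding ep eq half by simp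
    qed
  qed (auto simp: ep)
  then have "AE x in lborel. p x = q x"
    by (subst (asm) sigma_finite_measure.density_unique_iff[OF sigma_finite_lborel]) auto
  then show ?thesis
    by eventually_elim (auto simp: p_def q_def max_def split: if_splits)
qed

text \<open>The parameters \<open>1 / (4 (n + 1))\<close> turn the Gaussian into the powers
  \<open>exp (- x^2) ^ (n + 1)\<close>. One factor goes into the weight, so that the moments start
  at 0. Only countably many profiles are used, which matters for null sets later.\<close>

lemma gauss_injective:
  assumes h: "\<And>n::nat. integrable lborel (\<lambda>x. h x * gauss (1 / (4 * (real n + 1))) x)"
    and z: "\<And>n::nat. (\<integral>x. h x * gauss (1 / (4 * (real n + 1))) x \<partial>lborel) = 0"
  shows "AE x in lborel. 0 < x \<longrightarrow> h x = 0"
proof -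
  define k where "k = (\<lambda>x. h x * gauss (1 / 4) x)"
  have eq: "k x * exp (- (x^2)) ^ n = 1 / (real n + 1) * (h x * gauss (1 / (4 * (real n + 1))) x)" for n x
  proof (cases "0 < x")
    case True
    have "exp (- (x^2)) * exp (- (x^2)) ^ n = exp (- (x^2) / (4 * (1 / (4 * (real n + 1)))))"
      by (simp add: exp_of_nat_mult[symmetric] exp_add[symmetric] algebra_simps)
    then have "k x * exp (- (x^2)) ^ n = h x * (2 * sqrt x) * exp (- (x^2) / (4 * (1 / (4 * (real n + 1)))))"
      using True by (simp add: k_def gauss_def)
    moreover have "gauss (1 / (4 * (real n + 1))) x = (real n + 1) * (2 * sqrt x) * exp (- (x^2) / (4 * (1 / (4 * (real n + 1)))))"
      using True by (simp add: gauss_def)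
    ultimately show ?thesis by simp
  qed (simp add: k_def gauss_def)
  have "AE x in lborel. k x = 0"
  proof (rule AE_zero_of_exp_moments)
    show "integrable lborel k" using h[of 0] by (simp add: k_def)
    show "(\<integral>x. k x * exp (- (x^2)) ^ n \<partial>lborel) = 0" for n
      unfolding eq using z[of n] by simp
  qed (simp add: k_def gauss_def)
  then show ?thesis
    by eventually_elim (auto simp: k_def gauss_def)
qed

section \<open>The Bessel series and the Friedrichs kernel\<close>

lemma summable_bessel: "summable (\<lambda>k. (1 / (fact k)^2) * (y::real) ^ k)"
proof (rule summable_comparison_test)
  show "\<exists>N. \<forall>n\<ge>N. norm ((1 / (fact n)^2) * y ^ n) \<le> inverse (fact n) * \<bar>y\<bar> ^ n"
  proof (intro exI[of _ 0] allI impI)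
    fix n
    have "1 \<le> (fact n :: real)" by (rule fact_ge_1)
    then have "(fact n :: real) * 1 \<le> fact n * fact n" by (intro mult_left_mono) auto
    then have "1 / (fact n)^2 \<le> (inverse (fact n) :: real)"
      by (simp add: power2_eq_square inverse_eq_divide frac_le)
    then have "1 / (fact n)^2 * \<bar>y\<bar> ^ n \<le> inverse (fact n) * \<bar>y\<bar> ^ n" by (rule mult_right_mono) simp
    then show "norm ((1 / (fact n)^2) * y ^ n) \<le> inverse (fact n) * \<bar>y\<bar> ^ n" by (simp add: abs_mult power_abs)
  qed
  show "summable (\<lambda>n. inverse (fact n) * \<bar>y\<bar> ^ n)" by (rule summable_exp)
qed

lemma bessel_I0_eq: "bessel_I0 z = (\<Sum>k. (1 / (fact k)^2) * ((z / 2)^2) ^ k)"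
  unfolding bessel_I0_def by (simp add: power_mult)

lemma isCont_bessel_I0: "isCont bessel_I0 z"
proof -
  have "isCont (\<lambda>x. \<Sum>k. (1 / (fact k)^2) * x ^ k) ((z / 2)^2)"
    by (rule isCont_powser_converges_everywhere[OF summable_bessel])
  then have "isCont (\<lambda>z. \<Sum>k. (1 / (fact k)^2) * ((z / 2)^2) ^ k) z"
    by (rule isCont_o2[rotated]) (intro continuous_intros, simp)
  then show ?thesis by (simp add: bessel_I0_eq[abs_def])
qed

lemma continuous_on_bessel_I0 [continuous_intros]:
  "continuous_on A f \<Longrightarrow> continuous_on A (\<lambda>x. bessel_I0 (f x))"
  by (rule continuous_on_compose2[of UNIV]) (auto intro: continuous_at_imp_continuous_on isCont_bessel_I0)

lemma measurable_bessel_I0 [measurable]: "bessel_I0 \<in> borel_measurable borel"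
  by (rule borel_measurable_continuous_onI) (auto intro: continuous_at_imp_continuous_on isCont_bessel_I0)

lemma measurable_E_plus [measurable (raw)]:
  assumes [measurable]: "f \<in> borel_measurable M" "g \<in> borel_measurable M"
  shows "(\<lambda>z. E_plus (f z) (g z) t) \<in> borel_measurable M"
  unfolding E_plus_def by measurable

lemma bessel_I0_nonneg: "0 \<le> bessel_I0 z"
  unfolding bessel_I0_eq by (intro suminf_nonneg summable_bessel) auto

lemma E_plus_nonneg: "0 < x \<Longrightarrow> 0 < y \<Longrightarrow> 0 < t \<Longrightarrow> 0 \<le> E_plus x y t"
  unfolding E_plus_def by (intro mult_nonneg_nonneg bessel_I0_nonneg divide_nonneg_pos) auto

text \<open>The Friedrichs flow shifts the parameter of the profile. Expanding
  \<open>bessel_I0\<close> makes each term a Gaussian moment with the combined parameter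
  \<open>h\<close>; nonnegative terms may be summed after integration, and the sum is an exponential
  series.\<close>

lemma nn_integral_E_plus_gauss:
  assumes x: "0 < x" and t: "0 < t" and b: "0 < b"
  shows "(\<integral>\<^sup>+y. ennreal (E_plus x y t * gauss b y) \<partial>lborel) = ennreal (gauss (t + b) x)"
proof -
  define h where "h = t * b / (t + b)"
  have h: "0 < h" using t b by (simp add: h_def)
  define A where "A = sqrt x * exp (- (x^2) / (4 * t)) / (2 * (t + b))"
  have A: "0 \<le> A" using x t b by (simp add: A_def)
  define z where "z = (x / (4 * t))^2"
  define F where "F = (\<lambda>k y. A * z ^ k / (fact k)^2 * (gauss h y * y powr (1 / 2 + 2 * real k)))"
  have F0: "0 \<le> F k y" for k y
    using A gauss_nonneg[of h y] by (auto simp: F_def z_def)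
  have F_eq: "F k y = (sqrt (x * y) / (2 * t) * exp (- (x^2 + y^2) / (4 * t)) * gauss b y) * ((1 / (fact k)^2) * ((x * y / (2 * t) / 2)^2) ^ k)" for k y
  proof (cases "0 < y")
    case True
    have gg: "gauss h y * sqrt y = 2 * (t + b) * (gauss t y * gauss b y)"
      using gauss_mult_gauss[OF t b, of y] t b by (simp add: h_def)
    have "y powr (1 / 2 + 2 * real k) = sqrt y * (y^2) ^ k"
    proof -
      have "y powr (2 * real k) = (y^2) ^ k"
        using powr_realpow[OF True, of "2 * k"] by (simp add: power_mult)
      then show ?thesis using True by (simp add: powr_add powr_half_sqrt)
    qed
    then have "F k y = A * z ^ k / (fact k)^2 * (gauss h y * sqrt y) * (y^2) ^ k"
      by (simp add: F_def)
    also have "\<dots> = A * z ^ k / (fact k)^2 * (2 * (t + b) * (gauss t y * gauss b y)) * (y^2) ^ k"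
      by (simp only: gg)
    also have "\<dots> = (A * (2 * (t + b)) * gauss t y) * gauss b y * ((1 / (fact k)^2) * (z * y^2) ^ k)"
      by (simp add: power_mult_distrib)
    also have "z * y^2 = (x * y / (2 * t) / 2)^2" by (simp add: z_def power_mult_distrib power_divide)
    also have "A * (2 * (t + b)) * gauss t y = sqrt (x * y) / (2 * t) * exp (- (x^2 + y^2) / (4 * t))"
    proof -
      have "exp (- (x^2 + y^2) / (4 * t)) = exp (- (x^2) / (4 * t)) * exp (- (y^2) / (4 * t))"
        by (simp add: exp_add[symmetric] diff_divide_distrib)
      moreover have "A * (2 * (t + b)) = sqrt x * exp (- (x^2) / (4 * t))" using t b by (simp add: A_def)
      ultimately show ?thesis using t True by (simp add: gauss_def real_sqrt_mult)
    qed
    finally show ?thesis by simp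
  qed (simp add: F_def gauss_def)
  have "(\<integral>\<^sup>+y. ennreal (E_plus x y t * gauss b y) \<partial>lborel) = (\<integral>\<^sup>+y. (\<Sum>k. ennreal (F k y)) \<partial>lborel)"
  proof (rule nn_integral_cong)
    fix y
    have sm: "summable (\<lambda>k. F k y)" unfolding F_eq by (intro summable_mult summable_bessel)
    have "(\<Sum>k. F k y) = E_plus x y t * gauss b y"
      unfolding F_eq suminf_mult[OF summable_bessel]
      by (simp add: E_plus_def bessel_I0_eq mult_ac)
    then show "ennreal (E_plus x y t * gauss b y) = (\<Sum>k. ennreal (F k y))"
      by (simp add: suminf_ennreal2[OF F0 sm])
  qed
  also have "\<dots> = (\<Sum>k. \<integral>\<^sup>+y. ennreal (F k y) \<partial>lborel)"
    by (rule nn_integral_suminf) (simp add: F_def)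
  \<comment> \<open>The moment contains \<open>Gamma (1 + k) = fact k\<close>, which cancels one of
    the two factorials of the Bessel coefficient.\<close>
  also have "\<dots> = (\<Sum>k. ennreal (A * ((z * (4 * h)) ^ k / fact k)))"
  proof (rule suminf_cong)
    fix k
    have "has_bochner_integral lborel (\<lambda>y. gauss h y * y powr (1 / 2 + 2 * real k)) ((4 * h) ^ k * fact k)"
    proof -
      have "(4 * h) powr (1 / 4 + real k + 3 / 4) * Gamma (1 / 4 + real k + 3 / 4) / (4 * h) = (4 * h) ^ k * fact k"
      proof -
        have "(4 * h) powr (1 + real k) = (4 * h) * (4 * h) ^ k" using h by (simp add: powr_add powr_realpow)
        moreover have "Gamma (1 + real k) = fact k" using Gamma_fact[of k, where 'a = real] by simp
        ultimately show ?thesis using h by (simp add: algebra_simps)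
      qed
      then show ?thesis using has_bochner_integral_gauss_powr[OF h, of "1 / 2 + 2 * real k"] by (simp add: add_divide_distrib)
    qed
    then have "has_bochner_integral lborel (F k) (A * z ^ k / (fact k)^2 * ((4 * h) ^ k * fact k))"
      unfolding F_def by (rule has_bochner_integral_mult_right)
    then have "(\<integral>\<^sup>+y. ennreal (F k y) \<partial>lborel) = ennreal (A * z ^ k / (fact k)^2 * ((4 * h) ^ k * fact k))"
      using F0 by (subst nn_integral_eq_integral) (auto simp: has_bochner_integral_iff)
    also have "A * z ^ k / (fact k)^2 * ((4 * h) ^ k * fact k) = A * ((z * (4 * h)) ^ k / fact k)"
      by (simp add: power2_eq_square power_mult_distrib)
    finally show "(\<integral>\<^sup>+y. ennreal (F k y) \<partial>lborel) = ennreal (A * ((z * (4 * h)) ^ k / fact k))" .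
  qed
  also have "\<dots> = ennreal (A * exp (z * (4 * h)))"
  proof -
    have "(\<lambda>k. (z * (4 * h)) ^ k / fact k) sums exp (z * (4 * h))"
      using exp_converges[of "z * (4 * h)"] by (simp add: divide_inverse mult.commute)
    then have "(\<lambda>k. A * ((z * (4 * h)) ^ k / fact k)) sums (A * exp (z * (4 * h)))" by (rule sums_mult)
    then show ?thesis using A h by (subst suminf_ennreal2) (auto simp: sums_iff z_def)
  qed
  also have "A * exp (z * (4 * h)) = gauss (t + b) x"
  proof -
    have "- (x^2) / (4 * t) + z * (4 * h) = - (x^2) / (4 * (t + b))"
      using t b unfolding z_def h_def by (simp add: divide_simps power2_eq_square) (simp add: algebra_simps)
    then have "exp (- (x^2) / (4 * t)) * exp (z * (4 * h)) = exp (- (x^2) / (4 * (t + b)))"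
      by (simp only: exp_add[symmetric])
    then show ?thesis using x t b by (simp add: A_def gauss_def)
  qed
  finally show ?thesis .
qed

lemma continuous_on_E_plus: "0 < t \<Longrightarrow> continuous_on A (\<lambda>y. E_plus x y t)"
  unfolding E_plus_def by (intro continuous_intros) auto

text \<open>For fixed \<open>x > 0\<close> the profile is bounded uniformly in time, since
  \<open>exp (- z) <= 1 / z\<close> compensates \<open>1 / s\<close>. Hence the mass of
  \<open>rho\<close> alone controls the double time integral in \<open>corr_kernel\<close>.\<close>

lemma gauss_le_x:
  assumes x: "0 < x"
  shows "gauss s x \<le> 2 * sqrt x / x^2"
proof (cases "0 < s")
  case True
  define z where "z = x^2 / 4"
  have z: "0 < z" using x by (simp add: z_def)
  have "z / s \<le> exp (z / s)" using exp_ge_add_one_self[of "z / s"] by linarith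
  then have "inverse (exp (z / s)) \<le> inverse (z / s)" using z True by (intro le_imp_inverse_le) auto
  then have "exp (- (z / s)) \<le> s / z" by (simp add: exp_minus)
  then have "sqrt x / (2 * s) * exp (- (z / s)) \<le> sqrt x / (2 * s) * (s / z)"
    using x True by (intro mult_left_mono) auto
  also have "sqrt x / (2 * s) * (s / z) = 2 * sqrt x / x^2" using True by (simp add: z_def)
  finally show ?thesis using x True by (simp add: gauss_def z_def)
qed (use x in \<open>simp add: gauss_def\<close>)

text \<open>\<open>corr_kernel c\<close> is the difference of the heat kernels of \<open>Delta(\<theta>)\<close> and of the Friedrichs extension; heat
  travels to the endpoint, waits there according to \<open>rho c\<close>, and returns.\<close>

definition corr_integrand :: "real \<Rightarrow> real \<Rightarrow> real \<Rightarrow> real \<Rightarrow> real \<times> real \<Rightarrow> real" where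
  "corr_integrand c T x y p = gauss (fst p) x * rho c (snd p) * gauss (T - fst p - snd p) y"

definition corr_kernel :: "real \<Rightarrow> real \<Rightarrow> real \<Rightarrow> real \<Rightarrow> real" where
  "corr_kernel c T x y = 2 * (\<integral>p. corr_integrand c T x y p \<partial>(lborel \<Otimes>\<^sub>M lborel))"

lemma measurable_corr_integrand [measurable]: "corr_integrand c T x y \<in> borel_measurable (lborel \<Otimes>\<^sub>M lborel)"
  unfolding corr_integrand_def by measurable

lemma corr_integrand_nonneg: "0 \<le> corr_integrand c T x y p"
  by (simp add: corr_integrand_def gauss_nonneg rho_nonneg)

lemma integrable_lborel_prod:
  fixes f g :: "real \<Rightarrow> real"
  assumes f: "integrable lborel f" and g: "integrable lborel g"
  shows "integrable (lborel \<Otimes>\<^sub>M lborel) (\<lambda>p. f (fst p) * g (snd p))"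
proof (rule lborel_pair.Fubini_integrable)
  have [measurable]: "f \<in> borel_measurable borel" "g \<in> borel_measurable borel" using f g by auto
  show "(\<lambda>p. f (fst p) * g (snd p)) \<in> borel_measurable (lborel \<Otimes>\<^sub>M lborel)" by measurable
  show "integrable lborel (\<lambda>x. \<integral>y. norm (f (fst (x, y)) * g (snd (x, y))) \<partial>lborel)"
    using f by (simp add: abs_mult)
  show "AE x in lborel. integrable lborel (\<lambda>y. f (fst (x, y)) * g (snd (x, y)))"
    using g by simp
qed

lemma corr_integrand_le:
  assumes x: "0 < x" and M: "\<And>s. gauss s y \<le> M"
  shows "corr_integrand c T x y p \<le> 2 * sqrt x / x^2 * M * (indicator {0<..<T} (fst p) * (indicator {..<T} (snd p) * rho c (snd p)))"
proof -
  have M0: "0 \<le> M" using M[of 0] gauss_nonneg[of 0 y] by linarith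
  show ?thesis
  proof (cases "0 < fst p \<and> 0 < snd p \<and> fst p + snd p < T")
    case True
    have "gauss (fst p) x * rho c (snd p) * gauss (T - fst p - snd p) y \<le> (2 * sqrt x / x^2) * rho c (snd p) * M"
      using x M0 by (intro mult_mono mult_nonneg_nonneg gauss_le_x M gauss_nonneg rho_nonneg) auto
    then show ?thesis using True by (simp add: corr_integrand_def mult_ac)
  next
    case False
    then have "corr_integrand c T x y p = 0" by (auto simp: corr_integrand_def gauss_def rho_def)
    then show ?thesis using x M0 rho_nonneg[of c "snd p"] by simp
  qed
qed

lemma integrable_corr_integrand_bound:
  assumes c: "0 < c"
  shows "integrable (lborel \<Otimes>\<^sub>M lborel) (\<lambda>p. z * (indicator {0<..<T} (fst p) * (indicator {..<T} (snd p) * rho c (snd p))))"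
proof (intro integrable_mult_right integrable_lborel_prod integrable_rho c)
  show "integrable lborel (indicator {0<..<T} :: real \<Rightarrow> real)"
    by (cases "0 < T") (auto intro!: integrable_real_indicator)
qed

lemma integrable_corr_integrand:
  assumes c: "0 < c" and x: "0 < x" and y: "0 < y"
  shows "integrable (lborel \<Otimes>\<^sub>M lborel) (corr_integrand c T x y)"
proof (rule Bochner_Integration.integrable_bound[OF integrable_corr_integrand_bound[OF c]])
  show "AE p in lborel \<Otimes>\<^sub>M lborel. norm (corr_integrand c T x y p) \<le> norm (2 * sqrt x / x^2 * (2 * sqrt y / y^2) * (indicator {0<..<T} (fst p) * (indicator {..<T} (snd p) * rho c (snd p))))"
  proof (intro AE_I2)
    fix p
    show "norm (corr_integrand c T x y p) \<le> norm (2 * sqrt x / x^2 * (2 * sqrt y / y^2) * (indicator {0<..<T} (fst p) * (indicator {..<T} (snd p) * rho c (snd p))))"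
      using order.trans[OF corr_integrand_le[OF x gauss_le_x[OF y]] abs_ge_self] corr_integrand_nonneg[of c T x y p]
      by (simp only: real_norm_def abs_of_nonneg)
  qed
qed measurable

lemma ennreal_corr_kernel:
  assumes c: "0 < c" and x: "0 < x" and y: "0 < y"
  shows "ennreal (corr_kernel c T x y) = 2 * (\<integral>\<^sup>+r. \<integral>\<^sup>+s. ennreal (gauss r x) * (ennreal (rho c s) * ennreal (gauss (T - r - s) y)) \<partial>lborel \<partial>lborel)"
proof -
  have "ennreal (\<integral>p. corr_integrand c T x y p \<partial>(lborel \<Otimes>\<^sub>M lborel)) = (\<integral>\<^sup>+p. ennreal (corr_integrand c T x y p) \<partial>(lborel \<Otimes>\<^sub>M lborel))"
    by (intro nn_integral_eq_integral[symmetric] integrable_corr_integrand c x y) (simp add: corr_integrand_nonneg)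
  also have "\<dots> = (\<integral>\<^sup>+r. \<integral>\<^sup>+s. ennreal (corr_integrand c T x y (r, s)) \<partial>lborel \<partial>lborel)"
    by (rule lborel.nn_integral_fst[symmetric]) measurable
  also have "\<dots> = (\<integral>\<^sup>+r. \<integral>\<^sup>+s. ennreal (gauss r x) * (ennreal (rho c s) * ennreal (gauss (T - r - s) y)) \<partial>lborel \<partial>lborel)"
    by (intro nn_integral_cong) (simp add: corr_integrand_def ennreal_mult gauss_nonneg rho_nonneg mult.assoc)
  finally show ?thesis by (simp add: corr_kernel_def ennreal_mult')
qed

lemma corr_kernel_nonneg: "0 \<le> corr_kernel c T x y"
  unfolding corr_kernel_def by (intro mult_nonneg_nonneg integral_nonneg_AE) (auto simp: corr_integrand_nonneg)

lemma isCont_gauss: "0 < y \<Longrightarrow> isCont (gauss s) y"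
proof (cases "0 < s")
  case True
  assume "0 < y" then show ?thesis using DERIV_gauss_x[OF True] by (intro DERIV_isCont)
next
  case False
  then have "gauss s = (\<lambda>_. 0)" by (auto simp: gauss_def)
  then show ?thesis by simp
qed

text \<open>Continuity is needed to evaluate on the diagonal an identity that holds only for almost
  every \<open>y\<close>. For \<open>y\<close> in a neighbourhood bounded away from 0 the bound of
  \<open>gauss_le_x\<close> is uniform.\<close>

lemma isCont_corr_kernel:
  assumes c: "0 < c" and x: "0 < x" and y: "0 < y"
  shows "isCont (corr_kernel c T x) y"
proof -
  define M where "M = 2 * sqrt (2 * y) / (y / 2)^2"
  have M: "gauss s z \<le> M" if z: "\<bar>z - y\<bar> < y / 2" for s z
  proof -
    have "- (y / 2) < z - y" "z - y < y / 2" using z by linarith+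
    then have z': "y / 2 \<le> z" "z \<le> 2 * y" "0 < z" using y by linarith+
    have "gauss s z \<le> 2 * sqrt z / z^2" by (rule gauss_le_x[OF z'(3)])
    also have "\<dots> \<le> M" unfolding M_def using z' y by (intro frac_le mult_left_mono power_mono) auto
    finally show ?thesis .
  qed
  have "((\<lambda>z. \<integral>p. corr_integrand c T x z p \<partial>(lborel \<Otimes>\<^sub>M lborel)) \<longlongrightarrow> (\<integral>p. corr_integrand c T x y p \<partial>(lborel \<Otimes>\<^sub>M lborel))) (at y within UNIV)"
  proof (rule tendsto_integral_at_within[OF _ _ _ integrable_corr_integrand_bound[OF c]])
    show "\<forall>\<^sub>F h in at y. corr_integrand c T x h \<in> borel_measurable (lborel \<Otimes>\<^sub>M lborel) \<and>
       (AE p in lborel \<Otimes>\<^sub>M lborel. \<bar>corr_integrand c T x h p\<bar> \<le> 2 * sqrt x / x^2 * M * (indicator {0<..<T} (fst p) * (indicator {..<T} (snd p) * rho c (snd p))))"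
      unfolding eventually_at
    proof (intro exI[of _ "y / 2"] conjI ballI impI)
      fix h assume "h \<noteq> y \<and> dist h y < y / 2"
      then have "gauss s h \<le> M" for s by (intro M) (simp add: dist_real_def)
      then have "corr_integrand c T x h p \<le> 2 * sqrt x / x^2 * M * (indicator {0<..<T} (fst p) * (indicator {..<T} (snd p) * rho c (snd p)))" for p
        by (rule corr_integrand_le[OF x])
      then show "AE p in lborel \<Otimes>\<^sub>M lborel. \<bar>corr_integrand c T x h p\<bar> \<le> 2 * sqrt x / x^2 * M * (indicator {0<..<T} (fst p) * (indicator {..<T} (snd p) * rho c (snd p)))"
        by (intro AE_I2) (simp only: abs_of_nonneg[OF corr_integrand_nonneg])
    qed (use y in auto)
    show "AE p in lborel \<Otimes>\<^sub>M lborel. ((\<lambda>h. corr_integrand c T x h p) \<longlongrightarrow> corr_integrand c T x y p) (at y)"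
      unfolding corr_integrand_def using isCont_gauss[OF y]
      by (intro AE_I2 tendsto_mult tendsto_const) (simp add: isCont_def)
  qed measurable
  then have "((\<lambda>z. corr_kernel c T x z) \<longlongrightarrow> corr_kernel c T x y) (at y)"
    unfolding corr_kernel_def by (intro tendsto_mult_left) simp
  then show ?thesis by (simp add: isCont_def)
qed

lemma measurable_corr_kernel [measurable (raw)]:
  assumes [measurable]: "f \<in> borel_measurable M" "g \<in> borel_measurable M"
  shows "(\<lambda>z. corr_kernel c T (f z) (g z)) \<in> borel_measurable M"
proof -
  have "(\<lambda>z. \<integral>p. corr_integrand c T (f z) (g z) p \<partial>(lborel \<Otimes>\<^sub>M lborel)) \<in> borel_measurable M"
  proof (rule sigma_finite_measure.borel_measurable_lebesgue_integral)
    show "sigma_finite_measure (lborel \<Otimes>\<^sub>M (lborel :: real measure) :: (real \<times> real) measure)"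
      by (simp add: lborel_prod sigma_finite_lborel)
    have "(\<lambda>w. corr_integrand c T (f (fst w)) (g (fst w)) (snd w)) \<in> borel_measurable (M \<Otimes>\<^sub>M (lborel \<Otimes>\<^sub>M lborel))"
      unfolding corr_integrand_def by measurable
    then show "(\<lambda>(z, p). corr_integrand c T (f z) (g z) p) \<in> borel_measurable (M \<Otimes>\<^sub>M (lborel \<Otimes>\<^sub>M lborel))"
      by (simp add: case_prod_beta')
  qed
  then show ?thesis unfolding corr_kernel_def by measurable
qed

lemma nn_integral_gauss_gauss:
  assumes b: "0 < b"
  shows "(\<integral>\<^sup>+x. ennreal (gauss s x) * ennreal (gauss b x) \<partial>lborel) = ennreal (1 / 2) * ennreal (shifted_inverse b s)"
proof (cases "0 < s")
  case True
  have "(\<integral>\<^sup>+x. ennreal (gauss s x) * ennreal (gauss b x) \<partial>lborel) = (\<integral>\<^sup>+x. ennreal (gauss s x * gauss b x) \<partial>lborel)"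
    by (intro nn_integral_cong) (simp add: ennreal_mult gauss_nonneg)
  also have "\<dots> = ennreal (1 / (2 * (s + b)))"
    using has_bochner_integral_gauss_gauss[OF True b] gauss_nonneg
    by (subst nn_integral_eq_integral) (auto simp: has_bochner_integral_iff)
  also have "1 / (2 * (s + b)) = 1 / 2 * shifted_inverse b s" using True by (simp add: shifted_inverse_def add.commute)
  also have "ennreal (1 / 2 * shifted_inverse b s) = ennreal (1 / 2) * ennreal (shifted_inverse b s)" by (rule ennreal_mult') simp
  finally show ?thesis .
qed (simp add: gauss_def shifted_inverse_def)

lemma ip_gauss_shifted_inverse: "0 < b \<Longrightarrow> ip (gauss b) (gauss r) = 1 / 2 * shifted_inverse b r"
  by (cases "0 < r") (simp_all add: ip_gauss_gauss shifted_inverse_def ip_gauss_nonpos)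

lemma half_twice: "ennreal (1 / 2) * (2 * z) = z" "2 * (ennreal (1 / 2) * z) = z"
proof -
  have "ennreal (1 / 2) * 2 = ennreal (1 / 2) * ennreal 2" by simp
  also have "\<dots> = 1" by (subst ennreal_mult'[symmetric]) auto
  finally have h: "ennreal (1 / 2) * 2 = 1" .
  show "ennreal (1 / 2) * (2 * z) = z" by (simp only: mult.assoc[symmetric] h mult_1)
  show "2 * (ennreal (1 / 2) * z) = z"
    by (simp only: mult.assoc[symmetric] mult.commute[of 2] h mult_1)
qed

text \<open>Integrate in \<open>y\<close> first: the pairing of the two profiles is half a shifted
  inverse, and the \<open>s\<close> integral of this against \<open>rho\<close> is
  \<open>flux_kernel c b\<close> by definition.\<close>

lemma nn_integral_corr_kernel_gauss:
  assumes c: "0 < c" and b: "0 < b" and x: "0 < x"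
  shows "(\<integral>\<^sup>+y. ennreal (corr_kernel c T x y * gauss b y) \<partial>lborel) = 2 * (\<integral>\<^sup>+r. ennreal (gauss r x) * ennreal (flux_kernel c b (T - r)) \<partial>lborel)"
proof -
  have "(\<integral>\<^sup>+y. ennreal (corr_kernel c T x y * gauss b y) \<partial>lborel) =
      (\<integral>\<^sup>+y. 2 * (\<integral>\<^sup>+r. \<integral>\<^sup>+s. ennreal (gauss r x) * (ennreal (rho c s) * (ennreal (gauss (T - r - s) y) * ennreal (gauss b y))) \<partial>lborel \<partial>lborel) \<partial>lborel)"
  proof (rule nn_integral_cong)
    fix y
    show "ennreal (corr_kernel c T x y * gauss b y) =
      2 * (\<integral>\<^sup>+r. \<integral>\<^sup>+s. ennreal (gauss r x) * (ennreal (rho c s) * (ennreal (gauss (T - r - s) y) * ennreal (gauss b y))) \<partial>lborel \<partial>lborel)"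
    proof (cases "0 < y")
      case True
      have "ennreal (corr_kernel c T x y * gauss b y) = ennreal (corr_kernel c T x y) * ennreal (gauss b y)"
        by (simp add: ennreal_mult corr_kernel_nonneg gauss_nonneg)
      also have "\<dots> = 2 * ((\<integral>\<^sup>+r. \<integral>\<^sup>+s. ennreal (gauss r x) * (ennreal (rho c s) * ennreal (gauss (T - r - s) y)) \<partial>lborel \<partial>lborel) * ennreal (gauss b y))"
        unfolding ennreal_corr_kernel[OF c x True] by (simp add: mult.assoc)
      also have "(\<integral>\<^sup>+r. \<integral>\<^sup>+s. ennreal (gauss r x) * (ennreal (rho c s) * ennreal (gauss (T - r - s) y)) \<partial>lborel \<partial>lborel) * ennreal (gauss b y)
          = (\<integral>\<^sup>+r. (\<integral>\<^sup>+s. ennreal (gauss r x) * (ennreal (rho c s) * ennreal (gauss (T - r - s) y)) \<partial>lborel) * ennreal (gauss b y) \<partial>lborel)"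
        by (rule nn_integral_multc[symmetric]) measurable
      also have "\<dots> = (\<integral>\<^sup>+r. \<integral>\<^sup>+s. ennreal (gauss r x) * (ennreal (rho c s) * ennreal (gauss (T - r - s) y)) * ennreal (gauss b y) \<partial>lborel \<partial>lborel)"
        by (intro nn_integral_cong nn_integral_multc[symmetric]) measurable
      finally show ?thesis by (simp add: mult.assoc)
    qed (simp add: gauss_def)
  qed
  also have "\<dots> = 2 * (\<integral>\<^sup>+y. \<integral>\<^sup>+r. \<integral>\<^sup>+s. ennreal (gauss r x) * (ennreal (rho c s) * (ennreal (gauss (T - r - s) y) * ennreal (gauss b y))) \<partial>lborel \<partial>lborel \<partial>lborel)"
    by (rule nn_integral_cmult) measurable
  also have "(\<integral>\<^sup>+y. \<integral>\<^sup>+r. \<integral>\<^sup>+s. ennreal (gauss r x) * (ennreal (rho c s) * (ennreal (gauss (T - r - s) y) * ennreal (gauss b y))) \<partial>lborel \<partial>lborel \<partial>lborel)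
      = (\<integral>\<^sup>+r. \<integral>\<^sup>+y. \<integral>\<^sup>+s. ennreal (gauss r x) * (ennreal (rho c s) * (ennreal (gauss (T - r - s) y) * ennreal (gauss b y))) \<partial>lborel \<partial>lborel \<partial>lborel)"
    by (rule lborel_pair.Fubini') measurable
  also have "\<dots> = (\<integral>\<^sup>+r. ennreal (gauss r x) * ennreal (flux_kernel c b (T - r)) \<partial>lborel)"
  proof (rule nn_integral_cong)
    fix r
    have "(\<integral>\<^sup>+y. \<integral>\<^sup>+s. ennreal (gauss r x) * (ennreal (rho c s) * (ennreal (gauss (T - r - s) y) * ennreal (gauss b y))) \<partial>lborel \<partial>lborel)
      = (\<integral>\<^sup>+s. \<integral>\<^sup>+y. ennreal (gauss r x) * (ennreal (rho c s) * (ennreal (gauss (T - r - s) y) * ennreal (gauss b y))) \<partial>lborel \<partial>lborel)"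
      by (rule lborel_pair.Fubini') measurable
    also have "\<dots> = (\<integral>\<^sup>+s. ennreal (gauss r x) * (ennreal (1 / 2) * (ennreal (rho c s) * ennreal (shifted_inverse b (T - r - s)))) \<partial>lborel)"
    proof (rule nn_integral_cong)
      fix s
      have "(\<integral>\<^sup>+y. ennreal (gauss r x) * (ennreal (rho c s) * (ennreal (gauss (T - r - s) y) * ennreal (gauss b y))) \<partial>lborel)
        = ennreal (gauss r x) * (ennreal (rho c s) * (\<integral>\<^sup>+y. ennreal (gauss (T - r - s) y) * ennreal (gauss b y) \<partial>lborel))"
        by (simp add: nn_integral_cmult)
      then show "(\<integral>\<^sup>+y. ennreal (gauss r x) * (ennreal (rho c s) * (ennreal (gauss (T - r - s) y) * ennreal (gauss b y))) \<partial>lborel)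
        = ennreal (gauss r x) * (ennreal (1 / 2) * (ennreal (rho c s) * ennreal (shifted_inverse b (T - r - s))))"
        unfolding nn_integral_gauss_gauss[OF b] by (simp only: mult_ac)
    qed
    also have "\<dots> = ennreal (gauss r x) * (ennreal (1 / 2) * (\<integral>\<^sup>+s. ennreal (rho c s) * ennreal (shifted_inverse b (T - r - s)) \<partial>lborel))"
      by (subst nn_integral_cmult, measurable)+
    finally show "(\<integral>\<^sup>+y. \<integral>\<^sup>+s. ennreal (gauss r x) * (ennreal (rho c s) * (ennreal (gauss (T - r - s) y) * ennreal (gauss b y))) \<partial>lborel \<partial>lborel)
      = ennreal (gauss r x) * ennreal (flux_kernel c b (T - r))"
      unfolding nn_flux_kernel[OF c b] .
  qed
  finally show ?thesis .
qed

lemma integrable_gauss_flux_kernel: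
  assumes c: "0 < c" and b: "0 < b" and x: "0 < x" and T: "0 < T"
  shows "integrable lborel (\<lambda>r. gauss r x * flux_kernel c b (T - r))"
proof -
  obtain Q where Q: "\<And>t. t \<in> {0..T} \<Longrightarrow> \<bar>flux_kernel c b t\<bar> \<le> Q"
    by (rule continuous_on_Icc_abs_bounded[OF continuous_flux_kernel[OF c b]]) blast
  show ?thesis
  proof (rule Bochner_Integration.integrable_bound)
    show "integrable lborel (\<lambda>r. indicator {0<..<T} r * (2 * sqrt x / x^2 * Q))"
      by (intro integrable_mult_left integrable_real_indicator) (use T in auto)
    have "\<bar>gauss r x * flux_kernel c b (T - r)\<bar> \<le> indicator {0<..<T} r * (2 * sqrt x / x^2 * Q)" for r
    proof (cases "0 < r \<and> r < T")
      case True
      then have "\<bar>gauss r x\<bar> * \<bar>flux_kernel c b (T - r)\<bar> \<le> 2 * sqrt x / x^2 * Q"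
        using gauss_nonneg[of r x] gauss_le_x[OF x, of r] x by (intro mult_mono Q) auto
      then show ?thesis using True by (simp add: abs_mult)
    next
      case False
      then have "gauss r x * flux_kernel c b (T - r) = 0" using flux_kernel_nonpos[of "T - r" c b] by (auto simp: gauss_def)
      then show ?thesis using False by (simp only: abs_zero) (auto simp: indicator_def)
    qed
    then show "AE r in lborel. norm (gauss r x * flux_kernel c b (T - r)) \<le> norm (indicator {0<..<T} r * (2 * sqrt x / x^2 * Q))"
      unfolding real_norm_def by (intro AE_I2 order.trans[OF _ abs_ge_self])
  qed measurable
qed

text \<open>The image of \<open>gauss b\<close> under the candidate kernel
  \<open>E_plus + corr_kernel\<close>. Formally it is \<open>dual_pairing\<close> with
  \<open>v\<close> replaced by the point mass at \<open>x\<close>.\<close>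

definition evolved_gauss :: "real \<Rightarrow> real \<Rightarrow> real \<Rightarrow> real \<Rightarrow> real" where
  "evolved_gauss c T b x = gauss (T + b) x + 2 * (\<integral>r. gauss r x * flux_kernel c b (T - r) \<partial>lborel)"

lemma measurable_evolved_gauss [measurable]: "evolved_gauss c T b \<in> borel_measurable borel"
  unfolding evolved_gauss_def by measurable

lemma evolved_gauss_nonneg: "0 < b \<Longrightarrow> 0 \<le> evolved_gauss c T b x"
  unfolding evolved_gauss_def by (intro add_nonneg_nonneg mult_nonneg_nonneg integral_nonneg_AE) (auto simp: gauss_nonneg flux_kernel_nonneg)

lemma ennreal_evolved_gauss:
  assumes c: "0 < c" and b: "0 < b" and x: "0 < x" and T: "0 < T"
  shows "ennreal (evolved_gauss c T b x) = ennreal (gauss (T + b) x) + 2 * (\<integral>\<^sup>+r. ennreal (gauss r x) * ennreal (flux_kernel c b (T - r)) \<partial>lborel)"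
proof -
  have "(\<integral>\<^sup>+r. ennreal (gauss r x) * ennreal (flux_kernel c b (T - r)) \<partial>lborel) = (\<integral>\<^sup>+r. ennreal (gauss r x * flux_kernel c b (T - r)) \<partial>lborel)"
    by (intro nn_integral_cong) (simp add: ennreal_mult gauss_nonneg flux_kernel_nonneg[OF b])
  also have "\<dots> = ennreal (\<integral>r. gauss r x * flux_kernel c b (T - r) \<partial>lborel)"
    by (intro nn_integral_eq_integral integrable_gauss_flux_kernel assms) (simp add: gauss_nonneg flux_kernel_nonneg[OF b])
  finally have *: "(\<integral>\<^sup>+r. ennreal (gauss r x) * ennreal (flux_kernel c b (T - r)) \<partial>lborel) = ennreal (\<integral>r. gauss r x * flux_kernel c b (T - r) \<partial>lborel)" .
  have "0 \<le> (\<integral>r. gauss r x * flux_kernel c b (T - r) \<partial>lborel)"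
    by (intro integral_nonneg_AE) (simp add: gauss_nonneg flux_kernel_nonneg[OF b])
  then show ?thesis unfolding * evolved_gauss_def by (simp add: ennreal_plus gauss_nonneg ennreal_mult')
qed

lemma has_bochner_integral_kernel_gauss:
  assumes c: "0 < c" and b: "0 < b" and x: "0 < x" and T: "0 < T"
  shows "has_bochner_integral lborel (\<lambda>y. (E_plus x y T + corr_kernel c T x y) * gauss b y) (evolved_gauss c T b x)"
proof (rule has_bochner_integral_nn_integral)
  have E0: "0 \<le> E_plus x y T * gauss b y" for y
    using E_plus_nonneg[OF x _ T, of y] gauss_nonneg[of b y] by (cases "0 < y") (auto simp: gauss_def)
  have D0: "0 \<le> corr_kernel c T x y * gauss b y" for y by (simp add: corr_kernel_nonneg gauss_nonneg)
  show "(\<integral>\<^sup>+y. ennreal ((E_plus x y T + corr_kernel c T x y) * gauss b y) \<partial>lborel) = ennreal (evolved_gauss c T b x)"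
  proof -
    have "(\<integral>\<^sup>+y. ennreal ((E_plus x y T + corr_kernel c T x y) * gauss b y) \<partial>lborel) =
        (\<integral>\<^sup>+y. ennreal (E_plus x y T * gauss b y) + ennreal (corr_kernel c T x y * gauss b y) \<partial>lborel)"
      by (intro nn_integral_cong) (simp add: distrib_right ennreal_plus E0 D0)
    also have "\<dots> = (\<integral>\<^sup>+y. ennreal (E_plus x y T * gauss b y) \<partial>lborel) + (\<integral>\<^sup>+y. ennreal (corr_kernel c T x y * gauss b y) \<partial>lborel)"
      by (rule nn_integral_add) measurable
    finally show ?thesis
      unfolding nn_integral_E_plus_gauss[OF x T b] nn_integral_corr_kernel_gauss[OF c b x] ennreal_evolved_gauss[OF c b x T] .
  qed
  show "AE y in lborel. 0 \<le> (E_plus x y T + corr_kernel c T x y) * gauss b y"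
    using E0 D0 by (intro AE_I2) (simp add: distrib_right)
  show "(\<lambda>y. (E_plus x y T + corr_kernel c T x y) * gauss b y) \<in> borel_measurable lborel" by measurable
qed (rule evolved_gauss_nonneg[OF b])

lemma integrable_shifted_inverse_flux_kernel:
  assumes c: "0 < c" and a: "0 < a" and b: "0 < b" and T: "0 < T"
  shows "integrable lborel (\<lambda>r. shifted_inverse b r * flux_kernel c a (T - r))"
proof -
  have "integrable lborel (\<lambda>r. 2 * (ip (gauss b) (gauss r) * flux_kernel c a (T - r)))"
    using T by (intro integrable_mult_right integrable_ip_gauss_flux_kernel c a sq_int_gauss) auto
  then show ?thesis by (simp add: ip_gauss_shifted_inverse[OF b])
qed

lemma dual_pairing_gauss:
  assumes c: "0 < c" and a: "0 < a" and b: "0 < b" and T: "0 < T"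
  shows "dual_pairing c a (gauss b) T = 1 / (2 * (T + b + a)) + (\<integral>r. shifted_inverse b r * flux_kernel c a (T - r) \<partial>lborel)"
proof -
  have "ip (gauss b) (gauss (a + T)) = 1 / (2 * (T + b + a))"
    using a b T by (subst ip_gauss_gauss) (auto simp: algebra_simps)
  then show ?thesis by (simp add: dual_pairing_def ip_gauss_shifted_inverse[OF b])
qed

text \<open>The candidate solution has the pairings that \<open>ip_evolution_gauss\<close>
  prescribes. It carries the flux kernel of \<open>b\<close>, the functional that of
  \<open>a\<close>; \<open>nn_flux_kernel_symmetric\<close> reconciles them.\<close>

lemma has_bochner_integral_evolved_gauss_gauss:
  assumes c: "0 < c" and a: "0 < a" and b: "0 < b" and T: "0 < T"
  shows "has_bochner_integral lborel (\<lambda>x. evolved_gauss c T b x * gauss a x) (dual_pairing c a (gauss b) T)"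
proof (rule has_bochner_integral_nn_integral)
  have I0: "0 \<le> (\<integral>r. shifted_inverse b r * flux_kernel c a (T - r) \<partial>lborel)"
    by (intro integral_nonneg_AE) (simp add: shifted_inverse_nonneg[OF b] flux_kernel_nonneg[OF a])
  show "0 \<le> dual_pairing c a (gauss b) T" unfolding dual_pairing_gauss[OF assms] using a b T I0 by simp
  show "AE x in lborel. 0 \<le> evolved_gauss c T b x * gauss a x" by (simp add: evolved_gauss_nonneg[OF b] gauss_nonneg)
  have "(\<integral>\<^sup>+x. ennreal (evolved_gauss c T b x * gauss a x) \<partial>lborel) =
      (\<integral>\<^sup>+x. ennreal (gauss (T + b) x) * ennreal (gauss a x) + 2 * (\<integral>\<^sup>+r. ennreal (flux_kernel c b (T - r)) * (ennreal (gauss r x) * ennreal (gauss a x)) \<partial>lborel) \<partial>lborel)"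
  proof (rule nn_integral_cong)
    fix x
    show "ennreal (evolved_gauss c T b x * gauss a x) =
      ennreal (gauss (T + b) x) * ennreal (gauss a x) + 2 * (\<integral>\<^sup>+r. ennreal (flux_kernel c b (T - r)) * (ennreal (gauss r x) * ennreal (gauss a x)) \<partial>lborel)"
    proof (cases "0 < x")
      case True
      have "(\<integral>\<^sup>+r. ennreal (flux_kernel c b (T - r)) * (ennreal (gauss r x) * ennreal (gauss a x)) \<partial>lborel) =
          (\<integral>\<^sup>+r. (ennreal (gauss r x) * ennreal (flux_kernel c b (T - r))) * ennreal (gauss a x) \<partial>lborel)"
        by (intro nn_integral_cong) (simp only: mult_ac)
      also have "\<dots> = (\<integral>\<^sup>+r. ennreal (gauss r x) * ennreal (flux_kernel c b (T - r)) \<partial>lborel) * ennreal (gauss a x)"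
        by (rule nn_integral_multc) measurable
      finally show ?thesis
        by (simp add: ennreal_mult evolved_gauss_nonneg[OF b] gauss_nonneg ennreal_evolved_gauss[OF c b True T] distrib_right mult.assoc)
    qed (simp add: gauss_def)
  qed
  also have "\<dots> = (\<integral>\<^sup>+x. ennreal (gauss (T + b) x) * ennreal (gauss a x) \<partial>lborel)
      + 2 * (\<integral>\<^sup>+x. \<integral>\<^sup>+r. ennreal (flux_kernel c b (T - r)) * (ennreal (gauss r x) * ennreal (gauss a x)) \<partial>lborel \<partial>lborel)"
    by (simp add: nn_integral_add nn_integral_cmult)
  also have "(\<integral>\<^sup>+x. \<integral>\<^sup>+r. ennreal (flux_kernel c b (T - r)) * (ennreal (gauss r x) * ennreal (gauss a x)) \<partial>lborel \<partial>lborel)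
      = (\<integral>\<^sup>+r. \<integral>\<^sup>+x. ennreal (flux_kernel c b (T - r)) * (ennreal (gauss r x) * ennreal (gauss a x)) \<partial>lborel \<partial>lborel)"
    by (rule lborel_pair.Fubini') measurable
  also have "\<dots> = (\<integral>\<^sup>+r. ennreal (1 / 2) * (ennreal (shifted_inverse a r) * ennreal (flux_kernel c b (T - r))) \<partial>lborel)"
    by (intro nn_integral_cong, subst nn_integral_cmult) (measurable, simp only: nn_integral_gauss_gauss[OF a] mult_ac)
  also have "\<dots> = ennreal (1 / 2) * (\<integral>\<^sup>+r. ennreal (shifted_inverse a r) * ennreal (flux_kernel c b (T - r)) \<partial>lborel)"
    by (rule nn_integral_cmult) measurable
  also have "(\<integral>\<^sup>+r. ennreal (shifted_inverse a r) * ennreal (flux_kernel c b (T - r)) \<partial>lborel) = (\<integral>\<^sup>+r. ennreal (shifted_inverse b r) * ennreal (flux_kernel c a (T - r)) \<partial>lborel)"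
    by (rule nn_flux_kernel_symmetric[OF c b a])
  also have "\<dots> = ennreal (\<integral>r. shifted_inverse b r * flux_kernel c a (T - r) \<partial>lborel)"
  proof -
    have "(\<integral>\<^sup>+r. ennreal (shifted_inverse b r) * ennreal (flux_kernel c a (T - r)) \<partial>lborel) = (\<integral>\<^sup>+r. ennreal (shifted_inverse b r * flux_kernel c a (T - r)) \<partial>lborel)"
      by (intro nn_integral_cong) (simp add: ennreal_mult shifted_inverse_nonneg[OF b] flux_kernel_nonneg[OF a])
    then show ?thesis
      using integrable_shifted_inverse_flux_kernel[OF assms] by (simp add: nn_integral_eq_integral shifted_inverse_nonneg[OF b] flux_kernel_nonneg[OF a])
  qed
  also have "2 * (ennreal (1 / 2) * ennreal (\<integral>r. shifted_inverse b r * flux_kernel c a (T - r) \<partial>lborel)) = ennreal (\<integral>r. shifted_inverse b r * flux_kernel c a (T - r) \<partial>lborel)"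
    by (rule half_twice)
  also have "(\<integral>\<^sup>+x. ennreal (gauss (T + b) x) * ennreal (gauss a x) \<partial>lborel) = ennreal (1 / (2 * (T + b + a)))"
  proof -
    have "1 / 2 * shifted_inverse a (T + b) = 1 / (2 * (T + b + a))" using a b T by (simp add: shifted_inverse_def add.commute)
    then show ?thesis unfolding nn_integral_gauss_gauss[OF a] by (subst ennreal_mult'[symmetric]) simp_all
  qed
  also have "ennreal (1 / (2 * (T + b + a))) + ennreal (\<integral>r. shifted_inverse b r * flux_kernel c a (T - r) \<partial>lborel) = ennreal (dual_pairing c a (gauss b) T)"
    unfolding dual_pairing_gauss[OF assms] using a b T I0 by (subst ennreal_plus) auto
  finally show "(\<integral>\<^sup>+x. ennreal (evolved_gauss c T b x * gauss a x) \<partial>lborel) = ennreal (dual_pairing c a (gauss b) T)" .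
qed measurable

text \<open>A closed set of full measure in an open set contains it. As \<open>h\<close> is
  continuous only on the positive axis, its zero set is cut at \<open>x / 2\<close> and completed by
  everything to the left, which makes it closed in the whole line.\<close>

lemma AE_eq_imp_eq_of_continuous:
  fixes h :: "real \<Rightarrow> real"
  assumes h: "continuous_on {0<..} h" and ae: "AE y in lborel. 0 < y \<longrightarrow> h y = 0" and x: "0 < x"
  shows "h x = 0"
proof -
  define C where "C = {..x / 2} \<union> {y \<in> {x / 2..}. h y = 0}"
  have "continuous_on {x / 2..} h" using x by (intro continuous_on_subset[OF h]) auto
  then have "closed {y \<in> {x / 2..}. h y = 0}"
    by (intro continuous_closed_preimage_constant) auto
  then have "closed C" unfolding C_def by (intro closed_Un) auto
  moreover have "AE y \<in> {x / 2<..} in lebesgue. y \<in> C"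
    using AE_completion[OF ae] by eventually_elim (use x in \<open>auto simp: C_def\<close>)
  ultimately have "x \<in> C"
    using x by (intro mem_closed_if_AE_lebesgue_open[of "{x / 2<..}" C]) auto
  then show ?thesis using x by (auto simp: C_def)
qed

text \<open>Two applications of \<open>gauss_injective\<close>. In \<open>x\<close>: the true and
  the candidate evolution of \<open>gauss (b n)\<close> agree almost everywhere, having equal
  pairings. In \<open>y\<close>, for fixed good \<open>x\<close>: the two kernels agree almost
  everywhere, having equal integrals against all \<open>gauss (b n)\<close>. Continuity in
  \<open>y\<close> then reaches \<open>y = x\<close>.\<close>

lemma heat_kernel_diagonal:
  assumes K: "heat_kernel \<theta> K" and \<theta>: "cos \<theta> \<noteq> 0" and T: "0 < T" and c: "0 < c" "ln c = - 2 * kappa \<theta>"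
  shows "AE x in lborel. 0 < x \<longrightarrow> K x x T = E_plus x x T + corr_kernel c T x x"
proof -
  define b where "b = (\<lambda>n::nat. 1 / (4 * (real n + 1)))"
  have b: "0 < b n" for n by (simp add: b_def)
  define U where "U = (\<lambda>n t x. LINT y:{0<..}|lborel. K x y t * gauss (b n) y)"
  have Kint: "set_integrable lborel {0<..} (\<lambda>y. K x y t * gauss (b n) y)" if "0 < t" "0 < x" for t x n
    using K that sq_int_gauss[of "b n"] unfolding heat_kernel_def by blast
  have evol: "\<exists>w. Delta_theta_rel \<theta> (U n t) w \<and> ((\<lambda>s. L2_norm (\<lambda>x. (U n (t + s) x - U n t x) / s + w x)) \<longlongrightarrow> 0) (at 0)"
    if "0 < t" for n t
    using K that sq_int_gauss[of "b n"] unfolding heat_kernel_def Let_def U_def by blast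
  have init: "((\<lambda>t. L2_norm (\<lambda>x. U n t x - gauss (b n) x)) \<longlongrightarrow> 0) (at_right 0)" for n
    using K sq_int_gauss[of "b n"] unfolding heat_kernel_def Let_def U_def by blast
  have dual: "ip (U n T) (gauss a) = dual_pairing c a (gauss (b n)) T" if "0 < a" for n a
    by (rule ip_evolution_gauss[OF c that \<theta> T sq_int_gauss evol init])
  have AE_U: "AE x in lborel. 0 < x \<longrightarrow> U n T x = evolved_gauss c T (b n) x" for n
  proof -
    have sU: "sq_int (U n T)" using evol[OF T, of n] by (auto simp: Delta_theta_rel_def Delta_max_rel_def)
    have iU: "integrable lborel (\<lambda>x. U n T x * gauss a x)" for a
      using sq_int_integrable_mult[OF sU sq_int_gauss, of a]
      by (simp add: set_integrable_def set_gauss del: real_scaleR_def)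
    have "AE x in lborel. 0 < x \<longrightarrow> U n T x - evolved_gauss c T (b n) x = 0"
    proof (rule gauss_injective)
      fix m :: nat
      define a where "a = 1 / (4 * (real m + 1))"
      have a: "0 < a" by (simp add: a_def)
      note hb = has_bochner_integral_evolved_gauss_gauss[OF c(1) a b[of n] T]
      have "integrable lborel (\<lambda>x. (U n T x - evolved_gauss c T (b n) x) * gauss a x)"
        unfolding left_diff_distrib using hb by (intro Bochner_Integration.integrable_diff iU) (rule integrable.intros)
      then show "integrable lborel (\<lambda>x. (U n T x - evolved_gauss c T (b n) x) * gauss (1 / (4 * (real m + 1))) x)" by (simp add: a_def)
      have "(\<integral>x. (U n T x - evolved_gauss c T (b n) x) * gauss a x \<partial>lborel) = ip (U n T) (gauss a) - dual_pairing c a (gauss (b n)) T"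
        unfolding left_diff_distrib ip_gauss_eq using hb iU by (simp add: has_bochner_integral_iff)
      then show "(\<integral>x. (U n T x - evolved_gauss c T (b n) x) * gauss (1 / (4 * (real m + 1))) x \<partial>lborel) = 0"
        using dual[OF a] by (simp add: a_def)
    qed
    then show ?thesis by simp
  qed
  \<comment> \<open>Countably many null sets are merged into one; this is what the second moment
    argument needs.\<close>
  then have "AE x in lborel. \<forall>n. 0 < x \<longrightarrow> U n T x = evolved_gauss c T (b n) x" unfolding AE_all_countable by blast
  then show ?thesis
  proof eventually_elim
    fix x assume U: "\<forall>n. 0 < x \<longrightarrow> U n T x = evolved_gauss c T (b n) x"
    show "0 < x \<longrightarrow> K x x T = E_plus x x T + corr_kernel c T x x"
    proof
      assume x: "0 < x"
      define h where "h = (\<lambda>y. K x y T - (E_plus x y T + corr_kernel c T x y))"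
      have "AE y in lborel. 0 < y \<longrightarrow> h y = 0"
      proof (rule gauss_injective)
        fix n :: nat
        note hb = has_bochner_integral_kernel_gauss[OF c(1) b[of n] x T]
        have iK: "integrable lborel (\<lambda>y. K x y T * gauss (b n) y)"
          using Kint[OF T x, of n] by (simp add: set_integrable_def set_gauss[of _ "\<lambda>y. K x y T"] del: real_scaleR_def)
        have vK: "(\<integral>y. K x y T * gauss (b n) y \<partial>lborel) = U n T x"
          by (simp add: U_def set_lebesgue_integral_def set_gauss[of _ "\<lambda>y. K x y T"] del: real_scaleR_def)
        have "integrable lborel (\<lambda>y. h y * gauss (b n) y)"
          unfolding h_def left_diff_distrib using hb by (intro Bochner_Integration.integrable_diff iK) (rule integrable.intros)
        then show "integrable lborel (\<lambda>y. h y * gauss (1 / (4 * (real n + 1))) y)" by (simp add: b_def)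
        have "(\<integral>y. h y * gauss (b n) y \<partial>lborel) = U n T x - evolved_gauss c T (b n) x"
          unfolding h_def left_diff_distrib using hb iK vK by (simp add: has_bochner_integral_iff)
        then show "(\<integral>y. h y * gauss (1 / (4 * (real n + 1))) y \<partial>lborel) = 0" using U x by (simp add: b_def)
      qed
      moreover have "continuous_on {0<..} h"
      proof -
        have "continuous_on ({0<..} \<times> {0<..}) (\<lambda>(x, y). K x y T)" using K T by (simp add: heat_kernel_def)
        then have "continuous_on {0<..} (\<lambda>y. (\<lambda>(x, y). K x y T) (x, y))"
          by (rule continuous_on_compose2) (use x in \<open>auto intro!: continuous_intros\<close>)
        then have "continuous_on {0<..} (\<lambda>y. K x y T)" by simp
        moreover have "continuous_on {0<..} (corr_kernel c T x)"
          by (intro continuous_at_imp_continuous_on ballI isCont_corr_kernel c x) simp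
        ultimately show ?thesis
          unfolding h_def by (intro continuous_on_diff continuous_on_add continuous_on_E_plus T)
      qed
      ultimately have "h x = 0" using x by (intro AE_eq_imp_eq_of_continuous)
      then show "K x x T = E_plus x x T + corr_kernel c T x x" by (simp add: h_def)
    qed
  qed
qed

section \<open>The trace\<close>

lemma nn_integral_rho:
  assumes c: "0 < c" and T: "0 < T"
  shows "(\<integral>\<^sup>+s. ennreal (indicator {..<T} s * rho c s) \<partial>lborel) = ennreal (nu c T)"
proof -
  have "(\<integral>\<^sup>+s. ennreal (indicator {..<T} s * rho c s) \<partial>lborel) = (\<integral>\<^sup>+s. ennreal (indicator {..<T} (T - s) * rho c (T - s)) \<partial>lborel)"
    by (rule nn_integral_reflect[symmetric]) measurable
  also have "\<dots> = (\<integral>\<^sup>+s. ennreal (indicator {0<..<T} s * rho c (T - s)) \<partial>lborel)"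
    by (intro nn_integral_cong) (auto simp: indicator_def rho_def)
  also have "\<dots> = ennreal (nu c T)"
    using has_bochner_integral_rho[OF c T] rho_nonneg
    by (subst nn_integral_eq_integral) (auto simp: has_bochner_integral_iff)
  finally show ?thesis .
qed

lemma nu_nonneg: "0 \<le> nu c T"
  by (simp add: nu_def H_nonneg)

text \<open>By \<open>gauss_mult_gauss\<close> the integrand has an elementary primitive. The exact
  value depends on \<open>r w / (r + w)\<close>, but both bounds depend only on
  \<open>r + w\<close>, which equals \<open>T - s\<close> in the trace integral and is thus constant
  in \<open>r\<close>.\<close>

lemma nn_integral_gauss_gauss_unit:
  assumes r: "0 < r" and w: "0 < w"
  defines "I \<equiv> (\<integral>\<^sup>+x. ennreal (indicator {0<..<1} x * (gauss r x * gauss w x)) \<partial>lborel)"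
  shows "I \<le> ennreal (1 / (2 * (r + w)))"
    and "ennreal ((1 - exp (- 1 / (4 * (r + w)))) * (1 / (2 * (r + w)))) \<le> I"
proof -
  define h where "h = r * w / (r + w)"
  have h: "0 < h" using r w by (simp add: h_def)
  define F where "F = (\<lambda>x. - exp (- (x^2) / (4 * h)))"
  have "has_bochner_integral lborel (\<lambda>x. indicator {0..1} x *\<^sub>R (x / (2 * h) * exp (- (x^2) / (4 * h)))) (F 1 - F 0)"
  proof (rule has_bochner_integral_FTC_Icc)
    fix x
    have "(F has_real_derivative x / (2 * h) * exp (- (x^2) / (4 * h))) (at x)"
      unfolding F_def using h by (auto intro!: derivative_eq_intros)
    then show "(F has_vector_derivative x / (2 * h) * exp (- (x^2) / (4 * h))) (at x within {0..1})"
      by (rule has_vector_derivative_at_within[OF has_real_derivative_iff_has_vector_derivative[THEN iffD1]])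
  qed (use h in \<open>auto intro!: continuous_intros\<close>)
  then have "has_bochner_integral lborel (\<lambda>x. 1 / (2 * (r + w)) * (indicator {0..1} x *\<^sub>R (x / (2 * h) * exp (- (x^2) / (4 * h))))) (1 / (2 * (r + w)) * (F 1 - F 0))"
    by (rule has_bochner_integral_mult_right)
  moreover have "AE x in lborel. 1 / (2 * (r + w)) * (indicator {0..1} x *\<^sub>R (x / (2 * h) * exp (- (x^2) / (4 * h)))) = indicator {0<..<1} x * (gauss r x * gauss w x)"
    using AE_lborel_singleton[of 0] AE_lborel_singleton[of 1]
  proof eventually_elim
    fix x :: real assume x: "x \<noteq> 0" "x \<noteq> 1"
    show "1 / (2 * (r + w)) * (indicator {0..1} x *\<^sub>R (x / (2 * h) * exp (- (x^2) / (4 * h)))) = indicator {0<..<1} x * (gauss r x * gauss w x)"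
    proof (cases "0 < x \<and> x < 1")
      case True
      then have "gauss h x * sqrt x = x / (2 * h) * exp (- (x^2) / (4 * h))"
        using h by (simp add: gauss_def)
      then show ?thesis using True by (simp add: gauss_mult_gauss[OF r w] h_def)
    next
      case False
      then show ?thesis using x by (auto simp: indicator_def)
    qed
  qed
  ultimately have "has_bochner_integral lborel (\<lambda>x. indicator {0<..<1} x * (gauss r x * gauss w x)) (1 / (2 * (r + w)) * (F 1 - F 0))"
    by (subst (asm) has_bochner_integral_cong_AE) auto
  then have I: "I = ennreal (1 / (2 * (r + w)) * (F 1 - F 0))"
    unfolding I_def using gauss_nonneg by (subst nn_integral_eq_integral) (auto simp: has_bochner_integral_iff)
  have F: "F 1 - F 0 = 1 - exp (- 1 / (4 * h))" by (simp add: F_def)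
  have "1 / (2 * (r + w)) * (F 1 - F 0) \<le> 1 / (2 * (r + w)) * 1"
    unfolding F using r w by (intro mult_left_mono) auto
  then show "I \<le> ennreal (1 / (2 * (r + w)))" unfolding I by (intro ennreal_leI) simp
  have "h \<le> r + w"
  proof -
    have "h \<le> r" using r w by (simp add: h_def field_simps)
    then show ?thesis using w by simp
  qed
  then have "1 / (4 * (r + w)) \<le> 1 / (4 * h)" using h by (intro divide_left_mono) auto
  then have "1 - exp (- 1 / (4 * (r + w))) \<le> F 1 - F 0" unfolding F by simp
  then have "1 / (2 * (r + w)) * (1 - exp (- 1 / (4 * (r + w)))) \<le> 1 / (2 * (r + w)) * (F 1 - F 0)"
    using r w by (intro mult_left_mono) auto
  then show "ennreal ((1 - exp (- 1 / (4 * (r + w)))) * (1 / (2 * (r + w)))) \<le> I"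
    unfolding I by (intro ennreal_leI) (simp add: mult.commute)
qed

lemma nn_integral_corr_kernel_diagonal:
  assumes c: "0 < c"
  shows "(\<integral>\<^sup>+x. ennreal (indicator {0<..<1} x * corr_kernel c T x x) \<partial>lborel) =
    2 * (\<integral>\<^sup>+s. ennreal (rho c s) * (\<integral>\<^sup>+r. \<integral>\<^sup>+x. ennreal (indicator {0<..<1} x * (gauss r x * gauss (T - r - s) x)) \<partial>lborel \<partial>lborel) \<partial>lborel)"
proof -
  have "(\<integral>\<^sup>+x. ennreal (indicator {0<..<1} x * corr_kernel c T x x) \<partial>lborel) =
     (\<integral>\<^sup>+x. 2 * (\<integral>\<^sup>+r. \<integral>\<^sup>+s. ennreal (rho c s) * ennreal (indicator {0<..<1} x * (gauss r x * gauss (T - r - s) x)) \<partial>lborel \<partial>lborel) \<partial>lborel)"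
  proof (rule nn_integral_cong)
    fix x :: real
    show "ennreal (indicator {0<..<1} x * corr_kernel c T x x) =
      2 * (\<integral>\<^sup>+r. \<integral>\<^sup>+s. ennreal (rho c s) * ennreal (indicator {0<..<1} x * (gauss r x * gauss (T - r - s) x)) \<partial>lborel \<partial>lborel)"
    proof (cases "0 < x \<and> x < 1")
      case True
      have "ennreal (gauss r x) * (ennreal (rho c s) * ennreal (gauss (T - r - s) x)) = ennreal (rho c s) * ennreal (gauss r x * gauss (T - r - s) x)" for r s
        by (simp add: ennreal_mult gauss_nonneg mult.left_commute)
      then show ?thesis using True ennreal_corr_kernel[OF c, of x x T] by simp
    qed simp
  qed
  also have "\<dots> = 2 * (\<integral>\<^sup>+x. \<integral>\<^sup>+r. \<integral>\<^sup>+s. ennreal (rho c s) * ennreal (indicator {0<..<1} x * (gauss r x * gauss (T - r - s) x)) \<partial>lborel \<partial>lborel \<partial>lborel)"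
    by (rule nn_integral_cmult) measurable
  also have "(\<integral>\<^sup>+x. \<integral>\<^sup>+r. \<integral>\<^sup>+s. ennreal (rho c s) * ennreal (indicator {0<..<1} x * (gauss r x * gauss (T - r - s) x)) \<partial>lborel \<partial>lborel \<partial>lborel)
     = (\<integral>\<^sup>+x. \<integral>\<^sup>+s. \<integral>\<^sup>+r. ennreal (rho c s) * ennreal (indicator {0<..<1} x * (gauss r x * gauss (T - r - s) x)) \<partial>lborel \<partial>lborel \<partial>lborel)"
    by (intro nn_integral_cong lborel_pair.Fubini') measurable
  also have "\<dots> = (\<integral>\<^sup>+s. \<integral>\<^sup>+x. \<integral>\<^sup>+r. ennreal (rho c s) * ennreal (indicator {0<..<1} x * (gauss r x * gauss (T - r - s) x)) \<partial>lborel \<partial>lborel \<partial>lborel)"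
    by (rule lborel_pair.Fubini') measurable
  also have "\<dots> = (\<integral>\<^sup>+s. \<integral>\<^sup>+r. \<integral>\<^sup>+x. ennreal (rho c s) * ennreal (indicator {0<..<1} x * (gauss r x * gauss (T - r - s) x)) \<partial>lborel \<partial>lborel \<partial>lborel)"
    by (intro nn_integral_cong lborel_pair.Fubini') measurable
  also have "\<dots> = (\<integral>\<^sup>+s. ennreal (rho c s) * (\<integral>\<^sup>+r. \<integral>\<^sup>+x. ennreal (indicator {0<..<1} x * (gauss r x * gauss (T - r - s) x)) \<partial>lborel \<partial>lborel) \<partial>lborel)"
  proof (rule nn_integral_cong)
    fix s
    have "(\<integral>\<^sup>+r. \<integral>\<^sup>+x. ennreal (rho c s) * ennreal (indicator {0<..<1} x * (gauss r x * gauss (T - r - s) x)) \<partial>lborel \<partial>lborel)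
      = (\<integral>\<^sup>+r. ennreal (rho c s) * (\<integral>\<^sup>+x. ennreal (indicator {0<..<1} x * (gauss r x * gauss (T - r - s) x)) \<partial>lborel) \<partial>lborel)"
      by (intro nn_integral_cong nn_integral_cmult) measurable
    also have "\<dots> = ennreal (rho c s) * (\<integral>\<^sup>+r. \<integral>\<^sup>+x. ennreal (indicator {0<..<1} x * (gauss r x * gauss (T - r - s) x)) \<partial>lborel \<partial>lborel)"
      by (rule nn_integral_cmult) measurable
    finally show "(\<integral>\<^sup>+r. \<integral>\<^sup>+x. ennreal (rho c s) * ennreal (indicator {0<..<1} x * (gauss r x * gauss (T - r - s) x)) \<partial>lborel \<partial>lborel) =
      ennreal (rho c s) * (\<integral>\<^sup>+r. \<integral>\<^sup>+x. ennreal (indicator {0<..<1} x * (gauss r x * gauss (T - r - s) x)) \<partial>lborel \<partial>lborel)" .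
  qed
  finally show ?thesis .
qed

text \<open>Up to the exponentially small defect of the unit interval, the inner integral is
  \<open>1 / (2 (T - s))\<close> over \<open>0 < r < T - s\<close>, that is one half. With the
  factor 2 only the mass of \<open>rho\<close> on \<open>(0, T)\<close> remains, which is
  \<open>nu c T\<close>. The defect for \<open>T - s\<close> is at most that for
  \<open>T\<close>.\<close>

lemma corr_kernel_diagonal_bounds:
  assumes c: "0 < c" and T: "0 < T"
  shows "integrable lborel (\<lambda>x. indicator {0<..<1} x * corr_kernel c T x x)"
    and "\<bar>(\<integral>x. indicator {0<..<1} x * corr_kernel c T x x \<partial>lborel) - nu c T\<bar> \<le> nu c T * exp (- 1 / (4 * T))"
proof -
  define W where "W = (\<lambda>s. \<integral>\<^sup>+r. \<integral>\<^sup>+x. ennreal (indicator {0<..<1} x * (gauss r x * gauss (T - r - s) x)) \<partial>lborel \<partial>lborel)"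
  define \<delta> where "\<delta> = exp (- 1 / (4 * T))"
  have \<delta>: "0 \<le> \<delta>" "\<delta> \<le> 1" using T by (simp_all add: \<delta>_def)
  have [measurable]: "W \<in> borel_measurable borel" unfolding W_def by measurable
  have zero: "(\<integral>\<^sup>+x. ennreal (indicator {0<..<1} x * (gauss r x * gauss (T - r - s) x)) \<partial>lborel) = 0"
    if "\<not> (0 < r \<and> r < T - s)" for r s
    using that by (subst nn_integral_0_iff_AE) (auto simp: gauss_def)
  have const: "(\<integral>\<^sup>+r. ennreal (indicator {0<..<L} r * z) \<partial>lborel) = ennreal (L * z)" if "0 < L" "0 \<le> z" for L z :: real
  proof -
    have "(\<integral>\<^sup>+r. ennreal (indicator {0<..<L} r * z) \<partial>lborel) = (\<integral>\<^sup>+r. ennreal z * indicator {0<..<L} r \<partial>lborel)"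
      by (intro nn_integral_cong) (auto simp: indicator_def)
    also have "\<dots> = ennreal z * ennreal L" using that by (subst nn_integral_cmult_indicator) auto
    also have "\<dots> = ennreal (L * z)" using that by (simp add: ennreal_mult mult.commute)
    finally show ?thesis .
  qed
  have up: "2 * (ennreal (rho c s) * W s) \<le> ennreal (indicator {..<T} s * rho c s)" for s
  proof (cases "0 < s \<and> s < T")
    case True
    have "W s \<le> (\<integral>\<^sup>+r. ennreal (indicator {0<..<T - s} r * (1 / (2 * (T - s)))) \<partial>lborel)"
      unfolding W_def
    proof (rule nn_integral_mono)
      fix r
      show "(\<integral>\<^sup>+x. ennreal (indicator {0<..<1} x * (gauss r x * gauss (T - r - s) x)) \<partial>lborel) \<le> ennreal (indicator {0<..<T - s} r * (1 / (2 * (T - s))))"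
        using nn_integral_gauss_gauss_unit(1)[of r "T - r - s"] zero[of r s] by (cases "0 < r \<and> r < T - s") (auto simp: algebra_simps)
    qed
    also have "\<dots> = ennreal ((T - s) * (1 / (2 * (T - s))))" using True by (intro const) auto
    also have "(T - s) * (1 / (2 * (T - s))) = 1 / 2" using True by (simp add: field_simps)
    finally have "2 * (ennreal (rho c s) * W s) \<le> 2 * (ennreal (rho c s) * ennreal (1 / 2))" by (intro mult_left_mono) auto
    also have "\<dots> = ennreal (rho c s)" unfolding mult.commute[of "ennreal (rho c s)"] by (rule half_twice)
    finally show ?thesis using True by simp
  next
    case False
    have "W s = 0" if "T \<le> s" unfolding W_def using that by (simp add: zero)
    then have z: "ennreal (rho c s) * W s = 0" using False by (cases "0 < s") (auto simp: rho_def)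
    show ?thesis unfolding z by simp
  qed
  have lo: "ennreal (1 - \<delta>) * ennreal (indicator {..<T} s * rho c s) \<le> 2 * (ennreal (rho c s) * W s)" for s
  proof (cases "0 < s \<and> s < T")
    case True
    have "(1 - \<delta>) * (1 / 2) = (T - s) * ((1 - \<delta>) * (1 / (2 * (T - s))))" using True by (simp add: field_simps)
    then have "ennreal ((1 - \<delta>) * (1 / 2)) = ennreal ((T - s) * ((1 - \<delta>) * (1 / (2 * (T - s)))))" by (rule arg_cong)
    also have "\<dots> = (\<integral>\<^sup>+r. ennreal (indicator {0<..<T - s} r * ((1 - \<delta>) * (1 / (2 * (T - s))))) \<partial>lborel)"
      using True \<delta> by (intro const[symmetric]) auto
    also have "\<dots> \<le> W s"
      unfolding W_def
    proof (rule nn_integral_mono)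
      fix r
      show "ennreal (indicator {0<..<T - s} r * ((1 - \<delta>) * (1 / (2 * (T - s))))) \<le> (\<integral>\<^sup>+x. ennreal (indicator {0<..<1} x * (gauss r x * gauss (T - r - s) x)) \<partial>lborel)"
      proof (cases "0 < r \<and> r < T - s")
        case r: True
        have "exp (- 1 / (4 * (T - s))) \<le> \<delta>"
          unfolding \<delta>_def using True T by (simp add: frac_le)
        then have "(1 - \<delta>) * (1 / (2 * (T - s))) \<le> (1 - exp (- 1 / (4 * (T - s)))) * (1 / (2 * (T - s)))"
          using True by (intro mult_right_mono) auto
        then have "ennreal ((1 - \<delta>) * (1 / (2 * (T - s)))) \<le> ennreal ((1 - exp (- 1 / (4 * (T - s)))) * (1 / (2 * (T - s))))"
          by (rule ennreal_leI)
        also have "\<dots> \<le> (\<integral>\<^sup>+x. ennreal (indicator {0<..<1} x * (gauss r x * gauss (T - r - s) x)) \<partial>lborel)"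
          using nn_integral_gauss_gauss_unit(2)[of r "T - r - s"] r by simp
        finally show ?thesis using r by simp
      qed simp
    qed
    finally have "2 * (ennreal (rho c s) * ennreal ((1 - \<delta>) * (1 / 2))) \<le> 2 * (ennreal (rho c s) * W s)" by (intro mult_left_mono) auto
    moreover have "2 * (ennreal (rho c s) * ennreal ((1 - \<delta>) * (1 / 2))) = ennreal (1 - \<delta>) * ennreal (rho c s)"
    proof -
      have "ennreal ((1 - \<delta>) * (1 / 2)) = ennreal (1 / 2) * ennreal (1 - \<delta>)" using \<delta> by (subst ennreal_mult[symmetric]) (auto simp: mult.commute)
      then have "2 * (ennreal (rho c s) * ennreal ((1 - \<delta>) * (1 / 2))) = 2 * (ennreal (1 / 2) * (ennreal (1 - \<delta>) * ennreal (rho c s)))"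
        by (simp only: mult_ac)
      then show ?thesis by (simp only: half_twice)
    qed
    ultimately show ?thesis using True by simp
  next
    case False
    then have z: "indicator {..<T} s * rho c s = 0" by (auto simp: rho_def indicator_def)
    show ?thesis unfolding z by simp
  qed
  define I where "I = (\<integral>\<^sup>+x. ennreal (indicator {0<..<1} x * corr_kernel c T x x) \<partial>lborel)"
  have I: "I = (\<integral>\<^sup>+s. 2 * (ennreal (rho c s) * W s) \<partial>lborel)"
    unfolding I_def nn_integral_corr_kernel_diagonal[OF c] W_def by (rule nn_integral_cmult[symmetric]) measurable
  have I1: "I \<le> ennreal (nu c T)"
    unfolding I nn_integral_rho[OF c T, symmetric] by (intro nn_integral_mono up)
  have "ennreal ((1 - \<delta>) * nu c T) = ennreal (1 - \<delta>) * ennreal (nu c T)" using \<delta> nu_nonneg by (simp add: ennreal_mult)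
  also have "\<dots> = (\<integral>\<^sup>+s. ennreal (1 - \<delta>) * ennreal (indicator {..<T} s * rho c s) \<partial>lborel)"
    unfolding nn_integral_rho[OF c T, symmetric] by (rule nn_integral_cmult[symmetric]) measurable
  also have "\<dots> \<le> I" unfolding I by (intro nn_integral_mono lo)
  finally have I2: "ennreal ((1 - \<delta>) * nu c T) \<le> I" .
  have nonneg: "0 \<le> indicator {0<..<1} x * corr_kernel c T x x" for x by (simp add: corr_kernel_nonneg)
  show int: "integrable lborel (\<lambda>x. indicator {0<..<1} x * corr_kernel c T x x)"
  proof (rule integrableI_nonneg)
    have "I < \<infinity>" using I1 by (rule order.strict_trans1) simp
    then show "(\<integral>\<^sup>+x. ennreal (indicator {0<..<1} x * corr_kernel c T x x) \<partial>lborel) < \<infinity>" by (simp add: I_def)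
  qed (use nonneg in auto)
  define J where "J = (\<integral>x. indicator {0<..<1} x * corr_kernel c T x x \<partial>lborel)"
  have J: "I = ennreal J" unfolding I_def J_def by (intro nn_integral_eq_integral int) (simp add: nonneg)
  have J0: "0 \<le> J" unfolding J_def by (intro integral_nonneg_AE) (simp add: nonneg)
  have "J \<le> nu c T" using I1 nu_nonneg by (simp add: J)
  moreover have "(1 - \<delta>) * nu c T \<le> J" using I2 J0 by (simp add: J)
  ultimately show "\<bar>(\<integral>x. indicator {0<..<1} x * corr_kernel c T x x \<partial>lborel) - nu c T\<bar> \<le> nu c T * exp (- 1 / (4 * T))"
    unfolding J_def[symmetric] \<delta>_def[symmetric] by (simp add: abs_le_iff algebra_simps)
qed

text \<open>Agreement of the kernels for almost every diagonal point suffices under the integral;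
  measurability of the diagonal of \<open>K\<close> comes from its joint continuity.\<close>

lemma Tr1_diff_bound:
  assumes K: "heat_kernel \<theta> K" and \<theta>: "cos \<theta> \<noteq> 0" and T: "0 < T" and c: "0 < c" "ln c = - 2 * kappa \<theta>"
  shows "\<bar>Tr1 K T - Tr1 E_plus T - nu c T\<bar> \<le> nu c T * exp (- 1 / (4 * T))"
proof -
  have iE: "integrable lborel (\<lambda>x. indicator {0<..<1} x * E_plus x x T)"
  proof -
    have "continuous_on {0..1} (\<lambda>x. E_plus x x T)"
      unfolding E_plus_def using T by (intro continuous_intros) auto
    then have "set_integrable lborel {0..1} (\<lambda>x. E_plus x x T)" by (rule borel_integrable_atLeastAtMost')
    then have "set_integrable lborel {0<..<1} (\<lambda>x. E_plus x x T)" by (rule set_integrable_subset) auto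
    then show ?thesis by (simp add: set_integrable_def)
  qed
  note D = corr_kernel_diagonal_bounds[OF c(1) T]
  have mK: "(\<lambda>x. indicator {0<..<1} x * K x x T) \<in> borel_measurable borel"
  proof -
    have "continuous_on ({0<..} \<times> {0<..}) (\<lambda>(x, y). K x y T)" using K T by (simp add: heat_kernel_def)
    then have "continuous_on {0<..} (\<lambda>x. (\<lambda>(x, y). K x y T) (x, x))"
      by (rule continuous_on_compose2) (auto intro!: continuous_intros)
    then have "continuous_on {0<..} (\<lambda>x. K x x T)" by simp
    then have "continuous_on {0<..<1} (\<lambda>x. K x x T)" by (rule continuous_on_subset) auto
    then have "(\<lambda>x. indicator {0<..<1} x *\<^sub>R K x x T) \<in> borel_measurable borel"
      by (intro borel_measurable_continuous_on_indicator) auto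
    then show ?thesis by simp
  qed
  have "Tr1 K T = (\<integral>x. indicator {0<..<1} x * E_plus x x T + indicator {0<..<1} x * corr_kernel c T x x \<partial>lborel)"
    unfolding Tr1_def set_lebesgue_integral_def real_scaleR_def
  proof (rule integral_cong_AE)
    show "AE x in lborel. indicator {0<..<1} x * K x x T = indicator {0<..<1} x * E_plus x x T + indicator {0<..<1} x * corr_kernel c T x x"
      using heat_kernel_diagonal[OF K \<theta> T c] by eventually_elim (auto simp: indicator_def)
  qed (use mK in auto)
  also have "\<dots> = Tr1 E_plus T + (\<integral>x. indicator {0<..<1} x * corr_kernel c T x x \<partial>lborel)"
    using iE D(1) by (simp add: Tr1_def set_lebesgue_integral_def)
  finally show ?thesis using D(2) by simp
qed

section \<open>A Hankel representation on the real line\<close>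

text \<open>For \<open>s = real k\<close> the quotient is \<open>0 / 0 = 0\<close> instead of its limit \<open>1\<close>; these exceptional points form a null set.\<close>

definition sincexp :: "nat \<Rightarrow> real \<Rightarrow> real" where
  "sincexp k s = exp (real k - s) * (sin (pi * (real k - s)) / (pi * (real k - s)))"

text \<open>Folding the Hankel contour of \<open>rGamma (s + 1)\<close> onto the real axis diverges at \<open>0\<close>. The part below \<open>exp 1\<close> is therefore
  integrated termwise, as if analytically continued in \<open>s\<close>, which gives \<open>hankel_series\<close>; the recursion in \<open>s\<close> of both parts justifies this.\<close>

definition hankel_tail :: "real \<Rightarrow> real \<Rightarrow> real" where
  "hankel_tail x s = (\<integral>v. indicator {exp 1..} v * (exp (- (x * v)) * v powr (- s - 1)) \<partial>lborel)"

lemma sincexp_abs_le: "\<bar>sincexp k s\<bar> \<le> exp (real k - s)"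
proof -
  have "\<bar>sin y / y\<bar> \<le> 1" for y :: real
    using abs_sin_x_le_abs_x[of y] by (cases "y = 0") (auto simp: divide_le_eq)
  then have "exp (real k - s) * \<bar>sin (pi * (real k - s)) / (pi * (real k - s))\<bar> \<le> exp (real k - s)"
    by (intro mult_left_le) auto
  then show ?thesis by (simp only: sincexp_def abs_mult abs_exp_cancel)
qed

lemma measurable_sincexp [measurable]: "sincexp k \<in> borel_measurable borel"
  unfolding sincexp_def by measurable

lemma sin_pi_nat_diff: "sin (pi * (real k - s)) = - ((- 1) ^ k * sin (pi * s))"
  by (simp add: right_diff_distrib sin_diff)

lemma sincexp_mult:
  assumes "s \<noteq> real k"
  shows "(real k - s) * sincexp k s = - ((- 1) ^ k * exp (real k - s) * (sin (pi * s) / pi))"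
  using assms by (simp add: sincexp_def sin_pi_nat_diff)

lemma sincexp_Suc: "sincexp (Suc k) s = sincexp k (s - 1)"
  by (simp add: sincexp_def algebra_simps)

lemma summable_sincexp: "summable (\<lambda>k. \<bar>x ^ k / fact k * sincexp k s\<bar>)"
proof (rule summable_comparison_test)
  show "\<exists>N. \<forall>k\<ge>N. norm \<bar>x ^ k / fact k * sincexp k s\<bar> \<le> exp (- s) * (inverse (fact k) * (\<bar>x\<bar> * exp 1) ^ k)"
  proof (intro exI[of _ 0] allI impI)
    fix k
    have "\<bar>x ^ k / fact k\<bar> * \<bar>sincexp k s\<bar> \<le> \<bar>x ^ k / fact k\<bar> * exp (real k - s)"
      by (intro mult_left_mono sincexp_abs_le) auto
    also have "exp (real k - s) = exp (- s) * exp 1 ^ k"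
      by (simp add: exp_of_nat_mult[symmetric] exp_add[symmetric])
    also have "\<bar>x ^ k / fact k\<bar> * (exp (- s) * exp 1 ^ k) = exp (- s) * (inverse (fact k) * (\<bar>x\<bar> * exp 1) ^ k)"
      by (simp add: abs_mult power_abs power_mult_distrib divide_inverse mult_ac)
    finally show "norm \<bar>x ^ k / fact k * sincexp k s\<bar> \<le> exp (- s) * (inverse (fact k) * (\<bar>x\<bar> * exp 1) ^ k)"
      by (simp add: abs_mult)
  qed
  show "summable (\<lambda>k. exp (- s) * (inverse (fact k) * (\<bar>x\<bar> * exp 1) ^ k))"
    by (intro summable_mult summable_exp)
qed

text \<open>Termwise, \<open>exp (- x v)\<close> is expanded and \<open>v powr (k - s - 1)\<close>
  integrated over \<open>(0, e)\<close> to \<open>exp (k - s) / (k - s)\<close>. The factor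
  \<open>- sin (pi s) / pi\<close> in front turns the pole at \<open>s = k\<close> into the quotient
  in \<open>sincexp\<close>.\<close>

definition hankel_series :: "real \<Rightarrow> real \<Rightarrow> real" where
  "hankel_series x s = (\<Sum>k. x ^ k / fact k * sincexp k s)"

lemma exp_series: "(\<lambda>k. y ^ k / fact k) sums exp (y::real)"
  using exp_converges[of y] by (simp add: divide_inverse mult.commute)

text \<open>Split \<open>s = k - (k - s)\<close>. The factor \<open>k\<close> reduces the factorial
  and shifts the index, giving the series at \<open>s - 1\<close>; the factor \<open>k - s\<close>
  cancels the denominator of \<open>sincexp\<close> and leaves an exponential series.\<close>

lemma hankel_series_rec:
  assumes s: "\<And>k::nat. s \<noteq> real k"
  shows "s * hankel_series x s = x * hankel_series x (s - 1) + sin (pi * s) / pi * exp (- s) * exp (- (x * exp 1))"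
proof -
  have sm: "summable (\<lambda>k. x ^ k / fact k * sincexp k s)" for s
    using summable_sincexp by (rule summable_rabs_cancel)
  have e: "(\<lambda>k. sin (pi * s) / pi * exp (- s) * ((- (x * exp 1)) ^ k / fact k)) sums (sin (pi * s) / pi * exp (- s) * exp (- (x * exp 1)))"
    by (intro sums_mult exp_series)
  have term_eq: "s * (x ^ k / fact k * sincexp k s) = real k * (x ^ k / fact k * sincexp k s) + sin (pi * s) / pi * exp (- s) * ((- (x * exp 1)) ^ k / fact k)" for k
  proof -
    have "s * sincexp k s = real k * sincexp k s - (real k - s) * sincexp k s" by (simp add: algebra_simps)
    also have "\<dots> = real k * sincexp k s + (- 1) ^ k * exp (real k - s) * (sin (pi * s) / pi)"
      unfolding sincexp_mult[OF s] by simp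
    also have "exp (real k - s) = exp (- s) * exp 1 ^ k"
      by (simp add: exp_of_nat_mult[symmetric] exp_add[symmetric])
    finally have "s * (x ^ k / fact k * sincexp k s) = x ^ k / fact k * (real k * sincexp k s + (- 1) ^ k * (exp (- s) * exp 1 ^ k) * (sin (pi * s) / pi))"
      by (simp add: mult_ac)
    moreover have "(- (x * exp 1)) ^ k = (- 1) ^ k * x ^ k * exp 1 ^ k"
      by (simp add: power_minus[of "x * exp 1"] power_mult_distrib)
    ultimately show ?thesis by (simp add: algebra_simps)
  qed
  have sk: "(\<lambda>k. real k * (x ^ k / fact k * sincexp k s)) sums (x * hankel_series x (s - 1))"
  proof -
    have sm1: "(\<lambda>k. x * (x ^ k / fact k * sincexp k (s - 1))) sums (x * hankel_series x (s - 1))"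
      unfolding hankel_series_def by (intro sums_mult summable_sums sm)
    have e: "x * (x ^ k / fact k * sincexp k (s - 1)) = real (Suc k) * (x ^ Suc k / fact (Suc k) * sincexp (Suc k) s)" for k
    proof -
      have "real (Suc k) * (x ^ Suc k / fact (Suc k)) = x * (x ^ k / fact k)"
        by (simp add: fact_Suc del: of_nat_Suc)
      then show ?thesis unfolding sincexp_Suc by (simp only: mult.assoc[symmetric])
    qed
    have "(\<lambda>k. real (Suc k) * (x ^ Suc k / fact (Suc k) * sincexp (Suc k) s)) sums (x * hankel_series x (s - 1))"
      using sm1 unfolding e .
    then show ?thesis using sums_Suc_iff[of "\<lambda>k. real k * (x ^ k / fact k * sincexp k s)"] by simp
  qed
  have "(\<lambda>k. s * (x ^ k / fact k * sincexp k s)) sums (x * hankel_series x (s - 1) + sin (pi * s) / pi * exp (- s) * exp (- (x * exp 1)))"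
    unfolding term_eq by (rule sums_add[OF sk e])
  moreover have "(\<lambda>k. s * (x ^ k / fact k * sincexp k s)) sums (s * hankel_series x s)"
    unfolding hankel_series_def by (intro sums_mult summable_sums sm)
  ultimately show ?thesis by (rule sums_unique2[symmetric])
qed

lemma integrable_exp_atLeast:
  fixes x a :: real
  assumes x: "0 < x"
  shows "integrable lborel (\<lambda>v. indicator {a..} v * exp (- (x * v)))"
proof -
  have "((\<lambda>t. exp (- x * t)) has_integral exp (- x * a) / x) {a..}"
    by (rule has_integral_exp_minus_to_infinity[OF x])
  then have "((\<lambda>t. if t \<in> {a..} then exp (- (x * t)) else 0) has_integral exp (- x * a) / x) UNIV"
    by (subst has_integral_restrict_UNIV) simp
  then have "has_bochner_integral lborel (\<lambda>t. if t \<in> {a..} then exp (- (x * t)) else 0) (exp (- x * a) / x)"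
    by (intro has_bochner_integral_of_has_integral) auto
  then have "integrable lborel (\<lambda>t. if t \<in> {a..} then exp (- (x * t)) else 0)" by (rule integrable.intros)
  then show ?thesis
    by (rule Bochner_Integration.integrable_bound) (auto simp: indicator_def)
qed

lemma powr_neg_le_one:
  fixes v s :: real
  assumes "exp 1 \<le> v" "0 \<le> s"
  shows "v powr (- s) \<le> 1"
proof -
  have "1 \<le> v" using assms(1) one_le_exp_iff[of "1::real"] by linarith
  then show ?thesis using powr_mono[of "- s" 0 v] assms(2) by simp
qed

lemma integrable_hankel_tail:
  fixes x s :: real
  assumes x: "0 < x" and s: "- 1 \<le> s"
  shows "integrable lborel (\<lambda>v. indicator {exp 1..} v * (exp (- (x * v)) * v powr (- s - 1)))"
proof (rule Bochner_Integration.integrable_bound[OF integrable_exp_atLeast[OF x, of "exp 1"]])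
  have "exp (- (x * v)) * v powr (- s - 1) \<le> exp (- (x * v))" if "exp 1 \<le> v" for v
    using powr_neg_le_one[OF that, of "s + 1"] s by (intro mult_left_le) auto
  then show "AE v in lborel. norm (indicator {exp 1..} v * (exp (- (x * v)) * v powr (- s - 1))) \<le> norm (indicator {exp 1..} v * exp (- (x * v)))"
    by (intro AE_I2) (auto simp: indicator_def)
qed measurable

text \<open>Integration by parts in \<open>v\<close>. The boundary term at \<open>v = e\<close>,
  multiplied by \<open>- sin (pi s) / pi\<close>, is the negative of the extra term in
  \<open>hankel_series_rec\<close>, so the combination of both parts obeys a homogeneous
  recursion.\<close>

lemma hankel_tail_rec:
  fixes x s :: real
  assumes x: "0 < x" and s: "0 < s"
  shows "s * hankel_tail x s = exp (- (x * exp 1)) * exp (- s) - x * hankel_tail x (s - 1)"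
proof -
  define f where "f = (\<lambda>v. s * (exp (- (x * v)) * v powr (- s - 1)) + x * (exp (- (x * v)) * v powr (- (s - 1) - 1)))"
  define F where "F = (\<lambda>v. - (exp (- (x * v)) * v powr (- s)))"
  have "(\<integral>\<^sup>+v. ennreal (f v) * indicator {exp 1..} v \<partial>lborel) = ennreal (0 - F (exp 1))"
  proof (rule nn_integral_FTC_atLeast)
    show "f \<in> borel_measurable borel" unfolding f_def by measurable
    fix v :: real assume v: "exp 1 \<le> v"
    have v0: "0 < v" using v exp_gt_zero[of "1::real"] by linarith
    have "((\<lambda>v. v powr (- s)) has_real_derivative - s * v powr (- s - 1)) (at v)"
      using v0 by (rule has_real_derivative_powr)
    moreover have "((\<lambda>v. exp (- (x * v))) has_real_derivative - x * exp (- (x * v))) (at v)"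
      by (auto intro!: derivative_eq_intros)
    ultimately have "(F has_real_derivative - (- x * exp (- (x * v)) * v powr (- s) + - s * v powr (- s - 1) * exp (- (x * v)))) (at v)"
      unfolding F_def by (intro DERIV_minus DERIV_mult)
    then show "(F has_real_derivative f v) (at v)"
      by (simp add: f_def algebra_simps)
    show "0 \<le> f v" using s x by (simp add: f_def)
  next
    show "(F \<longlongrightarrow> 0) at_top"
    proof (rule Lim_null_comparison)
      show "\<forall>\<^sub>F v in at_top. norm (F v) \<le> exp (- (x * v))"
        using eventually_ge_at_top[of "exp 1"]
      proof eventually_elim
        case (elim v)
        have "exp (- (x * v)) * v powr (- s) \<le> exp (- (x * v))"
          using powr_neg_le_one[OF elim, of s] s by (intro mult_left_le) auto
        then show ?case by (simp add: F_def)
      qed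
      show "((\<lambda>v. exp (- (x * v))) \<longlongrightarrow> 0) at_top" using x by real_asymp
    qed
  qed
  moreover have "- F (exp 1) = exp (- (x * exp 1)) * exp (- s)" by (simp add: F_def powr_def)
  ultimately have nn: "(\<integral>\<^sup>+v. ennreal (indicator {exp 1..} v * f v) \<partial>lborel) = ennreal (exp (- (x * exp 1)) * exp (- s))"
    by (auto intro!: nn_integral_cong simp: indicator_def elim!: trans[rotated])
  have "has_bochner_integral lborel (\<lambda>v. indicator {exp 1..} v * f v) (exp (- (x * exp 1)) * exp (- s))"
  proof (rule has_bochner_integral_nn_integral[OF _ _ _ nn])
    show "(\<lambda>v. indicator {exp 1..} v * f v) \<in> borel_measurable lborel" unfolding f_def by measurable
    show "AE v in lborel. 0 \<le> indicator {exp 1..} v * f v" using s x by (auto simp: f_def)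
  qed simp
  then have "exp (- (x * exp 1)) * exp (- s) = (\<integral>v. indicator {exp 1..} v * f v \<partial>lborel)"
    by (simp add: has_bochner_integral_iff)
  also have "\<dots> = (\<integral>v. s * (indicator {exp 1..} v * (exp (- (x * v)) * v powr (- s - 1))) + x * (indicator {exp 1..} v * (exp (- (x * v)) * v powr (- (s - 1) - 1))) \<partial>lborel)"
    by (intro Bochner_Integration.integral_cong) (auto simp: f_def algebra_simps)
  also have "\<dots> = s * hankel_tail x s + x * hankel_tail x (s - 1)"
    unfolding hankel_tail_def using x s integrable_hankel_tail[of x s] integrable_hankel_tail[of x "s - 1"]
    by (subst Bochner_Integration.integral_add) auto
  finally show ?thesis by simp
qed

lemma rGamma_reflection_real: "rGamma z * rGamma (1 - z) = sin (pi * z) / (pi::real)"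
proof -
  have "complex_of_real (rGamma z * rGamma (1 - z)) = complex_of_real (sin (pi * z) / pi)"
  proof -
    have "sin (complex_of_real pi * complex_of_real z) = complex_of_real (sin (pi * z))"
      by (simp only: of_real_mult[symmetric] sin_of_real)
    then show ?thesis
      using rGamma_reflection_complex[of "complex_of_real z"]
      by (simp add: rGamma_complex_of_real[symmetric] del: rGamma_complex_of_real)
  qed
  then show ?thesis by (simp only: of_real_eq_iff)
qed

text \<open>In this strip the folded integral converges at 0: over the whole half line it equals
  \<open>Gamma (- s) * x powr s\<close>, and the reflection formula gives
  \<open>rGamma (s + 1)\<close>. Splitting at \<open>v = e\<close> and expanding the exponential
  below gives the two parts.\<close>

lemma rGamma_series_base:
  assumes x: "0 < x" and s: "- 1 < s" "s < 0"
  shows "x powr s * rGamma (s + 1) = - (sin (pi * s) / pi) * hankel_tail x s + hankel_series x s"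
proof -
  define p where "p = - s"
  have p: "0 < p" "p < 1" using s by (simp_all add: p_def)
  have sk: "s \<noteq> real k" for k using s by auto
  define f where "f = (\<lambda>v. exp (- (x * v)) * v powr (p - 1))"
  have full: "has_bochner_integral lborel (\<lambda>v. indicator {0<..} v * f v) (Gamma p * x powr (- p))"
  proof -
    define g where "g = (\<lambda>t::real. if t \<in> {0..} then t powr (p - 1) / exp t else 0)"
    have "(g has_integral Gamma p) UNIV"
      unfolding g_def has_integral_restrict_UNIV by (rule Gamma_integral_real[OF p(1)])
    then have g: "has_bochner_integral lborel g (Gamma p)"
      by (intro has_bochner_integral_of_has_integral) (auto simp: g_def)
    have "has_bochner_integral lborel (\<lambda>v. g (0 + x * v)) (Gamma p /\<^sub>R \<bar>x\<bar>)"
      using lborel_has_bochner_integral_real_affine_iff[of x g "Gamma p" 0] g x by simp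
    then have hb: "has_bochner_integral lborel (\<lambda>v. x powr (1 - p) * g (0 + x * v)) (x powr (1 - p) * (Gamma p /\<^sub>R \<bar>x\<bar>))"
      by (rule has_bochner_integral_mult_right)
    have e1: "x powr (1 - p) * (Gamma p /\<^sub>R \<bar>x\<bar>) = Gamma p * x powr (- p)"
      using x by (simp add: powr_diff powr_minus divide_inverse)
    have e2: "x powr (1 - p) * g (0 + x * v) = indicator {0<..} v * f v" for v
    proof (cases "0 < v")
      case True
      have "x powr (1 - p) * (x * v) powr (p - 1) = v powr (p - 1)"
        using x True by (simp add: powr_mult powr_add[symmetric] mult.assoc[symmetric])
      then show ?thesis using x True by (simp add: g_def f_def exp_minus divide_inverse mult.assoc[symmetric])
    next
      case False
      then show ?thesis using x by (auto simp: g_def mult_le_0_iff zero_le_mult_iff)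
    qed
    show ?thesis using hb unfolding e1 e2 .
  qed
  define h where "h = (\<lambda>k v. indicator {0<..<exp 1} v * ((- x) ^ k / fact k * v powr (real k + p - 1)))"
  have hk: "has_bochner_integral lborel (\<lambda>v. indicator {0<..<exp 1} v * v powr (real k + p - 1)) (exp (real k + p) / (real k + p))" for k
  proof -
    have "((\<lambda>v. v powr (real k + p - 1)) has_integral exp 1 powr (real k + p - 1 + 1) / (real k + p - 1 + 1)) {0..exp 1}"
      using p by (intro has_integral_powr_from_0) auto
    then have "((\<lambda>v. if v \<in> {0..exp 1} then v powr (real k + p - 1) else 0) has_integral exp (real k + p) / (real k + p)) UNIV"
      by (subst has_integral_restrict_UNIV) (simp add: powr_def)
    then have "has_bochner_integral lborel (\<lambda>v. if v \<in> {0..exp 1} then v powr (real k + p - 1) else 0) (exp (real k + p) / (real k + p))"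
      by (intro has_bochner_integral_of_has_integral) auto
    moreover have "AE v in lborel. (if v \<in> {0..exp 1} then v powr (real k + p - 1) else 0) = indicator {0<..<exp 1} v * v powr (real k + p - 1)"
      using AE_lborel_singleton[of 0] AE_lborel_singleton[of "exp 1"] by eventually_elim (auto simp: indicator_def)
    ultimately show ?thesis by (subst (asm) has_bochner_integral_cong_AE) auto
  qed
  have h_int: "integrable lborel (h k)" and h_val: "(\<integral>v. h k v \<partial>lborel) = (- x) ^ k / fact k * (exp (real k + p) / (real k + p))" for k
  proof -
    have "has_bochner_integral lborel (\<lambda>v. (- x) ^ k / fact k * (indicator {0<..<exp 1} v * v powr (real k + p - 1))) ((- x) ^ k / fact k * (exp (real k + p) / (real k + p)))"
      by (rule has_bochner_integral_mult_right[OF hk])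
    then show "integrable lborel (h k)" "(\<integral>v. h k v \<partial>lborel) = (- x) ^ k / fact k * (exp (real k + p) / (real k + p))"
      by (simp_all add: has_bochner_integral_iff h_def mult.left_commute)
  qed
  have h_abs: "(\<integral>v. norm (h k v) \<partial>lborel) = x ^ k / fact k * (exp (real k + p) / (real k + p))" for k
  proof -
    have "norm (h k v) = x ^ k / fact k * (indicator {0<..<exp 1} v * v powr (real k + p - 1))" for v
      using x by (simp add: h_def abs_mult power_abs indicator_def)
    then show ?thesis using hk[of k] by (simp add: has_bochner_integral_iff)
  qed
  have h_sum: "(\<lambda>k. h k v) sums (indicator {0<..<exp 1} v * f v)" for v
  proof (cases "v \<in> {0<..<exp 1}")
    case True
    have "(\<lambda>k. v powr (p - 1) * ((- (x * v)) ^ k / fact k)) sums (v powr (p - 1) * exp (- (x * v)))"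
      by (intro sums_mult exp_series)
    moreover have "v powr (p - 1) * ((- (x * v)) ^ k / fact k) = h k v" for k
    proof -
      have "v powr (real k + p - 1) = v ^ k * v powr (p - 1)"
        using True powr_add[of v "real k" "p - 1"] by (simp add: powr_realpow add_diff_eq)
      moreover have "(- (x * v)) ^ k = (- x) ^ k * v ^ k" by (simp add: power_mult_distrib[symmetric])
      ultimately show ?thesis using True by (simp add: h_def)
    qed
    ultimately show ?thesis using True by (simp add: f_def mult.commute)
  qed (simp add: h_def)
  have sum_bound: "summable (\<lambda>k. x ^ k / fact k * (exp (real k + p) / (real k + p)))"
  proof (rule summable_comparison_test)
    show "\<exists>N. \<forall>k\<ge>N. norm (x ^ k / fact k * (exp (real k + p) / (real k + p))) \<le> exp p / p * ((x * exp 1) ^ k / fact k)"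
    proof (intro exI[of _ 0] allI impI)
      fix k :: nat
      have "exp (real k + p) / (real k + p) \<le> exp (real k + p) / p" using p by (intro divide_left_mono) auto
      then have "x ^ k / fact k * (exp (real k + p) / (real k + p)) \<le> x ^ k / fact k * (exp (real k + p) / p)"
        using x by (intro mult_left_mono) auto
      also have "\<dots> = exp p / p * ((x * exp 1) ^ k / fact k)"
        by (simp add: exp_add power_mult_distrib exp_of_nat_mult[symmetric] mult_ac)
      finally show "norm (x ^ k / fact k * (exp (real k + p) / (real k + p))) \<le> exp p / p * ((x * exp 1) ^ k / fact k)"
        using x p by simp
    qed
    show "summable (\<lambda>k. exp p / p * ((x * exp 1) ^ k / fact k))"
      by (intro summable_mult sums_summable[OF exp_series])
  qed
  have sums: "(\<lambda>k. \<integral>v. h k v \<partial>lborel) sums (\<integral>v. (\<Sum>k. h k v) \<partial>lborel)"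
  proof (rule sums_integral[OF h_int])
    show "AE v in lborel. summable (\<lambda>k. norm (h k v))"
    proof (intro AE_I2)
      fix v
      have "summable (\<lambda>k. indicator {0<..<exp 1} v * (v powr (p - 1) * ((x * v) ^ k / fact k)))"
        by (intro summable_mult sums_summable[OF exp_series])
      moreover have "indicator {0<..<exp 1} v * (v powr (p - 1) * ((x * v) ^ k / fact k)) = norm (h k v)" for k
      proof (cases "v \<in> {0<..<exp 1}")
        case True
        then have "v powr (real k + p - 1) = v ^ k * v powr (p - 1)"
          using powr_add[of v "real k" "p - 1"] by (simp add: powr_realpow add_diff_eq)
        then show ?thesis using True x by (simp add: h_def abs_mult power_abs power_mult_distrib)
      qed (simp add: h_def)
      ultimately show "summable (\<lambda>k. norm (h k v))" by simp
    qed
    show "summable (\<lambda>k. \<integral>v. norm (h k v) \<partial>lborel)" unfolding h_abs by (rule sum_bound)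
  qed
  have small_int: "integrable lborel (\<lambda>v. indicator {0<..<exp 1} v * f v)"
    by (rule Bochner_Integration.integrable_bound[of _ "\<lambda>v. indicator {0<..} v * f v"])
       (use full in \<open>auto simp: has_bochner_integral_iff indicator_def f_def\<close>)
  have Ip: "hankel_tail x s = Gamma p * x powr (- p) - (\<integral>v. indicator {0<..<exp 1} v * f v \<partial>lborel)"
  proof -
    have "hankel_tail x s = (\<integral>v. indicator {0<..} v * f v - indicator {0<..<exp 1} v * f v \<partial>lborel)"
      unfolding hankel_tail_def
      by (intro Bochner_Integration.integral_cong) (auto simp: indicator_def f_def p_def intro: less_le_trans[OF exp_gt_zero])
    then show ?thesis using full small_int by (simp add: has_bochner_integral_iff)
  qed
  have "(\<lambda>k. (- x) ^ k / fact k * (exp (real k + p) / (real k + p))) sums (\<integral>v. indicator {0<..<exp 1} v * f v \<partial>lborel)"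
    using sums unfolding h_val sums_unique[OF h_sum, symmetric] .
  then have "(\<lambda>k. - (sin (pi * s) / pi) * ((- x) ^ k / fact k * (exp (real k + p) / (real k + p)))) sums (- (sin (pi * s) / pi) * (\<integral>v. indicator {0<..<exp 1} v * f v \<partial>lborel))"
    by (rule sums_mult)
  moreover have "- (sin (pi * s) / pi) * ((- x) ^ k / fact k * (exp (real k + p) / (real k + p))) = x ^ k / fact k * sincexp k s" for k
  proof -
    have "(real k - s) * sincexp k s = - ((- 1) ^ k * exp (real k - s) * (sin (pi * s) / pi))" by (rule sincexp_mult[OF sk])
    then have "sincexp k s = - ((- 1) ^ k * exp (real k - s) * (sin (pi * s) / pi)) / (real k - s)"
      using sk[of k] by (simp add: field_simps)
    moreover have "(- x) ^ k = (- 1) ^ k * x ^ k" by (rule power_minus)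
    ultimately show ?thesis by (simp add: p_def mult_ac)
  qed
  ultimately have B: "hankel_series x s = - (sin (pi * s) / pi) * (\<integral>v. indicator {0<..<exp 1} v * f v \<partial>lborel)"
    unfolding hankel_series_def by (simp add: sums_iff)
  have e1: "- (sin (pi * s) / pi) * hankel_tail x s + hankel_series x s = - (sin (pi * s) / pi) * (Gamma p * x powr (- p))"
    unfolding Ip B by (simp add: algebra_simps)
  have e2: "- (sin (pi * s) / pi) = rGamma p * rGamma (1 - p)"
    using rGamma_reflection_real[of p] by (simp add: p_def)
  have "rGamma p * Gamma p = 1" using Gamma_real_pos[OF p(1)] by (simp add: rGamma_inverse_Gamma)
  moreover have "rGamma p * rGamma (1 - p) * (Gamma p * x powr (- p)) = (rGamma p * Gamma p) * (rGamma (1 - p) * x powr (- p))" by (simp only: mult_ac)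
  ultimately have "rGamma p * rGamma (1 - p) * (Gamma p * x powr (- p)) = x powr s * rGamma (s + 1)"
    by (simp add: p_def add.commute)
  then show ?thesis using e1 unfolding e2 by simp
qed

text \<open>Both sides satisfy \<open>s f(s) = x f(s - 1)\<close>, so the identity climbs from the
  strip \<open>(- 1, 0)\<close> through the unit intervals. The integers, where
  \<open>sincexp\<close> has a default value, are left out.\<close>

lemma rGamma_series:
  assumes x: "0 < x" and s: "real n - 1 < s" "s < real n"
  shows "x powr s * rGamma (s + 1) = - (sin (pi * s) / pi) * hankel_tail x s + hankel_series x s"
  using s
proof (induction n arbitrary: s)
  case 0
  then show ?case by (intro rGamma_series_base[OF x]) auto
next
  case (Suc n)
  have s0: "0 < s" using Suc.prems by simp
  have sk: "s \<noteq> real k" for k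
  proof
    assume "s = real k"
    then have "n < k" "k < Suc n" using Suc.prems by auto
    then show False by simp
  qed
  have IH: "x powr (s - 1) * rGamma s = - (sin (pi * (s - 1)) / pi) * hankel_tail x (s - 1) + hankel_series x (s - 1)"
    using Suc.IH[of "s - 1"] Suc.prems by simp
  have sin: "sin (pi * (s - 1)) = - sin (pi * s)" by (simp add: right_diff_distrib)
  have "s * (- (sin (pi * s) / pi) * hankel_tail x s + hankel_series x s) = - (sin (pi * s) / pi) * (s * hankel_tail x s) + s * hankel_series x s"
    by (simp add: algebra_simps)
  also have "\<dots> = x * (- (sin (pi * (s - 1)) / pi) * hankel_tail x (s - 1) + hankel_series x (s - 1))"
    unfolding hankel_tail_rec[OF x s0] hankel_series_rec[OF sk] sin by (simp add: algebra_simps)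
  also have "\<dots> = x * (x powr (s - 1) * rGamma s)" by (simp only: IH)
  also have "\<dots> = s * (x powr s * rGamma (s + 1))"
    using x rGamma_plus1[of s] by (simp add: powr_diff)
  finally show ?case using s0 by simp
qed

text \<open>The Laplace transform of the sine. With \<open>L = ln v\<close> this is the origin of
  the denominator \<open>(ln v)^2 + pi^2\<close>; it converges only for
  \<open>L > 0\<close>.\<close>

lemma has_bochner_integral_exp_sin:
  assumes L: "0 < L"
  shows "has_bochner_integral lborel (\<lambda>s. indicator {0<..} s * (sin (pi * s) * exp (- (L * s)))) (pi / (L^2 + pi^2))"
proof -
  define D where "D = L^2 + pi^2"
  have D: "0 < D" unfolding D_def using L by (intro add_pos_pos) auto
  define f where "f = (\<lambda>s. sin (pi * s) * exp (- (L * s)))"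
  define F where "F = (\<lambda>s. - (exp (- (L * s)) * (L * sin (pi * s) + pi * cos (pi * s))) / D)"
  have [measurable]: "f \<in> borel_measurable borel" unfolding f_def by measurable
  have fF: "(F has_real_derivative f s) (at s)" for s
  proof -
    have "((\<lambda>s. exp (- (L * s))) has_real_derivative - L * exp (- (L * s))) (at s)"
      by (auto intro!: derivative_eq_intros)
    moreover have "((\<lambda>s. L * sin (pi * s) + pi * cos (pi * s)) has_real_derivative L * (cos (pi * s) * pi) + pi * (- sin (pi * s) * pi)) (at s)"
      by (auto intro!: derivative_eq_intros)
    ultimately have "(F has_real_derivative - (- L * exp (- (L * s)) * (L * sin (pi * s) + pi * cos (pi * s)) + (L * (cos (pi * s) * pi) + pi * (- sin (pi * s) * pi)) * exp (- (L * s))) / D) (at s)"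
      unfolding F_def by (intro DERIV_cdivide DERIV_minus DERIV_mult)
    moreover have "- (- L * exp (- (L * s)) * (L * sin (pi * s) + pi * cos (pi * s)) + (L * (cos (pi * s) * pi) + pi * (- sin (pi * s) * pi)) * exp (- (L * s))) = D * f s"
      by (simp add: D_def f_def algebra_simps power2_eq_square)
    ultimately show ?thesis using D by simp
  qed
  have bound: "\<bar>f s\<bar> \<le> exp (- (L * s))" for s
    by (simp add: f_def abs_mult mult_left_le_one_le)
  have dom: "integrable lborel (\<lambda>s. indicator {0..} s * exp (- (L * s)))"
    by (rule integrable_exp_atLeast[OF L])
  have int: "integrable lborel (\<lambda>s. indicator {0..} s * f s)"
    by (rule Bochner_Integration.integrable_bound[OF dom]) (auto simp: indicator_def bound)
  have "(\<lambda>n. \<integral>s. indicator {0..real n} s * f s \<partial>lborel) \<longlonglongrightarrow> (\<integral>s. indicator {0..} s * f s \<partial>lborel)"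
  proof (rule integral_dominated_convergence[OF _ _ dom])
    show "AE s in lborel. (\<lambda>n. indicator {0..real n} s * f s) \<longlonglongrightarrow> indicator {0..} s * f s"
    proof (intro AE_I2)
      fix s :: real
      have "\<forall>\<^sub>F n in sequentially. real n \<ge> s"
        using filterlim_real_sequentially unfolding filterlim_at_top by blast
      then have "\<forall>\<^sub>F n in sequentially. indicator {0..} s * f s = indicator {0..real n} s * f s"
        by eventually_elim (auto simp: indicator_def)
      then show "(\<lambda>n. indicator {0..real n} s * f s) \<longlonglongrightarrow> indicator {0..} s * f s"
        by (rule Lim_transform_eventually[OF tendsto_const])
    qed
    show "AE s in lborel. norm (indicator {0..real n} s * f s) \<le> indicator {0..} s * exp (- (L * s))" for n
      using bound by (auto simp: indicator_def)
  qed measurable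
  moreover have "(\<integral>s. indicator {0..real n} s * f s \<partial>lborel) = F (real n) - F 0" for n
  proof -
    have "has_bochner_integral lborel (\<lambda>s. indicator {0..real n} s *\<^sub>R f s) (F (real n) - F 0)"
    proof (rule has_bochner_integral_FTC_Icc)
      show "(F has_vector_derivative f s) (at s within {0..real n})" for s
        by (rule has_vector_derivative_at_within[OF has_real_derivative_iff_has_vector_derivative[THEN iffD1, OF fF]])
      show "continuous_on {0..real n} f" unfolding f_def by (intro continuous_intros)
    qed simp
    then show ?thesis by (simp add: has_bochner_integral_iff)
  qed
  moreover have "(\<lambda>n. F (real n) - F 0) \<longlonglongrightarrow> 0 - F 0"
  proof (intro tendsto_diff tendsto_const)
    show "(\<lambda>n. F (real n)) \<longlonglongrightarrow> 0"
    proof (rule Lim_null_comparison)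
      show "\<forall>\<^sub>F n in sequentially. norm (F (real n)) \<le> exp (- (L * real n)) * ((L + pi) / D)"
      proof (intro always_eventually allI)
        fix n
        have "\<bar>L * sin (pi * real n) + pi * cos (pi * real n)\<bar> \<le> \<bar>L * sin (pi * real n)\<bar> + \<bar>pi * cos (pi * real n)\<bar>"
          by (rule abs_triangle_ineq)
        also have "\<dots> \<le> L * 1 + pi * 1"
          unfolding abs_mult using L by (intro add_mono mult_mono) auto
        finally have "exp (- (L * real n)) * \<bar>L * sin (pi * real n) + pi * cos (pi * real n)\<bar> \<le> exp (- (L * real n)) * (L + pi)"
          by (intro mult_left_mono) auto
        then show "norm (F (real n)) \<le> exp (- (L * real n)) * ((L + pi) / D)"
          using D by (simp add: F_def abs_mult divide_right_mono)
      qed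
      have "(\<lambda>n. exp (- (L * real n))) \<longlonglongrightarrow> 0" using L by real_asymp
      then show "(\<lambda>n. exp (- (L * real n)) * ((L + pi) / D)) \<longlonglongrightarrow> 0" by (rule tendsto_mult_left_zero)
    qed
  qed
  ultimately have "(\<integral>s. indicator {0..} s * f s \<partial>lborel) = - F 0"
    using LIMSEQ_unique by fastforce
  also have "- F 0 = pi / D" by (simp add: F_def)
  finally have "has_bochner_integral lborel (\<lambda>s. indicator {0..} s * f s) (pi / D)"
    using int by (simp add: has_bochner_integral_iff)
  moreover have "AE s in lborel. indicator {0..} s * f s = indicator {0<..} s * f s"
    using AE_lborel_singleton[of 0] by eventually_elim (auto simp: indicator_def)
  ultimately show ?thesis
    by (subst (asm) has_bochner_integral_cong_AE) (auto simp: f_def D_def)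
qed

section \<open>Integration of the Hankel representation over the exponent\<close>

definition Acoef :: "nat \<Rightarrow> real" where
  "Acoef k = (\<integral>s. indicator {0<..} s * sincexp k s \<partial>lborel) / fact k"

definition Etotal :: real where
  "Etotal = (\<integral>s. indicator {0<..} s * exp (- (s::real)) \<partial>lborel)"

lemma integrable_exp_pos: "integrable lborel (\<lambda>s::real. indicator {0<..} s * exp (- s))"
  by (rule Bochner_Integration.integrable_bound[OF integrable_exp_atLeast[of 1 0]]) (auto simp: indicator_def)

lemma sincexp_le': "\<bar>indicator {0<..} s * sincexp k s\<bar> \<le> exp 1 ^ k * (indicator {0<..} s * exp (- s))"
proof -
  have "exp (real k - s) = exp 1 ^ k * exp (- s)" by (simp add: exp_of_nat_mult[symmetric] exp_add[symmetric])
  then show ?thesis using sincexp_abs_le[of k s] by (auto simp: indicator_def)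
qed

lemma integrable_sincexp: "integrable lborel (\<lambda>s. indicator {0<..} s * sincexp k s)"
  by (rule Bochner_Integration.integrable_bound[of _ "\<lambda>s. exp 1 ^ k * (indicator {0<..} s * exp (- s))"])
     (auto intro!: integrable_mult_right integrable_exp_pos order.trans[OF sincexp_le' abs_ge_self, folded real_norm_def] simp del: real_norm_def)

lemma integral_abs_sincexp_le: "(\<integral>s. \<bar>indicator {0<..} s * sincexp k s\<bar> \<partial>lborel) \<le> exp 1 ^ k * Etotal"
proof -
  have "(\<integral>s. \<bar>indicator {0<..} s * sincexp k s\<bar> \<partial>lborel) \<le> (\<integral>s. exp 1 ^ k * (indicator {0<..} s * exp (- s)) \<partial>lborel)"
    by (intro integral_mono integrable_abs integrable_sincexp integrable_mult_right integrable_exp_pos sincexp_le')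
  then show ?thesis by (simp add: Etotal_def)
qed

lemma Acoef_le: "\<bar>Acoef k\<bar> \<le> exp 1 ^ k / fact k * Etotal"
proof -
  have "\<bar>\<integral>s. indicator {0<..} s * sincexp k s \<partial>lborel\<bar> \<le> exp 1 ^ k * Etotal"
    using integral_abs_bound integral_abs_sincexp_le by (rule order.trans)
  then show ?thesis by (simp add: Acoef_def abs_divide divide_right_mono)
qed

text \<open>Integrate \<open>rGamma_series\<close> over \<open>s > 0\<close>. The series part may be
  integrated termwise by the factorial decay and yields an entire function of \<open>x\<close>; in
  the tail part Fubini puts the \<open>s\<close> integral inside, where it is a Laplace transform of
  the sine at \<open>ln v\<close>.\<close>

lemma H_1_expansion:
  assumes x: "0 < x"
  shows "H 1 x = (\<Sum>k. Acoef k * x ^ k) - (\<integral>v. indicator {exp 1..} v * (exp (- (x * v)) / (v * ((ln v)^2 + pi^2))) \<partial>lborel)"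
    and "summable (\<lambda>k. Acoef k * x ^ k)"
proof -
  define h where "h = (\<lambda>k s. x ^ k / fact k * (indicator {0<..} s * sincexp k s))"
  have h_int: "integrable lborel (h k)" for k
    unfolding h_def by (intro integrable_mult_right integrable_sincexp)
  have h_val: "(\<integral>s. h k s \<partial>lborel) = Acoef k * x ^ k" for k
    by (simp add: h_def Acoef_def)
  have h_abs: "(\<integral>s. norm (h k s) \<partial>lborel) \<le> Etotal * ((x * exp 1) ^ k / fact k)" for k
  proof -
    have "(\<integral>s. norm (h k s) \<partial>lborel) = x ^ k / fact k * (\<integral>s. \<bar>indicator {0<..} s * sincexp k s\<bar> \<partial>lborel)"
      using x by (simp add: h_def abs_mult)
    also have "\<dots> \<le> x ^ k / fact k * (exp 1 ^ k * Etotal)"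
      using x by (intro mult_left_mono integral_abs_sincexp_le) auto
    finally show ?thesis by (simp add: power_mult_distrib mult_ac)
  qed
  have h_smI: "summable (\<lambda>k. \<integral>s. norm (h k s) \<partial>lborel)"
  proof (rule summable_comparison_test)
    show "summable (\<lambda>k. Etotal * ((x * exp 1) ^ k / fact k))"
      by (intro summable_mult sums_summable[OF exp_series])
    show "\<exists>N. \<forall>k\<ge>N. norm (\<integral>s. norm (h k s) \<partial>lborel) \<le> Etotal * ((x * exp 1) ^ k / fact k)"
    proof (intro exI[of _ 0] allI impI)
      fix k
      have "0 \<le> (\<integral>s. norm (h k s) \<partial>lborel)" by (intro integral_nonneg_AE) simp
      then show "norm (\<integral>s. norm (h k s) \<partial>lborel) \<le> Etotal * ((x * exp 1) ^ k / fact k)"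
        unfolding real_norm_def[of "\<integral>s. norm (h k s) \<partial>lborel"] using h_abs by simp
    qed
  qed
  have h_sm: "AE s in lborel. summable (\<lambda>k. norm (h k s))"
  proof (intro AE_I2)
    fix s :: real
    have "summable (\<lambda>k. indicator {0<..} s * \<bar>x ^ k / fact k * sincexp k s\<bar>)"
      by (intro summable_mult summable_sincexp)
    moreover have "indicator {0<..} s * \<bar>x ^ k / fact k * sincexp k s\<bar> = norm (h k s)" for k
      by (simp add: h_def indicator_def)
    ultimately show "summable (\<lambda>k. norm (h k s))" by simp
  qed
  have hB: "(\<Sum>k. h k s) = indicator {0<..} s * hankel_series x s" for s
    unfolding h_def hankel_series_def by (simp add: indicator_def)
  have B_int: "integrable lborel (\<lambda>s. indicator {0<..} s * hankel_series x s)"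
    using integrable_suminf[OF h_int h_sm h_smI] by (simp add: hB)
  have B_sums: "(\<lambda>k. Acoef k * x ^ k) sums (\<integral>s. indicator {0<..} s * hankel_series x s \<partial>lborel)"
    using sums_integral[OF h_int h_sm h_smI] by (simp add: hB h_val)
  then show "summable (\<lambda>k. Acoef k * x ^ k)" by (rule sums_summable)
  define f where "f = (\<lambda>s v. indicator {0<..} s * (sin (pi * s) / pi) * (indicator {exp 1..} v * (exp (- (x * v)) * v powr (- s - 1))))"
  have f_int: "integrable (lborel \<Otimes>\<^sub>M lborel) (case_prod f)"
  proof (rule Bochner_Integration.integrable_bound)
    show "integrable (lborel \<Otimes>\<^sub>M lborel) (\<lambda>p. (indicator {0<..} (fst p) * exp (- fst p)) * (indicator {exp 1..} (snd p) * exp (- (x * snd p))))"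
      by (intro integrable_lborel_prod integrable_exp_pos integrable_exp_atLeast x)
    show "case_prod f \<in> borel_measurable (lborel \<Otimes>\<^sub>M lborel)" unfolding f_def by measurable
    have "\<bar>f s v\<bar> \<le> (indicator {0<..} s * exp (- s)) * (indicator {exp 1..} v * exp (- (x * v)))" for s v
    proof (cases "0 < s \<and> exp 1 \<le> v")
      case True
      have v0: "0 < v" using True exp_gt_zero[of "1::real"] by linarith
      \<comment> \<open>The benefit of the cut at \<open>exp 1\<close>:
        \<open>v powr (- s - 1) <= exp (- s)\<close> uniformly in \<open>v\<close>, so the double
        integral converges absolutely.\<close>
      have "1 \<le> ln v" using True v0 by (subst ln_ge_iff) auto
      then have "s * 1 \<le> s * ln v" using True by (intro mult_left_mono) auto
      then have "s \<le> (s + 1) * ln v" using \<open>1 \<le> ln v\<close> by (simp add: distrib_right)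
      then have p: "v powr (- s - 1) \<le> exp (- s)" using v0 by (simp add: powr_def algebra_simps)
      have "\<bar>sin (pi * s)\<bar> \<le> 1 * pi" using pi_gt3 abs_sin_le_one[of "pi * s"] by linarith
      then have "\<bar>sin (pi * s) / pi\<bar> \<le> 1" by (simp add: divide_le_eq)
      then have "\<bar>sin (pi * s) / pi\<bar> * (exp (- (x * v)) * v powr (- s - 1)) \<le> 1 * (exp (- (x * v)) * exp (- s))"
        using p by (intro mult_mono) auto
      then show ?thesis using True by (simp add: f_def abs_mult mult.commute)
    qed (auto simp: f_def)
    then show "AE p in lborel \<Otimes>\<^sub>M lborel. norm (case_prod f p) \<le> norm ((indicator {0<..} (fst p) * exp (- fst p)) * (indicator {exp 1..} (snd p) * exp (- (x * snd p))))"
      unfolding real_norm_def by (intro AE_I2 order.trans[OF _ abs_ge_self]) (auto simp: case_prod_beta)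
  qed
  have f1: "(\<integral>v. f s v \<partial>lborel) = indicator {0<..} s * (sin (pi * s) / pi * hankel_tail x s)" for s
    unfolding f_def hankel_tail_def by (simp del: times_divide_eq_left times_divide_eq_right)
  have f2: "(\<integral>s. f s v \<partial>lborel) = indicator {exp 1..} v * (exp (- (x * v)) / (v * ((ln v)^2 + pi^2)))" for v
  proof (cases "exp 1 \<le> v")
    case True
    have v0: "0 < v" using True exp_gt_zero[of "1::real"] by linarith
    have "1 \<le> ln v" using True v0 by (subst ln_ge_iff) auto
    then have lv: "0 < ln v" by simp
    have "(\<integral>s. f s v \<partial>lborel) = (\<integral>s. (exp (- (x * v)) / (v * pi)) * (indicator {0<..} s * (sin (pi * s) * exp (- (ln v * s)))) \<partial>lborel)"
    proof (intro Bochner_Integration.integral_cong refl)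
      fix s
      have "(- s - 1) * ln v = - (ln v * s) - ln v" by (simp add: algebra_simps)
      then have "v powr (- s - 1) = exp (- (ln v * s)) / v"
        using v0 by (simp add: powr_def exp_diff)
      then show "f s v = (exp (- (x * v)) / (v * pi)) * (indicator {0<..} s * (sin (pi * s) * exp (- (ln v * s))))"
        using True by (simp add: f_def)
    qed
    also have "\<dots> = exp (- (x * v)) / (v * pi) * (pi / ((ln v)^2 + pi^2))"
      using has_bochner_integral_exp_sin[OF lv] by (simp add: has_bochner_integral_iff)
    finally show ?thesis using True by (simp add: mult.commute)
  qed (simp add: f_def)
  have S_int: "integrable lborel (\<lambda>s. indicator {0<..} s * (sin (pi * s) / pi * hankel_tail x s))"
    using lborel_pair.integrable_fst[OF f_int] unfolding f1 .
  have S_val: "(\<integral>s. indicator {0<..} s * (sin (pi * s) / pi * hankel_tail x s) \<partial>lborel) = (\<integral>v. indicator {exp 1..} v * (exp (- (x * v)) / (v * ((ln v)^2 + pi^2))) \<partial>lborel)"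
    using lborel_pair.Fubini_integral[OF f_int] unfolding f1 f2 by simp
  have "H 1 x = (\<integral>s. indicator {0<..} s * hankel_series x s - indicator {0<..} s * (sin (pi * s) / pi * hankel_tail x s) \<partial>lborel)"
    unfolding H_def
  proof (rule integral_cong_AE)
    \<comment> \<open>The representation fails to be available at integers only, and these form a
      null set.\<close>
    have "countable (range real)" by simp
    then have "AE s in lborel. s \<notin> range real"
      by (intro AE_not_in countable_imp_null_set_lborel)
    then show "AE s in lborel. indicator {0<..} s * (x powr s * rGamma (s + 1)) = indicator {0<..} s * hankel_series x s - indicator {0<..} s * (sin (pi * s) / pi * hankel_tail x s)"
    proof eventually_elim
      fix s assume s: "s \<notin> range real"
      show "indicator {0<..} s * (x powr s * rGamma (s + 1)) = indicator {0<..} s * hankel_series x s - indicator {0<..} s * (sin (pi * s) / pi * hankel_tail x s)"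
      proof (cases "0 < s")
        case True
        define n where "n = nat \<lceil>s\<rceil>"
        have "s \<noteq> real n" using s by auto
        moreover have "s \<le> real n" "real n < s + 1" using True by (simp_all add: n_def) linarith+
        ultimately have "real n - 1 < s" "s < real n" by auto
        from rGamma_series[OF x this] show ?thesis using True by simp
      qed simp
    qed
  qed (use B_int S_int in auto)
  also have "\<dots> = (\<integral>s. indicator {0<..} s * hankel_series x s \<partial>lborel) - (\<integral>s. indicator {0<..} s * (sin (pi * s) / pi * hankel_tail x s) \<partial>lborel)"
    by (rule Bochner_Integration.integral_diff[OF B_int S_int])
  finally show "H 1 x = (\<Sum>k. Acoef k * x ^ k) - (\<integral>v. indicator {exp 1..} v * (exp (- (x * v)) / (v * ((ln v)^2 + pi^2))) \<partial>lborel)"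
    unfolding S_val using B_sums by (simp add: sums_iff)
qed

section \<open>Power series, Laplace transforms of compact support and exponentially small
  terms\<close>

lemma bigo_power_series:
  fixes a :: "nat \<Rightarrow> real"
  assumes a: "summable (\<lambda>k. \<bar>a k\<bar>)"
  shows "(\<lambda>t. (\<Sum>k. a k * t ^ k) - (\<Sum>j<N. a j * t ^ j)) \<in> O[at_right 0](\<lambda>t. t ^ N)"
proof (rule bigoI)
  define C where "C = (\<Sum>k. \<bar>a (k + N)\<bar>)"
  show "\<forall>\<^sub>F t in at_right 0. norm ((\<Sum>k. a k * t ^ k) - (\<Sum>j<N. a j * t ^ j)) \<le> C * norm (t ^ N)"
    unfolding eventually_at_right_field
  proof (intro exI[of _ 1] conjI allI impI)
    fix t :: real assume t: "0 < t" "t < 1"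
    have bd: "\<bar>a k * t ^ j\<bar> \<le> \<bar>a k\<bar>" for k j
      using t by (simp add: abs_mult power_le_one mult_left_le)
    have sm: "summable (\<lambda>k. a k * t ^ k)"
      by (rule summable_comparison_test[OF _ a]) (use bd in auto)
    have aN: "summable (\<lambda>k. \<bar>a (k + N)\<bar>)" by (rule summable_ignore_initial_segment[OF a])
    have sN: "summable (\<lambda>k. \<bar>a (k + N) * t ^ k\<bar>)"
      by (rule summable_comparison_test[OF _ aN]) (use bd in auto)
    have "(\<Sum>k. a k * t ^ k) - (\<Sum>j<N. a j * t ^ j) = (\<Sum>k. a (k + N) * t ^ (k + N))"
      using suminf_minus_initial_segment[OF sm, of N] by simp
    also have "\<dots> = (\<Sum>k. t ^ N * (a (k + N) * t ^ k))" by (simp add: power_add mult_ac)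
    also have "\<dots> = t ^ N * (\<Sum>k. a (k + N) * t ^ k)"
      by (rule suminf_mult[OF summable_rabs_cancel[OF sN]])
    finally have "norm ((\<Sum>k. a k * t ^ k) - (\<Sum>j<N. a j * t ^ j)) = \<bar>t ^ N\<bar> * \<bar>\<Sum>k. a (k + N) * t ^ k\<bar>"
      by (simp add: abs_mult)
    moreover have "\<bar>\<Sum>k. a (k + N) * t ^ k\<bar> \<le> (\<Sum>k. \<bar>a (k + N) * t ^ k\<bar>)" by (rule summable_rabs[OF sN])
    moreover have "\<dots> \<le> C" unfolding C_def by (intro suminf_le bd sN aN)
    ultimately show "norm ((\<Sum>k. a k * t ^ k) - (\<Sum>j<N. a j * t ^ j)) \<le> C * norm (t ^ N)"
      by (simp add: mult_left_mono mult.commute[of C])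
  qed simp
qed

text \<open>Expand the exponential: the moments of \<open>k\<close> are bounded by a multiple of
  \<open>B ^ j\<close>, and the factorials make the series converge absolutely. This is why a change
  of the lower limit of integration affects only the coefficients of the expansion.\<close>

lemma Laplace_compact_series:
  fixes k :: "real \<Rightarrow> real"
  assumes k: "integrable lborel k" and supp: "\<And>y. y \<notin> {0..B} \<Longrightarrow> k y = 0" and B: "0 \<le> B"
  obtains b where "summable (\<lambda>j. \<bar>b j\<bar>)" "\<And>t. 0 < t \<Longrightarrow> (\<integral>y. k y * exp (- (t * y)) \<partial>lborel) = (\<Sum>j. b j * t ^ j)"
proof -
  have [measurable]: "k \<in> borel_measurable borel" using k by auto
  define b where "b = (\<lambda>j. (- 1) ^ j / fact j * (\<integral>y. k y * y ^ j \<partial>lborel))"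
  define A where "A = (\<integral>y. \<bar>k y\<bar> \<partial>lborel)"
  have le: "\<bar>k y * y ^ j\<bar> \<le> B ^ j * \<bar>k y\<bar>" for j y
  proof (cases "y \<in> {0..B}")
    case True
    then have "y ^ j \<le> B ^ j" by (intro power_mono) auto
    then show ?thesis using True by (simp add: abs_mult mult.commute[of _ "\<bar>k y\<bar>"] mult_left_mono)
  qed (simp add: supp)
  have int: "integrable lborel (\<lambda>y. k y * y ^ j)" for j
    by (rule Bochner_Integration.integrable_bound[of _ "\<lambda>y. B ^ j * \<bar>k y\<bar>"])
       (use k B le in \<open>auto simp: abs_mult\<close>)
  have abs: "(\<integral>y. \<bar>k y * y ^ j\<bar> \<partial>lborel) \<le> B ^ j * A" for j
  proof -
    have "(\<integral>y. \<bar>k y * y ^ j\<bar> \<partial>lborel) \<le> (\<integral>y. B ^ j * \<bar>k y\<bar> \<partial>lborel)"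
      using k int by (intro integral_mono le integrable_abs integrable_mult_right) auto
    then show ?thesis by (simp add: A_def)
  qed
  show ?thesis
  proof (rule that[of b])
    show "summable (\<lambda>j. \<bar>b j\<bar>)"
    proof (rule summable_comparison_test)
      show "summable (\<lambda>j. A * (B ^ j / fact j))" by (intro summable_mult sums_summable[OF exp_series])
      show "\<exists>N. \<forall>j\<ge>N. norm \<bar>b j\<bar> \<le> A * (B ^ j / fact j)"
      proof (intro exI[of _ 0] allI impI)
        fix j
        have "\<bar>\<integral>y. k y * y ^ j \<partial>lborel\<bar> \<le> B ^ j * A" using integral_abs_bound abs by (rule order.trans)
        then show "norm \<bar>b j\<bar> \<le> A * (B ^ j / fact j)"
          by (simp add: b_def abs_mult divide_right_mono mult.commute)
      qed
    qed
    fix t :: real assume t: "0 < t"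
    define h where "h = (\<lambda>j y. (- t) ^ j / fact j * (k y * y ^ j))"
    have h_int: "integrable lborel (h j)" for j unfolding h_def by (intro integrable_mult_right int)
    have h_sums: "(\<lambda>j. h j y) sums (k y * exp (- (t * y)))" for y
    proof -
      have "(\<lambda>j. k y * ((- (t * y)) ^ j / fact j)) sums (k y * exp (- (t * y)))" by (intro sums_mult exp_series)
      moreover have "k y * ((- (t * y)) ^ j / fact j) = h j y" for j
        by (simp add: h_def power_mult_distrib[symmetric])
      ultimately show ?thesis by simp
    qed
    have "(\<lambda>j. \<integral>y. h j y \<partial>lborel) sums (\<integral>y. (\<Sum>j. h j y) \<partial>lborel)"
    proof (rule sums_integral[OF h_int])
      show "AE y in lborel. summable (\<lambda>j. norm (h j y))"
      proof (intro AE_I2)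
        fix y
        have "summable (\<lambda>j. \<bar>k y\<bar> * (\<bar>t * y\<bar> ^ j / fact j))" by (intro summable_mult sums_summable[OF exp_series])
        moreover have "\<bar>k y\<bar> * (\<bar>t * y\<bar> ^ j / fact j) = norm (h j y)" for j
          by (simp add: h_def abs_mult power_abs power_mult_distrib)
        ultimately show "summable (\<lambda>j. norm (h j y))" by simp
      qed
      show "summable (\<lambda>j. \<integral>y. norm (h j y) \<partial>lborel)"
      proof (rule summable_comparison_test)
        show "summable (\<lambda>j. A * ((t * B) ^ j / fact j))" by (intro summable_mult sums_summable[OF exp_series])
        show "\<exists>N. \<forall>j\<ge>N. norm (\<integral>y. norm (h j y) \<partial>lborel) \<le> A * ((t * B) ^ j / fact j)"
        proof (intro exI[of _ 0] allI impI)
          fix j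
          have "(\<integral>y. norm (h j y) \<partial>lborel) = (\<integral>y. t ^ j / fact j * \<bar>k y * y ^ j\<bar> \<partial>lborel)"
            using t by (simp add: h_def abs_mult power_abs)
          also have "\<dots> = t ^ j / fact j * (\<integral>y. \<bar>k y * y ^ j\<bar> \<partial>lborel)" by (rule integral_mult_right_zero)
          also have "\<dots> \<le> t ^ j / fact j * (B ^ j * A)" using t by (intro mult_left_mono abs) auto
          finally show "norm (\<integral>y. norm (h j y) \<partial>lborel) \<le> A * ((t * B) ^ j / fact j)"
            by (simp add: power_mult_distrib mult_ac)
        qed
      qed
    qed
    moreover have "(\<Sum>j. h j y) = k y * exp (- (t * y))" for y using h_sums by (simp add: sums_iff)
    moreover have "(\<integral>y. h j y \<partial>lborel) = b j * t ^ j" for j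
      by (simp add: h_def b_def power_minus[of t])
    ultimately show "(\<integral>y. k y * exp (- (t * y)) \<partial>lborel) = (\<Sum>j. b j * t ^ j)" by (simp add: sums_iff)
  qed
qed

text \<open>One term of the exponential series, \<open>z ^ N / fact N <= exp z\<close> at
  \<open>z = 1 / (4 t)\<close>, already gives the power.\<close>

lemma bigo_exp_inverse: "(\<lambda>t::real. exp (- 1 / (4 * t))) \<in> O[at_right 0](\<lambda>t. t ^ N)"
proof (rule bigoI)
  show "\<forall>\<^sub>F t in at_right (0::real). norm (exp (- 1 / (4 * t))) \<le> fact N * 4 ^ N * norm (t ^ N)"
    unfolding eventually_at_right_field
  proof (intro exI[of _ 1] conjI allI impI)
    fix t :: real assume t: "0 < t" "t < 1"
    define z where "z = 1 / (4 * t)"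
    have z: "0 < z" using t by (simp add: z_def)
    have "z ^ N / fact N = (\<Sum>k\<in>{N}. z ^ k / fact k)" by simp
    also have "\<dots> \<le> (\<Sum>k. z ^ k / fact k)"
      using z by (intro sum_le_suminf sums_summable[OF exp_series]) auto
    also have "\<dots> = exp z" using exp_series[of z] by (simp add: sums_iff)
    finally have "inverse (exp z) \<le> inverse (z ^ N / fact N)" using z by (intro le_imp_inverse_le) auto
    then have "exp (- z) \<le> fact N / z ^ N" by (simp add: exp_minus)
    also have "fact N / z ^ N = fact N * 4 ^ N * t ^ N" by (simp add: z_def power_divide power_mult_distrib)
    finally show "norm (exp (- 1 / (4 * t))) \<le> fact N * 4 ^ N * norm (t ^ N)"
      using t by (simp add: z_def)
  qed simp
qed

section \<open>The asymptotic expansion\<close>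

lemma integrable_log_density:
  fixes m :: real
  assumes t: "0 < t" and A: "0 < A"
  shows "integrable lborel (\<lambda>y. indicator {A..} y * (exp (- (t * y)) / (y * ((ln y + m)^2 + pi^2))))"
proof (rule Bochner_Integration.integrable_bound)
  show "integrable lborel (\<lambda>y. (1 / A) * (indicator {A..} y * exp (- (t * y))))"
    by (intro integrable_mult_right integrable_exp_atLeast t)
  show "AE y in lborel. norm (indicator {A..} y * (exp (- (t * y)) / (y * ((ln y + m)^2 + pi^2))))
      \<le> norm ((1 / A) * (indicator {A..} y * exp (- (t * y))))"
  proof (intro AE_I2)
    fix y :: real
    have "1 * 1 \<le> pi * pi" using pi_gt3 by (intro mult_mono) auto
    then have "1 \<le> (ln y + m)^2 + pi^2" using zero_le_power2[of "ln y + m"] unfolding power2_eq_square[of pi] by linarith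
    then have "A * 1 \<le> y * ((ln y + m)^2 + pi^2)" if "A \<le> y" using that A by (intro mult_mono) auto
    then have "exp (- (t * y)) / (y * ((ln y + m)^2 + pi^2)) \<le> exp (- (t * y)) / A" if "A \<le> y"
      using that A by (intro divide_left_mono) (auto intro!: mult_pos_pos add_nonneg_pos)
    then show "norm (indicator {A..} y * (exp (- (t * y)) / (y * ((ln y + m)^2 + pi^2))))
      \<le> norm ((1 / A) * (indicator {A..} y * exp (- (t * y))))"
      using A by (auto simp: indicator_def abs_mult)
  qed
qed measurable

text \<open>For real \<open>L\<close> the imaginary part of \<open>1 / (L + i pi)\<close> is
  \<open>- pi / (L^2 + pi^2)\<close>. This explains the plus sign of the logarithmic term in the
  theorem against the minus sign in \<open>H_1_expansion\<close>.\<close>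

lemma Im_log_integral:
  fixes m :: real
  assumes t: "0 < t"
  shows "(1 / pi) * Im (LINT y:{1..}|lborel. complex_of_real (exp (- (t * y)) / y)
      / (complex_of_real (ln y) + \<i> * complex_of_real pi + complex_of_real m))
    = - (\<integral>y. indicator {1..} y * (exp (- (t * y)) / (y * ((ln y + m)^2 + pi^2))) \<partial>lborel)"
proof -
  define g where "g = (\<lambda>y. complex_of_real (exp (- (t * y)) / y)
      / (complex_of_real (ln y) + \<i> * complex_of_real pi + complex_of_real m))"
  have [measurable]: "g \<in> borel_measurable borel" unfolding g_def by measurable
  have Img: "Im (indicator {1..} y *\<^sub>R g y) = - pi * (indicator {1..} y * (exp (- (t * y)) / (y * ((ln y + m)^2 + pi^2))))" for y
  proof -
    have "Im (g y) = - pi * (exp (- (t * y)) / (y * ((ln y + m)^2 + pi^2)))"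
      unfolding g_def by (simp add: Im_divide del: of_real_divide)
    then show ?thesis by simp
  qed
  have int: "integrable lborel (\<lambda>y. indicator {1..} y *\<^sub>R g y)"
  proof (rule Bochner_Integration.integrable_bound)
    show "integrable lborel (\<lambda>y. indicator {1..} y * exp (- (t * y)))" by (rule integrable_exp_atLeast[OF t])
    show "AE y in lborel. norm (indicator {1..} y *\<^sub>R g y) \<le> norm (indicator {1..} y * exp (- (t * y)))"
    proof (intro AE_I2)
      fix y :: real
      show "norm (indicator {1..} y *\<^sub>R g y) \<le> norm (indicator {1..} y * exp (- (t * y)))"
      proof (cases "1 \<le> y")
        case True
        define d where "d = complex_of_real (ln y) + \<i> * complex_of_real pi + complex_of_real m"
        have "\<bar>Im d\<bar> \<le> norm d" by (rule abs_Im_le_cmod)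
        then have d: "1 \<le> norm d" using pi_gt3 by (simp add: d_def)
        have "1 * 1 \<le> y * norm d" using True d by (intro mult_mono) auto
        then have "exp (- (t * y)) / (y * norm d) \<le> exp (- (t * y)) / 1"
          using True d by (intro divide_left_mono) auto
        then show ?thesis using True by (simp add: g_def d_def[symmetric] norm_divide norm_mult abs_mult)
      qed simp
    qed
  qed measurable
  have "Im (LINT y:{1..}|lborel. g y) = (\<integral>y. Im (indicator {1..} y *\<^sub>R g y) \<partial>lborel)"
    unfolding set_lebesgue_integral_def by (rule integral_Im[OF int, symmetric])
  also have "\<dots> = - pi * (\<integral>y. indicator {1..} y * (exp (- (t * y)) / (y * ((ln y + m)^2 + pi^2))) \<partial>lborel)"
    unfolding Img by (rule integral_mult_right_zero)
  finally show ?thesis unfolding g_def by simp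
qed

text \<open>With \<open>y = c v\<close> the relation \<open>ln c = - m\<close> turns
  \<open>ln v\<close> into \<open>ln y + m\<close> and the lower limit \<open>e\<close> into
  \<open>A = c e\<close>. Passing from \<open>A\<close> to 1 costs the Laplace transform of a
  compactly supported density, hence another convergent power series.\<close>

lemma nu_expansion:
  fixes m :: real
  assumes c: "0 < c" "ln c = - m"
  shows "\<exists>a. summable (\<lambda>j. \<bar>a j\<bar>) \<and> (\<forall>t. 0 < t \<longrightarrow> t < 1 \<longrightarrow>
    nu c t + (\<integral>y. indicator {1..} y * (exp (- (t * y)) / (y * ((ln y + m)^2 + pi^2))) \<partial>lborel)
      = (\<Sum>j. a j * t ^ j))"
proof -
  define A where "A = c * exp 1"
  have A: "0 < A" using c by (simp add: A_def)
  define f where "f = (\<lambda>b t y. indicator {b..} y * (exp (- (t * y)) / (y * ((ln y + m)^2 + pi^2))))"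
  have f_int: "integrable lborel (f b t)" if "0 < b" "0 < t" for b t
    unfolding f_def using that by (intro integrable_log_density)
  \<comment> \<open>The difference of indicators carries the right sign whether \<open>A\<close>
    lies below or above 1.\<close>
  define k where "k = (\<lambda>y. (indicator {1..} y - indicator {A..} y) * (1 / (y * ((ln y + m)^2 + pi^2))))"
  define B where "B = 1 + A"
  have B: "0 \<le> B" "1 \<le> B" "A \<le> B" using A by (simp_all add: B_def)
  have supp: "k y = 0" if "y \<notin> {0..B}" for y
    using that B A by (auto simp: k_def indicator_def)
  have kf: "k y * exp (- (t * y)) = f 1 t y - f A t y" for t y
    by (simp add: k_def f_def left_diff_distrib diff_divide_distrib)
  have k_eq: "k y = exp y * (f 1 1 y - f A 1 y)" for y
  proof -
    have "k y = exp y * (k y * exp (- (1 * y)))" by (simp add: exp_minus)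
    then show ?thesis unfolding kf .
  qed
  have k_int: "integrable lborel k"
  proof (rule Bochner_Integration.integrable_bound)
    \<comment> \<open>\<open>k\<close> is \<open>exp y\<close> times a difference of two integrable
      functions at \<open>t = 1\<close>, and on its support the weight is at most
      \<open>exp B\<close>.\<close>
    show "integrable lborel (\<lambda>y. exp B * (f 1 1 y - f A 1 y))"
      using f_int A by (intro integrable_mult_right Bochner_Integration.integrable_diff) auto
    show "k \<in> borel_measurable lborel" unfolding k_def by measurable
    show "AE y in lborel. norm (k y) \<le> norm (exp B * (f 1 1 y - f A 1 y))"
    proof (intro AE_I2)
      fix y
      show "norm (k y) \<le> norm (exp B * (f 1 1 y - f A 1 y))"
      proof (cases "y \<in> {0..B}")
        case True
        then show ?thesis unfolding k_eq by (simp add: abs_mult mult_right_mono)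
      qed (simp add: supp)
    qed
  qed
  obtain b where b: "summable (\<lambda>j. \<bar>b j\<bar>)"
    and b_sum: "\<And>t. 0 < t \<Longrightarrow> (\<integral>y. k y * exp (- (t * y)) \<partial>lborel) = (\<Sum>j. b j * t ^ j)"
    using Laplace_compact_series[OF k_int supp B(1)] by metis
  have Ac: "summable (\<lambda>j. \<bar>Acoef j * c ^ j\<bar>)"
  proof (rule summable_comparison_test)
    show "summable (\<lambda>j. Etotal * ((exp 1 * c) ^ j / fact j))" by (intro summable_mult sums_summable[OF exp_series])
    show "\<exists>N. \<forall>j\<ge>N. norm \<bar>Acoef j * c ^ j\<bar> \<le> Etotal * ((exp 1 * c) ^ j / fact j)"
    proof (intro exI[of _ 0] allI impI)
      fix j
      have "\<bar>Acoef j\<bar> * c ^ j \<le> (exp 1 ^ j / fact j * Etotal) * c ^ j"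
        using c by (intro mult_right_mono Acoef_le) auto
      then show "norm \<bar>Acoef j * c ^ j\<bar> \<le> Etotal * ((exp 1 * c) ^ j / fact j)"
        using c by (simp add: abs_mult power_mult_distrib mult_ac)
    qed
  qed
  show ?thesis
  proof (intro exI[of _ "\<lambda>j. Acoef j * c ^ j + b j"] conjI allI impI)
    show "summable (\<lambda>j. \<bar>Acoef j * c ^ j + b j\<bar>)"
      by (rule summable_comparison_test[OF _ summable_add[OF Ac b]]) auto
    fix t :: real assume t: "0 < t" "t < 1"
    have ct: "0 < c * t" using c t by simp
    have "(\<integral>y. f A t y \<partial>lborel) = c * (\<integral>v. f A t (c * v) \<partial>lborel)"
      using lborel_integral_real_affine[of c "f A t" 0] c by simp
    also have "\<dots> = (\<integral>v. c * f A t (c * v) \<partial>lborel)" by simp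
    also have "\<dots> = (\<integral>v. indicator {exp 1..} v * (exp (- (c * t * v)) / (v * ((ln v)^2 + pi^2))) \<partial>lborel)"
    proof (intro Bochner_Integration.integral_cong refl)
      fix v :: real
      show "c * f A t (c * v) = indicator {exp 1..} v * (exp (- (c * t * v)) / (v * ((ln v)^2 + pi^2)))"
      proof (cases "exp 1 \<le> v")
        case True
        have v0: "0 < v" using True exp_gt_zero[of "1::real"] by linarith
        have "ln (c * v) + m = ln v" using c v0 by (simp add: ln_mult)
        then show ?thesis using True c by (simp add: f_def A_def mult_ac)
      next
        case False
        then show ?thesis using c by (simp add: f_def A_def)
      qed
    qed
    finally have fA: "(\<integral>v. indicator {exp 1..} v * (exp (- (c * t * v)) / (v * ((ln v)^2 + pi^2))) \<partial>lborel) = (\<integral>y. f A t y \<partial>lborel)" ..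
    have "nu c t + (\<integral>y. f 1 t y \<partial>lborel) = (\<Sum>j. Acoef j * (c * t) ^ j) - (\<integral>y. f A t y \<partial>lborel) + (\<integral>y. f 1 t y \<partial>lborel)"
      unfolding nu_def H_1_expansion(1)[OF ct] fA ..
    also have "\<dots> = (\<Sum>j. Acoef j * (c * t) ^ j) + (\<integral>y. f 1 t y - f A t y \<partial>lborel)"
      using f_int[of 1 t] f_int[of A t] A t by simp
    also have "\<dots> = (\<Sum>j. Acoef j * (c * t) ^ j) + (\<Sum>j. b j * t ^ j)"
      using b_sum[OF t(1)] unfolding kf by simp
    also have "\<dots> = (\<Sum>j. Acoef j * (c * t) ^ j + b j * t ^ j)"
    proof (rule suminf_add[OF H_1_expansion(2)[OF ct]])
      have "\<bar>b j * t ^ j\<bar> \<le> \<bar>b j\<bar>" for j using t by (simp add: abs_mult power_le_one mult_left_le)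
      then show "summable (\<lambda>j. b j * t ^ j)" by (intro summable_comparison_test[OF _ b]) auto
    qed
    finally show "nu c t + (\<integral>y. indicator {1..} y * (exp (- (t * y)) / (y * ((ln y + m)^2 + pi^2))) \<partial>lborel)
      = (\<Sum>j. (Acoef j * c ^ j + b j) * t ^ j)"
      by (simp add: f_def power_mult_distrib algebra_simps)
  qed
qed

theorem theorem1:
  fixes \<theta> :: real
  assumes "0 \<le> \<theta>" and "\<theta> < pi" and "\<theta> \<noteq> pi / 2"
  shows "\<exists>a :: nat \<Rightarrow> real. \<forall>K. heat_kernel \<theta> K \<longrightarrow> (\<forall>N :: nat.
     (\<lambda>t. Tr1 K t - Tr1 E_plus t - (\<Sum>j<N. a j * t ^ j)
          - (1 / pi) * Im (LINT y:{1..}|lborel.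
               complex_of_real (exp (- (t * y)) / y)
                 / (complex_of_real (ln y) + \<i> * complex_of_real pi + complex_of_real (2 * kappa \<theta>))))
     \<in> O[at_right 0](\<lambda>t. t ^ N))"
proof -
  \<comment> \<open>This makes \<open>log_shift c r\<close> equal to
    \<open>ln r + euler_mascheroni - 2 * kappa \<theta>\<close>, the function dictated by the
    boundary condition.\<close>
  define c where "c = exp (- 2 * kappa \<theta>)"
  have c: "0 < c" "ln c = - (2 * kappa \<theta>)" by (simp_all add: c_def)
  have cos: "cos \<theta> \<noteq> 0"
  proof
    assume "cos \<theta> = 0"
    then have "\<theta> = pi / 2"
      using cos_inj_pi[of \<theta> "pi / 2"] assms(1,2) by simp
    with assms(3) show False by simp
  qed
  \<comment> \<open>The coefficients depend on \<theta> through \<open>c\<close> alone, so they are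
    fixed before any kernel \<open>K\<close> is given.\<close>
  obtain a where a: "summable (\<lambda>j. \<bar>a j\<bar>)"
    and nu: "\<And>t. 0 < t \<Longrightarrow> t < 1 \<Longrightarrow> nu c t + (\<integral>y. indicator {1..} y * (exp (- (t * y)) / (y * ((ln y + 2 * kappa \<theta>)^2 + pi^2))) \<partial>lborel)
      = (\<Sum>j. a j * t ^ j)"
    using nu_expansion[OF c] by blast
  show ?thesis
  proof (intro exI[of _ a] allI impI)
    fix K N assume K: "heat_kernel \<theta> K"
    define R where "R = (\<lambda>t. Tr1 K t - Tr1 E_plus t - nu c t)"
    have "R \<in> O[at_right 0](\<lambda>t. exp (- 1 / (4 * t)))"
    proof (rule bigoI)
      show "\<forall>\<^sub>F t in at_right 0. norm (R t) \<le> nu c 1 * norm (exp (- 1 / (4 * t)))"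
        unfolding eventually_at_right_field
      proof (intro exI[of _ 1] conjI allI impI)
        fix t :: real assume t: "0 < t" "t < 1"
        have "\<bar>R t\<bar> \<le> nu c t * exp (- 1 / (4 * t))"
          unfolding R_def using Tr1_diff_bound[OF K cos t(1) c(1)] c(2) by simp
        also have "nu c t \<le> nu c 1" unfolding nu_def using c t by (intro H_mono) auto
        finally show "norm (R t) \<le> nu c 1 * norm (exp (- 1 / (4 * t)))" by simp
      qed simp
    qed
    then have R: "R \<in> O[at_right 0](\<lambda>t. t ^ N)" using bigo_exp_inverse by (rule landau_o.big_trans)
    have "(\<lambda>t. R t + ((\<Sum>j. a j * t ^ j) - (\<Sum>j<N. a j * t ^ j))) \<in> O[at_right 0](\<lambda>t. t ^ N)"
      by (intro sum_in_bigo R bigo_power_series a)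
    moreover have "\<forall>\<^sub>F t in at_right 0. R t + ((\<Sum>j. a j * t ^ j) - (\<Sum>j<N. a j * t ^ j))
      = Tr1 K t - Tr1 E_plus t - (\<Sum>j<N. a j * t ^ j)
          - (1 / pi) * Im (LINT y:{1..}|lborel.
               complex_of_real (exp (- (t * y)) / y)
                 / (complex_of_real (ln y) + \<i> * complex_of_real pi + complex_of_real (2 * kappa \<theta>)))"
      unfolding eventually_at_right_field
    proof (intro exI[of _ 1] conjI allI impI)
      fix t :: real assume t: "0 < t" "t < 1"
      show "R t + ((\<Sum>j. a j * t ^ j) - (\<Sum>j<N. a j * t ^ j))
        = Tr1 K t - Tr1 E_plus t - (\<Sum>j<N. a j * t ^ j)
          - (1 / pi) * Im (LINT y:{1..}|lborel.
               complex_of_real (exp (- (t * y)) / y)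
                 / (complex_of_real (ln y) + \<i> * complex_of_real pi + complex_of_real (2 * kappa \<theta>)))"
        unfolding Im_log_integral[OF t(1)] nu[OF t, symmetric] R_def by simp
    qed simp
    ultimately show "(\<lambda>t. Tr1 K t - Tr1 E_plus t - (\<Sum>j<N. a j * t ^ j)
          - (1 / pi) * Im (LINT y:{1..}|lborel.
               complex_of_real (exp (- (t * y)) / y)
                 / (complex_of_real (ln y) + \<i> * complex_of_real pi + complex_of_real (2 * kappa \<theta>))))
     \<in> O[at_right 0](\<lambda>t. t ^ N)"
      by (rule landau_o.big.in_cong[THEN iffD1, rotated])
  qed
qed

end
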